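(* The decision problems for the following three classes of sentences are pairwise polynomial-time reducible to one another: (1) $\Sigma_{2,\le}$: sentences $\exists X\in\mathbb R^m.\forall Y\in\mathbb R^n.\,\Phi_{0,\le}(X,Y)$; (2) $\texttt{b-}\Sigma_{2,\le}$: sentences $\exists X\in I^m.\forall Y\in I^n.\,\Phi_{0,\le}(X,Y)$; (3) $\texttt{b-}\Sigma^{++}_{2,\le}$: sentences $\exists X\in I^m.\forall Y\in I^n.\,(\Psi_{0,\le}(Y)\to\Phi_{0,\le}(X,Y))$; where in each case $\Phi_{0,\le}$ and $\Psi_{0,\le}$ are $\mathrm{QFF}_\le$-formulas.
   Context: Let $\mathcal L$ be the first-order language over the signature $\langle \mathbb Z,+,\times,<,\le\rangle$ with connectives $\land,\lor$ and quantifiers $\exists,\forall$ (negation, implication and equality $s=t$, meaning $s\le t\land t\le s$, are used as abbreviations, negations being pushed onto atoms, so $\lnot(s\le t)$ is $t<s$); integer constants are encoded in binary and polynomials in atoms are given as terms over $\langle\mathbb Z,+,\times\rangle$. Formulas are interpreted over $\mathbb R$. A $\mathrm{QFF}_{\le}$-formula (resp. $\mathrm{QFF}_<$-formula) is a quantifier-free formula of $\mathcal L$ not containing $<$ (resp. $\le$). Let $I=[-1,1]$. For a vector of variables $X=(x_1,\dots,x_t)$ and a variable or constant $y$, $|X|\le y$ abbreviates $\bigwedge_j(-y\le x_j\land x_j\le y)$ and $|X|>y$ its negation. The notation $\exists X\in I^m.\forall Y\in I^n.\,\Phi_0(X,Y)$ abbreviates the $\mathcal L$-sentence $\exists X\in\mathbb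 R^m.\forall Y\in\mathbb R^n.\,(|Y|>1\lor(|X|\le 1\land\Phi_0(X,Y)))$. The decision problem for a class of sentences asks whether a given sentence of the class is true over $\mathbb R$. *)

theory Defs
  imports Complex_Main
begin

text \<open>Terms over the signature (Z,+,*) with variables indexed by naturals.
  Variables 0..m-1 stand for the existential block X, variables m..m+n-1 for the
  universal block Y.\<close>

datatype trm = Var nat | Const int | Add trm trm | Mul trm trm

text \<open>Quantifier-free formulas built from atoms s <= t and s < t with conjunction
  and disjunction (negations are pushed onto atoms; equality is an abbreviation).\<close>

datatype qff = Le trm trm | Lt trm trm | Conj qff qff | Disj qff qff

fun eval_trm :: "(nat \<Rightarrow> real) \<Rightarrow> trm \<Rightarrow> real" where
  "eval_trm \<rho> (Var i) = \<rho> i"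
| "eval_trm \<rho> (Const c) = real_of_int c"
| "eval_trm \<rho> (Add s t) = eval_trm \<rho> s + eval_trm \<rho> t"
| "eval_trm \<rho> (Mul s t) = eval_trm \<rho> s * eval_trm \<rho> t"

fun holds :: "(nat \<Rightarrow> real) \<Rightarrow> qff \<Rightarrow> bool" where
  "holds \<rho> (Le s t) = (eval_trm \<rho> s \<le> eval_trm \<rho> t)"
| "holds \<rho> (Lt s t) = (eval_trm \<rho> s < eval_trm \<rho> t)"
| "holds \<rho> (Conj f g) = (holds \<rho> f \<and> holds \<rho> g)"
| "holds \<rho> (Disj f g) = (holds \<rho> f \<or> holds \<rho> g)"

fun vars_trm :: "trm \<Rightarrow> nat set" where
  "vars_trm (Var i) = {i}"
| "vars_trm (Const c) = {}"
| "vars_trm (Add s t) = vars_trm s \<union> vars_trm t"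
| "vars_trm (Mul s t) = vars_trm s \<union> vars_trm t"

fun vars_qff :: "qff \<Rightarrow> nat set" where
  "vars_qff (Le s t) = vars_trm s \<union> vars_trm t"
| "vars_qff (Lt s t) = vars_trm s \<union> vars_trm t"
| "vars_qff (Conj f g) = vars_qff f \<union> vars_qff g"
| "vars_qff (Disj f g) = vars_qff f \<union> vars_qff g"

fun qff_le :: "qff \<Rightarrow> bool" where
  "qff_le (Le s t) = True"
| "qff_le (Lt s t) = False"
| "qff_le (Conj f g) = (qff_le f \<and> qff_le g)"
| "qff_le (Disj f g) = (qff_le f \<and> qff_le g)"

definition env :: "nat \<Rightarrow> (nat \<Rightarrow> real) \<Rightarrow> (nat \<Rightarrow> real) \<Rightarrow> nat \<Rightarrow> real" where
  "env m X Y i = (if i < m then X i else Y (i - m))"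

definition sigma2_true :: "nat \<Rightarrow> nat \<Rightarrow> qff \<Rightarrow> bool" where
  "sigma2_true m n \<Phi> \<longleftrightarrow> (\<exists>X. \<forall>Y. holds (env m X Y) \<Phi>)"

text \<open>exists X in I^m. forall Y in I^n. Phi(X,Y), i.e. literally
  exists X in R^m. forall Y in R^n. (|Y| > 1 or (|X| <= 1 and Phi(X,Y)))\<close>
definition b_sigma2_true :: "nat \<Rightarrow> nat \<Rightarrow> qff \<Rightarrow> bool" where
  "b_sigma2_true m n \<Phi> \<longleftrightarrow>
     (\<exists>X. \<forall>Y. (\<exists>j<n. \<bar>Y j\<bar> > 1) \<or> ((\<forall>i<m. \<bar>X i\<bar> \<le> 1) \<and> holds (env m X Y) \<Phi>))"

definition b_sigma2pp_true :: "nat \<Rightarrow> nat \<Rightarrow> qff \<Rightarrow> qff \<Rightarrow> bool" where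
  "b_sigma2pp_true m n \<Psi> \<Phi> \<longleftrightarrow>
     (\<exists>X. \<forall>Y. (\<exists>j<n. \<bar>Y j\<bar> > 1) \<or>
        ((\<forall>i<m. \<bar>X i\<bar> \<le> 1) \<and> (holds (env m X Y) \<Psi> \<longrightarrow> holds (env m X Y) \<Phi>)))"

text \<open>Alphabet: symbols 1..14 (0 is the blank of the machine model).
  1,2 = bits 0,1; 4 = number terminator; 5 = variable; 6,7 = nonneg./neg. constant;
  8 = +; 9 = *; 10 = <=; 11 = <; 12 = and; 13 = or.\<close>

definition alphabet :: "nat set" where "alphabet = {1..14}"

fun bits :: "nat \<Rightarrow> nat list" where
  "bits n = (if n = 0 then [] else (if n mod 2 = 0 then 1 else 2) # bits (n div 2))"

definition enc_nat :: "nat \<Rightarrow> nat list" where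
  "enc_nat n = bits n @ [4]"

fun enc_trm :: "trm \<Rightarrow> nat list" where
  "enc_trm (Var i) = 5 # enc_nat i"
| "enc_trm (Const c) = (if c \<ge> 0 then 6 else 7) # enc_nat (nat \<bar>c\<bar>)"
| "enc_trm (Add s t) = 8 # enc_trm s @ enc_trm t"
| "enc_trm (Mul s t) = 9 # enc_trm s @ enc_trm t"

fun enc_qff :: "qff \<Rightarrow> nat list" where
  "enc_qff (Le s t) = 10 # enc_trm s @ enc_trm t"
| "enc_qff (Lt s t) = 11 # enc_trm s @ enc_trm t"
| "enc_qff (Conj f g) = 12 # enc_qff f @ enc_qff g"
| "enc_qff (Disj f g) = 13 # enc_qff f @ enc_qff g"

definition Sigma2_le :: "nat list set" where
  "Sigma2_le = {enc_nat m @ enc_nat n @ enc_qff \<Phi> | m n \<Phi>.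
      qff_le \<Phi> \<and> vars_qff \<Phi> \<subseteq> {..<m+n} \<and> sigma2_true m n \<Phi>}"

definition b_Sigma2_le :: "nat list set" where
  "b_Sigma2_le = {enc_nat m @ enc_nat n @ enc_qff \<Phi> | m n \<Phi>.
      qff_le \<Phi> \<and> vars_qff \<Phi> \<subseteq> {..<m+n} \<and> b_sigma2_true m n \<Phi>}"

definition b_Sigma2pp_le :: "nat list set" where
  "b_Sigma2pp_le = {enc_nat m @ enc_nat n @ enc_qff \<Psi> @ enc_qff \<Phi> | m n \<Psi> \<Phi>.
      qff_le \<Psi> \<and> qff_le \<Phi> \<and> vars_qff \<Psi> \<subseteq> {m..<m+n} \<and> vars_qff \<Phi> \<subseteq> {..<m+n}
      \<and> b_sigma2pp_true m n \<Psi> \<Phi>}"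

datatype move = MoveL | MoveR | MoveS

text \<open>States 0..nstates-1 (start 0, halt 1), symbols 0..nsyms-1 (0 = blank).\<close>
record tmachine =
  nstates :: nat
  nsyms :: nat
  delta :: "nat \<Rightarrow> nat \<Rightarrow> nat \<times> nat \<times> move"

definition wf_tm :: "tmachine \<Rightarrow> bool" where
  "wf_tm M \<longleftrightarrow> 2 \<le> nstates M \<and> 15 \<le> nsyms M \<and>
     (\<forall>q<nstates M. \<forall>s<nsyms M. fst (delta M q s) < nstates M \<and> fst (snd (delta M q s)) < nsyms M)"

text \<open>Configuration (q, ls, rs): ls = cells left of the head (nearest first),
  rs = head cell followed by the cells to its right; missing cells are blank.\<close>
type_synonym config = "nat \<times> nat list \<times> nat list"

definition head_sym :: "nat list \<Rightarrow> nat" where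
  "head_sym rs = (case rs of [] \<Rightarrow> 0 | s # _ \<Rightarrow> s)"

definition step :: "tmachine \<Rightarrow> config \<Rightarrow> config" where
  "step M c = (case c of (q, ls, rs) \<Rightarrow>
     if q = 1 then c else
     (case delta M q (head_sym rs) of (q', s', d) \<Rightarrow>
       let rs' = s' # tl rs in
       (case d of
          MoveL \<Rightarrow> (case ls of [] \<Rightarrow> (q', [], 0 # rs') | l # ls' \<Rightarrow> (q', ls', l # rs'))
        | MoveR \<Rightarrow> (q', s' # ls, tl rs')
        | MoveS \<Rightarrow> (q', ls, rs'))))"

definition run :: "tmachine \<Rightarrow> nat \<Rightarrow> nat list \<Rightarrow> config" where
  "run M t w = (step M ^^ t) (0, [], w)"

definition halts_with :: "tmachine \<Rightarrow> nat list \<Rightarrow> nat \<Rightarrow> nat list \<Rightarrow> bool" where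
  "halts_with M w t v \<longleftrightarrow> fst (run M t w) = 1 \<and> takeWhile (\<lambda>s. s \<noteq> 0) (snd (snd (run M t w))) = v"

definition poly_time_computes :: "tmachine \<Rightarrow> (nat list \<Rightarrow> nat list) \<Rightarrow> bool" where
  "poly_time_computes M f \<longleftrightarrow> wf_tm M \<and>
     (\<exists>c d::nat. \<forall>w. set w \<subseteq> alphabet \<longrightarrow>
        (\<exists>t \<le> c * length w ^ d + c. halts_with M w t (f w)))"

definition poly_reducible :: "nat list set \<Rightarrow> nat list set \<Rightarrow> bool" where
  "poly_reducible A B \<longleftrightarrow>
     (\<exists>M f. poly_time_computes M f \<and> (\<forall>w. set w \<subseteq> alphabet \<longrightarrow> (w \<in> A \<longleftrightarrow> f w \<in> B)))"

end

theory Submission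
 imports Defs "HOL-Analysis.Function_Metric" "Jordan_Normal_Form.Char_Poly"
begin

text \<open>
 A formula without strict inequalities holds iff a continuous function, built from its atoms by
 \<open>max\<close> and \<open>min\<close>, is nonpositive. Eliminating a block of variables means projecting an open set whose
 frontier lies in the zero set of an integer polynomial. The critical values of the square of this
 polynomial, perturbed so that the critical points solve a monic system, are roots of a characteristic
 polynomial; this gives an integer polynomial for the frontier of the projection, with explicit bounds
 on its degree and norm. Doing this for both blocks of \<open>\<exists>X. \<forall>Y. \<Phi> t X Y\<close> shows that its truth value is
 constant for \<open>t \<ge> 2 ^ 2 ^ q\<close>, where \<open>q\<close> is cubic in the length of the sentence.

 Applied to a parameter that bounds \<open>X\<close>, and then to one that bounds \<open>Y\<close>, this reduces unbounded to
 bounded sentences by rescaling; applied to a tolerance, it turns the premises \<open>\<bar>Y\<bar> \<le> 1\<close> and \<open>\<Psi> Y\<close> into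
 disjuncts without strict inequalities. The thresholds are defined by repeated squaring of additional
 existentially quantified variables. The reductions are computed by structured programs on stacks,
 which are compiled to Turing machines that store one cell of every stack in each cell of the tape.
\<close>

section \<open>Integer polynomials with norm bounds\<close>

text \<open>No quantifier elimination is carried out. Truth at large parameter values cannot change
  along an interval on which one integer polynomial has no root, because a connected set that meets
  a set but not its frontier lies inside it. So only frontiers have to be followed through the two
  projections, and only degree and norm matter: a nonzero integer polynomial in one variable of norm
  \<open>H\<close> has no root beyond \<open>H + 1\<close>. Two projections make this bound doubly
  exponential, hence \<open>2 ^ 2 ^ q\<close>. Such a number is too long for a constant, and in the
  bounded classes no variable may even take it as a value; there its reciprocal is defined by
  squaring \<open>1 / 2\<close>, and the formula is made homogeneous so that rescaling needs no
  division. The auxiliary variables need many indices that are cheap to print: an index whose binary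
  code is a run of ones is printed from a unary counter. Three reductions in a cycle, from
  \<open>Sigma2_le\<close> to \<open>b_Sigma2_le\<close> to \<open>b_Sigma2pp_le\<close> and back,
  give all six by transitivity.\<close>

definition mval :: "(int \<times> nat list) list => (nat => real) => real" where
 "mval ms x = (\<Sum>(c, l)\<leftarrow>ms. of_int c * prod_list (map x l))"

definition mnorm :: "(int \<times> nat list) list => nat" where
 "mnorm ms = (\<Sum>(c, l)\<leftarrow>ms. nat \<bar>c\<bar>)"

definition monoms :: "nat set => nat => (int \<times> nat list) list => bool" where
 "monoms A d ms \<longleftrightarrow> (\<forall>(c, l)\<in>set ms. set l \<subseteq> A \<and> length l \<le> d)"

text \<open>Only upper bounds are recorded, so the monomial list is not normalised; repeated or
  cancelling monomials do no harm. The sum of absolute coefficients is subadditive under sums and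
  submultiplicative under products, which keeps later estimates short. Points have infinitely many
  coordinates, of which those in \<open>A\<close> matter.\<close>

definition ipoly :: "nat set => nat => nat => ((nat => real) => real) => bool" where
 "ipoly A d H p \<longleftrightarrow> (\<exists>ms. p = mval ms \<and> mnorm ms \<le> H \<and> monoms A d ms)"

lemma mval_simps [simp]:
 "mval [] x = 0"
 "mval ((c, l) # ms) x = of_int c * prod_list (map x l) + mval ms x"
 "mval (ms @ ns) x = mval ms x + mval ns x"
 by (auto simp: mval_def)

lemma mnorm_simps [simp]:
 "mnorm [] = 0"
 "mnorm ((c, l) # ms) = nat \<bar>c\<bar> + mnorm ms"
 "mnorm (ms @ ns) = mnorm ms + mnorm ns"
 by (auto simp: mnorm_def)

lemma monomsD:
 assumes "monoms A d ms" "(c, l) \<in> set ms"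
 shows "set l \<subseteq> A" "length l \<le> d"
 using assms by (auto simp: monoms_def)

lemma ipolyI:
 assumes "!!x. p x = mval ms x" "mnorm ms \<le> H"
  "!!c l. (c, l) \<in> set ms ==> set l \<subseteq> A \<and> length l \<le> d"
 shows "ipoly A d H p"
 unfolding ipoly_def monoms_def using assms by (intro exI[of _ ms]) fastforce

lemma ipolyE:
 assumes "ipoly A d H p"
 obtains ms where "p = mval ms" "mnorm ms \<le> H" "monoms A d ms"
 using assms unfolding ipoly_def by blast

lemma ipoly_mono:
 assumes "ipoly A d H p" "A \<subseteq> A'" "d \<le> d'" "H \<le> H'"
 shows "ipoly A' d' H' p"
proof -
 obtain ms where "p = mval ms" "mnorm ms \<le> H" "monoms A d ms" using assms(1) by (rule ipolyE)
 with assms(2-4) show ?thesis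
  by (intro ipolyI[where ms=ms]) (fastforce simp: monoms_def)+
qed

lemma ipoly_const: "ipoly A d (nat \<bar>c\<bar>) (\<lambda>_. of_int c)"
 by (rule ipolyI[where ms="[(c, [])]"]) auto

lemma ipoly_0: "ipoly A d H (\<lambda>_. 0)"
 by (rule ipolyI[where ms="[]"]) auto

lemma ipoly_1: "ipoly A d 1 (\<lambda>_. 1)"
 using ipoly_const[of A d 1] by simp

lemma ipoly_var: "i \<in> A ==> ipoly A 1 1 (\<lambda>x. x i)"
 by (rule ipolyI[where ms="[(1, [i])]"]) auto

lemma ipoly_add:
 assumes "ipoly A d H p" "ipoly A d' H' q"
 shows "ipoly A (max d d') (H + H') (\<lambda>x. p x + q x)"
proof -
 obtain ms where 1: "p = mval ms" "mnorm ms \<le> H" "monoms A d ms" using assms(1) by (rule ipolyE)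
 obtain ns where 2: "q = mval ns" "mnorm ns \<le> H'" "monoms A d' ns" using assms(2) by (rule ipolyE)
 show ?thesis
  using 1 2 by (intro ipolyI[where ms="ms @ ns"]) (fastforce simp: monoms_def le_max_iff_disj)+
qed

definition mmul :: "int \<times> nat list => (int \<times> nat list) list => (int \<times> nat list) list" where
 "mmul cl ms = map (\<lambda>(c', l'). (fst cl * c', snd cl @ l')) ms"

lemma mval_mmul: "mval (mmul (c, l) ms) x = of_int c * prod_list (map x l) * mval ms x"
 by (induction ms) (auto simp: mmul_def algebra_simps)

lemma mnorm_mmul: "mnorm (mmul (c, l) ms) = nat \<bar>c\<bar> * mnorm ms"
 by (induction ms) (auto simp: mmul_def algebra_simps abs_mult nat_mult_distrib)

lemma ipoly_mult:
 assumes "ipoly A d H p" "ipoly A d' H' q"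
 shows "ipoly A (d + d') (H * H') (\<lambda>x. p x * q x)"
proof -
 obtain ms where 1: "p = mval ms" "mnorm ms \<le> H" "monoms A d ms" using assms(1) by (rule ipolyE)
 obtain ns where 2: "q = mval ns" "mnorm ns \<le> H'" "monoms A d' ns" using assms(2) by (rule ipolyE)
 define ps where "ps = concat (map (\<lambda>cl. mmul cl ns) ms)"
 have v: "mval ps x = mval ms x * mval ns x" for x
  unfolding ps_def by (induction ms) (auto simp: mval_mmul algebra_simps)
 have n: "mnorm ps = mnorm ms * mnorm ns"
  unfolding ps_def by (induction ms) (auto simp: mnorm_mmul algebra_simps)
 show ?thesis
 proof (rule ipolyI[where ms=ps])
  show "p x * q x = mval ps x" for x using 1 2 v by simp
  show "mnorm ps \<le> H * H'" using 1 2 n by (simp add: mult_le_mono)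
  show "set l \<subseteq> A \<and> length l \<le> d + d'" if "(c, l) \<in> set ps" for c l
   using that 1(3) 2(3) unfolding ps_def mmul_def monoms_def by (fastforce intro: add_mono)
 qed
qed

lemma ipoly_cmult:
 assumes "ipoly A d H p"
 shows "ipoly A d (nat \<bar>c\<bar> * H) (\<lambda>x. of_int c * p x)"
 using ipoly_mult[OF ipoly_const[of A 0 c] assms] by simp

lemma ipoly_minus:
 assumes "ipoly A d H p" "ipoly A d' H' q"
 shows "ipoly A (max d d') (H + H') (\<lambda>x. p x - q x)"
 using ipoly_add[OF assms(1) ipoly_cmult[OF assms(2), of "-1"]] by simp

lemma ipoly_sum:
 assumes "finite S" "!!s. s \<in> S ==> ipoly A d (H s) (p s)"
 shows "ipoly A d (\<Sum>s\<in>S. H s) (\<lambda>x. \<Sum>s\<in>S. p s x)"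
 using assms
proof (induction S rule: finite_induct)
 case (insert a S)
 then show ?case using ipoly_add[of A d "H a" "p a" d] by simp
qed (simp add: ipoly_0)

lemma ipoly_prod:
 assumes "finite S" "!!s. s \<in> S ==> ipoly A (d s) (H s) (p s)"
 shows "ipoly A (\<Sum>s\<in>S. d s) (\<Prod>s\<in>S. H s) (\<lambda>x. \<Prod>s\<in>S. p s x)"
 using assms
proof (induction S rule: finite_induct)
 case (insert a S)
 then show ?case using ipoly_mult[of A "d a" "H a" "p a"] by simp
qed (use ipoly_1 in simp)

lemma ipoly_power:
 assumes "ipoly A d H p"
 shows "ipoly A (k * d) (H ^ k) (\<lambda>x. p x ^ k)"
 using ipoly_prod[of "{..<k}" A "\<lambda>_. d" "\<lambda>_. H" "\<lambda>_. p"] assms by simp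

lemma prod_list_map_cong: "(!!i. i \<in> set l ==> f i = g i) ==> prod_list (map f l) = prod_list (map g l)"
 by (induction l) auto

lemma ipoly_cong:
 assumes "ipoly A d H p" "!!i. i \<in> A ==> x i = y i"
 shows "p x = p y"
proof -
 obtain ms where ms: "p = mval ms" "monoms A d ms" using assms(1) by (rule ipolyE)
 have "monoms A d ms ==> mval ms x = mval ms y"
 proof (induction ms)
  case (Cons cl ms)
  obtain c l where "cl = (c, l)" by force
  with Cons show ?case
   using assms(2) by (auto intro!: prod_list_map_cong simp: monoms_def subset_iff)
 qed simp
 with ms show ?thesis by auto
qed

lemma continuous_mval: "continuous_on UNIV (mval ms)"
proof (induction ms)
 case (Cons cl ms)
 obtain c l where cl: "cl = (c, l)" by force
 have "continuous_on UNIV (\<lambda>x :: nat => real. prod_list (map x l))"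
  by (induction l) (auto intro!: continuous_intros continuous_on_product_coordinates)
 with Cons show ?case by (auto simp: cl intro!: continuous_intros)
qed (simp add: mval_def)

lemma ipoly_continuous: "ipoly A d H p ==> continuous_on UNIV p"
 by (metis continuous_mval ipolyE)

lemma prod_list_filter_var:
 "prod_list (map x l) = (x v :: real) ^ count_list l v * prod_list (map x (filter (\<lambda>i. i \<noteq> v) l))"
 by (induction l) auto

lemma length_filter_count: "length (filter (\<lambda>i. i \<noteq> v) l) + count_list l v = length l"
 by (induction l) auto

text \<open>Monomials are sorted by the multiplicity of \<open>v\<close>. Each coefficient comes
  from a sublist of the monomials, so it inherits the norm bound unchanged.\<close>

lemma ipoly_split:
 assumes "ipoly A d H p"
 obtains F where "!!k. ipoly (A - {v}) (d - k) H (F k)" "!!x. p x = (\<Sum>k\<le>d. x v ^ k * F k x)"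
proof -
 obtain ms where ms: "p = mval ms" "mnorm ms \<le> H" "monoms A d ms" using assms by (rule ipolyE)
 define G where "G k = map (\<lambda>(c, l). (c, filter (\<lambda>i. i \<noteq> v) l)) (filter (\<lambda>(c, l). count_list l v = k) ms)" for k
 have norm: "mnorm (G k) \<le> mnorm ms" for k
  unfolding G_def by (induction ms) auto
 have val: "(\<forall>(c, l)\<in>set ms. length l \<le> d) ==> mval ms x = (\<Sum>k\<le>d. x v ^ k * mval (G k) x)" for x
  unfolding G_def
 proof (induction ms)
  case (Cons cl ms)
  obtain c l where cl: "cl = (c, l)" by force
  have le: "count_list l v \<le> d" using Cons.prems count_le_length[of l v] cl by auto
  let ?g = "\<lambda>k. x v ^ k * mval (map (\<lambda>(c, l). (c, filter (\<lambda>i. i \<noteq> v) l)) (filter (\<lambda>(c, l). count_list l v = k) ms)) x"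
  have "(\<Sum>k\<le>d. x v ^ k * mval (map (\<lambda>(c, l). (c, filter (\<lambda>i. i \<noteq> v) l)) (filter (\<lambda>(c, l). count_list l v = k) (cl # ms))) x)
    = (\<Sum>k\<le>d. (if k = count_list l v then of_int c * prod_list (map x l) else 0) + ?g k)"
   by (rule sum.cong) (auto simp: cl algebra_simps prod_list_filter_var[of x l v])
  also have "\<dots> = of_int c * prod_list (map x l) + (\<Sum>k\<le>d. ?g k)"
   using le by (simp add: sum.distrib)
  finally show ?case using Cons by (simp add: cl)
 qed simp
 show thesis
 proof (rule that[of "\<lambda>k. mval (G k)"])
  show "p x = (\<Sum>k\<le>d. x v ^ k * mval (G k) x)" for x using val ms(1,3) unfolding monoms_def by blast
  show "ipoly (A - {v}) (d - k) H (mval (G k))" for k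
  proof (rule ipolyI[where ms="G k"])
   show "mnorm (G k) \<le> H" using norm ms(2) by (rule order_trans)
   fix c l assume "(c, l) \<in> set (G k)"
   then obtain l' where l': "(c, l') \<in> set ms" "count_list l' v = k" "l = filter (\<lambda>i. i \<noteq> v) l'"
    unfolding G_def by auto
   then show "set l \<subseteq> A - {v} \<and> length l \<le> d - k"
    using monomsD[OF ms(3) l'(1)] length_filter_count[of v l'] by auto
  qed simp
 qed
qed

lemma mval_line: "\<exists>q. \<forall>t. mval ms (\<lambda>i. w i + t * z i) = poly q t"
proof (induction ms)
 case (Cons cl ms)
 obtain c l where cl: "cl = (c, l)" by force
 have "\<exists>q. \<forall>t. prod_list (map (\<lambda>i. w i + t * z i) l) = poly q t"
 proof (induction l)
  case Nil show ?case by (rule exI[of _ 1]) simp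
 next
  case (Cons a l)
  then obtain q where "\<forall>t. prod_list (map (\<lambda>i. w i + t * z i) l) = poly q t" ..
  then show ?case by (intro exI[of _ "[:w a, z a:] * q"]) (simp add: algebra_simps)
 qed
 then obtain q where q: "\<forall>t. prod_list (map (\<lambda>i. w i + t * z i) l) = poly q t" ..
 from Cons obtain r where "\<forall>t. mval ms (\<lambda>i. w i + t * z i) = poly r t" ..
 with q show ?case by (intro exI[of _ "[:of_int c:] * q + r"]) (simp add: cl)
qed (rule exI[of _ 0], simp)

text \<open>On the line from \<open>w\<close> to \<open>z\<close> the function is a univariate
  polynomial that does not vanish at parameter 1. It has finitely many roots, while the parameters
  that lead into \<open>W\<close> form an open set around 0.\<close>

lemma ipoly_dense:
 assumes p: "ipoly A d H p" and nz: "p z \<noteq> 0" and W: "open W" "w \<in> W"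
 obtains x where "x \<in> W" "p x \<noteq> 0"
proof -
 obtain ms where ms: "p = mval ms" using p by (rule ipolyE)
 obtain q where q: "!!t. p (\<lambda>i. w i + t * (z i - w i)) = poly q t"
  using mval_line[of ms w "\<lambda>i. z i - w i"] ms by auto
 have "q \<noteq> 0" using nz q[of 1] by auto
 then have fin: "finite {t. poly q t = 0}" by (rule poly_roots_finite)
 have "continuous_on UNIV (\<lambda>t i. w i + t * (z i - w i))"
  by (intro continuous_on_coordinatewise_then_product continuous_intros)
 then have "open ((\<lambda>t i. w i + t * (z i - w i)) -` W)"
  using W(1) by (simp add: open_vimage)
 moreover have "0 \<in> (\<lambda>t i. w i + t * (z i - w i)) -` W" using W(2) by simp
 ultimately have "infinite ((\<lambda>t i. w i + t * (z i - w i)) -` W)"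
  by (intro infinite_openin[of UNIV _ "0::real"]) (auto simp: islimpt_UNIV)
 then obtain t where "t \<in> (\<lambda>t i. w i + t * (z i - w i)) -` W" "poly q t \<noteq> 0"
  using fin by (metis (mono_tags, lifting) finite_subset mem_Collect_eq subsetI)
 then show thesis using that q by (metis vimageD)
qed

text \<open>The factor \<open>d * d\<close> counts \<open>d\<close> coefficients, each multiplied by
  an exponent of at most \<open>d\<close>. For \<open>v\<close> outside \<open>A\<close> the
  derivative is the zero polynomial, so the statement is uniform in \<open>v\<close>.\<close>

lemma ipoly_deriv:
 assumes "ipoly A d H p"
 obtains q where "ipoly A (d - 1) (d * d * H) q"
  "!!x. ((\<lambda>t. p (x(v := t))) has_real_derivative q x) (at (x v))"
proof -
 obtain F where F: "!!k. ipoly (A - {v}) (d - k) H (F k)" "!!x. p x = (\<Sum>k\<le>d. x v ^ k * F k x)"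
  using ipoly_split[OF assms, of v] by metis
 define q where "q x = (\<Sum>k\<in>{1..d}. of_int (int k) * (x v ^ (k - 1) * F k x))" for x
 show thesis
 proof (cases "v \<in> A")
  case True
  have "ipoly A (d - 1) (\<Sum>k\<in>{1..d}. nat \<bar>int k\<bar> * (1 ^ (k - 1) * H)) q"
   unfolding q_def
  proof (intro ipoly_sum ipoly_cmult)
   fix k assume k: "k \<in> {1..d}"
   have "ipoly A ((k - 1) * 1 + (d - k)) (1 ^ (k - 1) * H) (\<lambda>x. x v ^ (k - 1) * F k x)"
    by (intro ipoly_mult ipoly_power ipoly_var True ipoly_mono[OF F(1)]) auto
   then show "ipoly A (d - 1) (1 ^ (k - 1) * H) (\<lambda>x. x v ^ (k - 1) * F k x)"
    using k by (elim ipoly_mono) auto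
  qed auto
  moreover have "(\<Sum>k\<in>{1..d}. nat \<bar>int k\<bar> * (1 ^ (k - 1) * H)) \<le> (\<Sum>k\<in>{1..d}. d * H)"
   by (rule sum_mono) auto
  ultimately have "ipoly A (d - 1) (d * d * H) q"
   by (elim ipoly_mono) (auto simp: algebra_simps)
  moreover have "((\<lambda>t. p (x(v := t))) has_real_derivative q x) (at (x v))" for x
  proof -
   have *: "F k (x(v := t)) = F k x" for k t by (rule ipoly_cong[OF F(1)]) auto
   have "{..d} = insert 0 {1..d}" by auto
   then have **: "(\<lambda>t. p (x(v := t))) = (\<lambda>t. (\<Sum>k\<in>{1..d}. t ^ k * F k x) + F 0 x)"
    by (simp add: F(2) * add.commute)
   show ?thesis unfolding ** q_def
    by (auto intro!: derivative_eq_intros sum.cong simp: algebra_simps)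
  qed
  ultimately show thesis by (rule that)
 next
  case False
  have "p (x(v := t)) = p x" for x t by (rule ipoly_cong[OF assms]) (use False in auto)
  then show thesis by (intro that[of "\<lambda>_. 0"]) (auto simp: ipoly_0)
 qed
qed

section \<open>Reduction modulo a critical system; critical values as eigenvalues\<close>

lemma prod_list_partition:
 "prod_list (map x l) = (prod_list (map x (filter P l)) * prod_list (map x (filter (\<lambda>i. \<not> P i) l)) :: real)"
 by (induction l) auto

lemma prod_list_count:
 assumes "finite V" "set l \<subseteq> V"
 shows "prod_list (map x l) = (\<Prod>i\<in>V. (x i :: real) ^ count_list l i)"
 using assms(2)
proof (induction l)
 case (Cons a l)
 have "(\<Prod>i\<in>V. x i ^ count_list (a # l) i) = (\<Prod>i\<in>V. (if i = a then x i else 1) * x i ^ count_list l i)"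
  by (rule prod.cong) auto
 also have "\<dots> = x a * (\<Prod>i\<in>V. x i ^ count_list l i)"
  using Cons.prems assms(1) by (simp add: prod.distrib)
 finally show ?case using Cons by simp
qed simp

text \<open>
 On the solution set of a system \<open>x i ^ d = x kap * G i x\<close> with \<open>deg G i < d\<close>, every polynomial
 is a combination of the finitely many monomials with exponents below \<open>d\<close>, with coefficients that are
 polynomials in the remaining variables.
\<close>
locale critical_system =
 fixes V A :: "nat set" and d h kap :: nat and G :: "nat => (nat => real) => real"
 assumes V: "finite V" "V \<subseteq> A" and kap: "kap \<notin> A" and d: "d \<ge> 1" and h: "h \<ge> 1"
  and G: "!!i. i \<in> V ==> ipoly A (d - 1) h (G i)"
begin

definition crit :: "(nat => real) => bool" where
 "crit x \<longleftrightarrow> (\<forall>i\<in>V. x i ^ d = x kap * G i x)"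

definition expos :: "(nat => nat) set" where
 "expos = V \<rightarrow>\<^sub>E {..<d}"

definition bmon :: "(nat => nat) => (nat => real) => real" where
 "bmon \<alpha> x = (\<Prod>i\<in>V. x i ^ \<alpha> i)"

definition params :: "nat set" where
 "params = insert kap (A - V)"

text \<open>A normal form modulo the ideal of the system, but demanded only for values at critical
  points. This is all that an eigenvector needs, and it avoids ideals altogether.\<close>

definition rep :: "nat => nat => ((nat => real) => real) => bool" where
 "rep e Q p \<longleftrightarrow> (\<exists>m. (\<forall>\<alpha>\<in>expos. ipoly params e Q (m \<alpha>)) \<and>
   (\<forall>x. crit x --> p x = (\<Sum>\<alpha>\<in>expos. m \<alpha> x * bmon \<alpha> x)))"

lemma finite_expos: "finite expos"
 using V by (simp add: expos_def finite_PiE)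

lemma card_expos: "card expos = d ^ card V"
 using V by (simp add: expos_def card_PiE)

lemma rep_mono: "rep e Q p ==> e \<le> e' ==> Q \<le> Q' ==> rep e' Q' p"
 unfolding rep_def by (meson ipoly_mono order_refl)

lemma rep_cong: "rep e Q p ==> (!!x. crit x ==> p x = q x) ==> rep e Q q"
 unfolding rep_def by auto

lemma rep_0: "rep e Q (\<lambda>_. 0)"
 unfolding rep_def by (intro exI[of _ "\<lambda>_ _. 0"]) (auto simp: ipoly_0)

lemma rep_add:
 assumes "rep e Q p" "rep e Q' q"
 shows "rep e (Q + Q') (\<lambda>x. p x + q x)"
proof -
 from assms(1) obtain m where m: "!!\<alpha>. \<alpha> \<in> expos ==> ipoly params e Q (m \<alpha>)"
  "!!x. crit x ==> p x = (\<Sum>\<alpha>\<in>expos. m \<alpha> x * bmon \<alpha> x)" unfolding rep_def by blast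
 from assms(2) obtain m' where m': "!!\<alpha>. \<alpha> \<in> expos ==> ipoly params e Q' (m' \<alpha>)"
  "!!x. crit x ==> q x = (\<Sum>\<alpha>\<in>expos. m' \<alpha> x * bmon \<alpha> x)" unfolding rep_def by blast
 show ?thesis unfolding rep_def
 proof (intro exI[of _ "\<lambda>\<alpha> x. m \<alpha> x + m' \<alpha> x"] conjI ballI allI impI)
  show "ipoly params e (Q + Q') (\<lambda>x. m \<alpha> x + m' \<alpha> x)" if "\<alpha> \<in> expos" for \<alpha>
   using ipoly_add[OF m(1)[OF that] m'(1)[OF that]] by simp
 qed (auto simp: m(2) m'(2) sum.distrib algebra_simps)
qed

lemma rep_cmult:
 assumes "rep e Q p"
 shows "rep e (nat \<bar>c\<bar> * Q) (\<lambda>x. of_int c * p x)"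
proof -
 from assms obtain m where m: "!!\<alpha>. \<alpha> \<in> expos ==> ipoly params e Q (m \<alpha>)"
  "!!x. crit x ==> p x = (\<Sum>\<alpha>\<in>expos. m \<alpha> x * bmon \<alpha> x)" unfolding rep_def by blast
 show ?thesis unfolding rep_def
  by (intro exI[of _ "\<lambda>\<alpha> x. of_int c * m \<alpha> x"] conjI ballI allI impI ipoly_cmult m(1))
   (auto simp: m(2) sum_distrib_left mult.assoc)
qed

lemma rep_mval:
 assumes "!!c l. (c, l) \<in> set ms ==> rep e Q (\<lambda>x. prod_list (map x l))"
 shows "rep e (mnorm ms * Q) (mval ms)"
 using assms
proof (induction ms)
 case Nil
 then show ?case using rep_0 by (simp add: mval_def)
next
 case (Cons cl ms)
 obtain c l where cl: "cl = (c, l)" by force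
 have "rep e (nat \<bar>c\<bar> * Q + mnorm ms * Q) (\<lambda>x. of_int c * prod_list (map x l) + mval ms x)"
  by (intro rep_add rep_cmult) (use Cons cl in auto)
 then show ?case by (simp add: cl algebra_simps)
qed

text \<open>Induction on the number of factors from \<open>V\<close>. Replacing
  \<open>x i ^ d\<close> by \<open>kap\<close> times a monomial of \<open>G i\<close>, of degree at
  most \<open>d - 1\<close>, does not raise the total degree, lowers the number of factors from
  \<open>V\<close>, and multiplies the norm by at most \<open>h\<close>. Hence the exponent of
  \<open>h\<close>.\<close>

lemma rep_monomial:
 assumes "set l \<subseteq> insert kap A"
 shows "rep (length l) (h ^ length (filter (\<lambda>i. i \<in> V) l)) (\<lambda>x. prod_list (map x l))"
 using assms
proof (induction "length (filter (\<lambda>i. i \<in> V) l)" arbitrary: l rule: less_induct)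
 case less
 let ?n = "length (filter (\<lambda>i. i \<in> V) l)"
 show ?case
 proof (cases "\<forall>i\<in>V. count_list l i < d")
  case True
  define \<beta> where "\<beta> = restrict (count_list l) V"
  have \<beta>: "\<beta> \<in> expos" using True by (auto simp: \<beta>_def expos_def)
  define r where "r x = prod_list (map x (filter (\<lambda>i. i \<notin> V) l))" for x :: "nat => real"
  have cnt: "count_list (filter (\<lambda>i. i \<in> V) l) i = count_list l i" if "i \<in> V" for i
   using that by (induction l) auto
  have r: "prod_list (map x l) = r x * bmon \<beta> x" for x
  proof -
   have "prod_list (map x l) = prod_list (map x (filter (\<lambda>i. i \<in> V) l)) * r x"
    unfolding r_def by (rule prod_list_partition)
   also have "prod_list (map x (filter (\<lambda>i. i \<in> V) l)) = bmon \<beta> x"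
    unfolding bmon_def \<beta>_def by (subst prod_list_count[OF V(1)]) (auto simp: cnt)
   finally show ?thesis by simp
  qed
  have ir: "ipoly params (length l) 1 r"
  proof (rule ipolyI[where ms="[(1, filter (\<lambda>i. i \<notin> V) l)]"])
   show "set l' \<subseteq> params \<and> length l' \<le> length l"
    if "(c, l') \<in> set [(1, filter (\<lambda>i. i \<notin> V) l)]" for c :: int and l'
    using that less.prems by (auto simp: params_def)
  qed (auto simp: r_def)
  show ?thesis unfolding rep_def
  proof (intro exI[of _ "\<lambda>\<alpha> x. if \<alpha> = \<beta> then r x else 0"] conjI ballI allI impI)
   fix \<alpha> assume "\<alpha> \<in> expos"
   have "1 \<le> h ^ ?n" using h by simp
   then show "ipoly params (length l) (h ^ ?n) (\<lambda>x. if \<alpha> = \<beta> then r x else 0)"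
    using ir by (cases "\<alpha> = \<beta>") (auto intro: ipoly_mono ipoly_0)
  next
   fix x
   have "(\<Sum>\<alpha>\<in>expos. (if \<alpha> = \<beta> then r x else 0) * bmon \<alpha> x) = (\<Sum>\<alpha>\<in>expos. if \<alpha> = \<beta> then r x * bmon \<beta> x else 0)"
    by (rule sum.cong) auto
   also have "\<dots> = r x * bmon \<beta> x" using \<beta> finite_expos by simp
   finally show "prod_list (map x l) = (\<Sum>\<alpha>\<in>expos. (if \<alpha> = \<beta> then r x else 0) * bmon \<alpha> x)"
    by (simp add: r)
  qed
 next
  case False
  then obtain i where i: "i \<in> V" "d \<le> count_list l i" by (auto simp: not_less)
  \<comment> \<open>\<open>l'\<close> is \<open>l\<close> without \<open>d\<close> copies of
    \<open>i\<close>, up to order; these copies are what the equation for \<open>i\<close>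
    rewrites.\<close>
  define l' where "l' = replicate (count_list l i - d) i @ filter (\<lambda>j. j \<noteq> i) l"
  have l': "prod_list (map x l) = x i ^ d * prod_list (map x l')" for x :: "nat => real"
   unfolding l'_def prod_list_filter_var[of x l i] using i(2)
   by (simp add: power_add[symmetric] prod_list_replicate mult.assoc[symmetric])
  have len: "length l' + d = length l"
   unfolding l'_def using i(2) length_filter_count[of i l] by simp
  have fl: "length (filter (\<lambda>j. j \<in> V) (filter (\<lambda>j. j \<noteq> i) l)) + count_list l i = ?n"
   using i(1) by (induction l) auto
  have nl: "length (filter (\<lambda>i. i \<in> V) l') + d = ?n"
   unfolding l'_def using i fl by simp
  have sl: "set l' \<subseteq> insert kap A"
   unfolding l'_def using less.prems i V by auto
  obtain ms where ms: "G i = mval ms" "mnorm ms \<le> h" "monoms A (d - 1) ms" using G[OF i(1)] by (rule ipolyE)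
  define ns where "ns = map (\<lambda>(c, g). (c, kap # g @ l')) ms"
  have nv: "mval ns x = x kap * mval ms x * prod_list (map x l')" for x
   unfolding ns_def by (induction ms) (auto simp: algebra_simps)
  have nn: "mnorm ns = mnorm ms" unfolding ns_def by (induction ms) auto
  have rep_ns: "rep (length l) (mnorm ns * h ^ (?n - 1)) (mval ns)"
  proof (rule rep_mval)
   fix c q assume "(c, q) \<in> set ns"
   then obtain g where g: "(c, g) \<in> set ms" "q = kap # g @ l'" unfolding ns_def by auto
   have kV: "kap \<notin> V" using V kap by auto
   have lt: "length (filter (\<lambda>i. i \<in> V) q) \<le> ?n - 1"
   proof -
    have "length (filter (\<lambda>i. i \<in> V) g) \<le> d - 1"
     using length_filter_le monomsD(2)[OF ms(3) g(1)] by (rule order_trans)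
    moreover have "length (filter (\<lambda>i. i \<in> V) q) = length (filter (\<lambda>i. i \<in> V) g) + length (filter (\<lambda>i. i \<in> V) l')"
     using kV by (simp add: g(2))
    ultimately show ?thesis using nl d by linarith
   qed
   have pos: "?n \<ge> 1" using nl d by simp
   have "rep (length q) (h ^ length (filter (\<lambda>i. i \<in> V) q)) (\<lambda>x. prod_list (map x q))"
   proof (rule less.hyps)
    show "length (filter (\<lambda>i. i \<in> V) q) < ?n" using lt pos by linarith
    show "set q \<subseteq> insert kap A" using monomsD(1)[OF ms(3) g(1)] g(2) sl by auto
   qed
   moreover have "length q \<le> length l" using monomsD(2)[OF ms(3) g(1)] len d g(2) by simp
   moreover have "h ^ length (filter (\<lambda>i. i \<in> V) q) \<le> h ^ (?n - 1)"
    using lt h by (rule power_increasing)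
   ultimately show "rep (length l) (h ^ (?n - 1)) (\<lambda>x. prod_list (map x q))"
    by (rule rep_mono)
  qed
  have "?n \<noteq> 0" using nl d by linarith
  then have "h * h ^ (?n - 1) = h ^ ?n" by (simp only: power_eq_if[of h ?n] if_False)
  moreover have "mnorm ns * h ^ (?n - 1) \<le> h * h ^ (?n - 1)"
   by (rule mult_le_mono1) (simp add: nn ms(2))
  ultimately have le: "mnorm ns * h ^ (?n - 1) \<le> h ^ ?n" by (simp only:)
  have "rep (length l) (h ^ ?n) (mval ns)" by (rule rep_mono[OF rep_ns order_refl le])
  then show ?thesis
   by (rule rep_cong) (use i(1) in \<open>auto simp: nv l' crit_def ms(1)\<close>)
 qed
qed

lemma rep_ipoly:
 assumes "ipoly A e Q p"
 shows "rep e (Q * h ^ e) p"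
proof -
 obtain ms where ms: "p = mval ms" "mnorm ms \<le> Q" "monoms A e ms" using assms by (rule ipolyE)
 have "rep e (mnorm ms * h ^ e) (mval ms)"
 proof (rule rep_mval)
  fix c l assume cl: "(c, l) \<in> set ms"
  have "rep (length l) (h ^ length (filter (\<lambda>i. i \<in> V) l)) (\<lambda>x. prod_list (map x l))"
   by (rule rep_monomial) (use monomsD(1)[OF ms(3) cl] in auto)
  moreover have "length (filter (\<lambda>i. i \<in> V) l) \<le> e"
   using monomsD(2)[OF ms(3) cl] length_filter_le[of _ l] by (rule order_trans[rotated])
  ultimately show "rep e (h ^ e) (\<lambda>x. prod_list (map x l))"
   using monomsD(2)[OF ms(3) cl] h by (elim rep_mono) (auto intro: power_increasing)
 qed
 then show ?thesis using ms(1,2) by (auto elim!: rep_mono)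
qed

lemma bmon_ipoly:
 assumes "\<alpha> \<in> expos"
 shows "ipoly A (card V * (d - 1)) 1 (bmon \<alpha>)"
proof -
 have "ipoly A (\<Sum>i\<in>V. \<alpha> i * 1) (\<Prod>i\<in>V. 1 ^ \<alpha> i) (bmon \<alpha>)"
  unfolding bmon_def using V by (intro ipoly_prod ipoly_power ipoly_var) auto
 moreover have "(\<Sum>i\<in>V. \<alpha> i * 1) \<le> (\<Sum>i\<in>V. d - 1)"
  using assms by (intro sum_mono) (auto simp: expos_def dest!: PiE_mem)
 ultimately show ?thesis by (auto elim: ipoly_mono)
qed

text \<open>The Leibniz expansion has \<open>fact N\<close> products of \<open>N\<close> entries
  with coefficients of absolute value 1.\<close>

lemma ipoly_det:
 fixes M :: "(nat => real) => real mat"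
 assumes "!!x. M x \<in> carrier_mat N N"
  and "!!i j. i < N ==> j < N ==> ipoly B e Q (\<lambda>x. M x $$ (i, j))"
 shows "ipoly B (N * e) (fact N * Q ^ N) (\<lambda>x. det (M x))"
proof -
 have "ipoly B (N * e) (\<Sum>p\<in>{p. p permutes {0..<N}}. nat \<bar>sign p\<bar> * (\<Prod>i\<in>{0..<N}. Q))
   (\<lambda>x. \<Sum>p\<in>{p. p permutes {0..<N}}. of_int (sign p) * (\<Prod>i\<in>{0..<N}. M x $$ (i, p i)))"
 proof (intro ipoly_sum ipoly_cmult finite_permutations)
  fix p assume p: "p \<in> {p. p permutes {0..<N}}"
  have "p i < N" if "i < N" for i using that p permutes_in_image[of p "{0..<N}" i] by simp
  then have "ipoly B (\<Sum>i\<in>{0..<N}. e) (\<Prod>i\<in>{0..<N}. Q) (\<lambda>x. \<Prod>i\<in>{0..<N}. M x $$ (i, p i))"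
   by (intro ipoly_prod assms) auto
  then show "ipoly B (N * e) (\<Prod>i\<in>{0..<N}. Q) (\<lambda>x. \<Prod>i\<in>{0..<N}. M x $$ (i, p i))" by simp
 qed simp
 moreover have "(\<Sum>p\<in>{p. p permutes {0..<N}}. nat \<bar>sign p\<bar> * (\<Prod>i\<in>{0..<N}. Q)) = fact N * Q ^ N"
 proof -
  have "(\<Sum>p\<in>{p. p permutes {0..<N}}. nat \<bar>sign p\<bar> * (\<Prod>i\<in>{0..<N}. Q)) = (\<Sum>p\<in>{p. p permutes {0..<N}}. Q ^ N)"
   by (rule sum.cong) (simp_all add: sign_def)
  moreover have "card {p. p permutes {0..<N}} = fact N" by (rule card_permutations) simp_all
  ultimately show ?thesis by (simp only: sum_constant of_nat_id)
 qed
 moreover have "(\<lambda>x. det (M x)) =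
   (\<lambda>x. \<Sum>p\<in>{p. p permutes {0..<N}}. of_int (sign p) * (\<Prod>i\<in>{0..<N}. M x $$ (i, p i)))"
 proof
  fix x
  have "dim_row (M x) = N" "dim_col (M x) = N" using assms(1)[of x] by (rule carrier_matD)+
  then show "det (M x) = (\<Sum>p\<in>{p. p permutes {0..<N}}. of_int (sign p) * (\<Prod>i\<in>{0..<N}. M x $$ (i, p i)))"
   by (simp add: det_def)
 qed
 ultimately show ?thesis by (simp only:)
qed

text \<open>The critical values of \<open>U\<close> are eigenvalues of the matrix of multiplication by \<open>U\<close>.\<close>
lemma critical_value_polynomial:
 assumes U: "ipoly A d Q U" and cc: "cc \<notin> insert kap A"
 defines "N \<equiv> d ^ card V" and "e \<equiv> d + card V * (d - 1)"
 obtains \<chi> where "ipoly (insert cc params) (N * e) (fact N * (Q * h ^ e + 1) ^ N) \<chi>"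
  "!!x. crit x ==> x cc = U x ==> \<chi> x = 0" "\<exists>x. \<chi> x \<noteq> 0"
proof -
 \<comment> \<open>Row \<open>\<beta>\<close> of the multiplication matrix: the normal form of
   \<open>U\<close> times the basis monomial \<open>\<beta>\<close>.\<close>
 have "\<forall>\<beta>\<in>expos. \<exists>m. (\<forall>\<alpha>\<in>expos. ipoly params e (Q * h ^ e) (m \<alpha>)) \<and>
   (\<forall>x. crit x --> U x * bmon \<beta> x = (\<Sum>\<alpha>\<in>expos. m \<alpha> x * bmon \<alpha> x))"
 proof
  fix \<beta> assume "\<beta> \<in> expos"
  then have "ipoly A e (Q * 1) (\<lambda>x. U x * bmon \<beta> x)"
   unfolding e_def by (intro ipoly_mult U bmon_ipoly)
  then show "\<exists>m. (\<forall>\<alpha>\<in>expos. ipoly params e (Q * h ^ e) (m \<alpha>)) \<and>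
   (\<forall>x. crit x --> U x * bmon \<beta> x = (\<Sum>\<alpha>\<in>expos. m \<alpha> x * bmon \<alpha> x))"
   using rep_ipoly[of e Q] unfolding rep_def by simp
 qed
 from bchoice[OF this] obtain m where
  m: "!!\<beta> \<alpha>. \<beta> \<in> expos ==> \<alpha> \<in> expos ==> ipoly params e (Q * h ^ e) (m \<beta> \<alpha>)"
    "!!\<beta> x. \<beta> \<in> expos ==> crit x ==> U x * bmon \<beta> x = (\<Sum>\<alpha>\<in>expos. m \<beta> \<alpha> x * bmon \<alpha> x)"
  by blast
 obtain f where f: "bij_betw f {0..<N} expos"
  using ex_bij_betw_nat_finite[OF finite_expos] by (auto simp: card_expos N_def)
 have fe: "f i \<in> expos" if "i < N" for i using f that by (auto simp: bij_betw_def)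
 define M where "M x = mat N N (\<lambda>(i, j). m (f i) (f j) x)" for x
 have Mc: "M x \<in> carrier_mat N N" for x by (simp add: M_def)
 define \<chi> where "\<chi> x = det (- (char_matrix (M x) (x cc)))" for x
 have eig: "\<chi> x = poly (char_poly (M x)) (x cc)" for x
  unfolding \<chi>_def using char_poly_matrix[OF Mc] by simp
 have e1: "e \<ge> 1" using d by (simp add: e_def)
 show thesis
 proof (rule that)
  show "ipoly (insert cc params) (N * e) (fact N * (Q * h ^ e + 1) ^ N) \<chi>"
   unfolding \<chi>_def
  proof (rule ipoly_det)
   show "- char_matrix (M x) (x cc) \<in> carrier_mat N N" for x using Mc by simp
   fix i j assume ij: "i < N" "j < N"
   have "(\<lambda>x. (- char_matrix (M x) (x cc)) $$ (i, j)) = (\<lambda>x. (if i = j then x cc else 0) - m (f i) (f j) x)"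
    using ij by (auto simp: char_matrix_def M_def)
   moreover have "ipoly (insert cc params) (max e e) (1 + Q * h ^ e) (\<lambda>x. (if i = j then x cc else 0) - m (f i) (f j) x)"
   proof (rule ipoly_minus)
    show "ipoly (insert cc params) e 1 (\<lambda>x. if i = j then x cc else 0)"
    proof (cases "i = j")
     case True
     then show ?thesis using ipoly_mono[OF ipoly_var[of cc "insert cc params"] order_refl e1 order_refl] by simp
    qed (simp add: ipoly_0)
    show "ipoly (insert cc params) e (Q * h ^ e) (m (f i) (f j))"
     by (rule ipoly_mono[OF m(1)]) (auto simp: fe ij)
   qed
   ultimately show "ipoly (insert cc params) e (Q * h ^ e + 1) (\<lambda>x. (- char_matrix (M x) (x cc)) $$ (i, j))"
    by (simp add: add.commute)
  qed
  show "\<chi> x = 0" if x: "crit x" "x cc = U x" for x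
  proof -
   \<comment> \<open>The values of the basis monomials at a critical point form an eigenvector. It
     is nonzero because the monomial with all exponents 0 has value 1.\<close>
   define v where "v = vec N (\<lambda>j. bmon (f j) x)"
   have "M x *\<^sub>v v = U x \<cdot>\<^sub>v v"
   proof (rule eq_vecI)
    fix i assume "i < dim_vec (U x \<cdot>\<^sub>v v)"
    then have i: "i < N" by (simp add: v_def)
    have "vec_index (M x *\<^sub>v v) i = (\<Sum>j\<in>{0..<N}. m (f i) (f j) x * bmon (f j) x)"
     using i by (simp add: M_def v_def scalar_prod_def)
    also have "\<dots> = (\<Sum>\<alpha>\<in>expos. m (f i) \<alpha> x * bmon \<alpha> x)"
     by (rule sum.reindex_bij_betw[OF f])
    also have "\<dots> = U x * bmon (f i) x" using m(2)[OF fe[OF i] x(1)] by simp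
    finally show "vec_index (M x *\<^sub>v v) i = vec_index (U x \<cdot>\<^sub>v v) i" using i by (simp add: v_def)
   qed (simp add: M_def v_def)
   moreover have "v \<noteq> 0\<^sub>v N"
   proof
    assume v0: "v = 0\<^sub>v N"
    have "restrict (\<lambda>_. 0) V \<in> expos" using d by (auto simp: expos_def)
    then obtain j where j: "j < N" "f j = restrict (\<lambda>_. 0) V"
     using f by (auto simp: bij_betw_def image_iff dest!: equalityD2 subsetD)
    have "vec_index v j = 1" using j by (simp add: v_def bmon_def)
    then show False using v0 j by simp
   qed
   ultimately have "eigenvector (M x) v (U x)"
    by (simp add: eigenvector_def v_def M_def)
   then have "eigenvalue (M x) (U x)" by (auto simp: eigenvalue_def)
   then show ?thesis using eig x(2) eigenvalue_root_char_poly[OF Mc] by simp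
  qed
  show "\<exists>x. \<chi> x \<noteq> 0"
  proof -
   let ?x = "\<lambda>_::nat. 0::real"
   \<comment> \<open>At fixed parameters the characteristic polynomial is monic and has finitely
     many roots. Since the matrix does not involve \<open>cc\<close>, this coordinate alone can be
     moved off them.\<close>
   have "char_poly (M ?x) \<noteq> 0" using degree_monic_char_poly[OF Mc[of ?x]] by auto
   then have "finite {c. poly (char_poly (M ?x)) c = 0}" by (rule poly_roots_finite)
   then obtain c where c: "poly (char_poly (M ?x)) c \<noteq> 0"
    using ex_new_if_finite[OF infinite_UNIV_char_0] by auto
   have "M (?x(cc := c)) = M ?x"
    unfolding M_def
   proof (rule cong_mat, goal_cases)
    case (3 i j)
    have "m (f i) (f j) (?x(cc := c)) = m (f i) (f j) ?x"
    proof (rule ipoly_cong[OF m(1)[OF fe[OF 3(1)] fe[OF 3(2)]]])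
     fix k assume "k \<in> params"
     with cc have "k \<noteq> cc" by (auto simp: params_def)
     then show "(?x(cc := c)) k = ?x k" by simp
    qed
    then show ?case by simp
   qed simp_all
   then show ?thesis using eig[of "?x(cc := c)"] c by (intro exI[of _ "?x(cc := c)"]) simp
  qed
 qed
qed

end

section \<open>Frontiers of projections\<close>

text \<open>Tychonoff: with infinitely many coordinates, boxes take the place of closed
  balls.\<close>

lemma compact_box: "compact {x :: nat => real. \<forall>i. \<bar>x i\<bar> \<le> b i}"
proof -
 have "compactin (product_topology (\<lambda>_. euclidean) UNIV) (\<Pi>\<^sub>E i\<in>UNIV. {- b i..b i})"
  by (simp add: compactin_PiE)
 moreover have "(\<Pi>\<^sub>E i\<in>UNIV. {- b i..b i}) = {x. \<forall>i. \<bar>x i\<bar> \<le> b i}"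
  by (auto simp: PiE_UNIV_domain abs_le_iff Pi_iff minus_le_iff)
 ultimately show ?thesis by (simp add: euclidean_product_topology)
qed

lemma tendsto_coordinate:
 fixes f :: "'b => nat => real"
 assumes "(f \<longlongrightarrow> l) F"
 shows "((\<lambda>n. f n i) \<longlongrightarrow> l i) F"
proof -
 have "continuous_on UNIV (\<lambda>x :: nat => real. x i)" by (rule continuous_on_product_coordinates)
 then show ?thesis using assms by (rule continuous_on_tendsto_compose) auto
qed

lemma bounded_subsequence:
 fixes z :: "nat => nat => real"
 assumes "!!n i. \<bar>z n i\<bar> \<le> b i"
 obtains l r where "strict_mono r" "(z \<circ> r) \<longlonglongrightarrow> l"
proof -
 have "seq_compact {x :: nat => real. \<forall>i. \<bar>x i\<bar> \<le> b i}"
  using compact_box[of b] by (simp add: compact_eq_seq_compact_metric)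
 then show thesis
  by (rule seq_compactE[of _ z]) (use assms that in auto)
qed

lemma ipoly_tendsto:
 assumes "ipoly A d H p" "(f \<longlongrightarrow> l) F"
 shows "((\<lambda>n. p (f n)) \<longlongrightarrow> p l) F"
 using continuous_on_tendsto_compose[OF ipoly_continuous[OF assms(1)] assms(2)] by simp

text \<open>After division by \<open>\<kappa> j ^ m\<close> all lower terms tend to 0. In this way
  the perturbation is eliminated: \<open>\<kappa>\<close> is the inverse of a vanishing coefficient,
  and only the leading coefficient in it survives.\<close>

lemma leading_coefficient_limit:
 fixes \<kappa> :: "nat => real" and \<phi> :: "nat => nat => real"
 assumes \<kappa>: "filterlim \<kappa> at_top sequentially"
  and \<phi>: "!!a. a \<le> m ==> \<phi> a \<longlonglongrightarrow> l a"
  and z: "!!j. (\<Sum>a\<le>m. \<kappa> j ^ a * \<phi> a j) = 0"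
 shows "l m = 0"
proof -
 have inv: "(\<lambda>j. inverse (\<kappa> j)) \<longlonglongrightarrow> 0"
  using \<kappa> by (rule tendsto_inverse_0_at_top)
 have "(\<lambda>j. \<Sum>a<m. inverse (\<kappa> j) ^ (m - a) * \<phi> a j) \<longlonglongrightarrow> (\<Sum>a<m. 0 ^ (m - a) * l a)"
  by (intro tendsto_intros inv \<phi>) auto
 moreover have "(\<Sum>a<m. 0 ^ (m - a) * l a) = 0" by (intro sum.neutral) auto
 ultimately have 1: "(\<lambda>j. - (\<Sum>a<m. inverse (\<kappa> j) ^ (m - a) * \<phi> a j)) \<longlonglongrightarrow> 0"
  using tendsto_minus by fastforce
 have "eventually (\<lambda>j. \<kappa> j > 0) sequentially"
  using \<kappa> by (simp add: filterlim_at_top_dense)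
 then have "eventually (\<lambda>j. - (\<Sum>a<m. inverse (\<kappa> j) ^ (m - a) * \<phi> a j) = \<phi> m j) sequentially"
 proof eventually_elim
  case (elim j)
  have "(\<Sum>a<m. inverse (\<kappa> j) ^ (m - a) * \<phi> a j) = inverse (\<kappa> j) ^ m * (\<Sum>a<m. \<kappa> j ^ a * \<phi> a j)"
   unfolding sum_distrib_left
  proof (rule sum.cong)
   fix a assume "a \<in> {..<m}"
   then have "inverse (\<kappa> j) ^ m * \<kappa> j ^ a = inverse (\<kappa> j) ^ (m - a)"
    using elim by (simp add: power_inverse field_simps power_add[symmetric])
   then show "inverse (\<kappa> j) ^ (m - a) * \<phi> a j = inverse (\<kappa> j) ^ m * (\<kappa> j ^ a * \<phi> a j)"
    by (simp add: mult.assoc[symmetric])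
  qed simp
  also have "(\<Sum>a<m. \<kappa> j ^ a * \<phi> a j) = - (\<kappa> j ^ m * \<phi> m j)"
   using z[of j] by (simp add: lessThan_Suc_atMost[symmetric])
  finally show ?case using elim by (simp add: power_inverse field_simps)
 qed
 then have "\<phi> m \<longlonglongrightarrow> 0" by (rule Lim_transform_eventually[OF 1])
 then show ?thesis using \<phi>[of m] LIMSEQ_unique by auto
qed

text \<open>The projection along \<open>V\<close>, kept in the full space as a set that ignores the
  coordinates in \<open>V\<close>. All sets thus have one type, and a projection can be projected
  again.\<close>

definition cylinder :: "nat set => (nat => real) set => (nat => real) set" where
 "cylinder V W = {x. \<exists>y\<in>W. \<forall>i. i \<notin> V --> y i = x i}"

lemma continuous_on_override:
 "continuous_on UNIV (\<lambda>x :: nat => real. \<lambda>i. if i \<in> V then z i else x i)"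
proof (intro continuous_on_coordinatewise_then_product)
 show "continuous_on UNIV (\<lambda>x :: nat => real. if i \<in> V then z i else x i)" for i
  by (cases "i \<in> V") (auto intro: continuous_on_product_coordinates)
qed

lemma open_cylinder:
 assumes "open W"
 shows "open (cylinder V W)"
proof -
 have "cylinder V W = (\<Union>z. (\<lambda>x i. if i \<in> V then z i else x i) -` W)"
 proof (intro equalityI subsetI)
  fix x assume "x \<in> cylinder V W"
  then obtain y where y: "y \<in> W" "\<forall>i. i \<notin> V --> y i = x i" by (auto simp: cylinder_def)
  then have "(\<lambda>i. if i \<in> V then y i else x i) = y" by auto
  with y show "x \<in> (\<Union>z. (\<lambda>x i. if i \<in> V then z i else x i) -` W)"
   by (intro UN_I[of y] vimageI2) simp_all
 next
  fix x assume "x \<in> (\<Union>z. (\<lambda>x i. if i \<in> V then z i else x i) -` W)"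
  then obtain z where "(\<lambda>i. if i \<in> V then z i else x i) \<in> W" by auto
  then show "x \<in> cylinder V W" unfolding cylinder_def
   by (intro CollectI bexI[of _ "\<lambda>i. if i \<in> V then z i else x i"]) simp_all
 qed
 then show ?thesis using assms by (auto intro!: open_vimage continuous_on_override)
qed

lemma frontier_bound:
 fixes W :: "(nat => real) set"
 assumes "\<forall>x\<in>W. (\<Sum>i\<in>V. (x i)\<^sup>2) < x k" "x \<in> closure W"
 shows "(\<Sum>i\<in>V. (x i)\<^sup>2) \<le> x k"
proof -
 have "closed {x :: nat => real. (\<Sum>i\<in>V. (x i)\<^sup>2) \<le> x k}"
  by (intro closed_Collect_le continuous_intros continuous_on_product_coordinates)
 then have "closure W \<subseteq> {x. (\<Sum>i\<in>V. (x i)\<^sup>2) \<le> x k}"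
  using assms(1) by (intro closure_minimal) (auto intro: less_imp_le)
 with assms(2) show ?thesis by auto
qed

lemma sum_squares_coordinate:
 fixes x :: "nat => real"
 assumes "finite V" "i \<in> V" "(\<Sum>i\<in>V. (x i)\<^sup>2) \<le> b"
 shows "\<bar>x i\<bar> \<le> 1 + b"
proof -
 have "(x i)\<^sup>2 \<le> b"
  using member_le_sum[of i V "\<lambda>i. (x i)\<^sup>2"] assms by auto
 moreover have "\<bar>x i\<bar> \<le> 1 + (x i)\<^sup>2"
 proof -
  have "0 \<le> (\<bar>x i\<bar> - 1)\<^sup>2 + 2 * \<bar>x i\<bar> * 0 + \<bar>x i\<bar>" by simp
  then show ?thesis by (simp add: power2_eq_square algebra_simps)
 qed
 ultimately show ?thesis by simp
qed

lemma ipoly_prune: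
 assumes "ipoly A d H p" "\<exists>x. p x \<noteq> 0"
 obtains F m where "!!k. ipoly (A - {v}) d H (F k)" "!!x. p x = (\<Sum>k\<le>m. x v ^ k * F k x)" "\<exists>x. F m x \<noteq> 0"
proof -
 obtain F where F: "!!k. ipoly (A - {v}) (d - k) H (F k)" "!!x. p x = (\<Sum>k\<le>d. x v ^ k * F k x)"
  using ipoly_split[OF assms(1)] by metis
 define S where "S = {k. k \<le> d \<and> (\<exists>x. F k x \<noteq> 0)}"
 have "S \<noteq> {}"
 proof
  assume "S = {}"
  then have "p x = 0" for x unfolding F(2) S_def by (intro sum.neutral) auto
  with assms(2) show False by auto
 qed
 then have m: "Max S \<in> S" by (intro Max_in) (auto simp: S_def)
 have "p x = (\<Sum>k\<le>Max S. x v ^ k * F k x)" for x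
  unfolding F(2)
 proof (rule sum.mono_neutral_right)
  show "\<forall>k\<in>{..d} - {..Max S}. x v ^ k * F k x = 0"
  proof
   fix k assume k: "k \<in> {..d} - {..Max S}"
   then have "k \<notin> S" using Max_ge[of S k] by (auto simp: S_def)
   then show "x v ^ k * F k x = 0" using k by (auto simp: S_def)
  qed
 qed (use m in \<open>auto simp: S_def\<close>)
 moreover have "ipoly (A - {v}) d H (F k)" for k by (rule ipoly_mono[OF F(1)]) auto
 moreover have "\<exists>x. F (Max S) x \<noteq> 0" using m unfolding S_def by blast
 ultimately show thesis using that[of F "Max S"] by simp
qed

text \<open>The split-off power of \<open>v\<close> vanishes only at \<open>v = 0\<close> and can be
  cancelled where \<open>v\<close> is positive. The cofactor has a coefficient \<open>F 0\<close>
  that is not identically zero and that governs its behaviour as \<open>v\<close> tends to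
  0.\<close>

lemma ipoly_lowest:
 assumes "ipoly A d H p" "\<exists>x. p x \<noteq> 0"
 obtains F m where "!!k. ipoly (A - {v}) d H (F k)"
  "!!x. p x = x v ^ m * (\<Sum>k\<le>d. x v ^ k * F k x)" "\<exists>x. F 0 x \<noteq> 0"
proof -
 obtain F where F: "!!k. ipoly (A - {v}) (d - k) H (F k)" "!!x. p x = (\<Sum>k\<le>d. x v ^ k * F k x)"
  using ipoly_split[OF assms(1)] by metis
 define P where "P k \<longleftrightarrow> k \<le> d \<and> (\<exists>x. F k x \<noteq> 0)" for k
 have "\<exists>k. P k"
 proof (rule ccontr)
  assume "\<nexists>k. P k"
  then have "p x = 0" for x unfolding F(2) P_def by (intro sum.neutral) auto
  with assms(2) show False by auto
 qed
 define m where "m = (LEAST k. P k)"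
 have m: "P m" unfolding m_def using \<open>\<exists>k. P k\<close> by (rule LeastI_ex)
 have lo: "F k x = 0" if "k < m" for k x
  using not_less_Least[of k P] that m unfolding m_def[symmetric] by (auto simp: P_def)
 define F' where "F' k x = (if k + m \<le> d then F (k + m) x else 0)" for k x
 have "p x = x v ^ m * (\<Sum>k\<le>d. x v ^ k * F' k x)" for x
 proof -
  have "(\<Sum>k\<le>d. x v ^ k * F' k x) = (\<Sum>k\<le>d - m. x v ^ k * F (k + m) x)"
   using m by (intro sum.mono_neutral_cong_right) (auto simp: F'_def P_def)
  then have "x v ^ m * (\<Sum>k\<le>d. x v ^ k * F' k x) = (\<Sum>k\<le>d - m. x v ^ (k + m) * F (k + m) x)"
   by (simp add: sum_distrib_left power_add mult_ac)
  also have "\<dots> = (\<Sum>k\<in>{m..d}. x v ^ k * F k x)"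
   using m by (intro sum.reindex_bij_witness[of _ "\<lambda>k. k - m" "\<lambda>k. k + m"]) (auto simp: P_def)
  also have "\<dots> = p x" unfolding F(2)
   by (rule sum.mono_neutral_left) (use lo in auto)
  finally show ?thesis by simp
 qed
 moreover have "ipoly (A - {v}) d H (F' k)" for k
 proof (cases "k + m \<le> d")
  case True
  then have "F' k = F (k + m)" by (auto simp: F'_def)
  then show ?thesis using ipoly_mono[OF F(1)[of "k + m"], of "A - {v}" d H] by simp
 next
  case False
  then have "F' k = (\<lambda>_. 0)" by (auto simp: F'_def)
  then show ?thesis by (simp add: ipoly_0)
 qed
 moreover have "\<exists>x. F' 0 x \<noteq> 0" using m by (auto simp: F'_def P_def)
 ultimately show thesis using that[of F' m] by simp
qed

text \<open>Degree of the critical value polynomial of \<open>R ^ 2\<close> for \<open>R\<close> of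
  degree \<open>r\<close> and \<open>n\<close> projected variables: the matrix has size
  \<open>(2 * r) ^ n\<close>, and its entries have degree at most the second factor.\<close>

definition zdeg :: "nat => nat => nat" where
 "zdeg n r = (2 * r) ^ n * (2 * r + n * (2 * r - 1))"

text \<open>The Leibniz bound for the same matrix. \<open>R ^ 2\<close> has norm
  \<open>H ^ 2\<close>, and its derivatives have norm at most
  \<open>2 * r * (2 * r) * H ^ 2\<close>.\<close>

definition znorm :: "nat => nat => nat => nat" where
 "znorm n r H = fact ((2 * r) ^ n) *
   (H\<^sup>2 * (2 * r * (2 * r) * H\<^sup>2) ^ (2 * r + n * (2 * r - 1)) + 1) ^ ((2 * r) ^ n)"

text \<open>The \<open>w j\<close> maximise \<open>U\<close> minus a small multiple of \<open>\<Sum>i\<in>V. x i ^ (d + 1)\<close> on the slice of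
 \<open>closure W\<close> through \<open>y\<close>; they lie in \<open>W\<close> because \<open>U\<close> vanishes on its frontier. The perturbation makes the
 equations for critical points monic.\<close>
lemma slice_critical_points:
 fixes U :: "(nat => real) => real"
 assumes V: "finite V" and W: "open W" and k: "k \<notin> V"
  and bd: "\<forall>x\<in>W. (\<Sum>i\<in>V. (x i)\<^sup>2) < x k"
  and U: "continuous_on UNIV U" and fr: "!!x. x \<in> frontier W ==> U x = 0"
  and G: "!!i x. i \<in> V ==> ((\<lambda>t. U (x(i := t))) has_real_derivative G i x) (at (x i))"
  and y: "y \<in> W" "U y > 0"
 obtains z w \<kappa> where "z \<in> closure W" "!!i. i \<notin> V ==> z i = y i" "U z \<ge> U y"
  "filterlim \<kappa> at_top sequentially" "(\<lambda>j. U (w j)) \<longlonglongrightarrow> U z"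
  "!!j i. i \<notin> V ==> w j i = y i" "!!j i. i \<in> V ==> w j i ^ d = \<kappa> j * G i (w j)"
proof -
 define C where "C = {x \<in> closure W. \<forall>i. i \<notin> V --> x i = y i}"
 define P where "P x = (\<Sum>i\<in>V. x i ^ (d + 1))" for x :: "nat => real"
 have yC: "y \<in> C" using y closure_subset by (auto simp: C_def)
 have cl: "closed C"
 proof -
  have "C = closure W \<inter> (\<Inter>i\<in>-V. {x. x i = y i})" by (auto simp: C_def)
  moreover have "closed {x :: nat => real. x i = y i}" for i
   by (intro closed_Collect_eq continuous_intros continuous_on_product_coordinates)
  ultimately show ?thesis by (simp add: closed_INT closed_Int)
 qed
 have "C \<subseteq> {x. \<forall>i. \<bar>x i\<bar> \<le> 1 + \<bar>y k\<bar> + \<bar>y i\<bar>}"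
 proof clarify
  fix x i assume x: "x \<in> C"
  then have "(\<Sum>i\<in>V. (x i)\<^sup>2) \<le> x k" using frontier_bound[OF bd] by (auto simp: C_def)
  moreover have "x k = y k" using x k by (auto simp: C_def)
  ultimately show "\<bar>x i\<bar> \<le> 1 + \<bar>y k\<bar> + \<bar>y i\<bar>"
   using sum_squares_coordinate[OF V, of i x "y k"] x by (cases "i \<in> V") (auto simp: C_def)
 qed
 then have cpt: "compact C"
  using compact_Int_closed[OF compact_box cl, of "\<lambda>i. 1 + \<bar>y k\<bar> + \<bar>y i\<bar>"]
  by (simp add: Int_absorb1)
 have contP: "continuous_on UNIV P" unfolding P_def
  by (intro continuous_intros continuous_on_product_coordinates)
 obtain z where z: "z \<in> C" "!!x. x \<in> C ==> U x \<le> U z"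
  using continuous_attains_sup[OF cpt, of U] yC U continuous_on_subset by blast
 obtain b where b: "!!x. x \<in> C ==> \<bar>P x\<bar> \<le> b"
 proof -
  have "compact (P ` C)" using cpt contP continuous_on_subset compact_continuous_image by blast
  then have "bounded (P ` C)" by (rule compact_imp_bounded)
  then show thesis using that unfolding bounded_iff by auto
 qed
 have b0: "b \<ge> 0" using b[OF yC] by linarith
 have Uz: "U z > 0" using z(2)[OF yC] y by linarith
 \<comment> \<open>The factor \<open>2 + real j\<close> makes \<open>\<eta>\<close> tend to 0. The
   remaining constants ensure \<open>2 * \<eta> j * b < U z\<close>, so that \<open>U\<close> is
   still positive at the perturbed maximum.\<close>
 define \<eta> where "\<eta> j = U z / ((2 * b + 1) * (2 + real j))" for j :: nat
 have \<eta>: "\<eta> j > 0" "2 * \<eta> j * b < U z" for j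
 proof -
  show "\<eta> j > 0" using Uz b0 by (simp add: \<eta>_def)
  have "(2 * b + 1) * 1 \<le> (2 * b + 1) * (2 + real j)" using b0 by (intro mult_left_mono) auto
  then have "2 * b < (2 * b + 1) * (2 + real j)" by (rule less_le_trans[rotated]) simp
  then have "2 * b / ((2 * b + 1) * (2 + real j)) < 1" using b0 by simp
  then have "U z * (2 * b / ((2 * b + 1) * (2 + real j))) < U z * 1"
   using Uz by (intro mult_strict_left_mono) auto
  then show "2 * \<eta> j * b < U z" by (simp add: \<eta>_def algebra_simps)
 qed
 have "\<exists>w. w \<in> C \<and> (\<forall>x\<in>C. U x - \<eta> j * P x \<le> U w - \<eta> j * P w)" for j
 proof -
  have "continuous_on C (\<lambda>x. U x - \<eta> j * P x)"
   using U contP by (intro continuous_intros) (auto intro: continuous_on_subset)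
  from continuous_attains_sup[OF cpt _ this] yC show ?thesis by blast
 qed
 then obtain w where w: "!!j. w j \<in> C"
   "!!j x. x \<in> C ==> U x - \<eta> j * P x \<le> U (w j) - \<eta> j * P (w j)" by metis
 have Uw: "U (w j) \<ge> U z - 2 * \<eta> j * b" for j
 proof -
  have "\<eta> j * P (w j) \<ge> - (\<eta> j * b)" "\<eta> j * P z \<le> \<eta> j * b"
   using b[OF w(1)[of j]] b[OF z(1)] \<eta>(1)[of j]
   by (auto simp: abs_le_iff minus_mult_right simp del: mult_minus_right)
  then show ?thesis using w(2)[OF z(1), of j] by linarith
 qed
 have wW: "w j \<in> W" for j
 proof (rule ccontr)
  assume "w j \<notin> W"
  then have "w j \<in> frontier W" using w(1)[of j] W by (auto simp: C_def frontier_def interior_open)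
  then have "U (w j) = 0" by (rule fr)
  then show False using Uw[of j] \<eta>(2)[of j] by linarith
 qed
 \<comment> \<open>\<open>w j\<close> lies in the open set \<open>W\<close>, so it may be moved a
   little in direction \<open>i\<close> without leaving \<open>C\<close>; a local maximum has
   vanishing derivative.\<close>
 have crit: "G i (w j) = \<eta> j * (real (d + 1) * w j i ^ d)" if i: "i \<in> V" for i j
 proof -
  let ?f = "\<lambda>t. U ((w j)(i := t)) - \<eta> j * P ((w j)(i := t))"
  have "P ((w j)(i := t)) = t ^ (d + 1) + (\<Sum>l\<in>V - {i}. w j l ^ (d + 1))" for t
   unfolding P_def using V i by (simp add: sum.remove)
  then have "((\<lambda>t. P ((w j)(i := t))) has_real_derivative real (d + 1) * w j i ^ d) (at (w j i))"
   using DERIV_add[OF DERIV_pow[of "d + 1" "w j i"] DERIV_const[of "\<Sum>l\<in>V - {i}. w j l ^ (d + 1)"]] by simp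
  then have der: "(?f has_real_derivative G i (w j) - \<eta> j * (real (d + 1) * w j i ^ d)) (at (w j i))"
   by (intro DERIV_diff DERIV_cmult G i)
  have "continuous_on UNIV (\<lambda>t. (w j)(i := t))"
  proof (intro continuous_on_coordinatewise_then_product)
   show "continuous_on UNIV (\<lambda>t. ((w j)(i := t)) l)" for l by (cases "l = i") auto
  qed
  then have "open ((\<lambda>t. (w j)(i := t)) -` W)" using W by (rule open_vimage[rotated])
  moreover have "w j i \<in> (\<lambda>t. (w j)(i := t)) -` W" using wW by simp
  ultimately obtain \<delta> where \<delta>: "\<delta> > 0" "!!t. \<bar>w j i - t\<bar> < \<delta> ==> (w j)(i := t) \<in> W"
   unfolding open_dist dist_real_def by (metis abs_minus_commute vimageD)
  have "?f t \<le> ?f (w j i)" if "\<bar>w j i - t\<bar> < \<delta>" for t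
  proof -
   have "(w j)(i := t) \<in> C"
    using \<delta>(2)[OF that] closure_subset w(1)[of j] i by (auto simp: C_def)
   from w(2)[OF this, of j] show ?thesis by simp
  qed
  then have "G i (w j) - \<eta> j * (real (d + 1) * w j i ^ d) = 0"
   by (intro DERIV_local_max[OF der \<delta>(1)]) auto
  then show ?thesis by simp
 qed
 \<comment> \<open>Absorbs the factor \<open>d + 1\<close> from differentiating the perturbation, so
   that the equations take the monic form of the critical system.\<close>
 define \<kappa> where "\<kappa> j = inverse (\<eta> j * real (d + 1))" for j
 show thesis
 proof (rule that[of z \<kappa> w])
  show "z \<in> closure W" "!!i. i \<notin> V ==> z i = y i" using z by (auto simp: C_def)
  show "U z \<ge> U y" using z(2)[OF yC] .
  have \<eta>0: "\<eta> \<longlonglongrightarrow> 0"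
   unfolding \<eta>_def by (rule real_tendsto_divide_at_top[OF tendsto_const])
    (use b0 in \<open>intro filterlim_tendsto_pos_mult_at_top[OF tendsto_const]
      filterlim_tendsto_add_at_top[OF tendsto_const] filterlim_real_sequentially; simp\<close>)
  show "filterlim \<kappa> at_top sequentially"
   unfolding \<kappa>_def
  proof (rule filterlim_inverse_at_top)
   show "(\<lambda>j. \<eta> j * real (d + 1)) \<longlonglongrightarrow> 0" using tendsto_mult_right[OF \<eta>0, of "real (d + 1)"] by (simp add: tendsto_mult_left_zero \<eta>0)
   show "\<forall>\<^sub>F j in sequentially. 0 < \<eta> j * real (d + 1)" using \<eta>(1) by simp
  qed
  show "(\<lambda>j. U (w j)) \<longlonglongrightarrow> U z"
  proof (rule real_tendsto_sandwich)
   show "\<forall>\<^sub>F j in sequentially. U z - 2 * \<eta> j * b \<le> U (w j)" using Uw by simp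
   show "\<forall>\<^sub>F j in sequentially. U (w j) \<le> U z" using z(2) w(1) by simp
   have "(\<lambda>j. U z - 2 * \<eta> j * b) \<longlonglongrightarrow> U z - 2 * 0 * b" by (intro tendsto_intros \<eta>0)
   then show "(\<lambda>j. U z - 2 * \<eta> j * b) \<longlonglongrightarrow> U z" by simp
  qed simp
  show "w j i = y i" if "i \<notin> V" for j i using w(1)[of j] that by (auto simp: C_def)
  show "w j i ^ d = \<kappa> j * G i (w j)" if "i \<in> V" for j i
  proof -
   have "\<eta> j * real (d + 1) \<noteq> 0" using \<eta>(1)[of j] by simp
   moreover have "v = inverse (e * f) * (e * (f * v))" if "e * f \<noteq> 0" for e f v :: real
    using that by (simp add: field_simps)
   ultimately show ?thesis unfolding crit[OF that] \<kappa>_def by blast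
  qed
 qed
qed

text \<open>Near a frontier point \<open>\<theta>\<close> of the projection there are points of
  \<open>W\<close> with \<open>R\<close> nonzero, and their slices have critical values
  \<open>U z > 0\<close>. A limit \<open>l\<close> of the points \<open>z\<close> lies over
  \<open>\<theta>\<close>, in \<open>closure W\<close> but not in \<open>W\<close>, so
  \<open>U l = 0\<close>; the polynomial equation for the values \<open>U z\<close> then tends to
  \<open>T 0 \<theta> = 0\<close>. The bound by \<open>x k\<close> makes the slices compact and lets
  the \<open>z\<close> converge. \<open>T\<close> is built from \<open>R\<close> alone and serves
  every \<open>W\<close>.\<close>

lemma projection_frontier:
 assumes A: "finite A" "V \<subseteq> A" and k: "k \<notin> V" and R: "ipoly A r H R" "\<exists>x. R x \<noteq> 0"
  and r: "r \<ge> 1" and H: "H \<ge> 1"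
 shows "\<exists>T. ipoly (A - V) (zdeg (card V) r) (znorm (card V) r H) T \<and> (\<exists>x. T x \<noteq> 0) \<and>
  (\<forall>W. open W --> frontier W \<subseteq> {x. R x = 0} --> (\<forall>x\<in>W. (\<Sum>i\<in>V. (x i)\<^sup>2) < x k) -->
    frontier (cylinder V W) \<subseteq> {x. T x = 0})"
proof -
 define d where "d = 2 * r"
 define Q where "Q = H\<^sup>2"
 define h where "h = d * d * Q"
 define U where "U x = (R x)\<^sup>2" for x
 have finV: "finite V" using A finite_subset by blast
 have d: "d \<ge> 1" using r by (simp add: d_def)
 have h: "h \<ge> 1" using d H by (simp add: h_def Q_def)
 have U: "ipoly A d Q U"
  using ipoly_power[OF R(1), of 2] by (simp add: U_def[abs_def] d_def Q_def)
 have "\<exists>q. ipoly A (d - 1) h q \<and> (\<forall>x. ((\<lambda>t. U (x(v := t))) has_real_derivative q x) (at (x v)))" for v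
  using ipoly_deriv[OF U, of v] unfolding h_def by metis
 then obtain G where dG: "!!v. ipoly A (d - 1) h (G v)"
  "!!v x. ((\<lambda>t. U (x(v := t))) has_real_derivative G v x) (at (x v))" by metis
 obtain kap where kap: "kap \<notin> A" using A(1) ex_new_if_finite[OF infinite_UNIV_nat] by blast
 obtain cc where cc: "cc \<notin> insert kap A"
  using A(1) ex_new_if_finite[OF infinite_UNIV_nat, of "insert kap A"] by blast
 interpret critical_system V A d h kap G
  by unfold_locales (use finV A kap d h dG in auto)
 obtain \<chi> where \<chi>: "ipoly (insert cc params) (zdeg (card V) r) (znorm (card V) r H) \<chi>"
  "!!x. crit x ==> x cc = U x ==> \<chi> x = 0" "\<exists>x. \<chi> x \<noteq> 0"
  using critical_value_polynomial[OF U cc]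
  unfolding zdeg_def znorm_def d_def h_def Q_def by metis
 \<comment> \<open>The perturbation parameter tends to infinity, so the leading coefficient in
   \<open>kap\<close> must vanish at the limit.\<close>
 obtain F m where F: "!!a. ipoly (insert cc params - {kap}) (zdeg (card V) r) (znorm (card V) r H) (F a)"
  "!!x. \<chi> x = (\<Sum>a\<le>m. x kap ^ a * F a x)" "\<exists>x. F m x \<noteq> 0"
  by (rule ipoly_prune[OF \<chi>(1,3), of kap]) blast
 \<comment> \<open>Critical values are positive, so the power of \<open>cc\<close> can be cancelled.
   When they tend to 0, the coefficient \<open>T 0\<close> remains.\<close>
 obtain T b where T: "!!a. ipoly (insert cc params - {kap} - {cc}) (zdeg (card V) r) (znorm (card V) r H) (T a)"
  "!!x. F m x = x cc ^ b * (\<Sum>a\<le>zdeg (card V) r. x cc ^ a * T a x)" "\<exists>x. T 0 x \<noteq> 0"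
  by (rule ipoly_lowest[OF F(1,3), of cc]) blast
 have vars: "insert cc params - {kap} - {cc} = A - V"
  using cc kap by (auto simp: params_def)
 show ?thesis
 proof (intro exI[of _ "T 0"] conjI allI impI)
  show "ipoly (A - V) (zdeg (card V) r) (znorm (card V) r H) (T 0)" using T(1)[of 0] vars by simp
  show "\<exists>x. T 0 x \<noteq> 0" by (rule T(3))
 next
  fix W assume W: "open W" and fr: "frontier W \<subseteq> {x. R x = 0}"
   and bd: "\<forall>x\<in>W. (\<Sum>i\<in>V. (x i)\<^sup>2) < x k"
  show "frontier (cylinder V W) \<subseteq> {x. T 0 x = 0}"
  proof
   fix \<theta> assume \<theta>: "\<theta> \<in> frontier (cylinder V W)"
   have \<theta>1: "\<theta> \<notin> cylinder V W" "\<theta> \<in> closure (cylinder V W)"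
    using \<theta> open_cylinder[OF W] by (auto simp: frontier_def interior_open)
   \<comment> \<open>The approximating points converge to \<open>\<theta>\<close> only outside
     \<open>V\<close>; \<open>\<mu>\<close> overwrites the coordinates in \<open>V\<close>.\<close>
   define \<mu> where "\<mu> x = (\<lambda>i. if i \<in> V then \<theta> i else x i)" for x :: "nat => real"
   have cont\<mu>: "continuous_on UNIV \<mu>" unfolding \<mu>_def by (rule continuous_on_override)
   have "\<exists>y. y \<in> W \<and> R y \<noteq> 0 \<and> dist (\<mu> y) \<theta> < inverse (real (Suc n))" for n
   proof -
    let ?B = "\<mu> -` ball \<theta> (inverse (real (Suc n)))"
    have "open ?B" using cont\<mu> by (intro open_vimage) auto
    moreover have "\<theta> \<in> ?B" by (simp add: \<mu>_def)
    ultimately obtain x where "x \<in> cylinder V W" "x \<in> ?B"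
     using \<theta>1(2) open_Int_closure_eq_empty[of ?B "cylinder V W"] by blast
    then obtain y where "y \<in> W" "\<forall>i. i \<notin> V --> y i = x i" by (auto simp: cylinder_def)
    moreover from this have "\<mu> y = \<mu> x" by (auto simp: \<mu>_def)
    ultimately have yW: "y \<in> W \<inter> ?B" using \<open>x \<in> ?B\<close> by simp
    have oW: "open (W \<inter> ?B)" using W \<open>open ?B\<close> by (rule open_Int)
    obtain x0 where x0: "R x0 \<noteq> 0" using R(2) by blast
    obtain y' where "y' \<in> W \<inter> ?B" "R y' \<noteq> 0"
     by (rule ipoly_dense[OF R(1) x0 oW yW])
    then show ?thesis by (intro exI[of _ y']) (simp add: dist_commute)
   qed
   then obtain y where y: "!!n. y n \<in> W" "!!n. R (y n) \<noteq> 0"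
    "!!n. dist (\<mu> (y n)) \<theta> < inverse (real (Suc n))" by metis
   have \<mu>lim: "(\<lambda>n. \<mu> (y n)) \<longlonglongrightarrow> \<theta>"
   proof (rule metric_LIMSEQ_I)
    fix e :: real assume "e > 0"
    then obtain N where "inverse (real (Suc N)) < e" using reals_Archimedean by blast
    moreover have "inverse (real (Suc n)) \<le> inverse (real (Suc N))" if "n \<ge> N" for n
     using that by (intro le_imp_inverse_le) auto
    ultimately show "\<exists>N. \<forall>n\<ge>N. dist (\<mu> (y n)) \<theta> < e" using y(3) by (metis dual_order.strict_trans2 less_trans less_imp_le)
   qed
   have T\<mu>: "T a (\<mu> x) = T a x" for a x
    by (rule ipoly_cong[OF T(1)]) (auto simp: vars \<mu>_def)
   have frU: "U x = 0" if "x \<in> frontier W" for x using fr that by (auto simp: U_def)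
   have "\<exists>z. z \<in> closure W \<and> (\<forall>i. i \<notin> V --> z i = y n i) \<and>
    (\<Sum>a\<le>zdeg (card V) r. U z ^ a * T a (y n)) = 0" for n
   proof -
    have "U (y n) > 0" using y(2)[of n] by (simp add: U_def)
    obtain z w \<kappa> where z: "z \<in> closure W" "!!i. i \<notin> V ==> z i = y n i" "U z \<ge> U (y n)"
     and \<kappa>: "filterlim \<kappa> at_top sequentially" and Uw: "(\<lambda>j. U (w j)) \<longlonglongrightarrow> U z"
     and w: "!!j i. i \<notin> V ==> w j i = y n i" "!!j i. i \<in> V ==> w j i ^ d = \<kappa> j * G i (w j)"
     by (rule slice_critical_points[OF finV W k bd ipoly_continuous[OF U] frU dG(2) y(1)[of n] \<open>U (y n) > 0\<close>, of d])
      (assumption, (rule that; assumption))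
    define Y where "Y c = (y n)(cc := c)" for c
    have F\<phi>: "F a x = F a (Y (x cc))" if "!!i. i \<notin> V ==> i \<noteq> kap ==> i \<noteq> cc ==> x i = y n i" for a x
     by (rule ipoly_cong[OF F(1)]) (use that in \<open>auto simp: params_def Y_def\<close>)
    have Ycont: "continuous_on UNIV Y" unfolding Y_def
    proof (intro continuous_on_coordinatewise_then_product)
     show "continuous_on UNIV (\<lambda>t. ((y n)(cc := t)) l)" for l by (cases "l = cc") auto
    qed
    have "F m (Y (U z)) = 0"
    proof (rule leading_coefficient_limit[OF \<kappa>, where \<phi>="\<lambda>a j. F a (Y (U (w j)))"])
     show "(\<lambda>j. F a (Y (U (w j)))) \<longlonglongrightarrow> F a (Y (U z))" for a
     proof -
      have "(\<lambda>j. Y (U (w j))) \<longlonglongrightarrow> Y (U z)"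
       using continuous_on_tendsto_compose[OF Ycont Uw] by simp
      then show ?thesis by (rule ipoly_tendsto[OF F(1)])
     qed
     fix j
     \<comment> \<open>With \<open>\<kappa> j\<close> and the critical value placed in the fresh
       coordinates \<open>kap\<close> and \<open>cc\<close>, the point satisfies the critical
       system.\<close>
     define x where "x = (w j)(kap := \<kappa> j, cc := U (w j))"
     have "U x = U (w j)"
      by (rule ipoly_cong[OF U]) (use kap cc in \<open>auto simp: x_def\<close>)
     moreover have "G i x = G i (w j)" for i
      by (rule ipoly_cong[OF dG(1)]) (use kap cc in \<open>auto simp: x_def\<close>)
     moreover have "i \<noteq> kap" "i \<noteq> cc" if "i \<in> V" for i using that A kap cc by auto
     moreover have "kap \<noteq> cc" using cc by auto
     ultimately have "\<chi> x = 0"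
      using w(2) by (intro \<chi>(2)) (auto simp: crit_def x_def)
     moreover have "F a x = F a (Y (U (w j)))" for a
      using F\<phi>[of x a] w(1) by (simp add: x_def)
     ultimately show "(\<Sum>a\<le>m. \<kappa> j ^ a * F a (Y (U (w j)))) = 0"
      using F(2)[of x] \<open>kap \<noteq> cc\<close> by (simp add: x_def)
    qed
    moreover have "T a (Y c) = T a (y n)" for a c
     by (rule ipoly_cong[OF T(1)]) (auto simp: Y_def)
    ultimately have "U z ^ b * (\<Sum>a\<le>zdeg (card V) r. U z ^ a * T a (y n)) = 0"
     using T(2)[of "Y (U z)"] by (simp add: Y_def)
    moreover have "U z > 0" using z(3) \<open>U (y n) > 0\<close> by linarith
    ultimately show ?thesis using z by auto
   qed
   then obtain z where z: "!!n. z n \<in> closure W" "!!n i. i \<notin> V ==> z n i = y n i"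
    "!!n. (\<Sum>a\<le>zdeg (card V) r. U (z n) ^ a * T a (y n)) = 0" by metis
   have conv: "(\<lambda>n. y n i) \<longlonglongrightarrow> \<theta> i" if "i \<notin> V" for i
    using tendsto_coordinate[OF \<mu>lim, of i] that by (simp add: \<mu>_def)
   have "\<exists>b. \<forall>n. \<bar>y n i\<bar> \<le> b" if "i \<notin> V" for i
    using convergent_imp_Bseq[OF convergentI[OF conv[OF that]]] unfolding Bseq_def by auto
   then obtain b where b: "!!i n. i \<notin> V ==> \<bar>y n i\<bar> \<le> b i" by metis
   have zb: "\<bar>z n i\<bar> \<le> (if i \<in> V then 1 + b k else b i)" for n i
   proof (cases "i \<in> V")
    case True
    have "(\<Sum>i\<in>V. (z n i)\<^sup>2) \<le> b k"
     using frontier_bound[OF bd z(1)[of n]] z(2)[OF k, of n] b[OF k, of n] by linarith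
    then show ?thesis using sum_squares_coordinate[OF finV True] True by simp
   next
    case False
    then show ?thesis using z(2) b by simp
   qed
   obtain l s where s: "strict_mono s" and l: "(z \<circ> s) \<longlonglongrightarrow> l"
    by (rule bounded_subsequence[OF zb])
   have lcl: "l \<in> closure W"
    by (rule closed_sequentially[OF closed_closure _ l]) (simp add: z(1))
   have l\<theta>: "l i = \<theta> i" if "i \<notin> V" for i
   proof -
    have "(\<lambda>n. (z \<circ> s) n i) \<longlonglongrightarrow> \<theta> i"
     using LIMSEQ_subseq_LIMSEQ[OF conv[OF that] s] that by (simp add: o_def z(2))
    with tendsto_coordinate[OF l, of i] show ?thesis by (rule LIMSEQ_unique)
   qed
   \<comment> \<open>\<open>l\<close> differs from \<open>\<theta>\<close> only in \<open>V\<close>;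
     if it were in \<open>W\<close>, then \<open>\<theta>\<close> would belong to the open
     projection and not to its frontier.\<close>
   have "l \<notin> W" using \<theta>1(1) l\<theta> by (auto simp: cylinder_def)
   then have "l \<in> frontier W" using lcl W by (simp add: frontier_def interior_open)
   then have Ul: "U l = 0" by (rule frU)
   have Ulim: "(\<lambda>n. U (z (s n))) \<longlonglongrightarrow> 0"
    using ipoly_tendsto[OF U l] Ul by (simp add: o_def)
   have Tlim: "(\<lambda>n. T a (y (s n))) \<longlonglongrightarrow> T a \<theta>" for a
    using LIMSEQ_subseq_LIMSEQ[OF ipoly_tendsto[OF T(1)[of a] \<mu>lim] s] by (simp add: o_def T\<mu>)
   have "(\<lambda>n. \<Sum>a\<le>zdeg (card V) r. U (z (s n)) ^ a * T a (y (s n))) \<longlonglongrightarrow> (\<Sum>a\<le>zdeg (card V) r. 0 ^ a * T a \<theta>)"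
    by (intro tendsto_sum tendsto_mult tendsto_power Ulim Tlim)
   moreover have "(\<Sum>a\<le>zdeg (card V) r. 0 ^ a * T a \<theta>) = (\<Sum>a\<in>{0}. 0 ^ a * T a \<theta>)"
    by (rule sum.mono_neutral_right) auto
   ultimately have "(\<lambda>n. 0) \<longlonglongrightarrow> T 0 \<theta>" using z(3) by simp
   then have "T 0 \<theta> = 0" by (simp add: LIMSEQ_const_iff)
   then show "\<theta> \<in> {x. T 0 x = 0}" by simp
  qed
 qed
qed

section \<open>Stabilisation of truth values\<close>

fun gval :: "(nat => real) => qff => real" where
 "gval x (Le s t) = eval_trm x s - eval_trm x t"
| "gval x (Lt s t) = eval_trm x s - eval_trm x t"
| "gval x (Conj f g) = max (gval x f) (gval x g)"
| "gval x (Disj f g) = min (gval x f) (gval x g)"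

lemma holds_iff_gval: "qff_le \<Phi> ==> holds x \<Phi> \<longleftrightarrow> gval x \<Phi> \<le> 0"
 by (induction \<Phi>) (auto simp: min_le_iff_disj)

lemma eval_trm_cong: "(!!i. i \<in> vars_trm t ==> x i = y i) ==> eval_trm x t = eval_trm y t"
 by (induction t) auto

lemma gval_cong: "(!!i. i \<in> vars_qff \<Phi> ==> x i = y i) ==> gval x \<Phi> = gval y \<Phi>"
 by (induction \<Phi>) (auto simp: eval_trm_cong[of _ x y])

lemma holds_cong: "(!!i. i \<in> vars_qff \<Phi> ==> x i = y i) ==> holds x \<Phi> = holds y \<Phi>"
 by (induction \<Phi>) (auto simp: eval_trm_cong[of _ x y])

fun tdeg :: "trm => nat" where
 "tdeg (Var i) = 1"
| "tdeg (Const c) = 0"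
| "tdeg (Add s t) = tdeg s + tdeg t"
| "tdeg (Mul s t) = tdeg s + tdeg t"

fun tnorm :: "trm => nat" where
 "tnorm (Var i) = 1"
| "tnorm (Const c) = nat \<bar>c\<bar>"
| "tnorm (Add s t) = tnorm s + tnorm t"
| "tnorm (Mul s t) = tnorm s * tnorm t"

lemma ipoly_trm:
 assumes "vars_trm t \<subseteq> A"
 shows "ipoly A (tdeg t) (tnorm t) (\<lambda>x. eval_trm x t)"
 using assms
proof (induction t)
 case (Var i)
 then show ?case using ipoly_var[of i A] by simp
next
 case (Const c)
 then show ?case by (simp add: ipoly_const)
next
 case (Add s t)
 then show ?case by (auto intro: ipoly_mono[OF ipoly_add])
next
 case (Mul s t)
 then show ?case by (auto intro: ipoly_mult)
qed

lemma continuous_eval_trm: "continuous_on UNIV (\<lambda>x. eval_trm x t)"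
 by (rule ipoly_continuous[OF ipoly_trm[OF order_refl]])

lemma continuous_gval: "continuous_on UNIV (\<lambda>x. gval x \<Phi>)"
 by (induction \<Phi>) (auto intro!: continuous_intros continuous_eval_trm)

text \<open>The summand 1 in an atom is for the slack variable that \<open>atomprod\<close>
  subtracts and for its presence even in constant atoms.\<close>

fun fdeg :: "qff => nat" where
 "fdeg (Le s t) = tdeg s + tdeg t + 1"
| "fdeg (Lt s t) = tdeg s + tdeg t + 1"
| "fdeg (Conj f g) = fdeg f + fdeg g"
| "fdeg (Disj f g) = fdeg f + fdeg g"

fun fnorm :: "qff => nat" where
 "fnorm (Le s t) = tnorm s + tnorm t + 1"
| "fnorm (Lt s t) = tnorm s + tnorm t + 1"
| "fnorm (Conj f g) = fnorm f * fnorm g"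
| "fnorm (Disj f g) = fnorm f * fnorm g"

text \<open>\<open>gval\<close> always equals the value of some atom, so this product vanishes
  wherever \<open>gval\<close> equals the slack \<open>x \<sigma>\<close>. The fresh variable also
  makes every factor a nonzero polynomial, even if both sides of an atom coincide.\<close>

fun atomprod :: "nat => qff => (nat => real) => real" where
 "atomprod \<sigma> (Le s t) x = eval_trm x s - eval_trm x t - x \<sigma>"
| "atomprod \<sigma> (Lt s t) x = eval_trm x s - eval_trm x t - x \<sigma>"
| "atomprod \<sigma> (Conj f g) x = atomprod \<sigma> f x * atomprod \<sigma> g x"
| "atomprod \<sigma> (Disj f g) x = atomprod \<sigma> f x * atomprod \<sigma> g x"

lemma fnorm_pos: "fnorm \<Phi> \<ge> 1"
 by (induction \<Phi>) (auto simp: Suc_le_eq)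

lemma ipoly_atom:
 assumes "vars_trm s \<subseteq> A" "vars_trm t \<subseteq> A" "\<sigma> \<in> A"
 shows "ipoly A (tdeg s + tdeg t + 1) (tnorm s + tnorm t + 1) (\<lambda>x. eval_trm x s - eval_trm x t - x \<sigma>)"
 by (rule ipoly_mono[OF ipoly_minus[OF ipoly_minus[OF ipoly_trm[OF assms(1)] ipoly_trm[OF assms(2)]] ipoly_var[OF assms(3)]]]) auto

lemma ipoly_atomprod:
 assumes "vars_qff \<Phi> \<subseteq> A" "\<sigma> \<in> A"
 shows "ipoly A (fdeg \<Phi>) (fnorm \<Phi>) (atomprod \<sigma> \<Phi>)"
 using assms
proof (induction \<Phi>)
 case (Le s t)
 then have "ipoly A (fdeg (Le s t)) (fnorm (Le s t)) (\<lambda>x. atomprod \<sigma> (Le s t) x)"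
  unfolding fdeg.simps fnorm.simps atomprod.simps by (intro ipoly_atom) auto
 then show ?case .
next
 case (Lt s t)
 then have "ipoly A (fdeg (Lt s t)) (fnorm (Lt s t)) (\<lambda>x. atomprod \<sigma> (Lt s t) x)"
  unfolding fdeg.simps fnorm.simps atomprod.simps by (intro ipoly_atom) auto
 then show ?case .
next
 case (Conj f g)
 then have "ipoly A (fdeg (Conj f g)) (fnorm (Conj f g)) (\<lambda>x. atomprod \<sigma> (Conj f g) x)"
  unfolding fdeg.simps fnorm.simps atomprod.simps by (intro ipoly_mult) auto
 then show ?case .
next
 case (Disj f g)
 then have "ipoly A (fdeg (Disj f g)) (fnorm (Disj f g)) (\<lambda>x. atomprod \<sigma> (Disj f g) x)"
  unfolding fdeg.simps fnorm.simps atomprod.simps by (intro ipoly_mult) auto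
 then show ?case .
qed

lemma atomprod_eq_0: "gval x \<Phi> = x \<sigma> ==> atomprod \<sigma> \<Phi> x = 0"
 by (induction \<Phi>) (auto simp: max_def min_def split: if_splits)

lemma atomprod_nonzero:
 assumes "\<sigma> \<notin> vars_qff \<Phi>"
 shows "finite {c. atomprod \<sigma> \<Phi> (x(\<sigma> := c)) = 0}"
 using assms
proof (induction \<Phi>)
 case (Le s t)
 have *: "eval_trm (x(\<sigma> := c)) s = eval_trm x s" "eval_trm (x(\<sigma> := c)) t = eval_trm x t" for c
  using Le by (auto intro!: eval_trm_cong)
 show ?case unfolding atomprod.simps * by simp
next
 case (Lt s t)
 have *: "eval_trm (x(\<sigma> := c)) s = eval_trm x s" "eval_trm (x(\<sigma> := c)) t = eval_trm x t" for c
  using Lt by (auto intro!: eval_trm_cong)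
 show ?case unfolding atomprod.simps * by simp
qed (simp_all add: Collect_disj_eq)

lemma frontier_less_subset:
 fixes f g :: "'a::topological_space => real"
 assumes "continuous_on UNIV f" "continuous_on UNIV g"
 shows "frontier {x. f x < g x} \<subseteq> {x. f x = g x}"
proof -
 have "open {x. f x < g x}" using assms by (rule open_Collect_less)
 moreover have "closure {x. f x < g x} \<subseteq> {x. f x \<le> g x}"
  by (rule closure_minimal) (auto intro: closed_Collect_le assms)
 ultimately show ?thesis by (auto simp: frontier_def interior_open)
qed

section \<open>Root bounds, uniformly on compact sets\<close>

lemma ipoly_empty:
 assumes "ipoly {} d H p"
 obtains c :: int where "\<bar>c\<bar> \<le> int H" "!!x. p x = of_int c"
proof -
 obtain ms where ms: "p = mval ms" "mnorm ms \<le> H" "monoms {} d ms" using assms by (rule ipolyE)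
 have "\<exists>c::int. \<bar>c\<bar> \<le> int (mnorm ms) \<and> (\<forall>x. mval ms x = of_int c)"
  using ms(3)
 proof (induction ms)
  case Nil
  then show ?case by (intro exI[of _ 0]) auto
 next
  case (Cons a ms)
  obtain b l where a: "a = (b, l)" by force
  then have l: "l = []" "monoms {} d ms" using Cons.prems by (auto simp: monoms_def)
  obtain c where "\<bar>c\<bar> \<le> int (mnorm ms)" "\<forall>x. mval ms x = of_int c"
   using Cons.IH[OF l(2)] by blast
  then show ?case using a l(1) by (intro exI[of _ "b + c"]) auto
 qed
 with ms(1,2) that show thesis by (metis of_nat_mono order_trans)
qed

text \<open>Cauchy's bound: the leading coefficient is a nonzero integer, so its absolute value is
  at least 1, and a geometric sum controls the lower terms.\<close>

lemma ipoly_root_bound: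
 assumes p: "ipoly {v} d H p" "\<exists>x. p x \<noteq> 0" and x: "x v > real H + 1"
 shows "p x \<noteq> 0"
proof -
 obtain F m where F: "!!k. ipoly ({v} - {v}) d H (F k)" "!!x. p x = (\<Sum>k\<le>m. x v ^ k * F k x)" "\<exists>x. F m x \<noteq> 0"
  by (rule ipoly_prune[OF p, of v]) blast
 have "\<exists>c::int. \<bar>c\<bar> \<le> int H \<and> (\<forall>x. F k x = of_int c)" for k
  by (rule ipoly_empty[of d H "F k"]) (use F(1)[of k] in auto)
 then obtain c :: "nat => int" where c: "!!k. \<bar>c k\<bar> \<le> int H" "!!k x. F k x = of_int (c k)" by metis
 have "c m \<noteq> 0" using F(3) c(2) by auto
 then have cm: "\<bar>real_of_int (c m)\<bar> \<ge> 1" by linarith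
 let ?t = "x v"
 have t: "?t > 1" using x by linarith
 have tm: "?t ^ m > 0" using t by simp
 have "\<bar>\<Sum>k<m. ?t ^ k * of_int (c k)\<bar> \<le> (\<Sum>k<m. \<bar>?t ^ k * of_int (c k)\<bar>)" by (rule sum_abs)
 also have "\<dots> \<le> (\<Sum>k<m. ?t ^ k * real H)"
 proof (rule sum_mono)
  fix k
  have "\<bar>real_of_int (c k)\<bar> \<le> real H" using c(1)[of k] by linarith
  then show "\<bar>?t ^ k * of_int (c k)\<bar> \<le> ?t ^ k * real H"
   using t by (simp add: abs_mult)
 qed
 also have "\<dots> = real H * (\<Sum>k<m. ?t ^ k)" by (simp add: sum_distrib_left mult.commute)
 also have "\<dots> = real H * (?t ^ m - 1) / (?t - 1)" using t by (simp add: geometric_sum)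
 also have "\<dots> < ?t ^ m"
 proof -
  have "real H * (?t ^ m - 1) \<le> real H * ?t ^ m" by (intro mult_left_mono) auto
  also have "\<dots> < (?t - 1) * ?t ^ m" using x tm by (intro mult_strict_right_mono) auto
  finally show ?thesis using t by (simp add: divide_less_eq mult.commute)
 qed
 also have "\<dots> \<le> \<bar>?t ^ m * of_int (c m)\<bar>" using cm tm by (simp add: abs_mult)
 finally have "\<bar>\<Sum>k<m. ?t ^ k * of_int (c k)\<bar> < \<bar>?t ^ m * of_int (c m)\<bar>" .
 moreover have "p x = (\<Sum>k<m. ?t ^ k * of_int (c k)) + ?t ^ m * of_int (c m)"
  by (simp add: F(2) c(2) lessThan_Suc_atMost[symmetric])
 ultimately show ?thesis by auto
qed

lemma compact_lower_bound:
 fixes f :: "'a::topological_space => real"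
 assumes "compact K" "continuous_on UNIV f" "!!x. x \<in> K ==> f x \<noteq> 0"
 shows "\<exists>\<delta>>0. \<forall>x\<in>K. \<delta> \<le> \<bar>f x\<bar>"
proof (cases "K = {}")
 case False
 have "continuous_on K (\<lambda>x. \<bar>f x\<bar>)"
  using assms(2) by (intro continuous_intros) (auto intro: continuous_on_subset)
 from continuous_attains_inf[OF assms(1) False this] obtain x where
  "x \<in> K" "\<forall>y\<in>K. \<bar>f x\<bar> \<le> \<bar>f y\<bar>" by blast
 then show ?thesis using assms(3) by (intro exI[of _ "\<bar>f x\<bar>"]) auto
qed (auto intro: exI[of _ 1])

lemma compact_upper_bound:
 fixes f :: "nat => 'a::topological_space => real"
 assumes "compact K" "!!k. continuous_on UNIV (f k)"
 shows "\<exists>C>0. \<forall>k\<le>m. \<forall>x\<in>K. \<bar>f k x\<bar> \<le> C"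
proof -
 have "\<exists>b. \<forall>x\<in>K. \<bar>f k x\<bar> \<le> b" for k
 proof -
  have "compact (f k ` K)"
   by (rule compact_continuous_image[OF continuous_on_subset[OF assms(2)] assms(1)]) auto
  then have "bounded (f k ` K)" by (rule compact_imp_bounded)
  then show ?thesis unfolding bounded_iff by auto
 qed
 then obtain b where b: "!!k x. x \<in> K ==> \<bar>f k x\<bar> \<le> b k" by metis
 show ?thesis
 proof (intro exI[of _ "1 + (\<Sum>k\<le>m. \<bar>b k\<bar>)"] conjI allI ballI impI)
  show "0 < 1 + (\<Sum>k\<le>m. \<bar>b k\<bar>)" by (simp add: add_pos_nonneg sum_nonneg)
  show "\<bar>f k x\<bar> \<le> 1 + (\<Sum>k\<le>m. \<bar>b k\<bar>)" if "k \<le> m" "x \<in> K" for k x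
   using b[OF that(2), of k] member_le_sum[of k "{..m}" "\<lambda>k. \<bar>b k\<bar>"] that(1) by auto
 qed
qed

text \<open>Compactness bounds the leading coefficient away from 0 and all coefficients from above,
  so one threshold for \<open>b\<close> serves every point of \<open>K\<close>.\<close>

lemma nonzero_for_large:
 fixes F :: "nat => (nat => real) => real"
 assumes K: "compact K" and F: "!!k. ipoly (A - {v}) d H (F k)"
  and p: "!!x. p x = (\<Sum>k\<le>m. x v ^ k * F k x)" and nz: "!!x. x \<in> K ==> F m x \<noteq> 0"
 shows "\<exists>b0. \<forall>b\<ge>b0. \<forall>x\<in>K. p (x(v := b)) \<noteq> 0"
proof -
 have "\<exists>\<delta>>0. \<forall>x\<in>K. \<delta> \<le> \<bar>F m x\<bar>"
  by (rule compact_lower_bound[OF K ipoly_continuous[OF F] nz])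
 then obtain \<delta> where \<delta>: "\<delta> > 0" "!!x. x \<in> K ==> \<bar>F m x\<bar> \<ge> \<delta>" by auto
 have "\<exists>C>0. \<forall>k\<le>m. \<forall>x\<in>K. \<bar>F k x\<bar> \<le> C"
  by (rule compact_upper_bound[OF K ipoly_continuous[OF F]])
 then obtain C where C: "C > 0" "!!k x. k \<le> m ==> x \<in> K ==> \<bar>F k x\<bar> \<le> C" by auto
 show ?thesis
 proof (intro exI[of _ "1 + (real m + 1) * C / \<delta>"] allI impI ballI)
  fix b x assume b: "b \<ge> 1 + (real m + 1) * C / \<delta>" and x: "x \<in> K"
  have b1: "b \<ge> 1" using b C \<delta> by (smt (verit) divide_nonneg_pos mult_nonneg_nonneg of_nat_0_le_iff)
  have "(real m + 1) * C / \<delta> < b" using b by linarith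
  then have bd: "(real m + 1) * C < b * \<delta>" using \<delta>(1) by (simp add: divide_less_eq)
  have Fx: "F k (x(v := b)) = F k x" for k by (rule ipoly_cong[OF F]) auto
  have e: "p (x(v := b)) = (\<Sum>k<m. b ^ k * F k x) + b ^ m * F m x"
   by (simp add: p Fx lessThan_Suc_atMost[symmetric])
  show "p (x(v := b)) \<noteq> 0"
  proof (cases m)
   case 0
   then show ?thesis using e nz[OF x] by simp
  next
   case (Suc n)
   have "\<bar>\<Sum>k<m. b ^ k * F k x\<bar> \<le> (\<Sum>k<m. \<bar>b ^ k * F k x\<bar>)" by (rule sum_abs)
   also have "\<dots> \<le> (\<Sum>k<m. b ^ n * C)"
   proof (rule sum_mono)
    fix k assume "k \<in> {..<m}"
    then have "b ^ k \<le> b ^ n" using b1 Suc by (intro power_increasing) auto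
    moreover have "\<bar>F k x\<bar> \<le> C" using C(2)[of k x] x \<open>k \<in> {..<m}\<close> by simp
    ultimately show "\<bar>b ^ k * F k x\<bar> \<le> b ^ n * C"
     using b1 by (simp add: abs_mult mult_mono)
   qed
   also have "\<dots> = b ^ n * (real m * C)" by simp
   also have "\<dots> < b ^ n * (b * \<delta>)"
    using b1 bd C(1) by (intro mult_strict_left_mono) (auto simp: algebra_simps)
   also have "\<dots> = b ^ m * \<delta>" using Suc by simp
   also have "\<dots> \<le> \<bar>b ^ m * F m x\<bar>" using \<delta>(2)[OF x] b1 by (simp add: abs_mult)
   finally show ?thesis using e by auto
  qed
 qed
qed

lemma nonzero_for_small:
 fixes F :: "nat => (nat => real) => real"
 assumes K: "compact K" and F: "!!k. ipoly (A - {v}) d H (F k)"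
  and p: "!!x. p x = x v ^ m * (\<Sum>k\<le>n. x v ^ k * F k x)" and nz: "!!x. x \<in> K ==> F 0 x \<noteq> 0"
 shows "\<exists>s0>0. \<forall>s. 0 < s \<and> s < s0 --> (\<forall>x\<in>K. p (x(v := s)) \<noteq> 0)"
proof -
 have "\<exists>\<delta>>0. \<forall>x\<in>K. \<delta> \<le> \<bar>F 0 x\<bar>"
  by (rule compact_lower_bound[OF K ipoly_continuous[OF F] nz])
 then obtain \<delta> where \<delta>: "\<delta> > 0" "!!x. x \<in> K ==> \<bar>F 0 x\<bar> \<ge> \<delta>" by auto
 have "\<exists>C>0. \<forall>k\<le>n. \<forall>x\<in>K. \<bar>F k x\<bar> \<le> C"
  by (rule compact_upper_bound[OF K ipoly_continuous[OF F]])
 then obtain C where C: "C > 0" "!!k x. k \<le> n ==> x \<in> K ==> \<bar>F k x\<bar> \<le> C" by auto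
 show ?thesis
 proof (intro exI[of _ "min 1 (\<delta> / ((real n + 1) * C))"] conjI allI impI ballI)
  show "0 < min 1 (\<delta> / ((real n + 1) * C))" using \<delta> C by simp
 next
  fix s x assume s': "0 < s \<and> s < min 1 (\<delta> / ((real n + 1) * C))" and x: "x \<in> K"
  then have s: "0 < s" "s < min 1 (\<delta> / ((real n + 1) * C))" by auto
  have "s < \<delta> / ((real n + 1) * C)" using s by simp
  moreover have "(real n + 1) * C > 0" using C(1) by (simp add: add_nonneg_pos)
  ultimately have bd: "s * ((real n + 1) * C) < \<delta>" by (simp only: pos_less_divide_eq)
  have Fx: "F k (x(v := s)) = F k x" for k by (rule ipoly_cong[OF F]) auto
  have "\<bar>\<Sum>k\<in>{1..n}. s ^ k * F k x\<bar> \<le> (\<Sum>k\<in>{1..n}. \<bar>s ^ k * F k x\<bar>)" by (rule sum_abs)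
  also have "\<dots> \<le> (\<Sum>k\<in>{1..n}. s * C)"
  proof (rule sum_mono)
   fix k assume k: "k \<in> {1..n}"
   have "s ^ k \<le> s ^ 1" using s k by (intro power_decreasing) auto
   moreover have "\<bar>F k x\<bar> \<le> C" using C(2)[of k x] x k by simp
   ultimately show "\<bar>s ^ k * F k x\<bar> \<le> s * C"
    using s by (simp add: abs_mult mult_mono)
  qed
  also have "\<dots> = s * (real n * C)" by simp
  also have "\<dots> \<le> s * ((real n + 1) * C)" using s C(1) by (intro mult_left_mono) auto
  also have "\<dots> < \<delta>" by (rule bd)
  also have "\<dots> \<le> \<bar>F 0 x\<bar>" using \<delta>(2)[OF x] .
  finally have "\<bar>\<Sum>k\<in>{1..n}. s ^ k * F k x\<bar> < \<bar>F 0 x\<bar>" .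
  moreover have "(\<Sum>k\<le>n. s ^ k * F k x) = F 0 x + (\<Sum>k\<in>{1..n}. s ^ k * F k x)"
  proof -
   have "{..n} = insert 0 {1..n}" by auto
   then show ?thesis by simp
  qed
  ultimately have "(\<Sum>k\<le>n. s ^ k * F k x) \<noteq> 0" by auto
  then show "p (x(v := s)) \<noteq> 0" using s by (simp add: p Fx)
 qed
qed

text \<open>Every coordinate other than \<open>\<tau>\<close> and those in \<open>VX\<close> belongs
  to the universal player, so a block \<open>VY\<close> appears only where variables are
  counted.\<close>

definition game :: "nat => nat set => qff => real => bool" where
 "game \<tau> VX \<Phi> t \<longleftrightarrow> (\<exists>X. \<forall>Y. holds (\<lambda>i. if i = \<tau> then t else if i \<in> VX then X i else Y i) \<Phi>)"

text \<open>Two projection bounds composed, the universal block first. The summands 2 in the degrees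
  and the factors \<open>n + 1\<close> and \<open>m + 1\<close> in the norms come from the
  polynomial of a ball, by which the frontier polynomial is multiplied before each
  projection.\<close>

definition threshold :: "nat => nat => nat => nat => nat" where
 "threshold m n d H = znorm m (2 + zdeg n (2 + d)) ((m + 1) * znorm n (2 + d) ((n + 1) * H))"

lemma ipoly_sum_squares:
 assumes "finite V" "V \<subseteq> A" "k \<in> A"
 shows "ipoly A 2 (card V + 1) (\<lambda>x. (\<Sum>i\<in>V. (x i)\<^sup>2) - x k)"
proof -
 have "ipoly A 2 (\<Sum>i\<in>V. 1) (\<lambda>x. \<Sum>i\<in>V. (x i)\<^sup>2)"
 proof (rule ipoly_sum[OF assms(1)])
  fix i assume "i \<in> V"
  then have "i \<in> A" using assms(2) by auto
  from ipoly_power[OF ipoly_var[OF this], of 2] show "ipoly A 2 1 (\<lambda>x. (x i)\<^sup>2)" by simp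
 qed
 from ipoly_minus[OF this ipoly_var[OF assms(3)]] show ?thesis by (simp add: numeral_2_eq_2)
qed

lemma sum_squares_nonzero:
 assumes "k \<notin> V"
 shows "\<exists>x. (\<Sum>i\<in>V. (x i)\<^sup>2) - x k \<noteq> (0::real)"
proof -
 define x where "x i = (if i = k then 1 else 0 :: real)" for i
 have "(\<Sum>i\<in>V. (x i)\<^sup>2) = 0" by (rule sum.neutral) (use assms in \<open>auto simp: x_def\<close>)
 moreover have "x k = 1" by (simp add: x_def)
 ultimately have "(\<Sum>i\<in>V. (x i)\<^sup>2) - x k \<noteq> 0" by simp
 then show ?thesis by blast
qed

lemma continuous_sum_squares: "continuous_on UNIV (\<lambda>x :: nat => real. \<Sum>i\<in>V. (x i)\<^sup>2)"
 by (intro continuous_intros continuous_on_product_coordinates)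

lemma frontier_Compl_closure: "frontier (- closure S) \<subseteq> frontier S"
proof -
 have "interior S \<subseteq> interior (closure S)" by (intro interior_mono closure_subset)
 then show ?thesis unfolding frontier_complement unfolding frontier_def closure_closure by blast
qed

lemma ipoly_mult_nonzero:
 assumes "ipoly A d H p" "\<exists>x. p x \<noteq> 0" "ipoly A d' H' q" "\<exists>x. q x \<noteq> 0"
 shows "\<exists>x. p x * q x \<noteq> 0"
proof -
 obtain z where z: "p z \<noteq> 0" using assms(2) by blast
 obtain w where w: "q w \<noteq> 0" using assms(4) by blast
 have "continuous_on UNIV q" using assms(3) by (rule ipoly_continuous)
 then have "open {x. q x \<noteq> 0}" by (intro open_Collect_neq) auto
 then obtain x where "x \<in> {x. q x \<noteq> 0}" "p x \<noteq> 0"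
  using ipoly_dense[OF assms(1) z, of "{x. q x \<noteq> 0}" w] w by blast
 then show ?thesis by auto
qed

text \<open>Bounded strategies that win up to vanishing errors have a convergent subsequence, and
  non-strict inequalities survive the limit. Each \<open>Y\<close> has to be answered only from some
  index on, so the range of \<open>Y\<close> may grow with \<open>n\<close>.\<close>

lemma strategy_limit:
 fixes e :: "(nat => real) => (nat => real) => nat => real"
 assumes le: "qff_le \<Phi>" and e: "!!Y. continuous_on UNIV (\<lambda>X. e X Y)" and b: "!!n i. \<bar>Z n i\<bar> \<le> b"
  and Z: "!!Y. P Y ==> \<forall>\<^sub>F n in sequentially. gval (e (Z n) Y) \<Phi> \<le> inverse (real (Suc n))"
 shows "\<exists>L. (\<forall>i. \<bar>L i\<bar> \<le> b) \<and> (\<forall>Y. P Y --> holds (e L Y) \<Phi>)"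
proof -
 obtain L f where f: "strict_mono f" and L: "(Z \<circ> f) \<longlonglongrightarrow> L"
  by (rule bounded_subsequence[where b="\<lambda>_. b", OF b])
 show ?thesis
 proof (intro exI[of _ L] conjI allI impI)
  have "(\<lambda>n. \<bar>(Z \<circ> f) n i\<bar>) \<longlonglongrightarrow> \<bar>L i\<bar>" for i by (intro tendsto_rabs tendsto_coordinate[OF L])
  then show "\<bar>L i\<bar> \<le> b" for i by (rule LIMSEQ_le_const2) (use b in auto)
  fix Y assume "P Y"
  from continuous_on_tendsto_compose[OF e L] have "(\<lambda>n. e ((Z \<circ> f) n) Y) \<longlonglongrightarrow> e L Y" by simp
  from continuous_on_tendsto_compose[OF continuous_gval this]
  have 1: "(\<lambda>n. gval (e (Z (f n)) Y) \<Phi>) \<longlonglongrightarrow> gval (e L Y) \<Phi>" by simp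
  have 2: "(\<lambda>n. inverse (real (Suc (f n)))) \<longlonglongrightarrow> 0"
   using LIMSEQ_subseq_LIMSEQ[OF LIMSEQ_inverse_real_of_nat f] by (simp add: o_def)
  have "gval (e L Y) \<Phi> \<le> 0"
   by (rule tendsto_le[OF _ 2 1 eventually_subseq[OF f Z[OF \<open>P Y\<close>]]]) simp
  then show "holds (e L Y) \<Phi>" using holds_iff_gval[OF le] by simp
 qed
qed

section \<open>Constancy of truth above the threshold\<close>

definition pt :: "nat => nat => nat => nat => real => real => real => real => nat => real" where
 "pt \<tau> \<rho> \<sigma> \<beta> t r s b = (\<lambda>_. 0)(\<tau> := t, \<rho> := r, \<sigma> := s, \<beta> := b)"

lemma continuous_pt: "continuous_on UNIV (\<lambda>t. pt \<tau> \<rho> \<sigma> \<beta> t r s b)"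
proof (intro continuous_on_coordinatewise_then_product)
 show "continuous_on UNIV (\<lambda>t. pt \<tau> \<rho> \<sigma> \<beta> t r s b i)" for i
  by (cases "i = \<beta>"; cases "i = \<sigma>"; cases "i = \<rho>"; cases "i = \<tau>") (auto simp: pt_def intro: continuous_intros)
qed

text \<open>Bounding \<open>X\<close> and \<open>Y\<close> by \<open>\<rho>\<close> and \<open>\<beta>\<close> and allowing a slack \<open>\<sigma>\<close> turns both quantifiers into projections
 of open sets that are bounded in the projected directions. The truth value for the original formula
 is recovered for large \<open>\<rho>\<close>, small \<open>\<sigma>\<close> and large \<open>\<beta>\<close>, chosen in this order.\<close>
locale prenex_game =
 fixes \<tau> \<rho> \<sigma> \<beta> :: nat and VX VY :: "nat set" and \<Phi> :: qff
 assumes fin: "finite VX" "finite VY" and disj: "VX \<inter> VY = {}"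
  and vars: "vars_qff \<Phi> \<subseteq> insert \<tau> (VX \<union> VY)" and le: "qff_le \<Phi>"
  and dist: "distinct [\<tau>, \<rho>, \<sigma>, \<beta>]" and fresh: "{\<tau>, \<rho>, \<sigma>, \<beta>} \<inter> (VX \<union> VY) = {}"
begin

definition bad :: "(nat => real) set" where
 "bad = {x. (\<Sum>i\<in>VY. (x i)\<^sup>2) < x \<beta>} \<inter> {x. x \<sigma> < gval x \<Phi>}"

text \<open>Removing the closure of the projection keeps the set open, as the second projection
  requires. Its frontier is still inside the frontier of the first projection.\<close>

definition good :: "(nat => real) set" where
 "good = {x. (\<Sum>i\<in>VX. (x i)\<^sup>2) < x \<rho>} \<inter> - closure (cylinder VY bad)"

lemma open_bad: "open bad"
 unfolding bad_def
 by (intro open_Int open_Collect_less continuous_sum_squares continuous_on_product_coordinates continuous_gval)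

lemma open_good: "open good"
 unfolding good_def
 by (intro open_Int open_Collect_less continuous_sum_squares continuous_on_product_coordinates) auto

lemma fresh': "\<rho> \<notin> vars_qff \<Phi>" "\<sigma> \<notin> vars_qff \<Phi>" "\<beta> \<notin> vars_qff \<Phi>" "\<tau> \<notin> VX" "\<tau> \<notin> VY"
  "\<rho> \<notin> VX" "\<rho> \<notin> VY" "\<sigma> \<notin> VX" "\<sigma> \<notin> VY" "\<beta> \<notin> VX" "\<beta> \<notin> VY"
 using vars dist fresh by auto

lemma frontier_polynomial:
 obtains T where "ipoly {\<tau>, \<rho>, \<sigma>, \<beta>} (zdeg (card VX) (2 + zdeg (card VY) (2 + fdeg \<Phi>)))
   (threshold (card VX) (card VY) (fdeg \<Phi>) (fnorm \<Phi>)) T" "\<exists>x. T x \<noteq> 0"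
  "frontier (cylinder VX good) \<subseteq> {x. T x = 0}"
proof -
 define A where "A = {\<tau>, \<rho>, \<sigma>, \<beta>} \<union> VX \<union> VY"
 have A: "finite A" "VY \<subseteq> A" "VX \<subseteq> A - VY" "\<beta> \<in> A" "\<rho> \<in> A - VY" "\<sigma> \<in> A" "vars_qff \<Phi> \<subseteq> A"
  using fin disj fresh vars by (auto simp: A_def)
 \<comment> \<open>On the frontier of \<open>bad\<close> one of its two strict inequalities becomes
   an equality, and either equality makes a factor of \<open>R\<close> vanish.\<close>
 define R where "R x = ((\<Sum>i\<in>VY. (x i)\<^sup>2) - x \<beta>) * atomprod \<sigma> \<Phi> x" for x
 have R: "ipoly A (2 + fdeg \<Phi>) ((card VY + 1) * fnorm \<Phi>) R"
  unfolding R_def by (intro ipoly_mult ipoly_sum_squares ipoly_atomprod fin A)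
 have Rnz: "\<exists>x. R x \<noteq> 0"
  unfolding R_def
 proof (rule ipoly_mult_nonzero[OF ipoly_sum_squares[OF fin(2) A(2) A(4)] _ ipoly_atomprod[OF A(7) A(6)]])
  show "\<exists>x. (\<Sum>i\<in>VY. (x i)\<^sup>2) - x \<beta> \<noteq> (0::real)" by (rule sum_squares_nonzero[OF fresh'(11)])
  have "\<exists>c. c \<notin> {c. atomprod \<sigma> \<Phi> ((\<lambda>_. 0)(\<sigma> := c)) = 0}"
   by (rule ex_new_if_finite[OF infinite_UNIV_char_0 atomprod_nonzero[OF fresh'(2)]])
  then show "\<exists>x. atomprod \<sigma> \<Phi> x \<noteq> 0" by auto
 qed
 have fr1: "frontier bad \<subseteq> {x. R x = 0}"
 proof
  fix x assume x: "x \<in> frontier bad"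
  have "frontier bad \<subseteq> frontier {x. (\<Sum>i\<in>VY. (x i)\<^sup>2) < x \<beta>} \<union> frontier {x. x \<sigma> < gval x \<Phi>}"
   unfolding bad_def by (rule frontier_Int_subset)
  also have "\<dots> \<subseteq> {x. (\<Sum>i\<in>VY. (x i)\<^sup>2) = x \<beta>} \<union> {x. x \<sigma> = gval x \<Phi>}"
   by (intro Un_mono frontier_less_subset continuous_sum_squares continuous_on_product_coordinates continuous_gval)
  finally have "(\<Sum>i\<in>VY. (x i)\<^sup>2) = x \<beta> \<or> x \<sigma> = gval x \<Phi>" using x by auto
  then show "x \<in> {x. R x = 0}" using atomprod_eq_0[of x \<Phi> \<sigma>] by (auto simp: R_def)
 qed
 have le11: "1 \<le> 2 + fdeg \<Phi>" and le12: "1 \<le> (card VY + 1) * fnorm \<Phi>"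
  using fnorm_pos[of \<Phi>] by auto
 obtain T1 where T1: "ipoly (A - VY) (zdeg (card VY) (2 + fdeg \<Phi>)) (znorm (card VY) (2 + fdeg \<Phi>) ((card VY + 1) * fnorm \<Phi>)) T1"
  "\<exists>x. T1 x \<noteq> 0"
  "\<forall>W. open W --> frontier W \<subseteq> {x. R x = 0} --> (\<forall>x\<in>W. (\<Sum>i\<in>VY. (x i)\<^sup>2) < x \<beta>) -->
    frontier (cylinder VY W) \<subseteq> {x. T1 x = 0}"
  using projection_frontier[OF A(1,2) fresh'(11) R Rnz le11 le12] by (rule exE) (elim conjE, rule that)
 have fr2: "frontier (cylinder VY bad) \<subseteq> {x. T1 x = 0}"
  by (rule T1(3)[rule_format, OF open_bad fr1]) (auto simp: bad_def)
 define R2 where "R2 x = ((\<Sum>i\<in>VX. (x i)\<^sup>2) - x \<rho>) * T1 x" for x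
 have R2: "ipoly (A - VY) (2 + zdeg (card VY) (2 + fdeg \<Phi>)) ((card VX + 1) * znorm (card VY) (2 + fdeg \<Phi>) ((card VY + 1) * fnorm \<Phi>)) R2"
  unfolding R2_def by (intro ipoly_mult ipoly_sum_squares fin A T1)
 have R2nz: "\<exists>x. R2 x \<noteq> 0"
  unfolding R2_def
 proof (rule ipoly_mult_nonzero[OF ipoly_sum_squares[OF fin(1) A(3) A(5)] _ T1(1,2)])
  show "\<exists>x. (\<Sum>i\<in>VX. (x i)\<^sup>2) - x \<rho> \<noteq> (0::real)" by (rule sum_squares_nonzero[OF fresh'(6)])
 qed
 have fr3: "frontier good \<subseteq> {x. R2 x = 0}"
 proof
  fix x assume x: "x \<in> frontier good"
  have "frontier good \<subseteq> frontier {x. (\<Sum>i\<in>VX. (x i)\<^sup>2) < x \<rho>} \<union> frontier (- closure (cylinder VY bad))"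
   unfolding good_def by (rule frontier_Int_subset)
  also have "\<dots> \<subseteq> {x. (\<Sum>i\<in>VX. (x i)\<^sup>2) = x \<rho>} \<union> frontier (cylinder VY bad)"
   by (intro Un_mono frontier_less_subset frontier_Compl_closure continuous_sum_squares continuous_on_product_coordinates)
  finally have "(\<Sum>i\<in>VX. (x i)\<^sup>2) = x \<rho> \<or> T1 x = 0" using x fr2 by auto
  then show "x \<in> {x. R2 x = 0}" by (auto simp: R2_def)
 qed
 have znorm_pos: "znorm n r H \<ge> 1" for n r H
  unfolding znorm_def by (simp add: Suc_le_eq)
 have fin2: "finite (A - VY)" using A(1) by simp
 have le1: "1 \<le> 2 + zdeg (card VY) (2 + fdeg \<Phi>)" by simp
 have le2: "1 \<le> (card VX + 1) * znorm (card VY) (2 + fdeg \<Phi>) ((card VY + 1) * fnorm \<Phi>)"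
  using znorm_pos[of "card VY" "2 + fdeg \<Phi>" "(card VY + 1) * fnorm \<Phi>"] by simp
 obtain T2 where T2: "ipoly (A - VY - VX) (zdeg (card VX) (2 + zdeg (card VY) (2 + fdeg \<Phi>)))
   (threshold (card VX) (card VY) (fdeg \<Phi>) (fnorm \<Phi>)) T2"
  "\<exists>x. T2 x \<noteq> 0"
  "\<forall>W. open W --> frontier W \<subseteq> {x. R2 x = 0} --> (\<forall>x\<in>W. (\<Sum>i\<in>VX. (x i)\<^sup>2) < x \<rho>) -->
    frontier (cylinder VX W) \<subseteq> {x. T2 x = 0}"
  using projection_frontier[OF fin2 A(3) fresh'(6) R2 R2nz le1 le2, folded threshold_def]
  by (rule exE) (elim conjE, rule that)
 have "A - VY - VX = {\<tau>, \<rho>, \<sigma>, \<beta>}" using fresh by (auto simp: A_def)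
 moreover have "frontier (cylinder VX good) \<subseteq> {x. T2 x = 0}"
  by (rule T2(3)[rule_format, OF open_good fr3]) (auto simp: good_def)
 ultimately show thesis using that[of T2] T2(1,2) by simp
qed

abbreviation "point \<equiv> pt \<tau> \<rho> \<sigma> \<beta>"

lemma point_simps: "point t r s b \<tau> = t" "point t r s b \<rho> = r" "point t r s b \<sigma> = s" "point t r s b \<beta> = b"
 using dist by (auto simp: pt_def)

definition env3 :: "real => (nat => real) => (nat => real) => nat => real" where
 "env3 t X Y = (\<lambda>i. if i = \<tau> then t else if i \<in> VX then X i else Y i)"

lemma goodD:
 assumes "point t r s b \<in> cylinder VX good"
 shows "\<exists>X. (\<Sum>i\<in>VX. (X i)\<^sup>2) < r \<and> (\<forall>Y. (\<Sum>i\<in>VY. (Y i)\<^sup>2) < b --> gval (env3 t X Y) \<Phi> \<le> s)"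
proof -
 obtain x where x: "x \<in> good" "!!i. i \<notin> VX ==> x i = point t r s b i"
  using assms by (auto simp: cylinder_def)
 have xv: "x \<tau> = t" "x \<rho> = r" "x \<sigma> = s" "x \<beta> = b"
  using x(2) fresh' point_simps by auto
 show ?thesis
 proof (intro exI[of _ x] conjI allI impI)
  show "(\<Sum>i\<in>VX. (x i)\<^sup>2) < r" using x(1) xv by (auto simp: good_def)
 next
  fix Y :: "nat => real" assume Y: "(\<Sum>i\<in>VY. (Y i)\<^sup>2) < b"
  define y where "y = (\<lambda>i. if i \<in> VY then Y i else x i)"
  have "x \<notin> cylinder VY bad" using x(1) closure_subset by (auto simp: good_def)
  moreover have "\<forall>i. i \<notin> VY --> y i = x i" by (simp add: y_def)
  ultimately have "y \<notin> bad" unfolding cylinder_def by blast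
  moreover have "(\<Sum>i\<in>VY. (y i)\<^sup>2) = (\<Sum>i\<in>VY. (Y i)\<^sup>2)" by (simp add: y_def)
  moreover have "y \<beta> = b" "y \<sigma> = s" using fresh' xv by (auto simp: y_def)
  ultimately have "gval y \<Phi> \<le> s" using Y by (auto simp: bad_def)
  moreover have "gval y \<Phi> = gval (env3 t x Y) \<Phi>"
  proof (rule gval_cong)
   fix i assume "i \<in> vars_qff \<Phi>"
   then show "y i = env3 t x Y i" using vars disj fresh' xv by (auto simp: y_def env3_def)
  qed
  ultimately show "gval (env3 t x Y) \<Phi> \<le> s" by simp
 qed
qed

text \<open>The positive slack separates: a limit of bad points over \<open>x\<close> would supply a
  \<open>Y\<close> with \<open>gval\<close> at least \<open>s\<close>, whereas \<open>X\<close>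
  keeps \<open>gval\<close> at most 0 for every \<open>Y\<close>. The ball of radius
  \<open>b\<close> makes the bad points converge.\<close>

lemma goodI:
 assumes X: "!!Y. holds (env3 t X Y) \<Phi>" "(\<Sum>i\<in>VX. (X i)\<^sup>2) < r" and s: "s > 0"
 shows "point t r s b \<in> cylinder VX good"
proof -
 define x where "x = (\<lambda>i. if i \<in> VX then X i else point t r s b i)"
 have xv: "x \<tau> = t" "x \<rho> = r" "x \<sigma> = s" "x \<beta> = b"
  using fresh' point_simps by (auto simp: x_def)
 have "x \<notin> closure (cylinder VY bad)"
 proof
  assume "x \<in> closure (cylinder VY bad)"
  then obtain z where z: "!!n. z n \<in> cylinder VY bad" "z \<longlonglongrightarrow> x"
   unfolding closure_sequential by blast
  then have "\<exists>y. y \<in> bad \<and> (\<forall>i. i \<notin> VY --> y i = z n i)" for n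
   unfolding cylinder_def by blast
  then obtain y where y: "!!n. y n \<in> bad" "!!n i. i \<notin> VY ==> y n i = z n i" by metis
  have conv: "(\<lambda>n. y n i) \<longlonglongrightarrow> x i" if "i \<notin> VY" for i
   using tendsto_coordinate[OF z(2), of i] that by (simp add: y(2))
  have "\<exists>c. \<forall>n. \<bar>y n i\<bar> \<le> c" if "i \<notin> VY" for i
   using convergent_imp_Bseq[OF convergentI[OF conv[OF that]]] unfolding Bseq_def by auto
  then obtain c where c: "!!i n. i \<notin> VY ==> \<bar>y n i\<bar> \<le> c i" by metis
  have "\<bar>y n i\<bar> \<le> (if i \<in> VY then 1 + c \<beta> else c i)" for n i
  proof (cases "i \<in> VY")
   case True
   have "(\<Sum>i\<in>VY. (y n i)\<^sup>2) \<le> c \<beta>"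
    using y(1)[of n] c[OF fresh'(11), of n] by (auto simp: bad_def)
   then show ?thesis using sum_squares_coordinate[OF fin(2) True] True by simp
  qed (use c in auto)
  then obtain l f where f: "strict_mono f" and l: "(y \<circ> f) \<longlonglongrightarrow> l"
   by (rule bounded_subsequence)
  have lx: "l i = x i" if "i \<notin> VY" for i
  proof -
   have "(\<lambda>n. (y \<circ> f) n i) \<longlonglongrightarrow> x i"
    using LIMSEQ_subseq_LIMSEQ[OF conv[OF that] f] by (simp add: o_def)
   with tendsto_coordinate[OF l, of i] show ?thesis by (rule LIMSEQ_unique)
  qed
  have "(\<lambda>n. gval ((y \<circ> f) n) \<Phi>) \<longlonglongrightarrow> gval l \<Phi>"
   using continuous_on_tendsto_compose[OF continuous_gval l] by simp
  moreover have "(\<lambda>n. (y \<circ> f) n \<sigma>) \<longlonglongrightarrow> l \<sigma>" by (rule tendsto_coordinate[OF l])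
  moreover have "(y \<circ> f) n \<sigma> \<le> gval ((y \<circ> f) n) \<Phi>" for n
   using y(1)[of "f n"] by (auto simp: bad_def)
  ultimately have "l \<sigma> \<le> gval l \<Phi>" by (intro LIMSEQ_le) auto
  moreover have "gval l \<Phi> = gval (env3 t X l) \<Phi>"
  proof (rule gval_cong)
   fix i assume "i \<in> vars_qff \<Phi>"
   then consider "i = \<tau>" | "i \<in> VX" | "i \<in> VY" using vars by auto
   then show "l i = env3 t X l i"
   proof cases
    case 2
    then have "i \<notin> VY" using disj by auto
    then show ?thesis using lx[of i] 2 fresh' by (auto simp: env3_def x_def)
   next
    case 1
    then show ?thesis using lx[of i] fresh' xv by (auto simp: env3_def)
   next
    case 3
    then show ?thesis using disj fresh' by (auto simp: env3_def)
   qed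
  qed
  moreover have "gval (env3 t X l) \<Phi> \<le> 0" using X(1) holds_iff_gval[OF le] by blast
  moreover have "l \<sigma> = s" using lx[OF fresh'(9)] xv by simp
  ultimately show False using s by simp
 qed
 moreover have "(\<Sum>i\<in>VX. (x i)\<^sup>2) < x \<rho>" using X(2) xv by (simp add: x_def)
 ultimately have "x \<in> good" by (simp add: good_def)
 moreover have "\<forall>i. i \<notin> VX --> x i = point t r s b i" by (simp add: x_def)
 ultimately show ?thesis unfolding cylinder_def by blast
qed

lemma game_limit:
 assumes "!!n::nat. \<exists>X. (\<Sum>i\<in>VX. (X i)\<^sup>2) < r \<and>
   (\<forall>Y. (\<Sum>i\<in>VY. (Y i)\<^sup>2) < real n --> gval (env3 t X Y) \<Phi> \<le> inverse (real (Suc n)))"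
 shows "game \<tau> VX \<Phi> t"
proof -
 from assms obtain X0 where X0: "!!n. (\<Sum>i\<in>VX. (X0 n i)\<^sup>2) < r"
  "!!n Y. (\<Sum>i\<in>VY. (Y i)\<^sup>2) < real n ==> gval (env3 t (X0 n) Y) \<Phi> \<le> inverse (real (Suc n))" by metis
 define X where "X n = (\<lambda>i. if i \<in> VX then X0 n i else 0)" for n
 have b: "\<bar>X n i\<bar> \<le> 1 + \<bar>r\<bar>" for n i
 proof (cases "i \<in> VX")
  case True
  have "(\<Sum>i\<in>VX. (X0 n i)\<^sup>2) \<le> \<bar>r\<bar>" using X0(1)[of n] by linarith
  from sum_squares_coordinate[OF fin(1) True this] show ?thesis using True by (simp add: X_def)
 qed (simp add: X_def)
 have c: "continuous_on UNIV (\<lambda>X. env3 t X Y)" for Y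
 proof (intro continuous_on_coordinatewise_then_product)
  show "continuous_on UNIV (\<lambda>X. env3 t X Y i)" for i
   by (cases "i = \<tau>"; cases "i \<in> VX") (auto simp: env3_def intro: continuous_on_product_coordinates)
 qed
 have ev: "\<forall>\<^sub>F n in sequentially. gval (env3 t (X n) Y) \<Phi> \<le> inverse (real (Suc n))" if True for Y
 proof -
  obtain N where N: "(\<Sum>i\<in>VY. (Y i)\<^sup>2) < real N" using reals_Archimedean2 by blast
  have "env3 t (X n) Y = env3 t (X0 n) Y" for n by (rule ext) (simp add: X_def env3_def)
  with N X0(2)[of Y] show ?thesis unfolding eventually_sequentially by (intro exI[of _ N]) auto
 qed
 from strategy_limit[where e = "env3 t" and Z = X and P = "\<lambda>_. True", OF le c b ev]
 obtain L where "\<forall>Y. holds (env3 t L Y) \<Phi>" by auto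
 then show ?thesis unfolding game_def env3_def by blast
qed

text \<open>The auxiliary parameters are removed from the frontier polynomial in the order opposite
  to their choice: leading coefficient in \<open>\<beta>\<close>, lowest in \<open>\<sigma>\<close>,
  leading in \<open>\<rho>\<close>. What is left is univariate in \<open>\<tau>\<close> without
  roots above the threshold. Choosing \<open>r\<close>, \<open>s\<close> and \<open>b\<close> one
  after another then makes the frontier polynomial nonzero on the whole segment from
  \<open>t\<close> to \<open>u\<close>, and connectedness carries membership in the projection of
  \<open>good\<close> along it.\<close>

lemma game_mono_above:
 assumes t: "real (threshold (card VX) (card VY) (fdeg \<Phi>) (fnorm \<Phi>)) + 1 < t"
  and u: "real (threshold (card VX) (card VY) (fdeg \<Phi>) (fnorm \<Phi>)) + 1 < u"
  and g: "game \<tau> VX \<Phi> t"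
 shows "game \<tau> VX \<Phi> u"
proof -
 let ?D = "zdeg (card VX) (2 + zdeg (card VY) (2 + fdeg \<Phi>))"
 let ?H = "threshold (card VX) (card VY) (fdeg \<Phi>) (fnorm \<Phi>)"
 obtain T where T: "ipoly {\<tau>, \<rho>, \<sigma>, \<beta>} ?D ?H T" "\<exists>x. T x \<noteq> 0"
  "frontier (cylinder VX good) \<subseteq> {x. T x = 0}"
  by (rule frontier_polynomial)
 obtain F1 m1 where F1: "!!k. ipoly ({\<tau>, \<rho>, \<sigma>, \<beta>} - {\<beta>}) ?D ?H (F1 k)"
  "!!x. T x = (\<Sum>k\<le>m1. x \<beta> ^ k * F1 k x)" "\<exists>x. F1 m1 x \<noteq> 0"
  by (rule ipoly_prune[OF T(1,2), of \<beta>]) blast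
 obtain F2 m2 where F2: "!!k. ipoly ({\<tau>, \<rho>, \<sigma>, \<beta>} - {\<beta>} - {\<sigma>}) ?D ?H (F2 k)"
  "!!x. F1 m1 x = x \<sigma> ^ m2 * (\<Sum>k\<le>?D. x \<sigma> ^ k * F2 k x)" "\<exists>x. F2 0 x \<noteq> 0"
  by (rule ipoly_lowest[OF F1(1,3), of \<sigma>]) blast
 obtain F3 m3 where F3: "!!k. ipoly ({\<tau>, \<rho>, \<sigma>, \<beta>} - {\<beta>} - {\<sigma>} - {\<rho>}) ?D ?H (F3 k)"
  "!!x. F2 0 x = (\<Sum>k\<le>m3. x \<rho> ^ k * F3 k x)" "\<exists>x. F3 m3 x \<noteq> 0"
  by (rule ipoly_prune[OF F2(1,3), of \<rho>]) blast
 have "{\<tau>, \<rho>, \<sigma>, \<beta>} - {\<beta>} - {\<sigma>} - {\<rho>} = {\<tau>}" using dist by auto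
 then have F3': "ipoly {\<tau>} ?D ?H (F3 m3)" using F3(1)[of m3] by simp
 define J where "J = {min t u..max t u}"
 define K where "K r s b = (\<lambda>v. point v r s b) ` J" for r s b
 have J: "compact J" "connected J" "t \<in> J" "u \<in> J" by (auto simp: J_def)
 have contJ: "continuous_on J (\<lambda>v. point v r s b)" for r s b
  by (rule continuous_on_subset[OF continuous_pt]) auto
 have K: "compact (K r s b)" "connected (K r s b)" for r s b
  unfolding K_def
  by (rule compact_continuous_image[OF contJ J(1)], rule connected_continuous_image[OF contJ J(2)])
 have nz3: "F3 m3 x \<noteq> 0" if "x \<in> K r s b" for x r s b
 proof (rule ipoly_root_bound[OF F3' F3(3)])
  show "real ?H + 1 < x \<tau>" using that t u by (auto simp: K_def J_def point_simps)
 qed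
 have "\<exists>b0. \<forall>b\<ge>b0. \<forall>x\<in>K 0 0 0. F2 0 (x(\<rho> := b)) \<noteq> 0"
  by (rule nonzero_for_large[OF K(1) F3(1,2)]) (erule nz3)
 then obtain r0 where r0': "\<forall>r\<ge>r0. \<forall>x\<in>K 0 0 0. F2 0 (x(\<rho> := r)) \<noteq> 0" ..
 note r0 = r0'[rule_format]
 obtain X where X: "!!Y. holds (env3 t X Y) \<Phi>" using g unfolding game_def env3_def by blast
 \<comment> \<open>The ball must contain the given winning \<open>X\<close>. It is fixed before
   \<open>n\<close>, so that the strategies obtained at \<open>u\<close> stay bounded when the slack
   shrinks and the range of \<open>Y\<close> grows.\<close>
 define r where "r = max r0 (1 + (\<Sum>i\<in>VX. (X i)\<^sup>2))"
 have nz2: "F2 0 x \<noteq> 0" if xK: "x \<in> K r 0 0" for x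
 proof -
  obtain v where v: "v \<in> J" "x = point v r 0 0" using xK unfolding K_def by blast
  have "(point v 0 0 0)(\<rho> := r) = x" using dist v(2) by (auto simp: pt_def)
  then show ?thesis using r0[of r "point v 0 0 0"] v(1) by (simp add: r_def K_def)
 qed
 have "\<exists>s0>0. \<forall>s. 0 < s \<and> s < s0 --> (\<forall>x\<in>K r 0 0. F1 m1 (x(\<sigma> := s)) \<noteq> 0)"
  by (rule nonzero_for_small[OF K(1) F2(1,2)]) (erule nz2)
 then obtain s0 where s0': "s0 > 0" "\<forall>s. 0 < s \<and> s < s0 --> (\<forall>x\<in>K r 0 0. F1 m1 (x(\<sigma> := s)) \<noteq> 0)"
  by (elim exE conjE) (rule that)
 note s0 = s0'(1) s0'(2)[rule_format, OF conjI]
 show ?thesis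
 proof (rule game_limit[of r])
  fix n :: nat
  define s where "s = min (s0 / 2) (inverse (real (Suc n)))"
  have s: "0 < s" "s < s0" "s \<le> inverse (real (Suc n))" using s0(1) by (auto simp: s_def)
  have nz1: "F1 m1 x \<noteq> 0" if xK: "x \<in> K r s 0" for x
  proof -
   obtain v where v: "v \<in> J" "x = point v r s 0" using xK unfolding K_def by blast
   have "(point v r 0 0)(\<sigma> := s) = x" using dist v(2) by (auto simp: pt_def)
   then show ?thesis using s0(2)[OF s(1,2), of "point v r 0 0"] v(1) by (simp add: K_def)
  qed
  have "\<exists>b0. \<forall>b\<ge>b0. \<forall>x\<in>K r s 0. T (x(\<beta> := b)) \<noteq> 0"
   by (rule nonzero_for_large[OF K(1) F1(1,2)]) (erule nz1)
  then obtain b0 where b0': "\<forall>b\<ge>b0. \<forall>x\<in>K r s 0. T (x(\<beta> := b)) \<noteq> 0" ..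
  note b0 = b0'[rule_format]
  define b where "b = max b0 (real n)"
  have nz: "T x \<noteq> 0" if xK: "x \<in> K r s b" for x
  proof -
   obtain v where v: "v \<in> J" "x = point v r s b" using xK unfolding K_def by blast
   have "(point v r s 0)(\<beta> := b) = x" using dist v(2) by (auto simp: pt_def)
   then show ?thesis using b0[of b "point v r s 0"] v(1) by (simp add: b_def K_def)
  qed
  have "point t r s b \<in> cylinder VX good"
   by (rule goodI[OF X _ s(1)]) (simp add: r_def)
  moreover have "K r s b \<inter> frontier (cylinder VX good) = {}" using T(3) nz by blast
  ultimately have "K r s b - cylinder VX good = {}"
   using connected_Int_frontier[OF K(2)[of r s b], of "cylinder VX good"] J(3) by (auto simp: K_def)
  then have "point u r s b \<in> cylinder VX good" using J(4) by (auto simp: K_def)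
  from goodD[OF this] obtain Z where Z': "(\<Sum>i\<in>VX. (Z i)\<^sup>2) < r" "\<forall>Y. (\<Sum>i\<in>VY. (Y i)\<^sup>2) < b --> gval (env3 u Z Y) \<Phi> \<le> s"
   by (elim exE conjE) (rule that)
  note Z = Z'(1) Z'(2)[rule_format]
  have "gval (env3 u Z Y) \<Phi> \<le> inverse (real (Suc n))" if "(\<Sum>i\<in>VY. (Y i)\<^sup>2) < real n" for Y
  proof -
   have "(\<Sum>i\<in>VY. (Y i)\<^sup>2) < b" using that by (simp add: b_def)
   from Z(2)[OF this] s(3) show ?thesis by linarith
  qed
  with Z(1) show "\<exists>X. (\<Sum>i\<in>VX. (X i)\<^sup>2) < r \<and>
   (\<forall>Y. (\<Sum>i\<in>VY. (Y i)\<^sup>2) < real n --> gval (env3 u X Y) \<Phi> \<le> inverse (real (Suc n)))" by blast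
 qed
qed

end

theorem game_eventually_constant:
 assumes "finite VX" "finite VY" "VX \<inter> VY = {}" "\<tau> \<notin> VX \<union> VY"
  and "vars_qff \<Phi> \<subseteq> insert \<tau> (VX \<union> VY)" "qff_le \<Phi>"
  and "real (threshold (card VX) (card VY) (fdeg \<Phi>) (fnorm \<Phi>)) + 1 < t"
  and "real (threshold (card VX) (card VY) (fdeg \<Phi>) (fnorm \<Phi>)) + 1 < u"
  and "game \<tau> VX \<Phi> t"
 shows "game \<tau> VX \<Phi> u"
proof -
 define S where "S = insert \<tau> (VX \<union> VY)"
 have S: "finite S" using assms by (simp add: S_def)
 obtain \<rho> where \<rho>: "\<rho> \<notin> S" using ex_new_if_finite[OF infinite_UNIV_nat S] by blast
 obtain \<sigma> where \<sigma>: "\<sigma> \<notin> insert \<rho> S"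
  using ex_new_if_finite[OF infinite_UNIV_nat, of "insert \<rho> S"] S by blast
 obtain \<beta> where \<beta>: "\<beta> \<notin> insert \<sigma> (insert \<rho> S)"
  using ex_new_if_finite[OF infinite_UNIV_nat, of "insert \<sigma> (insert \<rho> S)"] S by blast
 interpret prenex_game \<tau> \<rho> \<sigma> \<beta> VX VY \<Phi>
  by unfold_locales (use assms \<rho> \<sigma> \<beta> in \<open>auto simp: S_def\<close>)
 show ?thesis using assms(7-9) by (rule game_mono_above)
qed

section \<open>Explicit size of the threshold\<close>

lemma add_one_le_exp: "n + 1 \<le> (2::nat) ^ n"
 using less_exp[of n] by (simp only: Suc_eq_plus1[symmetric] Suc_le_eq)

text \<open>The exponent is the one that the norm bound requires, so that both bounds share
  it.\<close>

lemma zdeg_bound: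
 assumes "1 \<le> r" "r \<le> 2 ^ a" "n \<le> v"
 shows "zdeg n r \<le> 2 ^ (2 * (a + 1) * v + 2 * a + v + 6)"
proof -
 have N: "(2 * r) ^ n \<le> 2 ^ ((a + 1) * v)"
 proof -
  have "(2 * r) ^ n \<le> (2 * 2 ^ a) ^ n" using assms by (intro power_mono mult_le_mono) auto
  also have "\<dots> = 2 ^ ((a + 1) * n)" by (simp add: power_mult[symmetric] power_add[symmetric] algebra_simps)
  also have "\<dots> \<le> 2 ^ ((a + 1) * v)" using assms by (intro power_increasing mult_le_mono) auto
  finally show ?thesis .
 qed
 have e: "2 * r + n * (2 * r - 1) \<le> 2 ^ (a + 1 + v)"
 proof -
  have "2 * r + n * (2 * r - 1) \<le> 2 * r * (n + 1)" by (simp add: algebra_simps diff_mult_distrib2)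
  also have "\<dots> \<le> 2 * 2 ^ a * 2 ^ v"
  proof (intro mult_le_mono)
   have "n + 1 \<le> 2 ^ n" by (rule add_one_le_exp)
   also have "\<dots> \<le> 2 ^ v" using assms by (intro power_increasing) auto
   finally show "n + 1 \<le> 2 ^ v" .
  qed (use assms in auto)
  finally show ?thesis by (simp add: power_add)
 qed
 have "zdeg n r \<le> 2 ^ ((a + 1) * v) * 2 ^ (a + 1 + v)"
  unfolding zdeg_def by (rule mult_le_mono[OF N e])
 also have "\<dots> = 2 ^ ((a + 1) * v + (a + 1 + v))" by (simp add: power_add)
 also have "\<dots> \<le> 2 ^ (2 * (a + 1) * v + 2 * a + v + 6)"
  by (intro power_increasing) (auto simp: algebra_simps)
 finally show ?thesis .
qed

text \<open>Since \<open>H\<close> is at least 2, every numerical factor, including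
  \<open>fact N\<close> and the powers of \<open>2 * r\<close>, can be absorbed into a power of
  \<open>H\<close>; only exponents remain to be compared.\<close>

lemma znorm_bound:
 assumes "1 \<le> r" "r \<le> 2 ^ a" "n \<le> v" "2 \<le> H"
 shows "znorm n r H \<le> H ^ (2 ^ (2 * (a + 1) * v + 2 * a + v + 6))"
proof -
 define N where "N = (2 * r) ^ n"
 define e where "e = 2 * r + n * (2 * r - 1)"
 have N: "N \<le> 2 ^ ((a + 1) * v)"
 proof -
  have "(2 * r) ^ n \<le> (2 * 2 ^ a) ^ n" using assms by (intro power_mono mult_le_mono) auto
  also have "\<dots> = 2 ^ ((a + 1) * n)" by (simp add: power_mult[symmetric] power_add[symmetric] algebra_simps)
  also have "\<dots> \<le> 2 ^ ((a + 1) * v)" using assms by (intro power_increasing mult_le_mono) auto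
  finally show ?thesis by (simp add: N_def)
 qed
 have e: "e \<le> 2 ^ (a + 1 + v)"
 proof -
  have "e \<le> 2 * r * (n + 1)" by (simp add: e_def algebra_simps diff_mult_distrib2)
  also have "\<dots> \<le> 2 * 2 ^ a * 2 ^ v"
  proof (intro mult_le_mono)
   have "n + 1 \<le> 2 ^ n" by (rule add_one_le_exp)
   also have "\<dots> \<le> 2 ^ v" using assms by (intro power_increasing) auto
   finally show "n + 1 \<le> 2 ^ v" .
  qed (use assms in auto)
  finally show ?thesis by (simp add: power_add)
 qed
 have e1: "1 \<le> e" using assms by (simp add: e_def)
 have H1: "1 \<le> H ^ k" for k using assms(4) by simp
 have pow: "2 ^ k \<le> H ^ k" for k using assms(4) by (intro power_mono) auto
 have f: "fact N \<le> H ^ (N * N)"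
 proof -
  have "fact N \<le> N ^ N" using fact_le_power[of N, where 'a=nat] by (simp only: of_nat_id)
  also have "\<dots> \<le> (2 ^ N) ^ N" using less_exp[of N] by (intro power_mono) auto
  also have "\<dots> = 2 ^ (N * N)" by (simp add: power_mult)
  finally show ?thesis using pow order_trans by blast
 qed
 have i: "H\<^sup>2 * (2 * r * (2 * r) * H\<^sup>2) ^ e + 1 \<le> H ^ ((2 * a + 7) * e)"
 proof -
  have "2 * r * (2 * r) * H\<^sup>2 \<le> 2 * 2 ^ a * (2 * 2 ^ a) * H\<^sup>2"
   using assms by (intro mult_le_mono) auto
  also have "\<dots> = 2 ^ (2 * a + 2) * H\<^sup>2"
  proof -
   have "2 * 2 ^ a * (2 * 2 ^ a) = (2::nat) ^ Suc a * 2 ^ Suc a" by (simp only: power_Suc)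
   also have "\<dots> = 2 ^ (2 * a + 2)" by (simp only: power_add[symmetric]) (simp add: mult_2)
   finally show ?thesis by (simp only:)
  qed
  also have "\<dots> \<le> H ^ (2 * a + 2) * H\<^sup>2" by (intro mult_le_mono pow) auto
  also have "\<dots> = H ^ (2 * a + 2 + 2)" by (simp only: power_add)
  also have "2 * a + 2 + 2 = 2 * a + (4::nat)" by simp
  finally have "(2 * r * (2 * r) * H\<^sup>2) ^ e \<le> (H ^ (2 * a + 4)) ^ e" by (intro power_mono) auto
  then have "H\<^sup>2 * (2 * r * (2 * r) * H\<^sup>2) ^ e \<le> H\<^sup>2 * H ^ ((2 * a + 4) * e)"
   unfolding power_mult by (rule mult_le_mono[OF order_refl])
  also have "\<dots> = H ^ (2 + (2 * a + 4) * e)" by (simp only: power_add)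
  finally have *: "H\<^sup>2 * (2 * r * (2 * r) * H\<^sup>2) ^ e \<le> H ^ (2 + (2 * a + 4) * e)" .
  have "H ^ (2 + (2 * a + 4) * e) + 1 \<le> 2 * H ^ (2 + (2 * a + 4) * e)" using H1[of "2 + (2 * a + 4) * e"] by linarith
  also have "\<dots> \<le> H * H ^ (2 + (2 * a + 4) * e)" using assms(4) by (intro mult_le_mono) auto
  also have "\<dots> = H ^ (3 + (2 * a + 4) * e)"

  proof -
   have "3 + (2 * a + 4) * e = Suc (2 + (2 * a + 4) * e)" by linarith
   then show ?thesis by (simp only: power_Suc)
  qed
  also have "\<dots> \<le> H ^ ((2 * a + 7) * e)"
   using e1 assms(4) by (intro power_increasing) (auto simp: algebra_simps)
  finally show ?thesis using * by linarith
 qed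
 have "znorm n r H \<le> H ^ (N * N) * (H ^ ((2 * a + 7) * e)) ^ N"
  unfolding znorm_def N_def[symmetric] e_def[symmetric]
  by (intro mult_le_mono f power_mono i) auto
 also have "\<dots> = H ^ (N * N + (2 * a + 7) * e * N)" by (simp add: power_add power_mult)
 also have "\<dots> \<le> H ^ (2 ^ (2 * (a + 1) * v + 2 * a + v + 6))"
 proof (rule power_increasing)
  let ?z = "2 * (a + 1) * v + 2 * a + v + 5"
  have "N * N \<le> 2 ^ ((a + 1) * v) * 2 ^ ((a + 1) * v)" by (intro mult_le_mono N)
  also have "\<dots> = 2 ^ (2 * (a + 1) * v)" by (simp add: power_add[symmetric] mult_2 algebra_simps)
  also have "\<dots> \<le> 2 ^ ?z" by (intro power_increasing) auto
  finally have 1: "N * N \<le> 2 ^ ?z" .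
  have "2 * a + 7 \<le> 2 ^ (a + 3)"
  proof (induction a)
   case (Suc a)
   have "(2::nat) ^ (Suc a + 3) = 2 * 2 ^ (a + 3)" by (simp only: add_Suc power_Suc)
   moreover have "2 * Suc a + 7 \<le> 2 * (2 * a + 7)" by simp
   moreover have "2 * (2 * a + 7) \<le> 2 * 2 ^ (a + 3)" using Suc by (rule mult_le_mono2)
   ultimately show ?case by (simp only:)
  qed simp
  then have "(2 * a + 7) * e * N \<le> 2 ^ (a + 3) * 2 ^ (a + 1 + v) * 2 ^ ((a + 1) * v)"
   by (intro mult_le_mono e N)
  also have "\<dots> = 2 ^ (a + 3 + (a + 1 + v) + (a + 1) * v)" by (simp only: power_add)
  also have "\<dots> \<le> 2 ^ ?z" by (intro power_increasing) (auto simp: algebra_simps)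
  finally have "(2 * a + 7) * e * N \<le> 2 ^ ?z" .
  then show "N * N + (2 * a + 7) * e * N \<le> 2 ^ (2 * (a + 1) * v + 2 * a + v + 6)"
  proof -
   have "2 * (a + 1) * v + 2 * a + v + 6 = Suc ?z" by simp
   then have "2 ^ (2 * (a + 1) * v + 2 * a + v + 6) = 2 * (2::nat) ^ ?z" by (simp only: power_Suc)
   then show ?thesis using 1 \<open>(2 * a + 7) * e * N \<le> 2 ^ ?z\<close> by linarith
  qed
 qed (use assms(4) in simp)
 finally show ?thesis .
qed

text \<open>\<open>z1\<close> and \<open>z2\<close> are the exponents of the two projections.
  \<open>z1\<close> is quadratic in \<open>l\<close>, and \<open>z2\<close> contains
  \<open>2 * l * z1\<close>, which is where the cube comes from. The constant 20 covers the lower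
  order terms for \<open>l\<close> at least 7.\<close>

lemma threshold_bound:
 assumes l: "l \<ge> 7" and mn: "m \<le> l" "n \<le> l" and d: "2 + d \<le> 2 ^ (2 * l)" and H: "H \<ge> 2"
 shows "threshold m n d H + 2 \<le> H ^ (2 ^ (20 * l ^ 3))"
proof -
 define z1 where "z1 = 2 * (2 * l + 1) * l + 2 * (2 * l) + l + 6"
 define z2 where "z2 = 2 * (z1 + 2 + 1) * l + 2 * (z1 + 2) + l + 6"
 have deg1: "zdeg n (2 + d) \<le> 2 ^ z1"
  unfolding z1_def by (rule zdeg_bound) (use d mn in auto)
 have lexp: "k + 1 \<le> 2 ^ l" if "k \<le> l" for k
 proof -
  have "k + 1 \<le> l + 1" using that by simp
  also have "l + 1 \<le> 2 ^ l" using less_exp[of l] by (simp add: Suc_le_eq)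
  finally show ?thesis .
 qed
 have powH: "2 ^ k \<le> H ^ k" for k using H by (intro power_mono) auto
 have nH: "(n + 1) * H \<le> H ^ (l + 1)"
 proof -
  have "(n + 1) * H \<le> 2 ^ l * H" by (intro mult_le_mono lexp mn) auto
  also have "\<dots> \<le> H ^ l * H" by (intro mult_le_mono powH) auto
  finally show ?thesis by (simp add: mult.commute)
 qed
 have nH2: "2 \<le> (n + 1) * H" using H by (simp add: add_increasing2)
 have "znorm n (2 + d) ((n + 1) * H) \<le> ((n + 1) * H) ^ (2 ^ z1)"
  unfolding z1_def by (rule znorm_bound) (use d mn nH2 in auto)
 also have "\<dots> \<le> (H ^ (l + 1)) ^ (2 ^ z1)" by (intro power_mono nH) auto
 also have "\<dots> = H ^ ((l + 1) * 2 ^ z1)" by (simp only: power_mult)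
 finally have n1: "znorm n (2 + d) ((n + 1) * H) \<le> H ^ ((l + 1) * 2 ^ z1)" .
 define H2 where "H2 = (m + 1) * znorm n (2 + d) ((n + 1) * H)"
 have H2: "H2 \<le> H ^ (2 ^ (z1 + l + 1))"
 proof -
  have "H2 \<le> 2 ^ l * H ^ ((l + 1) * 2 ^ z1)" unfolding H2_def by (intro mult_le_mono lexp mn n1)
  also have "\<dots> \<le> H ^ l * H ^ ((l + 1) * 2 ^ z1)" by (intro mult_le_mono powH) auto
  also have "\<dots> = H ^ (l + (l + 1) * 2 ^ z1)" by (simp add: power_add)
  also have "\<dots> \<le> H ^ (2 ^ (z1 + l + 1))"
  proof (rule power_increasing)
   have "l + (l + 1) * 2 ^ z1 \<le> l * 2 ^ z1 + (l + 1) * 2 ^ z1" by (intro add_mono) auto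
   also have "\<dots> = (2 * l + 1) * 2 ^ z1" by (simp add: algebra_simps)
   also have "\<dots> \<le> 2 ^ (l + 1) * 2 ^ z1" using lexp[of l] by (intro mult_le_mono) auto
   finally show "l + (l + 1) * 2 ^ z1 \<le> 2 ^ (z1 + l + 1)" by (simp add: power_add algebra_simps)
  qed (use H in simp)
  finally show ?thesis .
 qed
 have rr: "2 + zdeg n (2 + d) \<le> 2 ^ (z1 + 2)"
 proof -
  have "(1::nat) \<le> 2 ^ z1" by simp
  moreover have "(2::nat) ^ (z1 + 2) = 4 * 2 ^ z1" by (simp add: power_add)
  ultimately show ?thesis using deg1 by linarith
 qed
 have z: "z1 + l + 1 + z2 + 1 \<le> 20 * l ^ 3"
 proof -
  obtain k where k: "l = k + 7" using l by (metis add.commute le_Suc_ex)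
  show ?thesis unfolding z2_def z1_def k by (simp add: power3_eq_cube algebra_simps)
 qed
 have H2': "2 \<le> H ^ (2 ^ (z1 + l + 1))" using H self_le_power[of H "2 ^ (z1 + l + 1)"] by simp
 have "threshold m n d H \<le> znorm m (2 + zdeg n (2 + d)) H2" by (simp add: threshold_def H2_def)
 also have "\<dots> \<le> (H ^ (2 ^ (z1 + l + 1))) ^ (2 ^ z2)"
 proof (cases "2 \<le> H2")
  case True
  have "znorm m (2 + zdeg n (2 + d)) H2 \<le> H2 ^ (2 ^ z2)"
   unfolding z2_def by (rule znorm_bound[OF _ rr mn(1) True]) simp
  also have "\<dots> \<le> (H ^ (2 ^ (z1 + l + 1))) ^ (2 ^ z2)" by (intro power_mono H2) auto
  finally show ?thesis .
 next
  case False
  have "znorm m (2 + zdeg n (2 + d)) H2 \<le> znorm m (2 + zdeg n (2 + d)) 2"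
   unfolding znorm_def using False by (intro mult_le_mono power_mono add_mono) auto
  also have "\<dots> \<le> 2 ^ (2 ^ z2)"
   unfolding z2_def by (rule znorm_bound[OF _ rr mn(1)]) auto
  also have "\<dots> \<le> (H ^ (2 ^ (z1 + l + 1))) ^ (2 ^ z2)" by (intro power_mono H2') auto
  finally show ?thesis .
 qed
 also have "\<dots> = H ^ (2 ^ (z1 + l + 1 + z2))" by (simp only: power_mult[symmetric] power_add)
 finally have t: "threshold m n d H \<le> H ^ (2 ^ (z1 + l + 1 + z2))" .
 let ?e = "2 ^ (z1 + l + 1 + z2) :: nat"
 have "2 \<le> H ^ ?e" using H self_le_power[of H ?e] by simp
 then have "threshold m n d H + 2 \<le> H ^ ?e + H ^ ?e" using t by linarith
 also have "\<dots> \<le> H * H ^ ?e" using H by (simp add: mult_2[symmetric])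
 also have "\<dots> = H ^ (1 + ?e)" by simp
 also have "\<dots> \<le> H ^ (?e + ?e)" using H by (intro power_increasing add_mono) auto
 also have "?e + ?e = 2 ^ (z1 + l + 1 + z2 + 1)" by simp
 also have "H ^ (2 ^ (z1 + l + 1 + z2 + 1)) \<le> H ^ (2 ^ (20 * l ^ 3))"
  using H z by (intro power_increasing) auto
 finally show ?thesis .
qed

section \<open>Bounded and relaxed quantifiers\<close>

text \<open>Unlike in \<open>env\<close>, the universal block keeps its indices, as it does in
  \<open>game\<close>.\<close>

definition mix :: "nat => (nat => real) => (nat => real) => nat => real" where
 "mix m X Y i = (if i < m then X i else Y i)"

lemma holds_foldr_Conj: "holds x (foldr Conj fs f) \<longleftrightarrow> (\<forall>g\<in>set fs. holds x g) \<and> holds x f"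
 by (induction fs) auto

lemma holds_foldr_Disj: "holds x (foldr Disj fs f) \<longleftrightarrow> (\<exists>g\<in>set fs. holds x g) \<or> holds x f"
 by (induction fs) auto

lemma qff_le_foldr:
 "qff_le (foldr Conj fs f) \<longleftrightarrow> (\<forall>g\<in>set fs. qff_le g) \<and> qff_le f"
 "qff_le (foldr Disj fs f) \<longleftrightarrow> (\<forall>g\<in>set fs. qff_le g) \<and> qff_le f"
 by (induction fs) auto

lemma vars_qff_foldr:
 "vars_qff (foldr Conj fs f) = (\<Union>g\<in>set fs. vars_qff g) \<union> vars_qff f"
 "vars_qff (foldr Disj fs f) = (\<Union>g\<in>set fs. vars_qff g) \<union> vars_qff f"
 by (induction fs) auto

lemma fdeg_foldr:
 "fdeg (foldr Conj fs f) = (\<Sum>g\<leftarrow>fs. fdeg g) + fdeg f"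
 "fdeg (foldr Disj fs f) = (\<Sum>g\<leftarrow>fs. fdeg g) + fdeg f"
 by (induction fs) auto

lemma fnorm_foldr:
 "fnorm (foldr Conj fs f) = (\<Prod>g\<leftarrow>fs. fnorm g) * fnorm f"
 "fnorm (foldr Disj fs f) = (\<Prod>g\<leftarrow>fs. fnorm g) * fnorm f"
 by (induction fs) auto

text \<open>For \<open>c > 0\<close>, the formula relaxed by \<open>k / c\<close>; with \<open>sw\<close> and for \<open>c < 0\<close>, its violation by \<open>k / c\<close>.\<close>
fun scl :: "bool => trm => int => qff => qff" where
 "scl sw c k (Le s t) = Le (Mul c s) (Add (Const k) (Mul c t))"
| "scl sw c k (Lt s t) = Lt (Mul c s) (Add (Const k) (Mul c t))"
| "scl sw c k (Conj f g) = (if sw then Disj else Conj) (scl sw c k f) (scl sw c k g)"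
| "scl sw c k (Disj f g) = (if sw then Conj else Disj) (scl sw c k f) (scl sw c k g)"

lemma holds_scl_relax:
 assumes "qff_le \<Phi>" "eval_trm x c \<ge> 0"
 shows "holds x (scl False c 1 \<Phi>) \<longleftrightarrow> eval_trm x c * gval x \<Phi> \<le> 1"
 using assms
 by (induction \<Phi>) (auto simp: algebra_simps max_mult_distrib_left min_mult_distrib_left min_le_iff_disj)

lemma holds_scl_dual:
 assumes "qff_le \<Phi>" "eval_trm x c \<le> 0"
 shows "holds x (scl True c (-1) \<Phi>) \<longleftrightarrow> 1 \<le> - eval_trm x c * gval x \<Phi>"
 using assms
proof (induction \<Phi>)
 case (Conj f g)
 have "- eval_trm x c * max (gval x f) (gval x g) = max (- eval_trm x c * gval x f) (- eval_trm x c * gval x g)"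
  using Conj.prems by (intro max_mult_distrib_left[THEN trans]) auto
 then show ?case using Conj by (simp only: scl.simps if_True holds.simps gval.simps qff_le.simps le_max_iff_disj)
next
 case (Disj f g)
 have "- eval_trm x c * min (gval x f) (gval x g) = min (- eval_trm x c * gval x f) (- eval_trm x c * gval x g)"
  using Disj.prems by (intro min_mult_distrib_left[THEN trans]) auto
 then show ?case using Disj by (simp only: scl.simps if_True holds.simps gval.simps qff_le.simps min.bounded_iff)
qed (auto simp: algebra_simps)

lemma qff_le_scl: "qff_le (scl sw c k \<Phi>) = qff_le \<Phi>"
 by (induction \<Phi>) auto

lemma vars_qff_scl: "vars_qff (scl sw c k \<Phi>) \<subseteq> vars_trm c \<union> vars_qff \<Phi>"
 by (induction \<Phi>) auto

lemma fdeg_scl_var: "fdeg (scl sw (Var v) k \<Phi>) \<le> 3 * fdeg \<Phi>"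
 by (induction \<Phi>) auto

lemma two_le_power: "(2::nat) \<le> 2 ^ (n + 1)"
 by simp

lemma fnorm_scl_var: "\<bar>k\<bar> = 1 ==> fnorm (scl sw (Var v) k \<Phi>) \<le> 2 ^ fdeg \<Phi> * fnorm \<Phi>"
proof (induction \<Phi>)
 case (Conj f g)
 from mult_le_mono[OF Conj.IH] Conj.prems show ?case by (auto simp: power_add algebra_simps)
next
 case (Disj f g)
 from mult_le_mono[OF Disj.IH] Disj.prems show ?case by (auto simp: power_add algebra_simps)
next
 case (Le s t)
 from mult_le_mono1[OF two_le_power, of "tnorm s + tnorm t + 1" "tdeg s + tdeg t"] Le show ?case by simp
next
 case (Lt s t)
 from mult_le_mono1[OF two_le_power, of "tnorm s + tnorm t + 1" "tdeg s + tdeg t"] Lt show ?case by simp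
qed

lemma finite_vars_qff: "finite (vars_qff \<Phi>)"
proof -
 have "finite (vars_trm t)" for t by (induction t) auto
 then show ?thesis by (induction \<Phi>) auto
qed

text \<open>The threshold in the form used by the reductions: \<open>l\<close> is a length, at least
  7 for every encoded sentence, and a norm of at most \<open>2 ^ K\<close> enters the exponent only
  through the factor \<open>K\<close>. The bound \<open>15 * l\<close> leaves room for the clauses
  added to the input formula.\<close>

lemma game_constant_large:
 assumes "finite VX" "finite VY" "VX \<inter> VY = {}" "\<tau> \<notin> VX \<union> VY" "vars_qff \<Phi> \<subseteq> insert \<tau> (VX \<union> VY)" "qff_le \<Phi>"
  and l: "l \<ge> 7" "card VX \<le> l" "card VY \<le> l" and d: "fdeg \<Phi> \<le> 15 * l" and H: "fnorm \<Phi> \<le> 2 ^ K" "K \<ge> 1"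
  and q: "K * 2 ^ (20 * l ^ 3) \<le> 2 ^ q" and t: "t \<ge> 2 ^ (2 ^ q)" and u: "u \<ge> 2 ^ (2 ^ q)"
  and g: "game \<tau> VX \<Phi> t"
 shows "game \<tau> VX \<Phi> u"
proof -
 have pos: "fnorm \<Phi> \<ge> 1" by (rule fnorm_pos)
 have "2 + fdeg \<Phi> \<le> 2 ^ (2 * l)"
 proof -
  have "2 + 15 * k \<le> 4 ^ k" if "k \<ge> 7" for k :: nat
   using that by (induction k rule: dec_induct) auto
  from this[OF l(1)] d show ?thesis by (simp add: power_mult)
 qed
 then have "threshold (card VX) (card VY) (fdeg \<Phi>) (max 2 (fnorm \<Phi>)) + 2 \<le> (max 2 (fnorm \<Phi>)) ^ (2 ^ (20 * l ^ 3))"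
  using l by (intro threshold_bound) auto
 also have "\<dots> \<le> (2 ^ K) ^ (2 ^ (20 * l ^ 3))"
 proof (rule power_mono)
  have "2 ^ 1 \<le> (2::nat) ^ K" using H(2) by (intro power_increasing) auto
  then show "max 2 (fnorm \<Phi>) \<le> 2 ^ K" using H by simp
 qed simp
 also have "\<dots> = 2 ^ (K * 2 ^ (20 * l ^ 3))" by (simp only: power_mult)
 also have "\<dots> \<le> 2 ^ (2 ^ q)" using q by (intro power_increasing) auto
 finally have 1: "threshold (card VX) (card VY) (fdeg \<Phi>) (max 2 (fnorm \<Phi>)) + 2 \<le> 2 ^ (2 ^ q)" .
 have "znorm n r H \<le> znorm n r H'" if "H \<le> H'" for n r H H'
  unfolding znorm_def using that by (intro mult_le_mono power_mono add_mono) auto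
 then have "threshold (card VX) (card VY) (fdeg \<Phi>) (fnorm \<Phi>) \<le> threshold (card VX) (card VY) (fdeg \<Phi>) (max 2 (fnorm \<Phi>))"
  unfolding threshold_def by (meson max.cobounded2 mult_le_mono2)
 with 1 have "threshold (card VX) (card VY) (fdeg \<Phi>) (fnorm \<Phi>) + 2 \<le> 2 ^ (2 ^ q)" by linarith
 then have "real (threshold (card VX) (card VY) (fdeg \<Phi>) (fnorm \<Phi>) + 2) \<le> real (2 ^ (2 ^ q))"
  by (rule of_nat_mono)
 then have "real (threshold (card VX) (card VY) (fdeg \<Phi>) (fnorm \<Phi>)) + 2 \<le> 2 ^ (2 ^ q)" by simp
 then show ?thesis
  by (intro game_eventually_constant[OF assms(1-6) _ _ g]) (use t u in linarith)+
qed

lemma fresh_above: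
 fixes V :: "nat set"
 assumes "finite V"
 shows "\<exists>z\<ge>m. \<forall>i\<in>V. i < z"
proof -
 obtain b where "\<forall>i\<in>V. i < b" using assms finite_nat_set_iff_bounded by auto
 then show ?thesis by (intro exI[of _ "m + b"]) auto
qed

text \<open>Origin of the constant 32: \<open>20 * l ^ 3\<close> comes from the threshold, and the
  rest swallows the linear terms.\<close>

lemma cube_absorb: "7 \<le> l ==> (7 + 7 * l) + 20 * l ^ 3 \<le> 32 * (l::nat) ^ 3"
proof -
 assume "7 \<le> l"
 then obtain k where k: "l = k + 7" by (metis add.commute le_Suc_ex)
 show ?thesis unfolding k by (simp add: power3_eq_cube algebra_simps)
qed

lemma exponent_absorb:
 assumes "l \<ge> 7"
 shows "7 * l * 2 ^ (20 * l ^ 3) \<le> (2::nat) ^ (32 * l ^ 3)"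
proof -
 have "7 * l * 2 ^ (20 * l ^ 3) \<le> 2 ^ (7 * l) * 2 ^ (20 * l ^ 3)"
  using less_exp[of "7 * l"] by (intro mult_le_mono) auto
 also have "\<dots> = 2 ^ (7 * l + 20 * l ^ 3)" by (simp only: power_add)
 also have "\<dots> \<le> 2 ^ (32 * l ^ 3)" using cube_absorb[OF assms] by (intro power_increasing) auto
 finally show ?thesis .
qed

lemma sum_list_const: "(\<Sum>x\<leftarrow>xs. c) = length xs * (c::nat)"
 by (induction xs) auto

lemma prod_list_const: "(\<Prod>x\<leftarrow>xs. c) = (c::nat) ^ length xs"
 by (induction xs) auto

section \<open>Bounds for the existential and for the universal block\<close>

lemma continuous_mix: "continuous_on UNIV (\<lambda>X. mix m X Y)" "continuous_on UNIV (\<lambda>Y. mix m X Y)"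
proof (intro continuous_on_coordinatewise_then_product)
 show "continuous_on UNIV (\<lambda>X. mix m X Y i)" for i
  by (cases "i < m") (auto simp: mix_def intro: continuous_on_product_coordinates)
 show "continuous_on UNIV (\<lambda>Y. mix m X Y)"
 proof (intro continuous_on_coordinatewise_then_product)
  show "continuous_on UNIV (\<lambda>Y. mix m X Y i)" for i
   by (cases "i < m") (auto simp: mix_def intro: continuous_on_product_coordinates)
 qed
qed

text \<open>With the conjuncts \<open>(X i) ^ 2 \<le> \<tau>\<close> added, \<open>X0\<close> itself
  wins for one huge value of \<open>\<tau>\<close>. Truth is constant above the threshold, so some
  \<open>X\<close> wins for \<open>\<tau> = R\<close> as well.\<close>

lemma exists_bounded_X:
 assumes le: "qff_le \<Phi>" and l: "l \<ge> 7" "card (vars_qff \<Phi>) \<le> l" "fdeg \<Phi> \<le> l" "fnorm \<Phi> \<le> 2 ^ l"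
  and R: "R \<ge> 2 ^ (2 ^ (32 * l ^ 3))" and X0: "!!Y. holds (mix m X0 Y) \<Phi>"
 obtains X where "!!i. i \<in> vars_qff \<Phi> ==> i < m ==> (X i)\<^sup>2 \<le> R" "!!Y. holds (mix m X Y) \<Phi>"
proof -
 define V where "V = vars_qff \<Phi>"
 have V: "finite V" unfolding V_def by (rule finite_vars_qff)
 define VX where "VX = V \<inter> {..<m}"
 define VY where "VY = V \<inter> {m..}"
 obtain \<tau> where \<tau>: "\<tau> \<ge> m" "!!i. i \<in> V ==> i < \<tau>" using fresh_above[OF V, of m] by auto
 define xs where "xs = sorted_list_of_set VX"
 have fin: "finite VX" "finite VY" using V by (auto simp: VX_def VY_def)
 have xs: "set xs = VX" "length xs \<le> l"
  using fin card_mono[of V VX] V l(2) by (auto simp: xs_def VX_def V_def)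
 define G where "G = foldr Conj (map (\<lambda>i. Le (Mul (Var i) (Var i)) (Var \<tau>)) xs) \<Phi>"
 have game: "game \<tau> VX G t \<longleftrightarrow> (\<exists>X. (\<forall>i\<in>VX. (X i)\<^sup>2 \<le> t) \<and> (\<forall>Y. holds (mix m X Y) \<Phi>))" for t
 proof -
  let ?e = "\<lambda>X Y i. if i = \<tau> then t else if i \<in> VX then X i else Y i :: real"
  have "holds (?e X Y) \<Phi> = holds (mix m X Y) \<Phi>" for X Y
   by (rule holds_cong) (use \<tau> in \<open>auto simp: mix_def VX_def V_def\<close>)
  moreover have "?e X Y i = X i" if "i \<in> VX" for X Y i using that \<tau> by (auto simp: VX_def)
  ultimately have "holds (?e X Y) G \<longleftrightarrow> (\<forall>i\<in>VX. (X i)\<^sup>2 \<le> t) \<and> holds (mix m X Y) \<Phi>" for X Y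
   by (auto simp: G_def holds_foldr_Conj xs power2_eq_square)
  then show ?thesis unfolding game_def by auto
 qed
 \<comment> \<open>Large enough both to exceed the threshold and to bound all squares of
   \<open>X0\<close>.\<close>
 define t0 where "t0 = 2 ^ (2 ^ (32 * l ^ 3)) + (\<Sum>i\<in>VX. (X0 i)\<^sup>2)"
 have "game \<tau> VX G t0"
  unfolding game
 proof (intro exI[of _ X0] conjI ballI allI X0)
  fix i assume "i \<in> VX"
  then have "(X0 i)\<^sup>2 \<le> (\<Sum>i\<in>VX. (X0 i)\<^sup>2)" using fin by (intro member_le_sum) auto
  then show "(X0 i)\<^sup>2 \<le> t0" by (simp add: t0_def add_increasing)
 qed
 moreover have "game \<tau> VX G R" if "game \<tau> VX G t0"
 proof (rule game_constant_large[OF fin _ _ _ _ l(1) _ _ _ _ _ _ _ R that])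
  show "VX \<inter> VY = {}" "\<tau> \<notin> VX \<union> VY" "vars_qff G \<subseteq> insert \<tau> (VX \<union> VY)" "qff_le G"
   using \<tau> le by (auto simp: VX_def VY_def G_def qff_le_foldr vars_qff_foldr xs V_def)
  show "card VX \<le> l" "card VY \<le> l"
   using l(2) card_mono[of V VX] card_mono[of V VY] V by (auto simp: VX_def VY_def V_def)
  show "fdeg G \<le> 15 * l"
   using l(3) xs(2) by (simp add: G_def fdeg_foldr o_def sum_list_const)
  have "fnorm G = 3 ^ length xs * fnorm \<Phi>"
   by (simp add: G_def fnorm_foldr o_def prod_list_const numeral_3_eq_3)
  also have "\<dots> \<le> 4 ^ length xs * 2 ^ l" using l(4) by (intro mult_le_mono power_mono) auto
  also have "\<dots> \<le> 4 ^ l * 2 ^ l" using xs(2) by (intro mult_le_mono power_increasing) auto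
  also have "\<dots> = 2 ^ (3 * l)" by (simp add: power_mult power_mult_distrib[symmetric])
  also have "\<dots> \<le> 2 ^ (7 * l)" by (intro power_increasing) auto
  finally show "fnorm G \<le> 2 ^ (7 * l)" .
  show "7 * l * 2 ^ (20 * l ^ 3) \<le> 2 ^ (32 * l ^ 3)" by (rule exponent_absorb[OF l(1)])
  show "1 \<le> 7 * l" using l(1) by simp
  show "2 ^ (2 ^ (32 * l ^ 3)) \<le> t0" by (simp add: t0_def sum_nonneg)
 qed
 ultimately obtain X where "\<forall>i\<in>VX. (X i)\<^sup>2 \<le> R" "\<forall>Y. holds (mix m X Y) \<Phi>" unfolding game by auto
 then show thesis using that[of X] by (auto simp: VX_def V_def)
qed

text \<open>The disjuncts \<open>\<tau> \<le> (Y i) ^ 2\<close> excuse \<open>X\<close> from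
  answering large \<open>Y\<close>. Truth at \<open>\<tau> = t\<close> passes to all larger values,
  and winning \<open>X\<close> against growing boxes converge because a constant bounds them. That
  constant is itself doubly exponential and enters the norm of the formula, so a larger exponent
  than for \<open>X\<close> is used.\<close>

lemma truth_from_bounded_Y:
 assumes le: "qff_le \<Phi>" and l: "l \<ge> 7" "card (vars_qff \<Phi>) \<le> l" "fdeg \<Phi> \<le> l" "fnorm \<Phi> \<le> 2 ^ l"
  and t: "t \<ge> 2 ^ (2 ^ (96 * l ^ 3))"
  and X: "!!i. i \<in> vars_qff \<Phi> ==> i < m ==> (X i)\<^sup>2 \<le> 2 ^ (2 ^ (32 * l ^ 3))"
  and XY: "!!Y. (!!i. i \<in> vars_qff \<Phi> ==> i \<ge> m ==> (Y i)\<^sup>2 < t) ==> holds (mix m X Y) \<Phi>"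
 shows "\<exists>X. \<forall>Y. holds (mix m X Y) \<Phi>"
proof -
 define V where "V = vars_qff \<Phi>"
 have V: "finite V" unfolding V_def by (rule finite_vars_qff)
 define VX where "VX = V \<inter> {..<m}"
 define VY where "VY = V \<inter> {m..}"
 obtain \<tau> where \<tau>: "\<tau> \<ge> m" "!!i. i \<in> V ==> i < \<tau>" using fresh_above[OF V, of m] by auto
 define xs where "xs = sorted_list_of_set VX"
 define ys where "ys = sorted_list_of_set VY"
 have fin: "finite VX" "finite VY" using V by (auto simp: VX_def VY_def)
 have cards: "card VX \<le> l" "card VY \<le> l"
  using l(2) card_mono[of V VX] card_mono[of V VY] V by (auto simp: VX_def VY_def V_def)
 have xs: "set xs = VX" "length xs \<le> l" and ys: "set ys = VY" "length ys \<le> l"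
  using fin cards by (auto simp: xs_def ys_def)
 define b where "b = 32 * l ^ 3"
 define R where "R = (2::nat) ^ (2 ^ b)"
 define G where "G = foldr Conj (map (\<lambda>i. Le (Mul (Var i) (Var i)) (Const (int R))) xs)
   (foldr Disj (map (\<lambda>i. Le (Var \<tau>) (Mul (Var i) (Var i))) ys) \<Phi>)"
 have game: "game \<tau> VX G s \<longleftrightarrow> (\<exists>X. \<forall>Y. (\<forall>i\<in>VX. (X i)\<^sup>2 \<le> real R) \<and>
   ((\<exists>i\<in>VY. s \<le> (Y i)\<^sup>2) \<or> holds (mix m X Y) \<Phi>))" for s
 proof -
  let ?e = "\<lambda>X Y i. if i = \<tau> then s else if i \<in> VX then X i else Y i :: real"
  have "holds (?e X Y) \<Phi> = holds (mix m X Y) \<Phi>" for X Y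
   by (rule holds_cong) (use \<tau> in \<open>auto simp: mix_def VX_def V_def\<close>)
  moreover have "?e X Y i = X i" if "i \<in> VX" for X Y i using that \<tau> by (auto simp: VX_def)
  moreover have "?e X Y i = Y i" if "i \<in> VY" for X Y i using that \<tau> by (auto simp: VX_def VY_def)
  ultimately have "holds (?e X Y) G \<longleftrightarrow> (\<forall>i\<in>VX. (X i)\<^sup>2 \<le> real R) \<and>
   ((\<exists>i\<in>VY. s \<le> (Y i)\<^sup>2) \<or> holds (mix m X Y) \<Phi>)" for X Y
   by (auto simp: G_def holds_foldr_Conj holds_foldr_Disj xs ys power2_eq_square)
  then show ?thesis unfolding game_def by auto
 qed
 have "game \<tau> VX G t"
  unfolding game
 proof (intro exI[of _ X] conjI ballI allI)
  fix Y
  show "(X i)\<^sup>2 \<le> real R" if "i \<in> VX" for i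
   using X[of i] that by (auto simp: VX_def V_def R_def b_def)
  show "(\<exists>i\<in>VY. t \<le> (Y i)\<^sup>2) \<or> holds (mix m X Y) \<Phi>"
  proof (rule disjCI)
   assume "\<not> holds (mix m X Y) \<Phi>"
   then obtain i where "i \<in> vars_qff \<Phi>" "i \<ge> m" "\<not> (Y i)\<^sup>2 < t" using XY[of Y] by auto
   then show "\<exists>i\<in>VY. t \<le> (Y i)\<^sup>2" by (intro bexI[of _ i]) (auto simp: VY_def V_def)
  qed
 qed
 moreover have "game \<tau> VX G u" if "game \<tau> VX G t" "u \<ge> 2 ^ (2 ^ (96 * l ^ 3))" for u
 proof (rule game_constant_large[OF fin _ _ _ _ l(1) cards _ _ _ _ t that(2,1)])
  show "VX \<inter> VY = {}" "\<tau> \<notin> VX \<union> VY" "vars_qff G \<subseteq> insert \<tau> (VX \<union> VY)" "qff_le G"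
   using \<tau> le by (auto simp: VX_def VY_def G_def qff_le_foldr vars_qff_foldr xs ys V_def)
  show "fdeg G \<le> 15 * l"
   using l(3) xs(2) ys(2) by (simp add: G_def fdeg_foldr o_def sum_list_const)
  have "fnorm G = (R + 2) ^ length xs * (3 ^ length ys * fnorm \<Phi>)"
   by (simp add: G_def fnorm_foldr o_def prod_list_const numeral_3_eq_3)
  also have "\<dots> \<le> (R + 2) ^ l * (4 ^ l * 2 ^ l)"
  proof (intro mult_le_mono)
   show "(R + 2) ^ length xs \<le> (R + 2) ^ l" using xs(2) by (intro power_increasing) auto
   have "(3::nat) ^ length ys \<le> 4 ^ length ys" by (intro power_mono) auto
   also have "\<dots> \<le> 4 ^ l" using ys(2) by (intro power_increasing) auto
   finally show "(3::nat) ^ length ys \<le> 4 ^ l" .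
  qed (rule l(4))
  also have "\<dots> \<le> (2 ^ (2 ^ b + 1)) ^ l * (4 ^ l * 2 ^ l)"
  proof -
   have "(2::nat) \<le> 2 ^ (2 ^ b)" using self_le_power[of "2::nat" "2 ^ b"] by simp
   moreover have "(2::nat) ^ (2 ^ b + 1) = 2 * 2 ^ (2 ^ b)" by simp
   ultimately have "R + 2 \<le> 2 ^ (2 ^ b + 1)" unfolding R_def by linarith
   then show ?thesis by (intro mult_le_mono1 power_mono) simp_all
  qed
  also have "\<dots> = 2 ^ ((2 ^ b + 1) * l + 2 * l + l)"
  proof -
   have "(4::nat) ^ l = 2 ^ (2 * l)" by (simp add: power_mult)
   then show ?thesis by (simp only: power_add[of _ "(2 ^ b + 1) * l + 2 * l" l]
     power_add[of _ "(2 ^ b + 1) * l" "2 * l"] power_mult[of _ "2 ^ b + 1" l] mult.assoc)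
  qed
  finally show "fnorm G \<le> 2 ^ ((2 ^ b + 1) * l + 2 * l + l)" .
  show "1 \<le> (2 ^ b + 1) * l + 2 * l + l" using l(1) by simp
  have "(2 ^ b + 1) * l + 2 * l + l = (2 ^ b + 4) * l" by (simp add: algebra_simps)
  also have "\<dots> \<le> 2 ^ (b + 3) * 2 ^ l"
  proof (intro mult_le_mono)
   have "1 \<le> (2::nat) ^ b" by simp
   moreover have "(2::nat) ^ (b + 3) = 8 * 2 ^ b" by (simp add: power_add)
   ultimately show "2 ^ b + 4 \<le> (2::nat) ^ (b + 3)" by linarith
   show "l \<le> 2 ^ l" using less_exp[of l] by simp
  qed
  finally have "((2 ^ b + 1) * l + 2 * l + l) * 2 ^ (20 * l ^ 3) \<le> 2 ^ (b + 3) * 2 ^ l * 2 ^ (20 * l ^ 3)"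
   by (rule mult_le_mono1)
  also have "\<dots> = 2 ^ (b + 3 + l + 20 * l ^ 3)" by (simp only: power_add)
  also have "\<dots> \<le> 2 ^ (96 * l ^ 3)"
   using cube_absorb[OF l(1)] by (intro power_increasing) (auto simp: b_def)
  finally show "((2 ^ b + 1) * l + 2 * l + l) * 2 ^ (20 * l ^ 3) \<le> 2 ^ (96 * l ^ 3)" .
 qed
 ultimately have all: "game \<tau> VX G u" if "u \<ge> 2 ^ (2 ^ (96 * l ^ 3))" for u using that by blast
 have "\<exists>X. (\<forall>i\<in>VX. (X i)\<^sup>2 \<le> real R) \<and> (\<forall>Y. (\<exists>i\<in>VY. real n \<le> (Y i)\<^sup>2) \<or> holds (mix m X Y) \<Phi>)" for n :: nat
 proof -
  have "game \<tau> VX G (max (2 ^ (2 ^ (96 * l ^ 3))) (real n))" by (rule all) simp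
  then obtain X where "!!Y. (\<forall>i\<in>VX. (X i)\<^sup>2 \<le> real R) \<and>
   ((\<exists>i\<in>VY. max (2 ^ (2 ^ (96 * l ^ 3))) (real n) \<le> (Y i)\<^sup>2) \<or> holds (mix m X Y) \<Phi>)" unfolding game by auto
  then show ?thesis by (intro exI[of _ X]) (auto; fastforce)
 qed
 then obtain Z where Z: "!!n i. i \<in> VX ==> (Z n i)\<^sup>2 \<le> real R"
  "!!n Y. (\<exists>i\<in>VY. real n \<le> (Y i)\<^sup>2) \<or> holds (mix m (Z n) Y) \<Phi>" by metis
 define W where "W n = (\<lambda>i. if i \<in> VX then Z n i else 0)" for n :: nat
 have b: "\<bar>W n i\<bar> \<le> 1 + real R" for n i
 proof (cases "i \<in> VX")
  case True
  then show ?thesis using sum_squares_coordinate[of "{i}" i "Z n" "real R"] Z(1)[of i n] by (simp add: W_def)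
 qed (simp add: W_def)
 have ev: "\<forall>\<^sub>F n in sequentially. gval (mix m (W n) Y) \<Phi> \<le> inverse (real (Suc n))" if True for Y
 proof -
  obtain N where N: "(\<Sum>i\<in>VY. (Y i)\<^sup>2) < real N" using reals_Archimedean2 by blast
  have "gval (mix m (W n) Y) \<Phi> \<le> inverse (real (Suc n))" if "n \<ge> N" for n
  proof -
   have "(\<Sum>i\<in>VY. (Y i)\<^sup>2) < real n" using N that by linarith
   then have "(Y i)\<^sup>2 < real n" if "i \<in> VY" for i
    using member_le_sum[of i VY "\<lambda>i. (Y i)\<^sup>2"] that fin by fastforce
   then have "holds (mix m (Z n) Y) \<Phi>" using Z(2)[of n Y] by force
   moreover have "gval (mix m (Z n) Y) \<Phi> = gval (mix m (W n) Y) \<Phi>"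
    by (rule gval_cong) (auto simp: mix_def W_def VX_def V_def)
   ultimately have "gval (mix m (W n) Y) \<Phi> \<le> 0" using holds_iff_gval[OF le] by simp
   also have "0 \<le> inverse (real (Suc n))" by simp
   finally show ?thesis .
  qed
  then show ?thesis unfolding eventually_sequentially by blast
 qed
 from strategy_limit[where e = "mix m" and Z = W and P = "\<lambda>_. True", OF le continuous_mix(1) b ev]
 obtain L where "\<forall>Y. holds (mix m L Y) \<Phi>" by auto
 then show ?thesis by blast
qed

text \<open>By compactness, a strict violation of \<open>\<bar>Y i\<bar> \<le> 1\<close> or of \<open>\<Psi>\<close> can be demanded with a margin \<open>- 1 / z\<close>,
 and \<open>\<Phi>\<close> may be replaced by \<open>\<Phi>\<close> up to an error \<open>1 / t\<close> if \<open>t\<close> is large enough. This expresses the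
 implication \<open>\<Psi> --> \<Phi>\<close> without strict inequalities.\<close>
definition relaxed :: "nat => nat set => qff => qff => real => real => (nat => real) => bool" where
 "relaxed m V \<Psi> \<Phi> t z X \<longleftrightarrow> z \<le> 0 \<and> (\<forall>i\<in>V. i < m --> (X i)\<^sup>2 \<le> 1) \<and>
   (\<forall>Y. (\<exists>i\<in>V. m \<le> i \<and> z * (Y i)\<^sup>2 \<le> z - 1) \<or> 1 \<le> - z * gval (mix m X Y) \<Psi> \<or> t * gval (mix m X Y) \<Phi> \<le> 1)"

text \<open>If no margin worked, there would be counterexamples \<open>Y\<close> whose violations of
  the box and of \<open>\<Psi>\<close> tend to 0. Their limit lies in the box and satisfies
  \<open>\<Psi>\<close>, yet has \<open>t * gval\<close> of \<open>\<Phi>\<close> at least 1,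
  against the assumption on \<open>X\<close>.\<close>

lemma relaxed_of_bounded:
 assumes le: "qff_le \<Psi>" "qff_le \<Phi>" and V: "finite V" "vars_qff \<Psi> \<union> vars_qff \<Phi> \<subseteq> V" and t: "t > 0"
  and X: "!!i. i \<in> V ==> i < m ==> \<bar>X i\<bar> \<le> 1"
  and XY: "!!Y. (!!i. i \<in> V ==> m \<le> i ==> \<bar>Y i\<bar> \<le> 1) ==> holds (mix m X Y) \<Psi> ==> holds (mix m X Y) \<Phi>"
 shows "\<exists>z. relaxed m V \<Psi> \<Phi> t z X"
proof (rule ccontr)
 assume no: "\<nexists>z. relaxed m V \<Psi> \<Phi> t z X"
 have Xsq: "(X i)\<^sup>2 \<le> 1" if "i \<in> V" "i < m" for i
  using X[OF that] by (simp add: abs_square_le_1)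
 have "\<exists>Y. (\<forall>i\<in>V. m \<le> i --> (Y i)\<^sup>2 < 1 + inverse (real (Suc n))) \<and>
   gval (mix m X Y) \<Psi> < inverse (real (Suc n)) \<and> 1 < t * gval (mix m X Y) \<Phi>" for n
 proof -
  \<comment> \<open>For \<open>z = - c\<close> with \<open>c > 0\<close> the clause
    \<open>z * (Y i) ^ 2 \<le> z - 1\<close> says that \<open>(Y i) ^ 2\<close> is at least
    \<open>1 + 1 / c\<close>.\<close>
  let ?z = "- real (Suc n)"
  from no have "\<not> relaxed m V \<Psi> \<Phi> t ?z X" by blast
  then obtain Y where Y: "!!i. i \<in> V ==> m \<le> i ==> \<not> ?z * (Y i)\<^sup>2 \<le> ?z - 1"
   "\<not> 1 \<le> - ?z * gval (mix m X Y) \<Psi>" "\<not> t * gval (mix m X Y) \<Phi> \<le> 1"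
   using Xsq unfolding relaxed_def by auto
  have pos: "real (Suc n) > 0" by simp
  have "(Y i)\<^sup>2 < 1 + inverse (real (Suc n))" if "i \<in> V" "m \<le> i" for i
  proof -
   have "real (Suc n) * (Y i)\<^sup>2 < real (Suc n) + 1" using Y(1)[OF that] by linarith
   then have "(Y i)\<^sup>2 < (real (Suc n) + 1) / real (Suc n)"
    using pos by (simp only: pos_less_divide_eq mult.commute)
   also have "\<dots> = 1 + inverse (real (Suc n))" using pos by (simp add: add_divide_distrib inverse_eq_divide del: of_nat_Suc)
   finally show ?thesis .
  qed
  moreover have "gval (mix m X Y) \<Psi> < inverse (real (Suc n))"
  proof -
   have "real (Suc n) * gval (mix m X Y) \<Psi> < 1" using Y(2) by linarith
   then have "gval (mix m X Y) \<Psi> < 1 / real (Suc n)"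
    using pos by (simp only: pos_less_divide_eq mult.commute)
   then show ?thesis by (simp only: inverse_eq_divide)
  qed
  ultimately show ?thesis using Y(3) by (intro exI[of _ Y]) auto
 qed
 then obtain Y0 where Y0: "!!n i. i \<in> V ==> m \<le> i ==> (Y0 n i)\<^sup>2 < 1 + inverse (real (Suc n))"
   "!!n. gval (mix m X (Y0 n)) \<Psi> < inverse (real (Suc n))" "!!n. 1 < t * gval (mix m X (Y0 n)) \<Phi>"
  by metis
 define Y where "Y n = (\<lambda>i. if i \<in> V \<and> m \<le> i then Y0 n i else 0)" for n
 have "\<bar>Y n i\<bar> \<le> 3" for n i
 proof (cases "i \<in> V \<and> m \<le> i")
  case True
  have "inverse (real (Suc n)) \<le> 1" by (simp add: inverse_le_1_iff)
  then have "(Y0 n i)\<^sup>2 \<le> 2" using Y0(1)[of i n] True by auto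
  then show ?thesis using sum_squares_coordinate[of "{i}" i "Y0 n" 2] True by (simp add: Y_def)
 qed (auto simp: Y_def)
 then obtain L f where f: "strict_mono f" and L: "(Y \<circ> f) \<longlonglongrightarrow> L"
  by (rule bounded_subsequence[where b="\<lambda>_. 3"])
 have gv: "gval (mix m X (Y n)) \<Psi> = gval (mix m X (Y0 n)) \<Psi>" "gval (mix m X (Y n)) \<Phi> = gval (mix m X (Y0 n)) \<Phi>" for n
  by (rule gval_cong; use V in \<open>auto simp: mix_def Y_def\<close>)+
 from continuous_on_tendsto_compose[OF continuous_mix(2) L]
 have mixL: "(\<lambda>n. mix m X ((Y \<circ> f) n)) \<longlonglongrightarrow> mix m X L" by simp
 have gL: "(\<lambda>n. gval (mix m X ((Y \<circ> f) n)) F) \<longlonglongrightarrow> gval (mix m X L) F" for F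
  using continuous_on_tendsto_compose[OF continuous_gval mixL] by simp
 have inv: "(\<lambda>n. inverse (real (Suc (f n)))) \<longlonglongrightarrow> 0"
  using LIMSEQ_subseq_LIMSEQ[OF LIMSEQ_inverse_real_of_nat f] by (simp add: o_def)
 have Lb: "\<bar>L i\<bar> \<le> 1" if "i \<in> V" "m \<le> i" for i
 proof -
  have "(\<lambda>n. ((Y \<circ> f) n i)\<^sup>2) \<longlonglongrightarrow> (L i)\<^sup>2" by (intro tendsto_power tendsto_coordinate[OF L])
  moreover have "(\<lambda>n. 1 + inverse (real (Suc (f n)))) \<longlonglongrightarrow> 1 + 0" by (intro tendsto_add tendsto_const inv)
  moreover have "((Y \<circ> f) n i)\<^sup>2 \<le> 1 + inverse (real (Suc (f n)))" for n
   using Y0(1)[OF that, of "f n"] that by (simp add: Y_def)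
  ultimately have "(L i)\<^sup>2 \<le> 1 + 0" by (intro LIMSEQ_le) auto
  then show ?thesis by (simp add: abs_square_le_1)
 qed
 have "gval (mix m X L) \<Psi> \<le> 0"
  by (rule LIMSEQ_le[OF gL inv]) (use Y0(2) gv in \<open>auto intro: less_imp_le\<close>)
 then have "holds (mix m X L) \<Psi>" using holds_iff_gval[OF le(1)] by simp
 with XY[of L] Lb have "holds (mix m X L) \<Phi>" by blast
 then have "gval (mix m X L) \<Phi> \<le> 0" using holds_iff_gval[OF le(2)] by simp
 then have "t * gval (mix m X L) \<Phi> \<le> 0" using t by (simp add: mult_le_0_iff)
 moreover have "1 \<le> t * gval (mix m X L) \<Phi>"
  by (rule LIMSEQ_le_const[OF tendsto_mult_left[OF gL]]) (use Y0(3) gv in \<open>auto intro: less_imp_le\<close>)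
 ultimately show False by simp
qed

text \<open>For \<open>Y\<close> in the box with \<open>\<Psi>\<close>, neither escape clause can
  hold when \<open>z \<le> 0\<close>, so \<open>X\<close> wins up to \<open>1 / t\<close>; a limit
  of such \<open>X\<close> wins exactly. As \<open>\<Psi>\<close> has only universal variables, the
  admissible \<open>Y\<close> are the same along the sequence.\<close>

lemma bounded_of_relaxed:
 assumes le: "qff_le \<Psi>" "qff_le \<Phi>" and V: "finite V" "vars_qff \<Psi> \<union> vars_qff \<Phi> \<subseteq> V" and Psi: "vars_qff \<Psi> \<subseteq> {m..}"
  and all: "!!n::nat. \<exists>t z X. t \<ge> real n \<and> relaxed m V \<Psi> \<Phi> t z X"
 shows "\<exists>X. (\<forall>i\<in>V. i < m --> \<bar>X i\<bar> \<le> 1) \<and>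
  (\<forall>Y. (\<forall>i\<in>V. m \<le> i --> \<bar>Y i\<bar> \<le> 1) --> holds (mix m X Y) \<Psi> --> holds (mix m X Y) \<Phi>)"
proof -
 have "\<exists>X. (\<forall>i\<in>V. i < m --> \<bar>X i\<bar> \<le> 1) \<and> (\<forall>Y. (\<forall>i\<in>V. m \<le> i --> \<bar>Y i\<bar> \<le> 1) -->
   holds (mix m X Y) \<Psi> --> gval (mix m X Y) \<Phi> \<le> inverse (real (Suc n)))" for n
 proof -
  obtain t z X where t: "t \<ge> real (Suc n)" and r: "relaxed m V \<Psi> \<Phi> t z X" using all[of "Suc n"] by blast
  have z: "z \<le> 0" using r by (simp add: relaxed_def)
  show ?thesis
  proof (intro exI[of _ X] conjI allI impI ballI)
   show "\<bar>X i\<bar> \<le> 1" if "i \<in> V" "i < m" for i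
    using r that by (auto simp: relaxed_def abs_square_le_1)
   fix Y assume Y: "\<forall>i\<in>V. m \<le> i --> \<bar>Y i\<bar> \<le> 1" and h: "holds (mix m X Y) \<Psi>"
   have "\<not> z * (Y i)\<^sup>2 \<le> z - 1" if "i \<in> V" "m \<le> i" for i
   proof -
    have "(Y i)\<^sup>2 \<le> 1" using Y that by (simp add: abs_square_le_1)
    then have "z * 1 \<le> z * (Y i)\<^sup>2" using z by (intro mult_left_mono_neg) auto
    then show ?thesis by simp
   qed
   moreover have "\<not> 1 \<le> - z * gval (mix m X Y) \<Psi>"
   proof -
    have "gval (mix m X Y) \<Psi> \<le> 0" using h holds_iff_gval[OF le(1)] by simp
    then have "- z * gval (mix m X Y) \<Psi> \<le> 0" using z by (simp add: zero_le_mult_iff)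
    then show ?thesis by linarith
   qed
   ultimately have 1: "t * gval (mix m X Y) \<Phi> \<le> 1" using r unfolding relaxed_def by blast
   have t0: "t > 0" using t by (simp add: less_le_trans[OF _ t] del: of_nat_Suc)
   have "gval (mix m X Y) \<Phi> \<le> 1 / t" using 1 t0 by (simp add: pos_le_divide_eq mult.commute)
   also have "\<dots> \<le> inverse (real (Suc n))"
    using t t0 unfolding inverse_eq_divide by (intro divide_left_mono) (auto simp del: of_nat_Suc)
   finally show "gval (mix m X Y) \<Phi> \<le> inverse (real (Suc n))" .
  qed
 qed
 then obtain X0 where X0: "!!n i. i \<in> V ==> i < m ==> \<bar>X0 n i\<bar> \<le> 1"
  "!!n Y. \<forall>i\<in>V. m \<le> i --> \<bar>Y i\<bar> \<le> 1 ==> holds (mix m (X0 n) Y) \<Psi> ==> gval (mix m (X0 n) Y) \<Phi> \<le> inverse (real (Suc n))"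
  by metis
 define X where "X n = (\<lambda>i. if i \<in> V \<and> i < m then X0 n i else 0)" for n
 have hPsi: "holds (mix m Z Y) \<Psi> = holds (mix m Z' Y) \<Psi>" for Z Z' Y
  by (rule holds_cong) (use Psi in \<open>auto simp: mix_def\<close>)
 have b: "\<bar>X n i\<bar> \<le> 1" for n i using X0(1) by (simp add: X_def)
 let ?P = "\<lambda>Y. (\<forall>i\<in>V. m \<le> i --> \<bar>Y i\<bar> \<le> 1) \<and> holds (mix m (\<lambda>_. 0) Y) \<Psi>"
 have ev: "\<forall>\<^sub>F n in sequentially. gval (mix m (X n) Y) \<Phi> \<le> inverse (real (Suc n))"
  if Y: "?P Y" for Y
 proof (intro always_eventually allI)
  fix n
  have "gval (mix m (X n) Y) \<Phi> = gval (mix m (X0 n) Y) \<Phi>"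
   by (rule gval_cong) (use V in \<open>auto simp: mix_def X_def\<close>)
  moreover have "holds (mix m (X0 n) Y) \<Psi>" using Y hPsi by blast
  ultimately show "gval (mix m (X n) Y) \<Phi> \<le> inverse (real (Suc n))" using X0(2) Y by simp
 qed
 have "\<exists>L. (\<forall>i. \<bar>L i\<bar> \<le> 1) \<and> (\<forall>Y. ?P Y --> holds (mix m L Y) \<Phi>)"
  by (rule strategy_limit[OF le(2) continuous_mix(1) b ev])
 then obtain L
  where L: "\<forall>i. \<bar>L i\<bar> \<le> 1" "\<forall>Y. ?P Y --> holds (mix m L Y) \<Phi>"
  by (elim exE conjE)
 show ?thesis
 proof (intro exI[of _ L] conjI allI impI ballI)
  show "\<bar>L i\<bar> \<le> 1" for i using L(1) by simp
  fix Y assume "\<forall>i\<in>V. m \<le> i --> \<bar>Y i\<bar> \<le> 1" "holds (mix m L Y) \<Psi>"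
  then show "holds (mix m L Y) \<Phi>" using L(2)[rule_format, of Y] hPsi by blast
 qed
qed

text \<open>The margin \<open>z\<close> becomes one more existential variable, so
  \<open>relaxed\<close> is a game with parameter \<open>t\<close>. Constancy above the threshold
  turns truth at one \<open>t\<close> into truth at arbitrarily large ones, as the passage to the
  limit demands.\<close>

lemma bounded_iff_relaxed:
 assumes le: "qff_le \<Psi>" "qff_le \<Phi>" and Psi: "vars_qff \<Psi> \<subseteq> {m..}"
  and l: "l \<ge> 7" "card (vars_qff \<Psi> \<union> vars_qff \<Phi>) + 1 \<le> l" "fdeg \<Psi> + fdeg \<Phi> \<le> l" "fnorm \<Psi> * fnorm \<Phi> \<le> 2 ^ l"
  and t: "t \<ge> 2 ^ (2 ^ (32 * l ^ 3))"
 defines "V \<equiv> vars_qff \<Psi> \<union> vars_qff \<Phi>"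
 shows "(\<exists>X. (\<forall>i\<in>V. i < m --> \<bar>X i\<bar> \<le> 1) \<and>
  (\<forall>Y. (\<forall>i\<in>V. m \<le> i --> \<bar>Y i\<bar> \<le> 1) --> holds (mix m X Y) \<Psi> --> holds (mix m X Y) \<Phi>)) \<longleftrightarrow>
  (\<exists>z X. relaxed m V \<Psi> \<Phi> t z X)"
proof
 have V: "finite V" unfolding V_def by (simp add: finite_vars_qff)
 have t0: "t > 0" using t by (rule less_le_trans[rotated]) simp
 {
  assume "\<exists>X. (\<forall>i\<in>V. i < m --> \<bar>X i\<bar> \<le> 1) \<and>
   (\<forall>Y. (\<forall>i\<in>V. m \<le> i --> \<bar>Y i\<bar> \<le> 1) --> holds (mix m X Y) \<Psi> --> holds (mix m X Y) \<Phi>)"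
  then obtain X where X: "\<forall>i\<in>V. i < m --> \<bar>X i\<bar> \<le> 1"
   "\<forall>Y. (\<forall>i\<in>V. m \<le> i --> \<bar>Y i\<bar> \<le> 1) --> holds (mix m X Y) \<Psi> --> holds (mix m X Y) \<Phi>" by blast
  have "\<exists>z. relaxed m V \<Psi> \<Phi> t z X"
   by (rule relaxed_of_bounded[OF le V _ t0]) (use X in \<open>auto simp: V_def\<close>)
  then show "\<exists>z X. relaxed m V \<Psi> \<Phi> t z X" by blast
 next
  assume rel: "\<exists>z X. relaxed m V \<Psi> \<Phi> t z X"
  define VX where "VX = V \<inter> {..<m}"
  define VY where "VY = V \<inter> {m..}"
  obtain z where z: "z \<ge> m" "!!i. i \<in> V ==> i < z" using fresh_above[OF V, of m] by auto
  define \<tau> where "\<tau> = Suc z"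
  have \<tau>: "\<tau> \<noteq> z" "\<tau> \<ge> m" "!!i. i \<in> V ==> i < \<tau>" using z(1) by (auto simp: \<tau>_def dest!: z(2))
  define xs where "xs = sorted_list_of_set VX"
  define ys where "ys = sorted_list_of_set VY"
  have fin: "finite (insert z VX)" "finite VX" "finite VY" using V by (auto simp: VX_def VY_def)
  have cards: "card VX + 1 \<le> l" "card VY \<le> l"
   using l(2) card_mono[of V VX] card_mono[of V VY] V by (auto simp: VX_def VY_def V_def)
  have zVX: "z \<notin> VX" using z by (auto simp: VX_def)
  have xs: "set xs = VX" "length xs \<le> l" and ys: "set ys = VY" "length ys \<le> l"
   using fin cards by (auto simp: xs_def ys_def)
  define G where "G = foldr Conj (map (\<lambda>i. Le (Mul (Var i) (Var i)) (Const 1)) xs) (Conj (Le (Var z) (Const 0))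
    (foldr Disj (map (\<lambda>i. Le (Mul (Var z) (Mul (Var i) (Var i))) (Add (Const (-1)) (Var z))) ys)
     (Disj (scl True (Var z) (-1) \<Psi>) (scl False (Var \<tau>) 1 \<Phi>))))"
  have game: "game \<tau> (insert z VX) G s \<longleftrightarrow> (\<exists>c X. relaxed m V \<Psi> \<Phi> s c X)" if s: "s \<ge> 0" for s
  proof -
   let ?e = "\<lambda>X Y i. if i = \<tau> then s else if i \<in> insert z VX then X i else Y i :: real"
   have gv: "gval (?e X Y) \<Psi> = gval (mix m X Y) \<Psi>" "gval (?e X Y) \<Phi> = gval (mix m X Y) \<Phi>" for X Y
    by (rule gval_cong; use \<tau> z in \<open>auto simp: mix_def VX_def V_def\<close>)+
   have eX: "?e X Y i = X i" if "i \<in> insert z VX" for X Y i using that \<tau> by (auto simp: VX_def)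
   have eY: "?e X Y i = Y i" if "i \<in> VY" for X Y i using that \<tau> z by (auto simp: VX_def VY_def)
   have et: "?e X Y \<tau> = s" for X Y by simp
   have "holds (?e X Y) G \<longleftrightarrow> (\<forall>i\<in>VX. (X i)\<^sup>2 \<le> 1) \<and> X z \<le> 0 \<and>
     ((\<exists>i\<in>VY. X z * (Y i)\<^sup>2 \<le> X z - 1) \<or> 1 \<le> - X z * gval (mix m X Y) \<Psi> \<or> s * gval (mix m X Y) \<Phi> \<le> 1)" for X Y
   proof (cases "X z \<le> 0")
    case True
    have ez: "eval_trm (?e X Y) (Var z) = X z" using \<tau>(1) by simp
    have 1: "holds (?e X Y) (scl True (Var z) (-1) \<Psi>) \<longleftrightarrow> 1 \<le> - X z * gval (mix m X Y) \<Psi>"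
     using holds_scl_dual[OF le(1), of "?e X Y" "Var z"] True unfolding ez gv by simp
    have et': "eval_trm (?e X Y) (Var \<tau>) = s" by simp
    have 2: "holds (?e X Y) (scl False (Var \<tau>) 1 \<Phi>) \<longleftrightarrow> s * gval (mix m X Y) \<Phi> \<le> 1"
     using holds_scl_relax[OF le(2), of "?e X Y" "Var \<tau>"] s unfolding et' gv by simp
    have 3: "(\<forall>g\<in>set (map (\<lambda>i. Le (Mul (Var i) (Var i)) (Const 1)) xs). holds (?e X Y) g) \<longleftrightarrow> (\<forall>i\<in>VX. (X i)\<^sup>2 \<le> 1)"
     using \<tau> by (auto simp: xs power2_eq_square VX_def)
    have 4: "(\<exists>g\<in>set (map (\<lambda>i. Le (Mul (Var z) (Mul (Var i) (Var i))) (Add (Const (-1)) (Var z))) ys). holds (?e X Y) g)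
      \<longleftrightarrow> (\<exists>i\<in>VY. X z * (Y i)\<^sup>2 \<le> X z - 1)"
    proof -
     have "holds (?e X Y) (Le (Mul (Var z) (Mul (Var i) (Var i))) (Add (Const (-1)) (Var z))) \<longleftrightarrow> X z * (Y i)\<^sup>2 \<le> X z - 1"
      if "i \<in> VY" for i using eY[OF that, of X Y] \<tau>(1) by (simp add: power2_eq_square)
     then show ?thesis by (simp only: set_map ys bex_simps) (rule bex_cong; simp)
    qed
    show ?thesis unfolding G_def holds_foldr_Conj holds_foldr_Disj holds.simps(3,4) 1 2 3 4
     using True \<tau>(1) by simp
   next
    case False
    then show ?thesis using \<tau>(1) by (auto simp: G_def holds_foldr_Conj)
   qed
   then have "(\<forall>Y. holds (?e X Y) G) \<longleftrightarrow> relaxed m V \<Psi> \<Phi> s (X z) X" for X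
    unfolding relaxed_def VX_def VY_def by auto
   then have "game \<tau> (insert z VX) G s \<longleftrightarrow> (\<exists>X. relaxed m V \<Psi> \<Phi> s (X z) X)"
    unfolding game_def by simp
   also have "\<dots> \<longleftrightarrow> (\<exists>c X. relaxed m V \<Psi> \<Phi> s c X)"
   proof
    assume "\<exists>c X. relaxed m V \<Psi> \<Phi> s c X"
    then obtain c X where r: "relaxed m V \<Psi> \<Phi> s c X" by blast
    have "mix m (X(z := c)) Y = mix m X Y" for Y using z(1) by (auto simp: mix_def)
    then have "relaxed m V \<Psi> \<Phi> s c (X(z := c))" using r z(1) by (auto simp: relaxed_def)
    then show "\<exists>X. relaxed m V \<Psi> \<Phi> s (X z) X" by (intro exI[of _ "X(z := c)"]) simp
   qed blast
   finally show ?thesis .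
  qed
  have const: "game \<tau> (insert z VX) G u" if "game \<tau> (insert z VX) G t" "u \<ge> 2 ^ (2 ^ (32 * l ^ 3))" for u
  proof (rule game_constant_large[OF fin(1,3) _ _ _ _ l(1) _ cards(2) _ _ _ _ t that(2,1)])
   show "insert z VX \<inter> VY = {}" "\<tau> \<notin> insert z VX \<union> VY" "qff_le G"
    using \<tau> z le by (auto simp: VX_def VY_def G_def qff_le_foldr V_def qff_le_scl)
   show "vars_qff G \<subseteq> insert \<tau> (insert z VX \<union> VY)"
    using vars_qff_scl[of True "Var z" "-1" \<Psi>] vars_qff_scl[of False "Var \<tau>" 1 \<Phi>]
    by (auto simp: VX_def VY_def G_def vars_qff_foldr xs ys V_def)
   show "card (insert z VX) \<le> l" using cards(1) fin(2) zVX by simp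
   show "fdeg G \<le> 15 * l"
    using l(3) xs(2) ys(2) l(1) fdeg_scl_var[of True z "-1" \<Psi>] fdeg_scl_var[of False \<tau> 1 \<Phi>]
    by (simp add: G_def fdeg_foldr o_def sum_list_const)
   have "fnorm G = 3 ^ length xs * (2 * (4 ^ length ys * (fnorm (scl True (Var z) (-1) \<Psi>) * fnorm (scl False (Var \<tau>) 1 \<Phi>))))"
    by (simp add: G_def fnorm_foldr o_def prod_list_const eval_nat_numeral)
   also have "\<dots> \<le> 4 ^ l * (2 * (4 ^ l * ((2 ^ fdeg \<Psi> * fnorm \<Psi>) * (2 ^ fdeg \<Phi> * fnorm \<Phi>))))"
   proof (intro mult_le_mono order_refl fnorm_scl_var)
    have "(3::nat) ^ length xs \<le> 4 ^ length xs" by (intro power_mono) auto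
    also have "\<dots> \<le> 4 ^ l" using xs(2) by (intro power_increasing) auto
    finally show "(3::nat) ^ length xs \<le> 4 ^ l" .
    show "(4::nat) ^ length ys \<le> 4 ^ l" using ys(2) by (intro power_increasing) auto
   qed auto
   also have "\<dots> = 4 ^ l * (2 * (4 ^ l * (2 ^ (fdeg \<Psi> + fdeg \<Phi>) * (fnorm \<Psi> * fnorm \<Phi>))))"
    by (simp only: power_add mult_ac)
   also have "\<dots> \<le> 4 ^ l * (2 * (4 ^ l * (2 ^ l * 2 ^ l)))"
    using l(3,4) by (intro mult_le_mono order_refl power_increasing) auto
   also have "\<dots> = 2 ^ (2 * l + 1 + 2 * l + l + l)"
   proof -
    have "(4::nat) ^ l = 2 ^ (2 * l)" by (simp add: power_mult)
    then show ?thesis by (simp only: power_add power_one_right mult.assoc)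
   qed
   also have "\<dots> \<le> 2 ^ (7 * l)" using l(1) by (intro power_increasing) auto
   finally show "fnorm G \<le> 2 ^ (7 * l)" .
   show "1 \<le> 7 * l" using l(1) by simp
   show "7 * l * 2 ^ (20 * l ^ 3) \<le> 2 ^ (32 * l ^ 3)" by (rule exponent_absorb[OF l(1)])
  qed
  have gt: "game \<tau> (insert z VX) G t" using game[of t] rel t0 by auto
  have "\<exists>u c X. u \<ge> real n \<and> relaxed m V \<Psi> \<Phi> u c X" for n :: nat
  proof -
   define u where "u = max (2 ^ (2 ^ (32 * l ^ 3))) (real n)"
   have "game \<tau> (insert z VX) G u" by (rule const[OF gt]) (simp add: u_def)
   moreover have "u \<ge> 0" by (simp add: u_def)
   ultimately have "\<exists>c X. relaxed m V \<Psi> \<Phi> u c X" using game[of u] by simp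
   moreover have "u \<ge> real n" by (simp add: u_def)
   ultimately show ?thesis by blast
  qed
  then show "\<exists>X. (\<forall>i\<in>V. i < m --> \<bar>X i\<bar> \<le> 1) \<and>
   (\<forall>Y. (\<forall>i\<in>V. m \<le> i --> \<bar>Y i\<bar> \<le> 1) --> holds (mix m X Y) \<Psi> --> holds (mix m X Y) \<Phi>)"
   by (intro bounded_of_relaxed[OF le V _ Psi]) (auto simp: V_def)
 }
qed

section \<open>Stack programs on Turing machines\<close>

text \<open>One digit has room for the 14 input symbols and for the stack markers of the parser and
  the translations, which lie between 16 and 25.\<close>

definition base :: nat where "base = 32"
definition nreg :: nat where "nreg = 16"

text \<open>The least significant digit belongs to register 0. The input tape therefore is already a
  tape with the input in register 0 and all other registers empty, up to the home mark, and the
  blank 0 is the cell with no contents at all.\<close>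

primrec code :: "nat => (nat => nat) => nat" where
 "code 0 f = 0"
| "code (Suc K) f = f 0 + base * code K (\<lambda>i. f (Suc i))"

primrec dig :: "nat => nat => nat" where
 "dig 0 s = s mod base"
| "dig (Suc i) s = dig i (s div base)"

lemma base_gt: "base > 14" "base > 0" by (simp_all add: base_def)

lemma dig_less: "dig i s < base"
 by (induction i arbitrary: s) (simp_all add: base_def)

lemma dig_code: "[| !!i. f i < base; i < K |] ==> dig i (code K f) = f i"
proof (induction K arbitrary: f i)
 case (Suc K)
 have f0: "f 0 < base" using Suc.prems(1) .
 have "(f 0 + base * x) div base = x" "(f 0 + base * x) mod base = f 0" for x
  using f0 by simp_all
 with Suc show ?case by (cases i) simp_all
qed simp

lemma code_less: "(!!i. f i < base) ==> code K f < base ^ K"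
proof (induction K arbitrary: f)
 case (Suc K)
 have "code K (\<lambda>i. f (Suc i)) + 1 \<le> base ^ K" using Suc by (simp add: Suc_le_eq)
 then have "base * (code K (\<lambda>i. f (Suc i)) + 1) \<le> base * base ^ K" by (rule mult_le_mono2)
 moreover have "f 0 < base" using Suc.prems .
 ultimately show ?case by simp
qed simp

lemma code_cong: "(!!i. i < K ==> f i = g i) ==> code K f = code K g"
proof (induction K arbitrary: f g)
 case (Suc K)
 have "code K (\<lambda>i. f (Suc i)) = code K (\<lambda>i. g (Suc i))"
  by (rule Suc.IH) (rule Suc.prems, simp)
 moreover have "f 0 = g 0" by (rule Suc.prems) simp
 ultimately show ?case by simp
qed simp

lemma code_0: "code K (\<lambda>_. 0) = 0"
 by (induction K) simp_all

lemma dig_0: "dig i 0 = 0"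
 by (induction i) simp_all

lemma code_single: "code (Suc K) (\<lambda>i. if i = 0 then a else 0) = a"
 by (simp add: code_0)

text \<open>\<open>IAct\<close> inspects the top symbol, 0 for an empty register, optionally deletes
  it, and jumps by a table. Every instruction names its successor.\<close>

datatype instr = IPush nat nat nat | IAct nat bool "nat => nat"

type_synonym regs = "nat => nat list"

definition hd0 :: "nat list => nat" where
 "hd0 xs = (case xs of [] => 0 | x # _ => x)"

lemma hd0_simps [simp]: "hd0 [] = 0" "hd0 (x # xs) = x"
 by (simp_all add: hd0_def)

fun istep :: "instr => regs => nat \<times> regs" where
 "istep (IPush r a n) R = (n, R(r := a # R r))"
| "istep (IAct r del j) R = (j (hd0 (R r)), if del then R(r := tl (R r)) else R)"

definition wf_instr :: "nat => instr => bool" where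
 "wf_instr F i = (case i of IPush r a n => r < nreg \<and> 0 < a \<and> a < base \<and> n \<le> F
   | IAct r del j => r < nreg \<and> (\<forall>a. j a \<le> F))"

definition wf_regs :: "regs => bool" where
 "wf_regs R \<longleftrightarrow> (\<forall>r. set (R r) \<subseteq> {1..<base})"

definition fstep :: "instr list => nat \<times> regs => nat \<times> regs" where
 "fstep C c = (if fst c < length C then istep (C ! fst c) (snd c) else c)"

definition setd :: "nat => nat => nat => nat" where
 "setd r a s = code (Suc nreg) (\<lambda>i. if i = r then a else dig i s)"

text \<open>States: 0 start, 1 halt; the instruction at \<open>pc\<close> owns the states \<open>4 + 3 * pc\<close> (scan to the right
 for the end of the register), \<open>5 + 3 * pc\<close> (inspect its last cell) and \<open>6 + 3 * pc\<close> (return to the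
 home cell before executing \<open>pc\<close>). Digit \<open>nreg\<close> of a cell marks the home cell.\<close>
definition tmdelta :: "instr list => nat => nat => nat \<times> nat \<times> move" where
 "tmdelta C q s = (if q = 0 then (4, setd nreg 1 s, MoveS) else if q < 4 then (1, s, MoveS) else
   let pc = (q - 4) div 3; ph = (q - 4) mod 3 in
   if ph = 2 then (if dig nreg s = 1 then (4 + 3 * pc, s, MoveS) else (q, s, MoveL))
   else if pc \<ge> length C then (1, setd nreg 0 s, MoveS)
   else (case C ! pc of
     IPush r a n => if dig r s = 0 then (6 + 3 * n, setd r a s, MoveS) else (q, s, MoveR)
    | IAct r del j =>
      if ph = 1 then (6 + 3 * j (dig r s), if del then setd r 0 s else s, MoveS)
      else if dig r s = 0 then (if dig nreg s = 1 then (4 + 3 * j 0, s, MoveS) else (q + 1, s, MoveL))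
      else (q, s, MoveR)))"

definition tm_of :: "instr list => tmachine" where
 "tm_of C = \<lparr>nstates = 7 + 3 * length C, nsyms = base ^ Suc nreg, delta = tmdelta C\<rparr>"

lemma setd_less: "a < base ==> setd r a s < base ^ Suc nreg"
 unfolding setd_def by (rule code_less) (simp add: dig_less)

lemma state_arith:
 "(5 + 3 * pc - 4) div 3 = pc" "(5 + 3 * pc - 4) mod 3 = 1" "(6 + 3 * pc - 4) div 3 = pc" "(6 + 3 * pc - 4) mod 3 = (2::nat)"
proof -
 have "5 + 3 * pc - 4 = 1 + 3 * pc" "6 + 3 * pc - 4 = 2 + 3 * pc" by simp_all
 then show "(5 + 3 * pc - 4) div 3 = pc" "(5 + 3 * pc - 4) mod 3 = 1" "(6 + 3 * pc - 4) div 3 = pc" "(6 + 3 * pc - 4) mod 3 = 2"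
  using mod_mult_self2[of 2 3 pc] by simp_all
qed

lemma tmdelta_state:
 "tmdelta C (4 + 3 * pc) s = (if pc \<ge> length C then (1, setd nreg 0 s, MoveS)
   else (case C ! pc of
     IPush r a n => if dig r s = 0 then (6 + 3 * n, setd r a s, MoveS) else (4 + 3 * pc, s, MoveR)
    | IAct r del j => if dig r s = 0 then (if dig nreg s = 1 then (4 + 3 * j 0, s, MoveS) else (5 + 3 * pc, s, MoveL))
      else (4 + 3 * pc, s, MoveR)))"
 "tmdelta C (5 + 3 * pc) s = (if pc \<ge> length C then (1, setd nreg 0 s, MoveS)
   else (case C ! pc of
     IPush r a n => if dig r s = 0 then (6 + 3 * n, setd r a s, MoveS) else (5 + 3 * pc, s, MoveR)
    | IAct r del j => (6 + 3 * j (dig r s), if del then setd r 0 s else s, MoveS)))"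
 "tmdelta C (6 + 3 * pc) s = (if dig nreg s = 1 then (4 + 3 * pc, s, MoveS) else (6 + 3 * pc, s, MoveL))"
 unfolding tmdelta_def Let_def using state_arith[of pc] by (simp_all split: instr.splits)

lemma wf_tm_of:
 assumes "!!i. i \<in> set C ==> wf_instr (length C) i"
 shows "wf_tm (tm_of C)"
proof -
 have "fst (tmdelta C q s) < 7 + 3 * length C \<and> fst (snd (tmdelta C q s)) < base ^ Suc nreg"
  if q: "q < 7 + 3 * length C" and s: "s < base ^ Suc nreg" for q s
 proof (cases "q < 4")
  case True
  then show ?thesis using s base_gt by (simp add: tmdelta_def setd_less del: power_Suc)
 next
  case False
  then have "q = 4 + 3 * ((q - 4) div 3) \<or> q = 5 + 3 * ((q - 4) div 3) \<or> q = 6 + 3 * ((q - 4) div 3)" by presburger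
  then obtain pc where pc: "q = 4 + 3 * pc \<or> q = 5 + 3 * pc \<or> q = 6 + 3 * pc" by blast
  have w: "pc < length C ==> wf_instr (length C) (C ! pc)" using assms by simp
  have le: "j \<le> L ==> 3 * j < Suc (3 * L)" "j \<le> L ==> 3 * j < 3 + 3 * L" for j L :: nat by simp_all
  show ?thesis using pc w q s base_gt
   by (elim disjE) (auto simp: le tmdelta_state setd_less wf_instr_def simp del: power_Suc split: instr.splits)
 qed
 moreover have "15 \<le> base ^ Suc nreg"
  using self_le_power[of base "Suc nreg"] by (simp add: base_def nreg_def)
 ultimately show ?thesis by (simp add: wf_tm_def tm_of_def)
qed

text \<open>The bottom of each stack is in the home cell, so a push or a pop changes only the cell
  at its right end.\<close>

definition content :: "regs => nat => nat => nat" where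
 "content R p i = (if i = nreg then (if p = 0 then 1 else 0)
   else if i < nreg \<and> p < length (R i) then rev (R i) ! p else 0)"

definition cell :: "regs => nat => nat" where
 "cell R p = code (Suc nreg) (content R p)"

definition cells :: "regs => nat => nat list" where
 "cells R L = map (cell R) [0..<L]"

lemma content_less: "wf_regs R ==> content R p i < base"
proof -
 assume w: "wf_regs R"
 have "rev (R i) ! p < base" if "p < length (R i)"
  using w that nth_mem[of p "rev (R i)"] by (fastforce simp: wf_regs_def)
 then show ?thesis by (auto simp: content_def base_def)
qed

lemma dig_cell:
 assumes "wf_regs R" "i \<le> nreg"
 shows "dig i (cell R p) = content R p i"
 unfolding cell_def using assms by (intro dig_code content_less) auto

lemma content_nonzero:
 assumes "wf_regs R" "r < nreg"
 shows "content R p r = 0 \<longleftrightarrow> length (R r) \<le> p"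
proof (cases "p < length (R r)")
 case True
 then have "rev (R r) ! p \<in> set (R r)" using nth_mem[of p "rev (R r)"] by simp
 then have "rev (R r) ! p \<noteq> 0" using assms(1) by (fastforce simp: wf_regs_def)
 then show ?thesis using True assms(2) by (simp add: content_def)
qed (use assms(2) in \<open>simp add: content_def\<close>)

lemma cell_blank:
 assumes "p > 0" "!!r. r < nreg ==> length (R r) \<le> p"
 shows "cell R p = 0"
proof -
 have "code (Suc nreg) (content R p) = code (Suc nreg) (\<lambda>_. 0)"
 proof (rule code_cong)
  fix i assume "i < Suc nreg"
  then consider "i = nreg" | "i < nreg" "length (R i) \<le> p" using assms(2) by fastforce
  then show "content R p i = 0" using assms(1) by cases (simp_all add: content_def)
 qed
 then show ?thesis by (simp only: cell_def code_0)
qed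

lemma setd_cell:
 assumes "wf_regs R" "!!i. i \<le> nreg ==> content R' p i = (if i = r then a else content R p i)"
 shows "setd r a (cell R p) = cell R' p"
 unfolding setd_def cell_def[of R']
 by (rule code_cong) (simp add: dig_cell[OF assms(1)] assms(2))

lemma walk_right:
 assumes "q \<noteq> 1" "!!s. s \<in> set us ==> delta M q s = (q, s, MoveR)"
 shows "(step M ^^ length us) (q, ls, us @ vs) = (q, rev us @ ls, vs)"
 using assms(2)
proof (induction us arbitrary: ls)
 case (Cons u us)
 have "step M (q, ls, (u # us) @ vs) = (q, u # ls, us @ vs)"
  using assms(1) Cons.prems[of u] by (simp add: step_def head_sym_def Let_def)
 then show ?case using Cons by (simp add: funpow_swap1)
qed simp

lemma walk_left:
 assumes "q \<noteq> 1" "!!s. s \<in> set us ==> delta M q s = (q, s, MoveL)"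
 shows "us \<noteq> [] ==> (step M ^^ length us) (q, rev (butlast us) @ [f], last us # vs) = (q, [], f # us @ vs)"
 using assms(2)
proof (induction us arbitrary: vs rule: rev_induct)
 case (snoc u us)
 have 1: "step M (q, rev us @ [f], u # vs) = (q, tl (rev us @ [f]), hd (rev us @ [f]) # u # vs)"
  using assms(1) snoc.prems(2)[of u]
  by (auto simp: step_def head_sym_def Let_def split: list.splits)
 show ?case
 proof (cases "us = []")
  case True
  then show ?thesis using 1 by simp
 next
  case False
  then have e: "rev us = last us # rev (butlast us)"
  proof -
   have "rev (butlast us @ [last us]) = last us # rev (butlast us)" by simp
   then show ?thesis using False by simp
  qed
  have "(step M ^^ length us) (q, rev (butlast us) @ [f], last us # u # vs) = (q, [], f # us @ u # vs)"
   using snoc.IH[OF False, of "u # vs"] snoc.prems by simp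
  moreover have "step M (q, rev us @ [f], u # vs) = (q, rev (butlast us) @ [f], last us # u # vs)"
   using 1 by (simp add: e)
  ultimately show ?thesis by (simp add: funpow_swap1)
 qed
qed simp

definition init_regs :: "nat list => regs" where
 "init_regs w = (\<lambda>r. if r = 0 then rev w else [])"

definition tape :: "regs => nat => nat => nat list" where
 "tape R p L = map (cell R) [p..<L]"

lemma tape_split: "p \<le> m ==> m \<le> L ==> tape R p L = tape R p m @ tape R m L"
 unfolding tape_def map_append[symmetric] using upt_add_eq_append[of p m "L - m"] by simp

lemma tape_Cons: "p < L ==> tape R p L = cell R p # tape R (Suc p) L"
 by (simp add: tape_def upt_rec)

lemma tape_empty: "L \<le> p ==> tape R p L = []"
 by (simp add: tape_def)

lemma cells_tape: "cells R L = tape R 0 L"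
 by (simp add: cells_def tape_def)

lemma set_tape: "set (tape R p L) = cell R ` {p..<L}"
 by (simp add: tape_def)

lemma length_tape: "length (tape R p L) = L - p"
 by (simp add: tape_def)

lemma tape_cong:
 assumes "!!i. p \<le> i ==> i < L ==> cell R i = cell R' i"
 shows "tape R p L = tape R' p L"
 unfolding tape_def by (rule map_cong) (use assms in auto)

lemma flag_cell: "wf_regs R ==> dig nreg (cell R p) = (if p = 0 then 1 else 0)"
 by (simp add: dig_cell content_def)

lemma return_home:
 assumes "wf_regs R" "p < L"
 shows "(step (tm_of C) ^^ Suc p) (6 + 3 * t, rev (tape R 0 p), tape R p L)
   = (4 + 3 * t, [], cells R L)"
proof -
 have home: "step (tm_of C) (6 + 3 * t, [], cells R L) = (4 + 3 * t, [], cells R L)"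
  using assms tape_Cons[of 0 L R]
  by (simp add: cells_tape step_def head_sym_def tm_of_def tmdelta_state flag_cell)
 show ?thesis
 proof (cases "p = 0")
  case True
  then show ?thesis using home by (simp add: cells_tape tape_empty)
 next
  case False
  let ?us = "tape R 1 (Suc p)"
  have us: "?us = tape R 1 p @ [cell R p]"
   using False by (subst tape_split[of 1 p]) (auto simp: tape_Cons tape_empty)
  have "(step (tm_of C) ^^ length ?us) (6 + 3 * t, rev (butlast ?us) @ [cell R 0], last ?us # tape R (Suc p) L)
    = (6 + 3 * t, [], cell R 0 # ?us @ tape R (Suc p) L)"
  proof (rule walk_left)
   fix s assume "s \<in> set ?us"
   then show "delta (tm_of C) (6 + 3 * t) s = (6 + 3 * t, s, MoveL)"
    using assms by (auto simp: set_tape tm_of_def tmdelta_state flag_cell)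
  qed (use us in auto)
  moreover have "cell R 0 # ?us @ tape R (Suc p) L = cells R L"
   using assms False tape_split[of 1 "Suc p" L R] tape_Cons[of 0 L R]
   by (simp add: cells_tape)
  moreover have "rev (butlast ?us) @ [cell R 0] = rev (tape R 0 p)"
   using False tape_Cons[of 0 p R] by (simp add: us[simplified])
  moreover have "last ?us # tape R (Suc p) L = tape R p L"
   using assms tape_Cons[of p L R] by (simp add: us[simplified])
  moreover have "length ?us = p" by (simp add: length_tape)
  ultimately have "(step (tm_of C) ^^ p) (6 + 3 * t, rev (tape R 0 p), tape R p L)
    = (6 + 3 * t, [], cells R L)" by simp
  then show ?thesis using home by simp
 qed
qed

lemma wf_regs_upd: "wf_regs R ==> set xs \<subseteq> {1..<base} ==> wf_regs (R(r := xs))"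
 by (simp add: wf_regs_def)

lemma wf_regs_istep:
 assumes "wf_regs R" "wf_instr F i"
 shows "wf_regs (snd (istep i R))"
proof (cases i)
 case (IPush r a n)
 then show ?thesis using assms by (auto simp: wf_instr_def wf_regs_def)
next
 case (IAct r del j)
 have "set (tl (R r)) \<subseteq> {1..<base}"
  using assms(1) by (cases "R r") (auto simp: wf_regs_def dest!: spec[of _ r])
 then show ?thesis using IAct assms by (auto intro!: wf_regs_upd)
qed

text \<open>A walk to the end of the register, a change, and a walk home. The first free cell may
  lie just beyond the written tape, where a blank is read; that is the code of an empty cell, so the
  written part grows by at most one.\<close>

lemma simulate_step:
 assumes wf: "wf_regs R" and pc: "pc < length C" and wi: "wf_instr (length C) (C ! pc)"
  and L: "L \<ge> 1" "!!r. r < nreg ==> length (R r) \<le> L"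
  and st: "istep (C ! pc) R = (pc', R')"
 shows "\<exists>n L'. n \<le> 2 * L + 4 \<and> L \<le> L' \<and> L' \<le> L + 1 \<and> (\<forall>r<nreg. length (R' r) \<le> L') \<and>
   (step (tm_of C) ^^ n) (4 + 3 * pc, [], cells R L) = (4 + 3 * pc', [], cells R' L')"
proof -
 let ?M = "tm_of C"
 let ?q = "4 + 3 * pc"
 have delta: "delta ?M = tmdelta C" by (simp add: tm_of_def)
 define r where "r = (case C ! pc of IPush r a n => r | IAct r del j => r)"
 have r: "r < nreg" using wi by (auto simp: r_def wf_instr_def split: instr.splits)
 define n where "n = length (R r)"
 have nL: "n \<le> L" using L(2)[OF r] by (simp add: n_def)
 have digr: "dig r (cell R p) = 0 \<longleftrightarrow> n \<le> p" for p
  using dig_cell[OF wf, of r p] content_nonzero[OF wf r, of p] r by (simp add: n_def)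
 have scan: "(step ?M ^^ n) (?q, [], cells R L) = (?q, rev (tape R 0 n), tape R n L)"
 proof -
  have "(step ?M ^^ length (tape R 0 n)) (?q, [], tape R 0 n @ tape R n L)
    = (?q, rev (tape R 0 n) @ [], tape R n L)"
  proof (rule walk_right)
   fix s assume "s \<in> set (tape R 0 n)"
   then obtain p where "p < n" "s = cell R p" by (auto simp: set_tape)
   then have "dig r s \<noteq> 0" using digr by auto
   then show "delta ?M ?q s = (?q, s, MoveR)"
    using pc by (auto simp: delta tmdelta_state r_def split: instr.splits)
  qed simp
  then show ?thesis using tape_split[of 0 n L R] nL by (simp add: length_tape cells_tape)
 qed
 define L' where "L' = max L (Suc n)"
 have L': "L \<le> L'" "L' \<le> L + 1" "n < L'" using nL by (auto simp: L'_def)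
 have head: "head_sym (tape R n L) = cell R n"
 proof (cases "n < L")
  case True
  then show ?thesis by (simp add: tape_Cons head_sym_def)
 next
  case False
  then have "n = L" using nL by simp
  then have "cell R n = 0" using L by (intro cell_blank) auto
  then show ?thesis using \<open>n = L\<close> by (simp add: tape_empty head_sym_def)
 qed
 have tail: "tl (tape R n L) = tape R (Suc n) L'"
  using nL by (cases "n < L") (auto simp: tape_Cons tape_empty L'_def)
 show ?thesis
 proof (cases "C ! pc")
  case (IPush r' a nx)
  then have r': "r' = r" by (simp add: r_def)
  have R': "R' = R(r := a # R r)" "pc' = nx" using st IPush r' by auto
  have a: "0 < a" "a < base" using wi IPush by (auto simp: wf_instr_def)
  have wf': "wf_regs R'" using wf a unfolding R'(1) by (auto intro!: wf_regs_upd simp: wf_regs_def)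
  have same: "cell R' p = cell R p" if "p \<noteq> n" for p
   unfolding cell_def
  proof (rule code_cong)
   fix i assume "i < Suc nreg"
   show "content R' p i = content R p i"
    using that by (auto simp: content_def R' n_def nth_append)
  qed
  have wr: "setd r a (cell R n) = cell R' n"
  proof (rule setd_cell[OF wf])
   fix i assume "i \<le> nreg"
   show "content R' n i = (if i = r then a else content R n i)"
    using r by (auto simp: content_def R' n_def nth_append)
  qed
  have c0: "tape R 0 n = tape R' 0 n" "tape R (Suc n) L' = tape R' (Suc n) L'"
   by (rule tape_cong, simp add: same)+
  have "step ?M (?q, rev (tape R 0 n), tape R n L)
    = (6 + 3 * nx, rev (tape R 0 n), setd r a (cell R n) # tape R (Suc n) L')"
   using IPush r' pc digr[of n] by (simp add: step_def head delta tmdelta_state tail)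
  then have 1: "step ?M (?q, rev (tape R 0 n), tape R n L)
    = (6 + 3 * nx, rev (tape R' 0 n), tape R' n L')"
   using tape_Cons[OF L'(3), of R'] by (simp add: wr c0)
  have "(step ?M ^^ (Suc n + (1 + n))) (?q, [], cells R L)
    = (step ?M ^^ Suc n) ((step ?M ^^ 1) ((step ?M ^^ n) (?q, [], cells R L)))"
   by (simp only: funpow_add comp_apply)
  also have "\<dots> = (4 + 3 * nx, [], cells R' L')"
   using scan 1 return_home[OF wf' L'(3), of C nx] by simp
  finally show ?thesis using nL L' L(2) R'
   by (intro exI[of _ "Suc n + (1 + n)"] exI[of _ L']) (fastforce simp: n_def L'_def)
 next
  case (IAct r' del j)
  then have r': "r' = r" by (simp add: r_def)
  have R': "R' = (if del then R(r := tl (R r)) else R)" "pc' = j (hd0 (R r))" using st IAct r' by auto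
  have wf': "wf_regs R'" using wf_regs_istep[OF wf wi] st by simp
  show ?thesis
  \<comment> \<open>With an empty register the scan ends on the home cell, and inspecting a cell to
    the left would leave the tape; the home mark selects a direct jump instead.\<close>
  proof (cases "n = 0")
   case True
   then have e: "R r = []" by (simp add: n_def)
   then have s': "R' = R" "pc' = j 0" using R' by (auto simp: fun_upd_idem)
   have "step ?M (?q, [], cells R L) = (4 + 3 * j 0, [], cells R L)"
    using IAct r' pc digr[of 0] True tape_Cons[of 0 L R] L(1)
    by (simp add: step_def head_sym_def delta tmdelta_state cells_tape flag_cell[OF wf])
   then show ?thesis using L(2) unfolding s' by (intro exI[of _ 1] exI[of _ L]) auto
  next
   case False
   then obtain x xs where x: "R r = x # xs" by (cases "R r") (auto simp: n_def)
   define p where "p = n - 1"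
   have p: "n = Suc p" "p < n" "p < L'" using False L' by (auto simp: p_def)
   have same: "cell R' i = cell R i" if "i \<noteq> p" for i
    unfolding cell_def
   proof (rule code_cong)
    fix k assume "k < Suc nreg"
    show "content R' i k = content R i k"
     using that x by (auto simp: content_def R' n_def p_def nth_append)
   qed
   have wr: "(if del then setd r 0 (cell R p) else cell R p) = cell R' p"
   proof (cases del)
    case True
    have "setd r 0 (cell R p) = cell R' p"
    proof (rule setd_cell[OF wf])
     fix i assume "i \<le> nreg"
     show "content R' p i = (if i = r then 0 else content R p i)"
      using r x True by (auto simp: content_def R' n_def p_def)
    qed
    then show ?thesis using True by simp
   qed (simp add: R')
   have tp: "dig r (cell R p) = hd0 (R r)"
    using dig_cell[OF wf, of r p] r x by (simp add: content_def p_def n_def nth_append)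
   have nz: "dig nreg (cell R n) = 0" using flag_cell[OF wf, of n] False by simp
   have "rev (tape R 0 n) = cell R p # rev (tape R 0 p)"
    using tape_split[of 0 p n R] p by (simp add: tape_Cons tape_empty)
   then have "step ?M (?q, rev (tape R 0 n), tape R n L)
     = (5 + 3 * pc, rev (tape R 0 p), cell R p # cell R n # tape R (Suc n) L')"
    using IAct r' pc digr[of n] nz by (simp add: step_def head delta tmdelta_state tail)
   moreover have "step ?M (5 + 3 * pc, rev (tape R 0 p), cell R p # cell R n # tape R (Suc n) L')
     = (6 + 3 * j (hd0 (R r)), rev (tape R 0 p), cell R' p # cell R n # tape R (Suc n) L')"
    using IAct r' pc wr tp by (cases del) (simp_all add: step_def head_sym_def delta tmdelta_state)
   moreover have "tape R 0 p = tape R' 0 p" by (rule tape_cong) (simp add: same)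
   moreover have "cell R n # tape R (Suc n) L' = tape R' n L'"
    using tape_Cons[OF L'(3), of R] tape_cong[of n L' R R'] same p by auto
   moreover have "cell R' p # tape R' n L' = tape R' p L'"
    using tape_Cons[OF p(3), of R'] p(1) by simp
   ultimately have 1: "step ?M (step ?M (?q, rev (tape R 0 n), tape R n L))
     = (6 + 3 * pc', rev (tape R' 0 p), tape R' p L')"
    using R'(2) by simp
   have "(step ?M ^^ (Suc p + (2 + n))) (?q, [], cells R L)
     = (step ?M ^^ Suc p) ((step ?M ^^ 2) ((step ?M ^^ n) (?q, [], cells R L)))"
    by (simp only: funpow_add comp_apply)
   also have "\<dots> = (4 + 3 * pc', [], cells R' L')"
    using scan 1 return_home[OF wf' p(3), of C pc'] by (simp add: numeral_2_eq_2)
   finally have run: "(step ?M ^^ (Suc p + (2 + n))) (?q, [], cells R L) = (4 + 3 * pc', [], cells R' L')" .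
   have "length (R' k) \<le> length (R k)" for k by (simp add: R')
   then have "\<forall>k<nreg. length (R' k) \<le> L'" using L(2) L'(1) by (meson order_trans)
   with run nL L' p show ?thesis
    by (intro exI[of _ "Suc p + (2 + n)"] exI[of _ L']) auto
  qed
 qed
qed

lemma simulate_run:
 assumes wi: "!!i. i \<in> set C ==> wf_instr (length C) i"
 shows "[| wf_regs R; pc \<le> length C; L \<ge> 1; !!r. r < nreg ==> length (R r) \<le> L; (fstep C ^^ N) (pc, R) = (pc', R') |]
  ==> \<exists>n L'. n \<le> N * (2 * (L + N) + 4) \<and> L \<le> L' \<and> (\<forall>r<nreg. length (R' r) \<le> L') \<and> wf_regs R' \<and>
   (step (tm_of C) ^^ n) (4 + 3 * pc, [], cells R L) = (4 + 3 * pc', [], cells R' L')"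
proof (induction N arbitrary: pc R L)
 case 0
 then show ?case by (intro exI[of _ 0] exI[of _ L]) auto
next
 case (Suc N)
 obtain pc1 R1 where 1: "fstep C (pc, R) = (pc1, R1)" by force
 have rest: "(fstep C ^^ N) (pc1, R1) = (pc', R')"
  using Suc.prems(5) 1 by (simp add: funpow_swap1)
 show ?case
 proof (cases "pc < length C")
  case True
  then have st: "istep (C ! pc) R = (pc1, R1)" using 1 by (simp add: fstep_def)
  have w: "wf_instr (length C) (C ! pc)" using wi True by simp
  obtain n1 L1 where n1: "n1 \<le> 2 * L + 4" "L \<le> L1" "L1 \<le> L + 1" "\<forall>r<nreg. length (R1 r) \<le> L1"
   "(step (tm_of C) ^^ n1) (4 + 3 * pc, [], cells R L) = (4 + 3 * pc1, [], cells R1 L1)"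
   using simulate_step[OF Suc.prems(1) True w Suc.prems(3,4) st] by auto
  have "wf_regs R1" using wf_regs_istep[OF Suc.prems(1) w] st by simp
  moreover have "pc1 \<le> length C" using w st by (cases "C ! pc") (auto simp: wf_instr_def)
  moreover have "1 \<le> L1" using n1 Suc.prems(3) by linarith
  ultimately obtain n2 L2 where n2: "n2 \<le> N * (2 * (L1 + N) + 4)" "L1 \<le> L2"
   "\<forall>r<nreg. length (R' r) \<le> L2" "wf_regs R'"
   "(step (tm_of C) ^^ n2) (4 + 3 * pc1, [], cells R1 L1) = (4 + 3 * pc', [], cells R' L2)"
   using Suc.IH[of R1 pc1 L1] n1(4) rest by auto
  have "(step (tm_of C) ^^ (n2 + n1)) (4 + 3 * pc, [], cells R L) = (4 + 3 * pc', [], cells R' L2)"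
   using n1(5) n2(5) by (simp add: funpow_add)
  moreover have "n2 + n1 \<le> Suc N * (2 * (L + Suc N) + 4)"
  proof -
   have "N * (2 * (L1 + N) + 4) \<le> N * (2 * (L + Suc N) + 4)" using n1(3) by (intro mult_le_mono2) simp
   moreover have "n1 \<le> 2 * (L + Suc N) + 4" using n1(1) by simp
   ultimately have "n2 + n1 \<le> N * (2 * (L + Suc N) + 4) + (2 * (L + Suc N) + 4)" using n2(1) by linarith
   then show ?thesis by (simp only: mult_Suc add.commute)
  qed
  ultimately show ?thesis using n1(2) n2 by (intro exI[of _ "n2 + n1"] exI[of _ L2]) auto
 next
  case False
  then have "pc1 = pc" "R1 = R" using 1 by (auto simp: fstep_def)
  with Suc.IH[of R pc L] Suc.prems rest obtain n L' where
   "n \<le> N * (2 * (L + N) + 4)" "L \<le> L'" "\<forall>r<nreg. length (R' r) \<le> L'" "wf_regs R'"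
   "(step (tm_of C) ^^ n) (4 + 3 * pc, [], cells R L) = (4 + 3 * pc', [], cells R' L')" by auto
  moreover have "N * (2 * (L + N) + 4) \<le> Suc N * (2 * (L + Suc N) + 4)" by (intro mult_le_mono) auto
  ultimately show ?thesis by (meson order_trans)
 qed
qed

lemma funpow_1: "f ^^ 1 = f" for f :: "'a => 'a"
 by (simp add: fun_eq_iff)

lemma wf_init: "set w \<subseteq> {1..<base} ==> wf_regs (init_regs w)"
 by (auto simp: wf_regs_def init_regs_def)

lemma cell_init:
 assumes "set w \<subseteq> {1..<base}" "p > 0"
 shows "cell (init_regs w) p = (if p < length w then w ! p else 0)"
proof -
 have "code (Suc nreg) (content (init_regs w) p) = code (Suc nreg) (\<lambda>i. if i = 0 then (if p < length w then w ! p else 0) else 0)"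
  by (rule code_cong) (use assms(2) in \<open>auto simp: content_def init_regs_def nreg_def\<close>)
 then show ?thesis by (simp only: cell_def code_single)
qed

lemma setd_init:
 assumes "set w \<subseteq> {1..<base}"
 shows "setd nreg 1 (if w = [] then 0 else hd w) = cell (init_regs w) 0"
  and "setd nreg 0 (cell (init_regs w) 0) = (if w = [] then 0 else hd w)"
proof -
 let ?x = "if w = [] then 0 else hd w"
 have x: "?x < base" using assms base_gt by (cases w) auto
 then have "dig i ?x = (if i = 0 then ?x else 0)" if "i < Suc nreg" for i
  using that by (cases i) (simp_all add: dig_0)
 then show "setd nreg 1 ?x = cell (init_regs w) 0"
  unfolding setd_def cell_def
  by (intro code_cong) (cases w; auto simp: content_def init_regs_def nreg_def rev_nth nth_append)
 have "setd nreg 0 (cell (init_regs w) 0) = code (Suc nreg) (\<lambda>i. if i = 0 then ?x else 0)"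
  unfolding setd_def
 proof (rule code_cong)
  fix i assume "i < Suc nreg"
  then have "dig i (cell (init_regs w) 0) = content (init_regs w) 0 i"
   by (intro dig_cell wf_init assms) simp
  then show "(if i = nreg then 0 else dig i (cell (init_regs w) 0)) = (if i = 0 then ?x else 0)"
   using \<open>i < Suc nreg\<close> by (cases w) (auto simp: content_def init_regs_def nreg_def nth_append)
 qed
 then show "setd nreg 0 (cell (init_regs w) 0) = ?x" by (simp only: code_single)
qed

text \<open>Erasing the home mark turns the first cell back into a plain symbol. Since all registers
  other than 0 are empty, the tape then is the output followed by blanks.\<close>

lemma halting:
 assumes v: "set v \<subseteq> {1..<base}" and L: "L \<ge> 1" "length v \<le> L"
 shows "\<exists>rs. step (tm_of C) (4 + 3 * length C, [], cells (init_regs v) L) = (1, [], rs) \<and> takeWhile (\<lambda>s. s \<noteq> 0) rs = v"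
proof -
 define x where "x = (if v = [] then 0 else hd v)"
 define rs where "rs = x # tape (init_regs v) 1 L"
 have "step (tm_of C) (4 + 3 * length C, [], cells (init_regs v) L) = (1, [], rs)"
  using tape_Cons[of 0 L "init_regs v"] L setd_init(2)[OF v]
  by (simp add: step_def head_sym_def tm_of_def tmdelta_state cells_tape rs_def x_def)
 moreover have "rs = v @ replicate (length rs - length v) 0"
 proof (rule nth_equalityI)
  have len: "length rs = L" using L by (simp add: rs_def length_tape)
  then show "length rs = length (v @ replicate (length rs - length v) 0)" using L by simp
  fix i assume i: "i < length rs"
  show "rs ! i = (v @ replicate (length rs - length v) 0) ! i"
  proof (cases i)
   case 0
   then show ?thesis using len L by (cases v) (auto simp: rs_def x_def)
  next
   case (Suc j)
   then have "rs ! i = cell (init_regs v) i" using i len by (simp add: rs_def tape_def)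
   then show ?thesis using cell_init[OF v, of i] Suc i len by (simp add: nth_append)
  qed
 qed
 moreover have "takeWhile (\<lambda>s. s \<noteq> 0) (v @ replicate n 0) = v" for n
 proof -
  have "\<forall>s\<in>set v. s \<noteq> 0" using v by auto
  then show ?thesis by (induction v) (cases n, auto)
 qed
 ultimately show ?thesis by metis
qed

lemma tm_of_halts:
 assumes wi: "!!i. i \<in> set C ==> wf_instr (length C) i"
  and w: "set w \<subseteq> {1..<base}"
  and run: "(fstep C ^^ N) (0, init_regs w) = (length C, init_regs v)"
 shows "\<exists>t \<le> 2 + N * (2 * (length w + 1 + N) + 4). halts_with (tm_of C) w t v"
proof -
 define L where "L = max 1 (length w)"
 have "step (tm_of C) (0, [], w) = (4, [], cells (init_regs w) L)"
 proof -
  have "head_sym w = (if w = [] then 0 else hd w)" by (cases w) (auto simp: head_sym_def)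
  moreover have "tl w = tape (init_regs w) 1 L"
   by (rule nth_equalityI) (auto simp: length_tape L_def tape_def cell_init[OF w] nth_tl)
  ultimately show ?thesis
   using setd_init(1)[OF w] tape_Cons[of 0 L "init_regs w"]
   by (simp add: step_def tm_of_def tmdelta_def cells_tape L_def)
 qed
 moreover obtain n L' where n: "n \<le> N * (2 * (L + N) + 4)" "L \<le> L'" "\<forall>r<nreg. length (init_regs v r) \<le> L'" "wf_regs (init_regs v)"
   "(step (tm_of C) ^^ n) (4 + 3 * 0, [], cells (init_regs w) L) = (4 + 3 * length C, [], cells (init_regs v) L')"
  using simulate_run[OF wi wf_init[OF w] _ _ _ run, of L] by (fastforce simp: L_def init_regs_def)
 moreover have "set v \<subseteq> {1..<base}" using n(4) by (auto simp: wf_regs_def init_regs_def dest!: spec[of _ 0])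
 moreover have "length v \<le> L'" using n(3)[rule_format, of 0] by (simp add: init_regs_def nreg_def)
 ultimately obtain rs where "step (tm_of C) (4 + 3 * length C, [], cells (init_regs v) L') = (1, [], rs)" "takeWhile (\<lambda>s. s \<noteq> 0) rs = v"
  using halting[of v L' C] by (auto simp: L_def)
 then have "(step (tm_of C) ^^ (1 + (n + 1))) (0, [], w) = (1, [], rs)"
  using n(5) \<open>step (tm_of C) (0, [], w) = (4, [], cells (init_regs w) L)\<close>
  by (simp only: funpow_add comp_apply funpow_1) simp
 then have "halts_with (tm_of C) w (1 + (n + 1)) v"
  using \<open>takeWhile (\<lambda>s. s \<noteq> 0) rs = v\<close> by (simp only: halts_with_def run_def) simp
 moreover have "1 + (n + 1) \<le> 2 + N * (2 * (length w + 1 + N) + 4)"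
 proof -
  have "N * (2 * (L + N) + 4) \<le> N * (2 * (length w + 1 + N) + 4)" by (intro mult_le_mono2) (simp add: L_def)
  then show ?thesis using n(1) by linarith
 qed
 ultimately show ?thesis by blast
qed

text \<open>Undoes the eta expansion of updates, which the simplifier would otherwise unfold.\<close>
lemma fun_upd_fold [simp]: "(\<lambda>a. if a = r then x else f a) = f(r := x)"
 by (simp add: fun_upd_def)

section \<open>Structured stack programs and their compilation\<close>

datatype prog = Skip | Push nat nat | Pop nat | Seq prog prog (infixr ";;" 60) | IfTop nat nat prog prog
 | Loop nat "nat => bool" prog

text \<open>The recursion runs on a copy of the loop register. The copy agrees with the register in
  well-formed programs, whose loop bodies do not change it.\<close>

primrec lp :: "(regs => regs) => nat => (nat => bool) => nat list => regs => regs" where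
 "lp f r S [] R = R"
| "lp f r S (x # xs) R = (if S x then lp f r S xs ((f R)(r := xs)) else R)"

primrec lpc :: "(regs => regs) => (regs => nat) => nat => (nat => bool) => nat list => regs => nat" where
 "lpc f g r S [] R = 0"
| "lpc f g r S (x # xs) R = (if S x then 2 + g R + lpc f g r S xs ((f R)(r := xs)) else 0)"

declare lp.simps(2) [simp del] lpc.simps(2) [simp del]

lemma lp_Cons [simp]: "lp f r S (x # xs) R = (if S x then lp f r S xs ((f R)(r := xs)) else R)"
 by (simp add: lp.simps(2) fun_upd_def del: fun_upd_fold)

lemma lpc_Cons [simp]: "lpc f g r S (x # xs) R = (if S x then 2 + g R + lpc f g r S xs ((f R)(r := xs)) else 0)"
 by (simp add: lpc.simps(2) fun_upd_def del: fun_upd_fold)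

text \<open>The body of a loop on \<open>r\<close> runs once for each symbol of \<open>r\<close>, as long as these satisfy \<open>S\<close>; the
 current symbol stays on top of \<open>r\<close> while the body runs.\<close>
primrec exec :: "prog => regs => regs" where
 "exec Skip R = R"
| "exec (Push r a) R = R(r := a # R r)"
| "exec (Pop r) R = R(r := tl (R r))"
| "exec (Seq p q) R = exec q (exec p R)"
| "exec (IfTop r a p q) R = (if hd0 (R r) = a then exec p R else exec q R)"
| "exec (Loop r S p) R = lp (exec p) r S (R r) R"

declare exec.simps(2,3) [simp del]

lemma exec_upd [simp]:
 "exec (Push r a) R = R(r := a # R r)"
 "exec (Pop r) R = R(r := tl (R r))"
 by (simp_all add: exec.simps(2,3) fun_upd_def del: fun_upd_fold)

primrec cost :: "prog => regs => nat" where
 "cost Skip R = 1"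
| "cost (Push r a) R = 1"
| "cost (Pop r) R = 1"
| "cost (Seq p q) R = cost p R + cost q (exec p R)"
| "cost (IfTop r a p q) R = 1 + (if hd0 (R r) = a then cost p R else cost q R)"
| "cost (Loop r S p) R = 1 + lpc (exec p) (cost p) r S (R r) R"

primrec mods :: "prog => nat set" where
 "mods Skip = {}"
| "mods (Push r a) = {r}"
| "mods (Pop r) = {r}"
| "mods (Seq p q) = mods p \<union> mods q"
| "mods (IfTop r a p q) = mods p \<union> mods q"
| "mods (Loop r S p) = insert r (mods p)"

primrec wfp :: "prog => bool" where
 "wfp Skip = True"
| "wfp (Push r a) = (r < nreg \<and> 0 < a \<and> a < base)"
| "wfp (Pop r) = (r < nreg)"
| "wfp (Seq p q) = (wfp p \<and> wfp q)"
| "wfp (IfTop r a p q) = (r < nreg \<and> wfp p \<and> wfp q)"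
| "wfp (Loop r S p) = (r < nreg \<and> r \<notin> mods p \<and> wfp p)"

lemma lp_unchanged:
 assumes "!!R. f R s = R s" "s \<noteq> r"
 shows "lp f r S xs R s = R s"
 using assms by (induction xs arbitrary: R) auto

lemma exec_unchanged: "s \<notin> mods p ==> exec p R s = R s"
 by (induction p arbitrary: R) (auto intro: lp_unchanged)

primrec clen :: "prog => nat" where
 "clen Skip = 1"
| "clen (Push r a) = 1"
| "clen (Pop r) = 1"
| "clen (Seq p q) = clen p + clen q"
| "clen (IfTop r a p q) = 1 + clen p + clen q"
| "clen (Loop r S p) = 2 + clen p"

text \<open>Relocated code: \<open>s\<close> is the address at which it is placed, \<open>e\<close>
  the address at which execution goes on afterwards. A top symbol 0, that is, an exhausted register,
  always leaves a loop.\<close>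

primrec compile :: "prog => nat => nat => instr list" where
 "compile Skip s e = [IAct 0 False (\<lambda>_. e)]"
| "compile (Push r a) s e = [IPush r a e]"
| "compile (Pop r) s e = [IAct r True (\<lambda>_. e)]"
| "compile (Seq p q) s e = compile p s (s + clen p) @ compile q (s + clen p) e"
| "compile (IfTop r a p q) s e = IAct r False (\<lambda>x. if x = a then s + 1 else s + 1 + clen p)
   # compile p (s + 1) e @ compile q (s + 1 + clen p) e"
| "compile (Loop r S p) s e = IAct r False (\<lambda>x. if x \<noteq> 0 \<and> S x then s + 1 else e)
   # compile p (s + 1) (s + 1 + clen p) @ [IAct r True (\<lambda>_. s)]"

lemma length_comp: "length (compile p s e) = clen p"
 by (induction p arbitrary: s e) auto

lemma wf_instr_simps:
 "wf_instr F (IPush r a n) \<longleftrightarrow> r < nreg \<and> 0 < a \<and> a < base \<and> n \<le> F"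
 "wf_instr F (IAct r del j) \<longleftrightarrow> r < nreg \<and> (\<forall>a. j a \<le> F)"
 by (simp_all add: wf_instr_def)

lemma wf_comp: "wfp p ==> s + clen p \<le> F ==> e \<le> F ==> i \<in> set (compile p s e) ==> wf_instr F i"
proof (induction p arbitrary: s e)
 case (Seq p q)
 then show ?case using Seq.IH(1)[of s "s + clen p"] Seq.IH(2)[of "s + clen p" e] by auto
next
 case (IfTop r a p q)
 then show ?case using IfTop.IH(1)[of "s + 1" e] IfTop.IH(2)[of "s + 1 + clen p" e]
  by (auto simp: wf_instr_simps)
next
 case (Loop r S p)
 then show ?case using Loop.IH[of "s + 1" "s + 1 + clen p"] by (auto simp: wf_instr_simps)
qed (auto simp: wf_instr_simps nreg_def)

definition code_at :: "instr list => nat => instr list => bool" where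
 "code_at C s c \<longleftrightarrow> s + length c \<le> length C \<and> (\<forall>i<length c. C ! (s + i) = c ! i)"

lemma at_append: "code_at C s (c @ d) \<longleftrightarrow> code_at C s c \<and> code_at C (s + length c) d"
proof
 assume a: "code_at C s (c @ d)"
 have "C ! (s + length c + i) = d ! i" if "i < length d" for i
  using a that unfolding code_at_def by (metis add.assoc length_append nat_add_left_cancel_less nth_append_length_plus)
 then show "code_at C s c \<and> code_at C (s + length c) d"
  using a by (auto simp: code_at_def nth_append)
next
 assume a: "code_at C s c \<and> code_at C (s + length c) d"
 have "C ! (s + i) = (c @ d) ! i" if "i < length c + length d" for i
 proof (cases "i < length c")
  case False
  then show ?thesis using a that unfolding code_at_def
   by (auto simp: nth_append dest!: conjunct2[THEN conjunct2, THEN spec[of _ "i - length c"]])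
 qed (use a in \<open>auto simp: code_at_def nth_append\<close>)
 then show "code_at C s (c @ d)" using a by (auto simp: code_at_def)
qed

lemma at_Cons: "code_at C s (x # d) \<longleftrightarrow> s < length C \<and> C ! s = x \<and> code_at C (Suc s) d"
 using at_append[of C s "[x]" d] by (auto simp: code_at_def)

lemma fstep_at: "code_at C s (x # d) ==> fstep C (s, R) = istep x R"
 by (simp add: at_Cons fstep_def)

lemma wf_regs_exec: "wfp p ==> wf_regs R ==> wf_regs (exec p R)"
proof (induction p arbitrary: R)
 case (Push r a)
 then show ?case by (auto simp: wf_regs_def)
next
 case (Pop r)
 then have "set (tl (R r)) \<subseteq> {1..<base}" by (cases "R r") (auto simp: wf_regs_def dest!: spec[of _ r])
 then show ?case using Pop by (auto intro!: wf_regs_upd)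
next
 case (Loop r S p)
 have "wf_regs (lp (exec p) r S xs R)" if "wf_regs R" "set xs \<subseteq> {1..<base}" for xs R
  using that
 proof (induction xs arbitrary: R)
  case (Cons x xs)
  have "wf_regs ((exec p R)(r := xs))" using Loop Cons.prems by (auto intro!: wf_regs_upd)
  then show ?case using Cons by auto
 qed simp
 moreover have "set (R r) \<subseteq> {1..<base}" using Loop.prems by (auto simp: wf_regs_def)
 ultimately show ?case using Loop.prems by simp
qed auto

lemma comp_correct:
 "[| wfp p; wf_regs R; code_at C s (compile p s e) |] ==>
   (fstep C ^^ cost p R) (s, R) = (e, exec p R)"
proof (induction p arbitrary: s e R)
 case Skip
 then show ?case by (simp add: fstep_at[of _ _ _ "[]"])
next
 case (Push r a)
 then show ?case by (simp add: fstep_at[of _ _ _ "[]"])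
next
 case (Pop r)
 then show ?case by (simp add: fstep_at[of _ _ _ "[]"])
next
 case (Seq p q)
 have "(fstep C ^^ cost p R) (s, R) = (s + clen p, exec p R)"
  using Seq.prems by (intro Seq.IH(1)) (auto simp: at_append)
 moreover have "(fstep C ^^ cost q (exec p R)) (s + clen p, exec p R) = (e, exec q (exec p R))"
  using Seq.prems by (intro Seq.IH(2)) (auto simp: at_append length_comp wf_regs_exec)
 ultimately show ?case by (simp add: funpow_add add.commute[of "cost p R"])
next
 case (IfTop r a p q)
 have h: "fstep C (s, R) = (if hd0 (R r) = a then s + 1 else s + 1 + clen p, R)"
  using IfTop.prems by (simp add: fstep_at)
 have a: "code_at C (s + 1) (compile p (s + 1) e)" "code_at C (s + 1 + clen p) (compile q (s + 1 + clen p) e)"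
  using IfTop.prems by (auto simp: at_Cons at_append length_comp)
 have "(fstep C ^^ cost p R) (s + 1, R) = (e, exec p R)" "(fstep C ^^ cost q R) (s + 1 + clen p, R) = (e, exec q R)"
  using IfTop.prems a by (auto intro!: IfTop.IH)
 then show ?case using h by (simp add: funpow_swap1)
next
 case (Loop r S p)
 let ?j = "\<lambda>x. if x \<noteq> 0 \<and> S x then s + 1 else e"
 have h: "fstep C (s, R) = (?j (hd0 (R r)), R)" for R
  using Loop.prems by (simp add: fstep_at)
 have a: "code_at C (s + 1) (compile p (s + 1) (s + 1 + clen p))" "code_at C (s + 1 + clen p) [IAct r True (\<lambda>_. s)]"
  using Loop.prems by (auto simp: at_Cons at_append length_comp)
 have b: "fstep C (s + 1 + clen p, R) = (s, R(r := tl (R r)))" for R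
  using a(2) by (simp add: fstep_at)
 have *: "(fstep C ^^ (1 + lpc (exec p) (cost p) r S xs R)) (s, R) = (e, lp (exec p) r S xs R)"
  if "wf_regs R" "R r = xs" for xs R
  using that
 proof (induction xs arbitrary: R)
  case Nil
  then show ?case using h[of R] by simp
 next
  case (Cons x xs)
  have x: "x \<noteq> 0" using Cons.prems by (auto simp: wf_regs_def dest!: spec[of _ r])
  show ?case
  proof (cases "S x")
   case False
   then show ?thesis using h[of R] Cons.prems by simp
  next
   case True
   let ?R = "(exec p R)(r := xs)"
   have "exec p R r = x # xs" using exec_unchanged[of r p R] Loop.prems(1) Cons.prems by simp
   then have pop: "fstep C (s + 1 + clen p, exec p R) = (s, ?R)" using b by simp
   have body: "(fstep C ^^ cost p R) (s + 1, R) = (s + 1 + clen p, exec p R)"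
    using Loop.prems Cons.prems a(1) by (intro Loop.IH) auto
   have "wf_regs ?R"
   proof (rule wf_regs_upd[OF wf_regs_exec])
    show "set xs \<subseteq> {1..<base}" using Cons.prems by (auto simp: wf_regs_def dest!: spec[of _ r])
   qed (use Loop.prems Cons.prems in auto)
   then have ih: "(fstep C ^^ (1 + lpc (exec p) (cost p) r S xs ?R)) (s, ?R) = (e, lp (exec p) r S xs ?R)"
    by (intro Cons.IH) simp_all
   have "fstep C (s, R) = (s + 1, R)" using h[of R] Cons.prems x True by simp
   then have A: "(fstep C ^^ (1 + lpc (exec p) (cost p) r S xs ?R + (1 + (cost p R + 1)))) (s, R)
     = (e, lp (exec p) r S xs ?R)"
    by (simp only: funpow_add comp_apply funpow_1 body pop) (use ih in simp)
   have B: "1 + lpc (exec p) (cost p) r S (x # xs) R = 1 + lpc (exec p) (cost p) r S xs ?R + (1 + (cost p R + 1))"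
    using True by simp
   have D: "lp (exec p) r S (x # xs) R = lp (exec p) r S xs ?R"
    using True by simp
   show ?thesis unfolding B D by (rule A)
  qed
 qed
 show ?case unfolding exec.simps cost.simps by (rule *[OF Loop.prems(2) refl])
qed

section \<open>Polynomial running time\<close>

definition measure_on :: "nat set => regs => nat" where
 "measure_on A R = (\<Sum>r\<in>A. length (R r))"

abbreviation total_length :: "regs => nat" where
 "total_length \<equiv> measure_on {..<nreg}"

abbreviation tmp :: nat where "tmp \<equiv> 15"

lemma measure_on_upd:
 assumes "finite A"
 shows "measure_on A (R(r := xs)) + (if r \<in> A then length (R r) else 0)
  = measure_on A R + (if r \<in> A then length xs else 0)"
proof (cases "r \<in> A")
 case True
 have "(\<Sum>s\<in>A - {r}. length ((R(r := xs)) s)) = (\<Sum>s\<in>A - {r}. length (R s))"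
  by (intro sum.cong) auto
 then show ?thesis using True assms
  by (simp add: measure_on_def sum.remove[of A r])
next
 case False
 then show ?thesis by (auto simp: measure_on_def intro!: sum.cong)
qed

lemma measure_on_notin [simp]: "finite A ==> r \<notin> A ==> measure_on A (R(r := xs)) = measure_on A R"
 using measure_on_upd[of A R r xs] by simp

lemma length_le_measure_on: "finite A ==> r \<in> A ==> length (R r) \<le> measure_on A R"
 using member_le_sum[of r A "\<lambda>r. length (R r)"] by (simp add: measure_on_def)

lemma measure_on_mono: "finite B ==> A \<subseteq> B ==> measure_on A R \<le> measure_on B R"
 by (simp add: measure_on_def sum_mono2)

lemma measure_on_Push: "finite A ==> measure_on A (R(r := a # R r)) \<le> measure_on A R + 1"
 using measure_on_upd[of A R r "a # R r"] by (simp split: if_splits)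

lemma measure_on_upd_le:
 "finite A ==> length xs \<le> length (R r) ==> measure_on A (R(r := xs)) \<le> measure_on A R"
 using measure_on_upd[of A R r xs] by (simp split: if_splits)

lemma measure_on_exec: "finite A ==> wfp p ==> measure_on A (exec p R) \<le> measure_on A R + cost p R"
proof (induction p arbitrary: R)
 case (Push r a)
 then show ?case using measure_on_Push[of A R r a] by simp
next
 case (Pop r)
 have "measure_on A (R(r := tl (R r))) \<le> measure_on A R"
  by (rule measure_on_upd_le[OF Pop(1)]) simp
 then show ?case by simp
next
 case (Seq p q)
 then have "measure_on A (exec p R) \<le> measure_on A R + cost p R"
  "measure_on A (exec q (exec p R)) \<le> measure_on A (exec p R) + cost q (exec p R)" by auto
 then show ?case by simp
next
 case (IfTop r a p q)
 then have "measure_on A (exec p R) \<le> measure_on A R + cost p R"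
  "measure_on A (exec q R) \<le> measure_on A R + cost q R" by auto
 then show ?case by auto
next
 case (Loop r S p)
 have "measure_on A (lp (exec p) r S xs R) \<le> measure_on A R + lpc (exec p) (cost p) r S xs R"
  if "R r = xs" for xs R
  using that
 proof (induction xs arbitrary: R)
  case (Cons x xs)
  have "exec p R r = x # xs" using exec_unchanged[of r p R] Loop.prems Cons.prems by simp
  then have "measure_on A ((exec p R)(r := xs)) \<le> measure_on A (exec p R)"
   by (intro measure_on_upd_le Loop.prems) simp
  moreover have "measure_on A (exec p R) \<le> measure_on A R + cost p R"
   using Loop by auto
  moreover have "measure_on A (lp (exec p) r S xs ((exec p R)(r := xs)))
   \<le> measure_on A ((exec p R)(r := xs)) + lpc (exec p) (cost p) r S xs ((exec p R)(r := xs))"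
   by (rule Cons.IH) simp
  ultimately show ?case by simp
 qed simp
 from this[of R "R r"] show ?case by simp
qed simp

text \<open>Linear cost and bounded growth, both measured on \<open>A\<close> only. A loop body may
  write long strings into registers outside \<open>A\<close>, for instance copies of registers in
  \<open>A\<close>, without making its next run more expensive.\<close>

definition light_by :: "nat => nat set => prog => bool" where
 "light_by K A p \<longleftrightarrow> (\<forall>R. wf_regs R --> R tmp = [] -->
   cost p R \<le> K * (measure_on A R + 1) \<and> measure_on A (exec p R) \<le> measure_on A R + K \<and> exec p R tmp = [])"

lemma light_byD:
 "light_by K A p ==> wf_regs R ==> R tmp = [] ==>
   cost p R \<le> K * (measure_on A R + 1) \<and> measure_on A (exec p R) \<le> measure_on A R + K \<and> exec p R tmp = []"
 by (simp add: light_by_def)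

definition light :: "nat set => prog => bool" where
 "light A p \<longleftrightarrow> wfp p \<and> (\<exists>K. light_by K A p)"

lemma lightI:
 assumes "wfp p" "!!R. [| wf_regs R; R tmp = [] |] ==> cost p R \<le> K * (measure_on A R + 1)"
  "!!R. [| wf_regs R; R tmp = [] |] ==> measure_on A (exec p R) \<le> measure_on A R + K"
  "!!R. [| wf_regs R; R tmp = [] |] ==> exec p R tmp = []"
 shows "light A p"
 using assms unfolding light_def light_by_def by blast

lemma light_wfp: "light A p ==> wfp p"
 by (simp add: light_def)

lemma light_const:
 assumes "finite A" "wfp p" "!!R. cost p R \<le> K" "tmp \<notin> mods p"
 shows "light A p"
proof (rule lightI[of _ K])
 fix R
 have "K \<le> K * (measure_on A R + 1)" by simp
 then show "cost p R \<le> K * (measure_on A R + 1)" using assms(3)[of R] by linarith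
 show "measure_on A (exec p R) \<le> measure_on A R + K"
  using measure_on_exec[OF assms(1,2), of R] assms(3)[of R] by linarith
 assume "R tmp = []"
 then show "exec p R tmp = []" using exec_unchanged[OF assms(4)] by simp
qed (rule assms)

lemma light_Skip [intro]: "finite A ==> light A Skip"
 by (rule light_const[of _ _ 1]) auto

lemma light_Push [intro]: "[| finite A; r < nreg; r \<noteq> tmp; 0 < a; a < base |] ==> light A (Push r a)"
 by (rule light_const[of _ _ 1]) auto

lemma light_Pop [intro]: "[| finite A; r < nreg; r \<noteq> tmp |] ==> light A (Pop r)"
 by (rule light_const[of _ _ 1]) auto

lemma light_Seq [intro]:
 assumes "light A p" "light A q"
 shows "light A (Seq p q)"
proof -
 from assms obtain K J where K: "light_by K A p" and J: "light_by J A q" by (auto simp: light_def)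
 show ?thesis
 proof (rule lightI[of _ "K + J + J * K"])
  show "wfp (Seq p q)" using assms by (simp add: light_def)
  fix R assume s: "wf_regs R" "R tmp = []"
  note 1 = light_byD[OF K s]
  then have 2: "cost q (exec p R) \<le> J * (measure_on A (exec p R) + 1)"
   "measure_on A (exec q (exec p R)) \<le> measure_on A (exec p R) + J" "exec q (exec p R) tmp = []"
   using light_byD[OF J wf_regs_exec] s assms(1) by (auto simp: light_def)
  have "J * (measure_on A (exec p R) + 1) \<le> J * (measure_on A R + K + 1)"
   using 1 by (intro mult_le_mono2) simp
  also have "\<dots> \<le> (J + J * K) * (measure_on A R + 1)" by (simp add: algebra_simps)
  finally show "cost (Seq p q) R \<le> (K + J + J * K) * (measure_on A R + 1)"
   using 1 2(1) by (simp add: algebra_simps)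
  show "measure_on A (exec (Seq p q) R) \<le> measure_on A R + (K + J + J * K)"
   using 1 2(2) by simp
  show "exec (Seq p q) R tmp = []" using 2 by simp
 qed
qed

lemma light_IfTop [intro]:
 assumes "light A p" "light A q" "r < nreg"
 shows "light A (IfTop r a p q)"
proof -
 from assms obtain K J where K: "light_by K A p" and J: "light_by J A q" by (auto simp: light_def)
 show ?thesis
 proof (rule lightI[of _ "K + J + 1"])
  show "wfp (IfTop r a p q)" using assms by (simp add: light_def)
  fix R assume s: "wf_regs R" "R tmp = []"
  note 1 = light_byD[OF K s] and 2 = light_byD[OF J s]
  show "cost (IfTop r a p q) R \<le> (K + J + 1) * (measure_on A R + 1)"
   using 1 2 by (simp add: algebra_simps)
  show "measure_on A (exec (IfTop r a p q) R) \<le> measure_on A R + (K + J + 1)"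
   using 1 2 by simp
  show "exec (IfTop r a p q) R tmp = []" using 1 2 by simp
 qed
qed

text \<open>Powers of a number that is at least 2 absorb constants and are closed under composition,
  so one exponent is enough. The scratch register \<open>tmp\<close> has to be empty between
  programs.\<close>

definition tame :: "prog => bool" where
 "tame p \<longleftrightarrow> wfp p \<and> (\<exists>k. \<forall>R. wf_regs R --> R tmp = [] -->
   cost p R \<le> (total_length R + 2) ^ k \<and> exec p R tmp = [])"

lemma tameI:
 assumes "wfp p" "!!R. [| wf_regs R; R tmp = [] |] ==> cost p R \<le> (total_length R + 2) ^ k"
  "!!R. [| wf_regs R; R tmp = [] |] ==> exec p R tmp = []"
 shows "tame p"
 using assms unfolding tame_def by blast

lemma tame_Seq [intro]:
 assumes "tame p" "tame q"
 shows "tame (Seq p q)"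
proof -
 from assms obtain k l where k: "\<forall>R. wf_regs R --> R tmp = [] -->
   cost p R \<le> (total_length R + 2) ^ k \<and> exec p R tmp = []"
  and l: "\<forall>R. wf_regs R --> R tmp = [] -->
   cost q R \<le> (total_length R + 2) ^ l \<and> exec q R tmp = []"
  unfolding tame_def by (elim exE conjE)
 have w: "wfp p" "wfp q" using assms by (auto simp: tame_def)
 show ?thesis
 proof (rule tameI[of _ "k + (k + 2) * l + 1"])
  show "wfp (Seq p q)" using w by simp
  fix R assume s: "wf_regs R" "R tmp = []"
  define n where "n = total_length R + 2"
  define m where "m = total_length (exec p R) + 2"
  have n2: "2 \<le> n" by (simp add: n_def)
  have 1: "cost p R \<le> n ^ k" "exec p R tmp = []" using k[rule_format, OF s] by (auto simp only: n_def)
  have 2: "cost q (exec p R) \<le> m ^ l" "exec q (exec p R) tmp = []"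
   using l[rule_format, OF wf_regs_exec[OF w(1) s(1)] 1(2)] by (auto simp only: m_def)
  have ge: "1 \<le> n ^ i" for i using n2 by (intro one_le_power) simp
  have double: "n ^ i + n ^ i \<le> n ^ Suc i" for i
   using mult_le_mono1[OF n2, of "n ^ i"] by (simp only: power_Suc mult_2)
  have "m \<le> n + n ^ k"
   using measure_on_exec[OF _ w(1), of "{..<nreg}" R] 1 by (simp add: n_def m_def)
  also have "\<dots> \<le> n ^ (k + 1) + n ^ (k + 1)"
   using ge[of k] n2 by (intro add_mono) (simp_all add: mult_le_mono)
  also have "\<dots> \<le> n ^ (k + 2)" using double[of "Suc k"] by (simp only: add_2_eq_Suc' Suc_eq_plus1[symmetric])
  finally have "m ^ l \<le> (n ^ (k + 2)) ^ l" by (rule power_mono) simp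
  then have "m ^ l \<le> n ^ ((k + 2) * l)" by (simp only: power_mult)
  then have "cost p R + cost q (exec p R) \<le> n ^ k + n ^ ((k + 2) * l)"
   using 1(1) 2(1) by linarith
  also have "\<dots> \<le> n ^ (k + (k + 2) * l) + n ^ (k + (k + 2) * l)"
   using n2 by (intro add_mono power_increasing) auto
  also have "\<dots> \<le> n ^ (k + (k + 2) * l + 1)" using double[of "k + (k + 2) * l"] by (simp only: Suc_eq_plus1)
  finally show "cost (Seq p q) R \<le> (total_length R + 2) ^ (k + (k + 2) * l + 1)"
   by (simp only: cost.simps n_def)
  show "exec (Seq p q) R tmp = []" using 2 by simp
 qed
qed

lemma poly_le_power:
 fixes K n :: nat
 assumes "x \<le> K * (n + 1) ^ 2"
 shows "x \<le> (n + 2) ^ (K + 2)"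
proof -
 have "K < 2 ^ K" by (rule less_exp)
 then have "K \<le> (n + 2) ^ K" using power_mono[of 2 "n + 2" K] by simp
 moreover have "(n + 1) ^ 2 \<le> (n + 2) ^ 2" by (rule power_mono) simp_all
 ultimately have "K * (n + 1) ^ 2 \<le> (n + 2) ^ K * (n + 2) ^ 2" by (rule mult_le_mono)
 then show ?thesis using assms by (simp only: power_add)
qed

lemma tame_light:
 assumes "light A p" "A \<subseteq> {..<nreg}"
 shows "tame p"
proof -
 from assms(1) obtain K where K: "light_by K A p" by (auto simp: light_def)
 show ?thesis
 proof (rule tameI[of _ "K + 2"])
  fix R assume s: "wf_regs R" "R tmp = []"
  show "exec p R tmp = []" using light_byD[OF K s] by simp
  have "K * (measure_on A R + 1) \<le> K * (total_length R + 1)"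
   using measure_on_mono[OF _ assms(2), of R] by (intro mult_le_mono2) simp
  also have "\<dots> \<le> K * (total_length R + 1)\<^sup>2" by (intro mult_le_mono2) (simp add: power2_eq_square)
  finally have "cost p R \<le> K * (total_length R + 1)\<^sup>2" using light_byD[OF K s] by linarith
  then show "cost p R \<le> (total_length R + 2) ^ (K + 2)" by (rule poly_le_power)
 qed (rule light_wfp[OF assms(1)])
qed

text \<open>Each iteration enlarges the measure by at most \<open>K\<close>, so the iterations
  together cost a quadratic amount: loops over light bodies are tame.\<close>

lemma light_lp:
 assumes w: "wfp p" "r \<notin> mods p" and A: "finite A"
  and K: "light_by K A p"
  and r: "r \<noteq> tmp"
 shows "[| wf_regs R; R tmp = []; R r = xs |] ==>
   lpc (exec p) (cost p) r S xs R \<le> length xs * (2 + K * (measure_on A R + length xs * K + 1)) \<and>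
   lp (exec p) r S xs R tmp = []"
proof (induction xs arbitrary: R)
 case (Cons x xs)
 let ?R = "(exec p R)(r := xs)"
 note 1 = light_byD[OF K Cons.prems(1,2)]
 have wr: "set xs \<subseteq> {1..<base}" using Cons.prems by (auto simp: wf_regs_def dest!: spec[of _ r])
 then have w2: "wf_regs ?R" using wf_regs_exec[OF w(1) Cons.prems(1)] by (simp add: wf_regs_upd)
 have "exec p R r = x # xs" using exec_unchanged[OF w(2), of R] Cons.prems by simp
 then have "measure_on A ?R \<le> measure_on A (exec p R)" by (intro measure_on_upd_le A) simp
 then have m: "measure_on A ?R \<le> measure_on A R + K" using 1 by simp
 have IH: "lpc (exec p) (cost p) r S xs ?R \<le> length xs * (2 + K * (measure_on A ?R + length xs * K + 1)) \<and>
   lp (exec p) r S xs ?R tmp = []"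
  by (rule Cons.IH) (use w2 1 r in auto)
 have "measure_on A ?R + length xs * K + 1 \<le> measure_on A R + length (x # xs) * K + 1"
  using m by simp
 then have "length xs * (2 + K * (measure_on A ?R + length xs * K + 1))
   \<le> length xs * (2 + K * (measure_on A R + length (x # xs) * K + 1))"
  by (intro mult_le_mono2 add_left_mono)
 moreover have "K * (measure_on A R + 1) \<le> K * (measure_on A R + length (x # xs) * K + 1)"
  by (intro mult_le_mono2) simp
 ultimately have "2 + cost p R + lpc (exec p) (cost p) r S xs ?R
   \<le> (2 + K * (measure_on A R + length (x # xs) * K + 1)) + length xs * (2 + K * (measure_on A R + length (x # xs) * K + 1))"
  using IH 1 by linarith
 also have "\<dots> = length (x # xs) * (2 + K * (measure_on A R + length (x # xs) * K + 1))" by simp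
 finally show ?case using IH Cons.prems(2) by simp
qed simp

lemma tame_Loop:
 assumes p: "light A p" and A: "A \<subseteq> {..<nreg}" and r: "r \<notin> mods p" "r < nreg" "r \<noteq> tmp"
 shows "tame (Loop r S p)"
proof -
 from p obtain K where K: "light_by K A p" by (auto simp: light_def)
 have fA: "finite A" using A finite_subset by blast
 note lp = light_lp[OF light_wfp[OF p] r(1) fA K r(3)]
 show ?thesis
 proof (rule tameI[of _ "(3 + K + K * K) + 2"])
  show "wfp (Loop r S p)" using light_wfp[OF p] r by simp
  fix R assume s: "wf_regs R" "R tmp = []"
  let ?n = "total_length R" and ?l = "length (R r)"
  note b = lp[OF s refl, of S]
  then show "exec (Loop r S p) R tmp = []" by simp
  have l: "?l \<le> ?n" using r by (intro length_le_measure_on) auto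
  have m: "measure_on A R \<le> ?n" using A by (intro measure_on_mono) auto
  have "?l * (2 + K * (measure_on A R + ?l * K + 1)) \<le> ?n * (2 + K * (?n + ?n * K + 1))"
   using l m by (intro mult_le_mono add_mono order_refl)
  then have "cost (Loop r S p) R \<le> 1 + ?n * (2 + K * (?n + ?n * K + 1))" using b by simp
  also have "\<dots> \<le> (3 + K + K * K) * (?n + 1) ^ 2" by (simp add: power2_eq_square algebra_simps)
  finally show "cost (Loop r S p) R \<le> (?n + 2) ^ ((3 + K + K * K) + 2)" by (rule poly_le_power)
 qed
qed

section \<open>A library of program fragments\<close>

abbreviation ifs :: "nat => (nat => prog) => nat list => prog" where
 "ifs r p xs \<equiv> foldr (\<lambda>a q. IfTop r a (p a) q) xs Skip"

definition branch :: "nat => (nat => prog) => prog" where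
 "branch r p = ifs r p [0..<base]"

lemma hd0_less: "wf_regs R ==> hd0 (R r) < base"
 using base_gt by (cases "R r") (auto simp: wf_regs_def dest!: spec[of _ r])

lemma exec_branch: "wf_regs R ==> exec (branch r p) R = exec (p (hd0 (R r))) R"
proof -
 have "hd0 (R r) \<in> set xs ==>
  exec (ifs r p xs) R = exec (p (hd0 (R r))) R" for xs
  by (induction xs) auto
 then show "wf_regs R ==> ?thesis" using hd0_less[of R r] by (simp add: branch_def)
qed

lemma wfp_branch: "r < nreg ==> (!!a. a < base ==> wfp (p a)) ==> wfp (branch r p)"
proof -
 assume "r < nreg"
 then have "(!!a. a \<in> set xs ==> wfp (p a)) ==> wfp (ifs r p xs)" for xs
  by (induction xs) auto
 note * = this
 show "(!!a. a < base ==> wfp (p a)) ==> wfp (branch r p)"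
  unfolding branch_def by (rule *) simp
qed

lemma mods_branch: "mods (branch r p) = (\<Union>a<base. mods (p a))"
proof -
 have "mods (ifs r p xs) = (\<Union>a\<in>set xs. mods (p a))" for xs
  by (induction xs) auto
 then show ?thesis by (simp add: branch_def lessThan_atLeast0)
qed

lemma light_branch [intro]:
 "[| finite A; r < nreg; !!a. a < base ==> light A (p a) |] ==> light A (branch r p)"
proof -
 assume "finite A" "r < nreg"
 then have "(!!a. a \<in> set xs ==> light A (p a)) ==> light A (ifs r p xs)" for xs
  by (induction xs) auto
 note * = this
 show "(!!a. a < base ==> light A (p a)) ==> light A (branch r p)"
  unfolding branch_def by (rule *) simp
qed

lemma cost_branch:
 assumes "!!a. a < base ==> cost (p a) R \<le> c"
 shows "cost (branch r p) R \<le> base + c + 1"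
proof -
 have "(!!a. a \<in> set xs ==> cost (p a) R \<le> c) ==>
  cost (ifs r p xs) R \<le> length xs + c + 1" for xs
  by (induction xs) fastforce+
 from this[of "[0..<base]"] assms show ?thesis by (simp add: branch_def)
qed

definition pushs :: "nat => nat list => prog" where
 "pushs r xs = foldr (\<lambda>a q. Push r a ;; q) xs Skip"

lemma exec_pushs [simp]: "exec (pushs r xs) R = R(r := rev xs @ R r)"
proof (induction xs arbitrary: R)
 case Nil
 then show ?case by (simp add: pushs_def)
next
 case (Cons a xs)
 have "exec (pushs r (a # xs)) R = exec (pushs r xs) (R(r := a # R r))" by (simp add: pushs_def)
 then show ?case by (simp add: Cons)
qed

lemma light_pushs [intro]:
 "[| finite A; r < nreg; r \<noteq> tmp; set xs \<subseteq> {1..<base} |] ==> light A (pushs r xs)"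
proof (induction xs)
 case (Cons a xs)
 then have "light A (Push r a ;; pushs r xs)" by (intro light_Seq light_Push) auto
 then show ?case by (simp add: pushs_def)
qed (auto simp: pushs_def)

lemma mods_pushs: "mods (pushs r xs) \<subseteq> {r}"
 by (induction xs) (auto simp: pushs_def)

definition echo :: "nat => nat => prog" where
 "echo s r = branch s (\<lambda>a. if a = 0 then Skip else Push r a)"

lemma exec_echo: "[| wf_regs R; R s = x # xs |] ==> exec (echo s r) R = R(r := x # R r)"
proof -
 assume a: "wf_regs R" "R s = x # xs"
 then have "x \<noteq> 0" by (auto simp: wf_regs_def dest!: spec[of _ s])
 then show ?thesis using a by (simp add: echo_def exec_branch)
qed

lemma cost_echo: "cost (echo s r) R \<le> base + 2"
 using cost_branch[of "\<lambda>a. if a = 0 then Skip else Push r a" R 1 s] by (simp add: echo_def)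

lemma mods_echo: "mods (echo s r) \<subseteq> {r}"
 by (auto simp: echo_def mods_branch split: if_splits)

lemma wfp_echo [simp]: "s < nreg ==> r < nreg ==> wfp (echo s r)"
 unfolding echo_def by (rule wfp_branch) auto

lemma light_echo [intro]: "[| finite A; s < nreg; r < nreg; r \<noteq> tmp |] ==> light A (echo s r)"
 unfolding echo_def by (rule light_branch) auto

abbreviation every :: "nat => bool" where "every \<equiv> \<lambda>_. True"

lemma lp_echo:
 assumes "s \<noteq> r"
 shows "[| wf_regs R; R s = xs @ ys; \<forall>x\<in>set xs. S x; ys = [] \<or> \<not> S (hd ys); s < nreg; r < nreg |] ==>
  lp (exec (echo s r)) s S (xs @ ys) R = R(s := ys, r := rev xs @ R r)"
proof (induction xs arbitrary: R)
 case Nil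
 then show ?case by (cases ys) (auto simp: fun_eq_iff)
next
 case (Cons x xs)
 let ?R = "R(s := xs @ ys, r := x # R r)"
 have e: "(exec (echo s r) R)(s := xs @ ys) = ?R"
  using Cons.prems assms by (simp add: exec_echo fun_upd_twist)
 have "wf_regs (exec (echo s r) R)" using Cons.prems by (intro wf_regs_exec) simp_all
 moreover have "set (xs @ ys) \<subseteq> {1..<base}" using Cons.prems(1,2)
  by (auto simp: wf_regs_def dest!: spec[of _ s])
 ultimately have "wf_regs ?R" unfolding e[symmetric] by (rule wf_regs_upd)
 then have "lp (exec (echo s r)) s S (xs @ ys) ?R = ?R(s := ys, r := rev xs @ ?R r)"
  by (rule Cons.IH) (use Cons.prems assms in auto)
 then show ?case using Cons.prems assms by (auto simp: e[simplified] fun_eq_iff)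
qed

lemma exec_Loop_echo:
 "[| wf_regs R; s \<noteq> r; s < nreg; r < nreg |] ==> exec (Loop s every (echo s r)) R = R(s := [], r := rev (R s) @ R r)"
 using lp_echo[of s r R "R s" "[]" every] by simp

lemma exec_Loop_echo_prefix:
 "[| wf_regs R; s \<noteq> r; s < nreg; r < nreg; R s = xs @ y # ys; \<forall>x\<in>set xs. S x; \<not> S y |] ==>
  exec (Loop s S (echo s r)) R = R(s := y # ys, r := rev xs @ R r)"
 using lp_echo[of s r R xs "y # ys" S] by simp

lemma lpc_const:
 assumes "!!R. g R \<le> c"
 shows "lpc f g r S xs R \<le> length xs * (2 + c)"
proof (induction xs arbitrary: R)
 case (Cons x xs)
 have "g R \<le> c" by (rule assms)
 then show ?case using Cons[of "(f R)(r := xs)"] by simp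
qed simp

lemma cost_Loop_const:
 assumes "!!R. cost p R \<le> c"
 shows "cost (Loop r S p) R \<le> 1 + length (R r) * (2 + c)"
 using lpc_const[of "cost p" c "exec p" r S "R r" R] assms by simp

text \<open>Every iteration removes a symbol from \<open>s \<in> A\<close> and adds at most one to
  \<open>t\<close>, so the measure does not grow and the cost is linear. Such a loop is light itself
  and may occur inside another loop.\<close>

lemma light_Loop_move:
 assumes p: "!!R. cost p R \<le> c" "wfp p" "mods p \<subseteq> {t}" and A: "finite A" "s \<in> A" and st: "s \<noteq> t" "s < nreg" "t \<noteq> tmp" "s \<noteq> tmp"
  and le: "!!R. length (exec p R t) \<le> length (R t) + 1"
 shows "light A (Loop s S p)"
proof (rule lightI[of _ "3 + c"])
 show "wfp (Loop s S p)" using p st by auto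
 fix R assume "wf_regs R" "R tmp = []"
 have "cost (Loop s S p) R \<le> 1 + length (R s) * (2 + c)" by (rule cost_Loop_const[OF p(1)])
 also have "\<dots> \<le> 1 + measure_on A R * (2 + c)"
  using length_le_measure_on[OF A] by (intro add_left_mono mult_le_mono1)
 also have "\<dots> \<le> (3 + c) * (measure_on A R + 1)" by (simp add: algebra_simps)
 finally show "cost (Loop s S p) R \<le> (3 + c) * (measure_on A R + 1)" .
 have "tmp \<notin> mods (Loop s S p)" using p(3) st by auto
 from exec_unchanged[OF this] \<open>R tmp = []\<close> show "exec (Loop s S p) R tmp = []" by simp
 have "measure_on A (lp (exec p) s S xs R) \<le> measure_on A R" if "R s = xs" for xs R
  using that
 proof (induction xs arbitrary: R)
  case (Cons x xs)
  have e: "exec p R = R(t := exec p R t)"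
   using exec_unchanged[of _ p R] p(3) by (auto simp: fun_eq_iff)
  have "measure_on A (exec p R) \<le> measure_on A R + 1"
   using measure_on_upd[OF A(1), of R t "exec p R t"] le[of R] e by (auto split: if_splits)
  moreover have "exec p R s = x # xs" using exec_unchanged[of s p R] p(3) st Cons.prems by auto
  then have "measure_on A ((exec p R)(s := xs)) + 1 = measure_on A (exec p R)"
   using measure_on_upd[OF A(1), of "exec p R" s xs] A by simp
  moreover have "measure_on A (lp (exec p) s S xs ((exec p R)(s := xs))) \<le> measure_on A ((exec p R)(s := xs))"
   by (rule Cons.IH) simp
  ultimately show ?case by simp
 qed simp
 from this[of R, OF refl] show "measure_on A (exec (Loop s S p) R) \<le> measure_on A R + (3 + c)"
  by simp
qed

lemma light_Loop_echo [intro]: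
 "[| finite A; s \<in> A; s \<noteq> t; s < nreg; t < nreg; t \<noteq> tmp; s \<noteq> tmp |] ==> light A (Loop s S (echo s t))"
proof (rule light_Loop_move[of _ "base + 2" t])
 fix R
 have "exec (echo s t) R = R \<or> (\<exists>a. exec (echo s t) R = R(t := a # R t))"
 proof -
  have "exec (ifs s (\<lambda>a. if a = 0 then Skip else Push t a) xs) R = R \<or>
   (\<exists>a. exec (ifs s (\<lambda>a. if a = 0 then Skip else Push t a) xs) R = R(t := a # R t))" for xs
   by (induction xs) auto
  then show ?thesis by (simp add: echo_def branch_def)
 qed
 then show "length (exec (echo s t) R t) \<le> length (R t) + 1" by auto
qed (use mods_echo cost_echo in auto)

lemma light_Loop_Push [intro]:
 "[| finite A; s \<in> A; s \<noteq> t; s < nreg; t < nreg; t \<noteq> tmp; s \<noteq> tmp; 0 < a; a < base |] ==> light A (Loop s S (Push t a))"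
 by (rule light_Loop_move[of _ 1 t]) auto

lemma light_Loop_Skip [intro]:
 "[| finite A; s \<in> A; s < nreg; s \<noteq> tmp |] ==> light A (Loop s S Skip)"
 by (rule light_Loop_move[of _ 1 "Suc s + 15"]) auto

lemma exec_Loop_Skip: "exec (Loop s every Skip) R = R(s := [])"
proof -
 have "R s = xs ==> lp (exec Skip) s every xs R = R(s := [])" for xs
  by (induction xs arbitrary: R) (auto simp: fun_eq_iff)
 then show ?thesis by simp
qed

definition clear :: "nat => prog" where
 "clear s = Loop s every Skip"

lemma exec_clear [simp]: "exec (clear s) R = R(s := [])"
 unfolding clear_def by (rule exec_Loop_Skip)

lemma light_clear [intro]: "[| finite A; s \<in> A; s < nreg; s \<noteq> tmp |] ==> light A (clear s)"
 unfolding clear_def by (rule light_Loop_Skip)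

definition shift :: "nat => nat => prog" where
 "shift s r = Loop s every (echo s r)"

lemma exec_shift:
 "[| wf_regs R; s \<noteq> r; s < nreg; r < nreg |] ==> exec (shift s r) R = R(s := [], r := rev (R s) @ R r)"
 unfolding shift_def by (rule exec_Loop_echo)

lemma light_shift [intro]:
 "[| finite A; s \<in> A; s \<noteq> t; s < nreg; t < nreg; t \<noteq> tmp; s \<noteq> tmp |] ==> light A (shift s t)"
 unfolding shift_def by (rule light_Loop_echo)

text \<open>A stack can be read only destructively. Its symbols are moved to \<open>tmp\<close> and
  back; on the way back, \<open>p\<close> sees each of them on top of \<open>tmp\<close>, and
  afterwards \<open>s\<close> is restored.\<close>

definition copying :: "nat => prog => prog" where
 "copying s p = Loop s every (echo s tmp) ;; Loop tmp every (echo tmp s ;; p)"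

lemma lp_copying:
 assumes p: "wfp p" "!!R x xs. wf_regs R ==> R tmp = x # xs ==> exec p R = R(r := g x # R r)"
  and r: "s \<noteq> r" "s \<noteq> tmp" "r \<noteq> tmp" "s < nreg" "r < nreg"
 shows "[| wf_regs R; R tmp = xs |] ==> lp (exec (echo tmp s ;; p)) tmp every xs R
  = R(tmp := [], s := rev xs @ R s, r := rev (map g xs) @ R r)"
proof (induction xs arbitrary: R)
 case Nil
 then show ?case by (auto simp: fun_eq_iff)
next
 case (Cons x xs)
 let ?R = "R(tmp := xs, s := x # R s, r := g x # R r)"
 have w: "wf_regs (exec (echo tmp s) R)" using Cons.prems r by (intro wf_regs_exec) (auto simp: nreg_def)
 moreover have "exec (echo tmp s) R = R(s := x # R s)" using Cons.prems by (rule exec_echo)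
 ultimately have "exec p (exec (echo tmp s) R) = R(s := x # R s, r := g x # R r)"
  using p(2)[of "R(s := x # R s)" x xs] Cons.prems r by simp
 then have e: "(exec (echo tmp s ;; p) R)(tmp := xs) = ?R"
  using r by (auto simp: fun_eq_iff)
 have "wf_regs (exec (echo tmp s ;; p) R)" using w p(1) by (simp add: wf_regs_exec)
 moreover have "set xs \<subseteq> {1..<base}" using Cons.prems(1,2)
  by (auto simp: wf_regs_def dest!: spec[of _ tmp])
 ultimately have "wf_regs ?R" unfolding e[symmetric] by (rule wf_regs_upd)
 then have "lp (exec (echo tmp s ;; p)) tmp every xs ?R
  = ?R(tmp := [], s := rev xs @ ?R s, r := rev (map g xs) @ ?R r)"
  by (rule Cons.IH) (use r in auto)
 then show ?case unfolding lp_Cons if_True e using r by (auto simp: fun_eq_iff)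
qed

lemma exec_copying:
 assumes p: "wfp p" "!!R x xs. wf_regs R ==> R tmp = x # xs ==> exec p R = R(r := g x # R r)"
  and r: "s \<noteq> r" "s \<noteq> tmp" "r \<noteq> tmp" "s < nreg" "r < nreg"
  and s: "wf_regs R" "R tmp = []"
 shows "exec (copying s p) R = R(r := map g (R s) @ R r)"
proof -
 let ?R = "R(s := [], tmp := rev (R s))"
 have 1: "exec (Loop s every (echo s tmp)) R = ?R"
  using exec_Loop_echo[of R s tmp] r s by (simp add: nreg_def)
 have "wf_regs (exec (Loop s every (echo s tmp)) R)"
  using r s mods_echo[of s tmp] by (intro wf_regs_exec) (auto simp: nreg_def)
 then have "wf_regs ?R" unfolding 1 .
 note lp = lp_copying[OF p r this]
 have "lp (exec (echo tmp s ;; p)) tmp every (rev (R s)) ?R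
   = ?R(tmp := [], s := rev (rev (R s)) @ ?R s, r := rev (map g (rev (R s))) @ ?R r)"
  by (rule lp) simp_all
 moreover have "exec (copying s p) R = lp (exec (echo tmp s ;; p)) tmp every (rev (R s)) ?R"
  unfolding copying_def exec.simps(4,6) 1[unfolded exec.simps(6)] by simp
 ultimately show ?thesis using r s by (auto simp: fun_eq_iff rev_map)
qed

lemma light_copying:
 assumes p: "wfp p" "!!R x xs. wf_regs R ==> R tmp = x # xs ==> exec p R = R(r := g x # R r)"
   "!!R. cost p R \<le> c" "mods p \<subseteq> {r}"
  and r: "s \<noteq> r" "s \<noteq> tmp" "r \<noteq> tmp" "s < nreg" "r < nreg" and A: "finite A" "s \<in> A" "r \<notin> A"
 shows "light A (copying s p)"
proof (rule lightI[of _ "12 + 2 * base + c"])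
 show "wfp (copying s p)" using p r mods_echo[of s tmp] mods_echo[of tmp s]
  by (auto simp: copying_def nreg_def)
 fix R assume s: "wf_regs R" "R tmp = []"
 note e = exec_copying[OF p(1,2) r s, simplified]
 show "measure_on A (exec (copying s p) R) \<le> measure_on A R + (12 + 2 * base + c)"
  "exec (copying s p) R tmp = []" using A r s by (simp_all add: e)
 let ?R = "exec (Loop s every (echo s tmp)) R"
 have "?R tmp = rev (R s)"
  using exec_Loop_echo[of R s tmp] r s by (simp add: nreg_def)
 moreover have "cost (Loop s every (echo s tmp)) R \<le> 1 + length (R s) * (2 + (base + 2))"
  by (intro cost_Loop_const cost_echo)
 moreover have "cost (Loop tmp every (echo tmp s ;; p)) ?R \<le> 1 + length (?R tmp) * (2 + (base + 2 + c))"
  using add_mono[OF cost_echo p(3)] by (intro cost_Loop_const) (simp only: cost.simps)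
 ultimately have "cost (copying s p) R \<le> 2 + length (R s) * (8 + 2 * base + c)"
  by (simp add: copying_def algebra_simps)
 also have "\<dots> \<le> 2 + measure_on A R * (8 + 2 * base + c)"
  using length_le_measure_on[OF A(1,2)] by (intro add_left_mono mult_le_mono1)
 also have "\<dots> \<le> (12 + 2 * base + c) * (measure_on A R + 1)" by (simp add: algebra_simps)
 finally show "cost (copying s p) R \<le> (12 + 2 * base + c) * (measure_on A R + 1)" .
qed

definition copy :: "nat => nat => prog" where
 "copy s r = copying s (echo tmp r)"

definition copies :: "nat => nat => nat => prog" where
 "copies s a r = copying s (Push r a)"

lemma exec_copy:
 "[| wf_regs R; R tmp = []; s \<noteq> r; s \<noteq> tmp; r \<noteq> tmp; s < nreg; r < nreg |] ==>
  exec (copy s r) R = R(r := R s @ R r)"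
 using exec_copying[of "echo tmp r" r "\<lambda>x. x" s R]
 by (simp add: copy_def exec_echo nreg_def)

lemma exec_copies:
 "[| wf_regs R; R tmp = []; s \<noteq> r; s \<noteq> tmp; r \<noteq> tmp; s < nreg; r < nreg; 0 < a; a < base |] ==>
  exec (copies s a r) R = R(r := replicate (length (R s)) a @ R r)"
 using exec_copying[of "Push r a" r "\<lambda>x. a" s R]
 by (simp add: copies_def map_replicate_const)

lemma light_copy [intro]:
 "[| finite A; s \<in> A; r \<notin> A; s \<noteq> r; s \<noteq> tmp; r \<noteq> tmp; s < nreg; r < nreg |] ==> light A (copy s r)"
 unfolding copy_def
 by (rule light_copying[of _ r "\<lambda>x. x" "base + 2", OF _ _ cost_echo mods_echo]) (auto simp: exec_echo nreg_def)

lemma light_copies [intro]: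
 "[| finite A; s \<in> A; r \<notin> A; s \<noteq> r; s \<noteq> tmp; r \<noteq> tmp; s < nreg; r < nreg; 0 < a; a < base |] ==> light A (copies s a r)"
 unfolding copies_def
 by (rule light_copying[of _ r "\<lambda>x. a" 1]) auto

section \<open>Computed functions and reductions\<close>

definition words :: "nat list set" where "words = {w. set w \<subseteq> alphabet}"

definition computes :: "nat list set => prog => (nat list => nat list) => bool" where
 "computes D p f \<longleftrightarrow> tame p \<and> (\<forall>w\<in>D. exec p (init_regs w) = init_regs (f w))"

text \<open>Reductions are composed as programs, and only the composite is compiled, so Turing
  machines never have to be composed.\<close>

definition reduces :: "nat list set => nat list set => bool" where
 "reduces A B \<longleftrightarrow> (\<exists>p f. computes words p f \<and> f ` words \<subseteq> words \<and> (\<forall>w\<in>words. w \<in> A \<longleftrightarrow> f w \<in> B))"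

lemma computes_Seq:
 assumes "computes D p f" "computes E q g" "f ` D \<subseteq> E"
 shows "computes D (p ;; q) (g \<circ> f)"
 using assms by (auto simp: computes_def)

lemma reduces_trans:
 assumes "reduces A B" "reduces B C"
 shows "reduces A C"
proof -
 from assms(1) obtain p f where f: "computes words p f" "f ` words \<subseteq> words" "\<forall>w\<in>words. w \<in> A \<longleftrightarrow> f w \<in> B"
  unfolding reduces_def by (elim exE conjE)
 from assms(2) obtain q g where g: "computes words q g" "g ` words \<subseteq> words" "\<forall>w\<in>words. w \<in> B \<longleftrightarrow> g w \<in> C"
  unfolding reduces_def by (elim exE conjE)
 have "computes words (p ;; q) (g \<circ> f)" by (rule computes_Seq[OF f(1) g(1) f(2)])
 then show ?thesis unfolding reduces_def
  using f(2,3) g(2,3) by (intro exI[of _ "p ;; q"] exI[of _ "g \<circ> f"]) auto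
qed

lemma length_init_regs: "total_length (init_regs w) = length w"
proof -
 have "total_length (init_regs w) = (\<Sum>r<nreg. if r = 0 then length w else 0)"
  unfolding measure_on_def by (rule sum.cong) (auto simp: init_regs_def)
 then show ?thesis by (simp add: nreg_def)
qed

lemma power_bound:
 fixes l e :: nat
 shows "(l + 2) ^ e \<le> 3 ^ e * l ^ e + 3 ^ e"
proof (cases "l = 0")
 case True
 have "(2::nat) ^ e \<le> 3 ^ e" by (rule power_mono) simp_all
 then have "(l + 2) ^ e \<le> 3 ^ e" using True by (simp only: add_0)
 then show ?thesis by (rule trans_le_add2)
next
 case False
 have "(l + 2) ^ e \<le> (3 * l) ^ e" using False by (intro power_mono) simp_all
 then show ?thesis by (simp only: power_mult_distrib)
qed

lemma reduces_poly_reducible: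
 assumes "reduces A B"
 shows "poly_reducible A B"
proof -
 from assms obtain p f where f: "computes words p f" "\<forall>w\<in>words. w \<in> A \<longleftrightarrow> f w \<in> B"
  unfolding reduces_def by (elim exE conjE)
 then have p: "wfp p" by (auto simp: computes_def tame_def)
 from f(1) obtain k where k: "!!R. [| wf_regs R; R tmp = [] |] ==> cost p R \<le> (total_length R + 2) ^ k"
  unfolding computes_def tame_def by blast
 define C where "C = compile p 0 (clen p)"
 have lC: "length C = clen p" by (simp add: C_def length_comp)
 have wi: "wf_instr (length C) i" if "i \<in> set C" for i
  using wf_comp[OF p, of 0 "clen p" "clen p" i] that lC by (simp add: C_def)
 \<comment> \<open>\<open>N\<close> program steps take about \<open>N * (length w + N)\<close>
   machine steps, a square of the power with exponent \<open>k + 1\<close>; the constant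
   \<open>8 = 2 ^ 3\<close> accounts for the 3.\<close>
 define e where "e = 2 * (k + 1) + 3"
 have "\<exists>t \<le> 3 ^ e * length w ^ e + 3 ^ e. halts_with (tm_of C) w t (f w)" if w: "set w \<subseteq> alphabet" for w
 proof -
  have w': "set w \<subseteq> {1..<base}" using w by (auto simp: alphabet_def base_def)
  define N where "N = cost p (init_regs w)"
  have "(fstep C ^^ N) (0, init_regs w) = (clen p, exec p (init_regs w))"
   unfolding N_def by (rule comp_correct[OF p wf_init[OF w']]) (simp add: code_at_def C_def)
  moreover have "exec p (init_regs w) = init_regs (f w)"
   using f(1) w by (simp add: computes_def words_def)
  ultimately have "(fstep C ^^ N) (0, init_regs w) = (length C, init_regs (f w))" by (simp add: lC)
  from tm_of_halts[OF wi w' this] obtain t where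
   t: "t \<le> 2 + N * (2 * (length w + 1 + N) + 4)" "halts_with (tm_of C) w t (f w)" by blast
  define n where "n = length w + 2"
  define M where "M = n ^ (k + 1)"
  have "N \<le> n ^ k" using k[OF wf_init[OF w']] length_init_regs[of w]
   by (simp add: N_def n_def init_regs_def)
  also have "\<dots> \<le> M" unfolding M_def n_def by (intro power_increasing) auto
  finally have N: "N \<le> M" .
  have n: "n \<le> M" using power_increasing[of 1 "k + 1" n] by (simp add: M_def n_def)
  have "N * (2 * (length w + 1 + N) + 4) \<le> M * (6 * M)"
   using N n by (intro mult_le_mono) (simp_all add: n_def)
  moreover have "1 \<le> M * M" using n by (simp add: n_def Suc_le_eq)
  ultimately have "t \<le> 8 * (M * M)" using t(1) by linarith
  also have "\<dots> = 2 ^ 3 * n ^ (2 * (k + 1))" by (simp add: M_def power_add[symmetric] mult_2)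
  also have "\<dots> \<le> n ^ 3 * n ^ (2 * (k + 1))" by (intro mult_le_mono1 power_mono) (simp_all add: n_def)
  also have "\<dots> = (length w + 2) ^ e" by (simp only: power_add[symmetric] e_def n_def add.commute)
  also have "\<dots> \<le> 3 ^ e * length w ^ e + 3 ^ e" by (rule power_bound)
  finally show ?thesis using t(2) by blast
 qed
 then have "poly_time_computes (tm_of C) f"
  unfolding poly_time_computes_def using wf_tm_of[of C] wi by blast
 then show ?thesis using f(2) unfolding poly_reducible_def words_def by blast
qed

section \<open>Recognising encodings\<close>

declare bits.simps [simp del]

lemma bits_0 [simp]: "bits 0 = []"
 by (simp add: bits.simps)

lemma bits_even: "n > 0 ==> bits (2 * n) = 1 # bits n"
 by (subst bits.simps) simp

lemma bits_odd: "bits (Suc (2 * n)) = 2 # bits n"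
 by (subst bits.simps) simp

lemma bits_cases:
 obtains "n = 0" | k where "n = 2 * k" "k > 0" "k < n" | k where "n = Suc (2 * k)" "k < n"
proof (cases "even n")
 case True
 then obtain k where "n = 2 * k" by blast
 then show ?thesis using that(1) that(2)[of k] by (cases "k = 0") auto
next
 case False
 then obtain k where "n = Suc (2 * k)" by (auto elim: oddE)
 then show ?thesis using that(3)[of k] by auto
qed

lemma set_bits: "set (bits n) \<subseteq> {1, 2}"
proof (induction n rule: less_induct)
 case (less n)
 show ?case using less by (cases n rule: bits_cases) (auto simp: bits_even bits_odd)
qed

primrec bits_value :: "nat list => nat" where
 "bits_value [] = 0"
| "bits_value (x # xs) = x - 1 + 2 * bits_value xs"

lemma bits_value_bits: "bits_value (bits n) = n"
proof (induction n rule: less_induct)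
 case (less n)
 show ?case using less by (cases n rule: bits_cases) (auto simp: bits_even bits_odd)
qed

text \<open>The arithmetic behind renaming and behind auxiliary names: printing \<open>P\<close> one
  bits in front of a code is an injective map whose values leave a long initial segment of indices
  free.\<close>

lemma bits_ones: "bits (2 ^ P * (i + 1) - 1) = replicate P 2 @ bits i"
proof (induction P)
 case (Suc P)
 have "2 ^ Suc P * (i + 1) - 1 = Suc (2 * (2 ^ P * (i + 1) - 1))"
  by (cases "2 ^ P * (i + 1)") auto
 then show ?case using Suc by (simp only: bits_odd) simp
qed simp

text \<open>Zero is special because its code has no bits and must not receive leading zeros; hence
  the case distinction on \<open>n\<close> when the header is printed.\<close>

lemma bits_zeros: "n > 0 ==> bits (2 ^ P * n) = replicate P 1 @ bits n"
proof (induction P)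
 case (Suc P)
 have "bits (2 * (2 ^ P * n)) = 1 # bits (2 ^ P * n)" by (rule bits_even) (simp add: Suc.prems)
 then show ?case using Suc by (simp add: mult.assoc)
qed simp

lemma enc_nat_prefix [simp]: "enc_nat m @ r = enc_nat m' @ r' \<longleftrightarrow> m = m' \<and> r = r'"
proof
 have four: "takeWhile (\<lambda>x. x \<noteq> 4) (enc_nat m @ r) = bits m" for m and r :: "nat list"
  using set_bits[of m] by (auto simp: enc_nat_def takeWhile_append)
 assume a: "enc_nat m @ r = enc_nat m' @ r'"
 then have "bits m = bits m'" using four[of m r] four[of m' r'] by simp
 then have "m = m'" using bits_value_bits by metis
 then show "m = m' \<and> r = r'" using a by simp
qed simp

lemma enc_trm_prefix [simp]: "enc_trm s @ r = enc_trm s' @ r' \<longleftrightarrow> s = s' \<and> r = r'"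
 by (induction s arbitrary: s' r r'; case_tac s'; auto)

lemma enc_qff_prefix [simp]: "enc_qff \<Phi> @ r = enc_qff \<Phi>' @ r' \<longleftrightarrow> \<Phi> = \<Phi>' \<and> r = r'"
 by (induction \<Phi> arbitrary: \<Phi>' r r'; case_tac \<Phi>'; auto)

lemma enc_qff_inj [simp]: "enc_qff \<Phi> = enc_qff \<Phi>' \<longleftrightarrow> \<Phi> = \<Phi>'"
 using enc_qff_prefix[of \<Phi> "[]" \<Phi>' "[]"] by (simp del: enc_qff_prefix)

lemma set_enc_nat: "set (enc_nat n) \<subseteq> {1, 2, 4}"
 using set_bits[of n] by (auto simp: enc_nat_def)

lemma set_enc_trm: "set (enc_trm s) \<subseteq> alphabet"
 using set_enc_nat by (induction s) (fastforce simp: alphabet_def)+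

lemma set_enc_qff: "set (enc_qff \<Phi>) \<subseteq> alphabet"
 using set_enc_trm by (induction \<Phi>) (auto simp: alphabet_def)

text \<open>Nonterminals of an LL(1) grammar of encodings: 16 and 17 for numbers and positive numbers,
 19 for terms, 20 for formulas; 21 blocks.\<close>
definition expand :: "nat => nat => nat list" where
 "expand t x =
  (if t = 16 \<and> x = 1 \<or> t = 17 \<and> x = 1 then [17]
   else if t = 16 \<and> x = 2 \<or> t = 17 \<and> x = 2 then [16]
   else if t = 16 \<and> x = 4 then []
   else if t = 19 \<and> (x = 5 \<or> x = 6) then [16]
   else if t = 19 \<and> x = 7 then [17]
   else if t = 19 \<and> (x = 8 \<or> x = 9) \<or> t = 20 \<and> x = 10 then [19, 19]
   else if t = 20 \<and> (x = 12 \<or> x = 13) then [20, 20]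
   else [21])"

text \<open>On an empty stack \<open>hd0 k\<close> is 0, for which the table has no entry either; it
  yields the blocking symbol 21, so input after the end of a complete word is rejected.\<close>

primrec parse :: "nat list => nat list => nat list" where
 "parse [] k = k"
| "parse (x # w) k = parse w (expand (hd0 k) x @ tl k)"

definition lang :: "nat => nat list set" where
 "lang t = (if t = 16 then range enc_nat else if t = 17 then {enc_nat n | n. n > 0}
   else if t = 19 then range enc_trm else if t = 20 then {enc_qff \<Phi> | \<Phi>. qff_le \<Phi>} else {})"

primrec langs :: "nat list => nat list set" where
 "langs [] = {[]}"
| "langs (t # k) = {u @ v | u v. u \<in> lang t \<and> v \<in> langs k}"

lemma langs_append: "w \<in> langs (l @ k) ==> \<exists>u v. w = u @ v \<and> u \<in> langs l \<and> v \<in> langs k"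
proof (induction l arbitrary: w)
 case (Cons t l)
 then obtain a b where ab: "w = a @ b" "a \<in> lang t" "b \<in> langs (l @ k)" by auto
 with Cons.IH obtain u v where "b = u @ v" "u \<in> langs l" "v \<in> langs k" by blast
 with ab show ?case by (intro exI[of _ "a @ u"] exI[of _ v]) auto
qed simp

lemma langs_single [simp]: "langs [t] = lang t"
 by simp

lemma lang_simps:
 "lang 16 = range enc_nat" "lang 17 = {enc_nat n | n. n > 0}" "lang 19 = range enc_trm"
 "lang 20 = {enc_qff \<Phi> | \<Phi>. qff_le \<Phi>}" "lang 21 = {}"
 by (simp_all add: lang_def)

text \<open>Two details make the grammar match the encoding exactly. After a zero bit a positive
  number must follow, as the most significant bit comes last; the same holds after the sign 7, as
  the constant 0 is written with 6. Strict atoms are excluded by the missing expansion of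
  11.\<close>

lemma Cons_langs_expand:
 assumes u: "u \<in> langs (expand t x)"
 shows "x # u \<in> lang t"
proof -
 have mem: "a \<in> lang 16 \<longleftrightarrow> (\<exists>n. a = enc_nat n)" "a \<in> lang 17 \<longleftrightarrow> (\<exists>n>0. a = enc_nat n)"
   "a \<in> lang 19 \<longleftrightarrow> (\<exists>s. a = enc_trm s)" "a \<in> lang 20 \<longleftrightarrow> (\<exists>f. qff_le f \<and> a = enc_qff f)" for a
  by (auto simp: lang_simps)
 have N: "n > 0 ==> 1 # enc_nat n = enc_nat (2 * n)" "2 # enc_nat n = enc_nat (Suc (2 * n))" "[4] = enc_nat 0" for n
  by (simp_all add: enc_nat_def bits_even bits_odd)
 have E: "5 # enc_nat n = enc_trm (Var n)" "6 # enc_nat n = enc_trm (Const (int n))"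
   "n > 0 ==> 7 # enc_nat n = enc_trm (Const (- int n))"
   "8 # enc_trm c @ enc_trm d = enc_trm (Add c d)" "9 # enc_trm c @ enc_trm d = enc_trm (Mul c d)" for n c d
  by simp_all
 have T: "a \<in> lang 16 ==> 5 # a \<in> lang 19" "a \<in> lang 16 ==> 6 # a \<in> lang 19" "a \<in> lang 17 ==> 7 # a \<in> lang 19"
   "a \<in> lang 19 ==> b \<in> lang 19 ==> 8 # a @ b \<in> lang 19" "a \<in> lang 19 ==> b \<in> lang 19 ==> 9 # a @ b \<in> lang 19" for a b
  unfolding mem by (metis E)+
 have F: "a \<in> lang 19 ==> b \<in> lang 19 ==> 10 # a @ b \<in> lang 20"
   "a \<in> lang 20 ==> b \<in> lang 20 ==> 12 # a @ b \<in> lang 20" "a \<in> lang 20 ==> b \<in> lang 20 ==> 13 # a @ b \<in> lang 20" for a b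
  unfolding mem by (metis enc_qff.simps qff_le.simps)+
 have M: "a \<in> lang 17 ==> 1 # a \<in> lang 16" "a \<in> lang 17 ==> 1 # a \<in> lang 17" "a \<in> lang 16 ==> 2 # a \<in> lang 16"
   "a \<in> lang 16 ==> 2 # a \<in> lang 17" "[4] \<in> lang 16" for a
  unfolding mem by (metis N nat_0_less_mult_iff zero_less_numeral zero_less_Suc)+
 show ?thesis
  using u unfolding expand_def by (auto simp: lang_simps(5) T F M simp del: One_nat_def split: if_splits)
qed

lemma parse_sound: "parse w k = [] ==> w \<in> langs k"
proof (induction w arbitrary: k)
 case (Cons x w)
 then have w: "w \<in> langs (expand (hd0 k) x @ tl k)" by simp
 then obtain u v where uv: "w = u @ v" "u \<in> langs (expand (hd0 k) x)" "v \<in> langs (tl k)"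
  using langs_append by blast
 have "x # u \<in> lang (hd0 k)" by (rule Cons_langs_expand[OF uv(2)])
 moreover from this have k: "k = hd0 k # tl k" by (cases k) (auto simp: lang_def)
 moreover have "x # w = (x # u) @ v" using uv by simp
 ultimately have "x # w \<in> langs (hd0 k # tl k)" using uv(3) unfolding langs.simps by blast
 then show ?case using k by metis
qed simp

lemma parse_enc_nat:
 "parse (enc_nat n @ w) (16 # k) = parse w k \<and> (n > 0 --> parse (enc_nat n @ w) (17 # k) = parse w k)"
proof (induction n rule: less_induct)
 case (less n)
 show ?case using less
  by (cases n rule: bits_cases) (auto simp: bits_even bits_odd enc_nat_def expand_def)
qed

lemma parse_enc_trm: "parse (enc_trm s @ w) (19 # k) = parse w k"
proof (induction s arbitrary: w k)
 case (Const c)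
 then show ?case by (auto simp: expand_def parse_enc_nat)
qed (simp_all add: expand_def parse_enc_nat)

lemma parse_enc_qff: "qff_le \<Phi> ==> parse (enc_qff \<Phi> @ w) (20 # k) = parse w k"
 by (induction \<Phi> arbitrary: w k) (simp_all add: expand_def parse_enc_trm)

lemma parse_complete: "w \<in> langs k ==> parse w k = []"
proof (induction k arbitrary: w)
 case (Cons t k)
 then obtain u v where uv: "w = u @ v" "u \<in> lang t" "v \<in> langs k" by auto
 have "parse (u @ v) (t # k) = parse v k"
  using uv(2) by (auto simp: lang_def parse_enc_trm parse_enc_qff parse_enc_nat split: if_splits)
 then show ?case using Cons.IH[OF uv(3)] uv(1) by simp
qed simp

lemma parse_iff: "parse w k = [] \<longleftrightarrow> w \<in> langs k"
 using parse_sound parse_complete by blast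

definition check_step :: prog where
 "check_step = echo 1 0 ;; branch 3 (\<lambda>t. branch 1 (\<lambda>x. Pop 3 ;; pushs 3 (rev (expand t x))))"

definition check :: "nat list => prog" where
 "check k = shift 0 1 ;; pushs 3 (rev k) ;; Loop 1 every check_step ;;
   IfTop 3 0 Skip (clear 3 ;; clear 0)"

lemma wfp_pushs: "r < nreg ==> set xs \<subseteq> {1..<base} ==> wfp (pushs r xs)"
 by (induction xs) (auto simp: pushs_def)

lemma expand_range: "set (expand t x) \<subseteq> {1..<base}"
 by (auto simp: expand_def base_def)

lemma light_check_step: "light {0,1,3} check_step"
 unfolding check_step_def
 by (intro light_Seq light_echo light_branch light_Pop light_pushs) (use expand_range in \<open>auto simp: nreg_def\<close>)

lemma mods_check_step: "mods check_step \<subseteq> {0, 3}"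
 by (auto simp: check_step_def mods_branch dest: subsetD[OF mods_echo] subsetD[OF mods_pushs])

lemma tame_check: "set k \<subseteq> {1..<base} ==> tame (check k)"
 unfolding check_def
 by (intro tame_Seq tame_Loop[OF light_check_step] tame_light[OF light_shift, of "{0}"]
   tame_light[of "{0,3}" "IfTop _ _ _ _"] tame_light[OF light_pushs, of "{}"] light_IfTop
   light_Seq light_Skip light_clear)
  (use mods_echo mods_check_step in \<open>auto simp: nreg_def\<close>)

lemma exec_check_step:
 assumes "wf_regs R" "R 1 = x # xs"
 shows "exec check_step R = R(0 := x # R 0, 3 := expand (hd0 (R 3)) x @ tl (R 3))"
proof -
 have "wf_regs (exec (echo 1 0) R)" using assms by (intro wf_regs_exec) (simp_all add: nreg_def)
 then have "wf_regs (R(0 := x # R 0))" using assms by (simp add: exec_echo)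
 then show ?thesis using assms by (simp add: check_step_def exec_echo exec_branch)
qed

lemma exec_check_loop:
 "[| wf_regs R; R 1 = w |] ==> lp (exec check_step) 1 every w R = R(0 := rev w @ R 0, 1 := [], 3 := parse w (R 3))"
proof (induction w arbitrary: R)
 case (Cons x w)
 let ?R = "R(0 := x # R 0, 1 := w, 3 := expand (hd0 (R 3)) x @ tl (R 3))"
 have e: "(exec check_step R)(1 := w) = ?R"
  using exec_check_step[OF Cons.prems] by (auto simp: fun_eq_iff)
 have "wf_regs (exec check_step R)" using Cons.prems(1) light_wfp[OF light_check_step] by (intro wf_regs_exec)
 moreover have "set w \<subseteq> {1..<base}" using Cons.prems by (auto simp: wf_regs_def dest!: spec[of _ 1])
 ultimately have "wf_regs ?R" unfolding e[symmetric] by (rule wf_regs_upd)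
 then have "lp (exec check_step) 1 every w ?R = ?R(0 := rev w @ ?R 0, 1 := [], 3 := parse w (?R 3))"
  by (rule Cons.IH) simp
 then show ?case unfolding lp_Cons if_True e by (auto simp: fun_eq_iff)
qed (auto simp: fun_eq_iff)

lemma words_wf: "w \<in> words ==> set w \<subseteq> {1..<base}"
 by (auto simp: words_def alphabet_def base_def)

lemma computes_check:
 assumes k: "set k \<subseteq> {1..<base}"
 shows "computes words (check k) (\<lambda>w. if w \<in> langs k then w else [])"
proof -
 have "exec (check k) (init_regs w) = init_regs (if w \<in> langs k then w else [])" if w: "w \<in> words" for w
 proof -
  let ?R = "(init_regs w)(0 := [], 1 := w, 3 := k)"
  have wf: "wf_regs (init_regs w)" by (intro wf_init words_wf w)
  have "wf_regs ?R" using wf words_wf[OF w] k by (intro wf_regs_upd) auto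
  moreover have "exec (shift 0 1 ;; pushs 3 (rev k)) (init_regs w) = ?R"
   using exec_shift[OF wf, of 0 1] by (simp add: nreg_def init_regs_def)
  moreover have "exec (check k) (init_regs w) = exec (IfTop 3 0 Skip (clear 3 ;; clear 0))
   (exec (Loop 1 every check_step) (exec (shift 0 1 ;; pushs 3 (rev k)) (init_regs w)))"
   by (simp only: check_def exec.simps)
  ultimately have e: "exec (check k) (init_regs w) = exec (IfTop 3 0 Skip (clear 3 ;; clear 0))
   ((init_regs w)(0 := rev w, 1 := [], 3 := parse w k))"
   using exec_check_loop[of ?R w] by (simp add: fun_upd_twist)
  have "hd0 (parse w k) = 0 \<longleftrightarrow> parse w k = []"
  proof -
   have "set (parse w k) \<subseteq> {1..<base}" using k
   proof (induction w arbitrary: k)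
    case (Cons x w)
    have "set (tl k) \<subseteq> {1..<base}" using Cons.prems by (cases k) auto
    then have "set (expand (hd0 k) x @ tl k) \<subseteq> {1..<base}" using expand_range by auto
    from Cons.IH[OF this] show ?case by simp
   qed simp
   then show ?thesis by (cases "parse w k") auto
  qed
  then show ?thesis unfolding e
   by (auto simp: parse_iff init_regs_def fun_eq_iff)
 qed
 then show ?thesis using tame_check[OF k] by (simp add: computes_def)
qed

section \<open>A calculus for executing programs symbolically\<close>

definition ok :: "regs => bool" where
 "ok R \<longleftrightarrow> wf_regs R \<and> R tmp = []"

text \<open>Well-formedness of intermediate states is part of the judgement, so that it only has to be
 checked for initial states.\<close>
definition runs :: "prog => regs => regs => bool" where
 "runs p R T \<longleftrightarrow> (ok R --> exec p R = T \<and> ok T)"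

lemma runsI: "wfp p ==> (ok R ==> exec p R = T) ==> T tmp = R tmp ==> runs p R T"
 using wf_regs_exec[of p R] by (auto simp: runs_def ok_def)

lemma runs_eq: "runs p R T ==> T = T' ==> runs p R T'"
 by simp

lemma runs_Skip: "runs Skip R R"
 by (auto simp: runs_def)

lemma runs_Seq: "runs p R T ==> runs q T U ==> runs (p ;; q) R U"
 by (auto simp: runs_def)

lemma runs_Push: "r < tmp ==> 0 < a ==> a < base ==> runs (Push r a) R (R(r := a # R r))"
 by (rule runsI) (auto simp: nreg_def)

lemma runs_pushs: "r < tmp ==> set xs \<subseteq> {1..<base} ==> runs (pushs r xs) R (R(r := rev xs @ R r))"
 by (rule runsI) (auto simp: nreg_def wfp_pushs)

lemma runs_Pop: "r < tmp ==> runs (Pop r) R (R(r := tl (R r)))"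
 by (rule runsI) (auto simp: nreg_def)

lemma runs_IfTop:
 "(hd0 (R r) = a ==> runs p R T) ==> (hd0 (R r) \<noteq> a ==> runs q R T) ==> runs (IfTop r a p q) R T"
 by (auto simp: runs_def)

lemma runs_branch: "runs (p (hd0 (R r))) R T ==> runs (branch r p) R T"
 by (auto simp: runs_def exec_branch ok_def)

lemma runs_clear: "r < tmp ==> runs (clear r) R (R(r := []))"
 by (rule runsI) (simp_all add: light_wfp[OF light_clear[of "{r}"]] nreg_def)

lemma runs_echo: "[| s < tmp; r < tmp; R s \<noteq> [] |] ==> runs (echo s r) R (R(r := hd (R s) # R r))"
 by (rule runsI) (auto simp: nreg_def ok_def intro: exec_echo[where xs = "tl (R s)"])

lemma runs_shift: "[| s < tmp; r < tmp; s \<noteq> r |] ==> runs (shift s r) R (R(s := [], r := rev (R s) @ R r))"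
proof (rule runsI)
 show "s < tmp ==> r < tmp ==> s \<noteq> r ==> wfp (shift s r)"
  using mods_echo[of s r] by (auto simp: shift_def nreg_def)
qed (auto simp: nreg_def exec_shift ok_def)

lemma runs_copy: "[| s < tmp; r < tmp; s \<noteq> r |] ==> runs (copy s r) R (R(r := R s @ R r))"
 using light_wfp[OF light_copy[of "{s}" s r]]
 by (intro runsI exec_copy) (auto simp: nreg_def ok_def)

lemma runs_copies: "[| s < tmp; r < tmp; s \<noteq> r; 0 < a; a < base |] ==>
  runs (copies s a r) R (R(r := replicate (length (R s)) a @ R r))"
 using light_wfp[OF light_copies[of "{s}" s r a]]
 by (intro runsI exec_copies) (auto simp: nreg_def ok_def)

abbreviation scans :: "prog => regs => regs => bool" where
 "scans p \<equiv> runs (Loop 1 every p)"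

lemma runs_Loop_stop: "R r = [] \<or> \<not> S (hd (R r)) ==> runs (Loop r S p) R R"
 by (cases "R r") (auto simp: runs_def)

lemma runs_Loop_step:
 assumes "R r = x # xs" "S x" "r \<notin> mods p" "r < tmp" "runs p R R'" "runs (Loop r S p) (R'(r := xs)) T"
 shows "runs (Loop r S p) R T"
 unfolding runs_def
proof
 assume ok: "ok R"
 then have e: "exec p R = R'" and ok': "ok R'" using assms(5) by (auto simp: runs_def)
 have "set xs \<subseteq> {1..<base}" using ok assms(1) by (auto simp: ok_def wf_regs_def dest!: spec[of _ r])
 then have "ok (R'(r := xs))" using ok' assms(4) by (auto simp: ok_def wf_regs_upd)
 then have "exec (Loop r S p) (R'(r := xs)) = T" "ok T" using assms(6) by (auto simp: runs_def)
 then show "exec (Loop r S p) R = T \<and> ok T" using assms(1,2) e by simp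
qed

definition skip_to4 :: "nat => nat => prog" where
 "skip_to4 s r = Loop s (\<lambda>x. x \<noteq> 4) (echo s r)"

lemma runs_skip_to4:
 assumes "s < tmp" "r < tmp" "s \<noteq> r" "R s = bits n @ 4 # ys"
 shows "runs (skip_to4 s r) R (R(s := 4 # ys, r := rev (bits n) @ R r))"
proof (rule runsI)
 show "wfp (skip_to4 s r)" using assms mods_echo[of s r] by (auto simp: skip_to4_def nreg_def)
 show "exec (skip_to4 s r) R = R(s := 4 # ys, r := rev (bits n) @ R r)" if "ok R"
  using exec_Loop_echo_prefix[of R s r "bits n" 4 ys "\<lambda>x. x \<noteq> 4"] assms that set_bits[of n]
  by (fastforce simp: skip_to4_def ok_def nreg_def)
qed (use assms in auto)

lemma light_skip_to4 [intro]:
 "[| finite A; s \<in> A; s \<noteq> t; s < nreg; t < nreg; t \<noteq> tmp; s \<noteq> tmp |] ==> light A (skip_to4 s t)"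
 unfolding skip_to4_def by (rule light_Loop_echo)

lemma ok_init: "w \<in> words ==> ok (init_regs w)"
 using wf_init[OF words_wf] by (auto simp: ok_def init_regs_def)

lemma computesI:
 assumes "tame p" "D \<subseteq> words" "!!w. w \<in> D ==> runs p (init_regs w) (init_regs (f w))"
 shows "computes D p f"
 using assms ok_init unfolding computes_def runs_def by blast

lemma tame_IfTop:
 assumes "tame p" "tame q" "r < nreg"
 shows "tame (IfTop r a p q)"
proof -
 from assms obtain k l where k: "\<forall>R. wf_regs R --> R tmp = [] -->
   cost p R \<le> (total_length R + 2) ^ k \<and> exec p R tmp = []"
  and l: "\<forall>R. wf_regs R --> R tmp = [] -->
   cost q R \<le> (total_length R + 2) ^ l \<and> exec q R tmp = []"
  unfolding tame_def by (elim exE conjE)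
 show ?thesis
 proof (rule tameI[of _ "k + l + 1"])
  show "wfp (IfTop r a p q)" using assms by (auto simp: tame_def)
  fix R assume s: "wf_regs R" "R tmp = []"
  note 1 = k[rule_format, OF s] l[rule_format, OF s]
  define n where "n = total_length R + 2"
  have n2: "2 \<le> n" by (simp add: n_def)
  define N where "N = n ^ (k + l)"
  have "n ^ k \<le> N" "n ^ l \<le> N" "1 \<le> N"
   unfolding N_def using n2 by (simp_all add: power_increasing one_le_power del: One_nat_def)
  moreover have "2 * N \<le> n ^ (k + l + 1)" using mult_le_mono1[OF n2, of N] by (simp add: N_def)
  ultimately have "1 + n ^ k \<le> n ^ (k + l + 1)" "1 + n ^ l \<le> n ^ (k + l + 1)" by linarith+
  then show "cost (IfTop r a p q) R \<le> (total_length R + 2) ^ (k + l + 1)"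
   using 1 unfolding n_def[symmetric] by (simp del: power.simps)
  show "exec (IfTop r a p q) R tmp = []" using 1 by simp
 qed
qed

lemma langs_words: "w \<in> langs k ==> w \<in> words"
proof (induction k arbitrary: w)
 case (Cons t k)
 have "set u \<subseteq> alphabet" if "u \<in> lang t" for u
 proof -
  have "set (enc_nat n) \<subseteq> alphabet" for n using set_enc_nat[of n] by (auto simp: alphabet_def)
  then have "set (enc_nat n) \<subseteq> alphabet" "set (enc_trm s) \<subseteq> alphabet" "set (enc_qff \<Phi>) \<subseteq> alphabet" for n s \<Phi>
   by (simp_all add: set_enc_trm set_enc_qff)
  then show ?thesis using that by (auto simp: lang_def split: if_splits dest: subsetD[OF set_enc_qff])
 qed
 then show ?case using Cons by (fastforce simp: words_def)
qed (simp add: words_def)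

text \<open>Syntactically wrong words are mapped to the empty word, which belongs to neither
  problem. A reduction has to be specified only on correct syntax; ranges of indices are not checked
  here and are left to the produced sentence.\<close>

lemma reduces_on_langs:
 assumes "tame p" and k: "set k \<subseteq> {1..<base}" "[] \<notin> langs k" and A: "A \<subseteq> langs k" and B: "[] \<notin> B"
  and "!!w. w \<in> langs k ==> \<exists>v\<in>words. runs p (init_regs w) (init_regs v) \<and> (w \<in> A \<longleftrightarrow> v \<in> B)"
 shows "reduces A B"
proof -
 obtain f where f: "!!w. w \<in> langs k ==> f w \<in> words" "!!w. w \<in> langs k ==> w \<in> A \<longleftrightarrow> f w \<in> B"
  and "!!w. w \<in> langs k ==> runs p (init_regs w) (init_regs (f w))"
  using assms(6) by metis
 then have p: "computes (langs k) p f" using assms(1) langs_words by (intro computesI) auto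
 let ?c = "\<lambda>w. if w \<in> langs k then w else []" and ?f = "\<lambda>w. if w = [] then [] else f w"
 have "computes (insert [] (langs k)) (IfTop 0 0 Skip p) ?f"
  unfolding computes_def
 proof
  show "tame (IfTop 0 0 Skip p)" using p
   by (intro tame_IfTop tame_light[of "{}" Skip]) (auto simp: computes_def nreg_def)
  show "\<forall>w\<in>insert [] (langs k). exec (IfTop 0 0 Skip p) (init_regs w) = init_regs (?f w)"
  proof
   fix w assume w: "w \<in> insert [] (langs k)"
   show "exec (IfTop 0 0 Skip p) (init_regs w) = init_regs (?f w)"
   proof (cases "w = []")
    case True
    then show ?thesis by (simp add: init_regs_def)
   next
    case False
    then have "w \<in> langs k" using w by simp
    moreover have "hd0 (rev w) \<noteq> 0"
    proof -
     have "last w \<in> set w" using False by simp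
     then have "last w \<noteq> 0" using words_wf[OF langs_words[OF \<open>w \<in> langs k\<close>]] by auto
     then show ?thesis using False by (cases w rule: rev_cases) auto
    qed
    ultimately show ?thesis using p False by (simp add: computes_def init_regs_def)
   qed
  qed
 qed
 then have "computes words (check k ;; IfTop 0 0 Skip p) (?f \<circ> ?c)"
  by (rule computes_Seq[OF computes_check[OF k(1)]]) auto
 moreover have "(?f \<circ> ?c) ` words \<subseteq> words" using f(1) by (auto simp: words_def)
 moreover have "w \<in> A \<longleftrightarrow> (?f \<circ> ?c) w \<in> B" for w
  using A B f(2)[of w] k(2) by (cases "w \<in> langs k") auto
 ultimately show ?thesis unfolding reduces_def by blast
qed

definition trivial :: qff where "trivial = Le (Const 0) (Const 0)"

definition insert_premise :: prog where
 "insert_premise = shift 0 1 ;; skip_to4 1 0 ;; Pop 1 ;; Push 0 4 ;; skip_to4 1 0 ;; Pop 1 ;;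
   pushs 0 (4 # enc_qff trivial) ;; shift 1 0"

lemma enc_trivial: "enc_qff trivial = [10, 6, 4, 6, 4]"
 by (simp add: trivial_def enc_nat_def)

lemma tame_insert_premise: "tame insert_premise"
 unfolding insert_premise_def
 by (intro tame_light[of "{0,1}"] light_Seq light_shift light_skip_to4 light_Pop light_Push light_pushs)
  (auto simp: nreg_def base_def enc_trivial)

lemma runs_insert_premise:
 "runs insert_premise (init_regs (enc_nat m @ enc_nat n @ v)) (init_regs (enc_nat m @ enc_nat n @ enc_qff trivial @ v))"
 unfolding insert_premise_def
 apply (rule runs_eq)
  apply (rule runs_Seq, rule runs_shift; simp?)
  apply (rule runs_Seq, rule runs_skip_to4[of _ _ _ m "enc_nat n @ v"]; simp add: init_regs_def enc_nat_def)
  apply (rule runs_Seq, rule runs_Pop; simp?)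
  apply (rule runs_Seq, rule runs_Push; simp add: base_def)
  apply (rule runs_Seq, rule runs_skip_to4[of _ _ _ n v]; simp add: init_regs_def enc_nat_def)
  apply (rule runs_Seq, rule runs_Pop; simp?)
  apply (rule runs_Seq, rule runs_pushs; simp add: enc_trivial base_def)
  apply (rule runs_shift; simp)
 apply (auto simp: fun_eq_iff init_regs_def enc_nat_def enc_trivial)
 done

lemma langs_Cons:
 "w \<in> langs (16 # k) \<longleftrightarrow> (\<exists>n v. v \<in> langs k \<and> w = enc_nat n @ v)"
 "w \<in> langs (20 # k) \<longleftrightarrow> (\<exists>\<Phi> v. qff_le \<Phi> \<and> v \<in> langs k \<and> w = enc_qff \<Phi> @ v)"
 unfolding langs.simps lang_simps by auto

lemma langs_bounded: "langs [16, 16, 20] = {enc_nat m @ enc_nat n @ enc_qff \<Phi> | m n \<Phi>. qff_le \<Phi>}"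
 unfolding set_eq_iff langs_Cons langs.simps(1) by auto

lemma langs_premise: "langs [16, 16, 20, 20] =
  {enc_nat m @ enc_nat n @ enc_qff \<Psi> @ enc_qff \<Phi> | m n \<Psi> \<Phi>. qff_le \<Psi> \<and> qff_le \<Phi>}"
 unfolding set_eq_iff langs_Cons langs.simps(1) by auto

declare langs.simps(2) [simp del] langs_single [simp del]

lemma mem_Sigma2_le: "enc_nat m @ enc_nat n @ enc_qff \<Phi> \<in> Sigma2_le \<longleftrightarrow>
  qff_le \<Phi> \<and> vars_qff \<Phi> \<subseteq> {..<m+n} \<and> sigma2_true m n \<Phi>"
 by (auto simp: Sigma2_le_def)

lemma mem_b_Sigma2_le: "enc_nat m @ enc_nat n @ enc_qff \<Phi> \<in> b_Sigma2_le \<longleftrightarrow>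
  qff_le \<Phi> \<and> vars_qff \<Phi> \<subseteq> {..<m+n} \<and> b_sigma2_true m n \<Phi>"
 by (auto simp: b_Sigma2_le_def)

lemma mem_b_Sigma2pp_le: "enc_nat m @ enc_nat n @ enc_qff \<Psi> @ enc_qff \<Phi> \<in> b_Sigma2pp_le \<longleftrightarrow>
  qff_le \<Psi> \<and> qff_le \<Phi> \<and> vars_qff \<Psi> \<subseteq> {m..<m+n} \<and> vars_qff \<Phi> \<subseteq> {..<m+n} \<and> b_sigma2pp_true m n \<Psi> \<Phi>"
 by (auto simp: b_Sigma2pp_le_def)

lemma Nil_notin: "[] \<notin> Sigma2_le" "[] \<notin> b_Sigma2_le" "[] \<notin> b_Sigma2pp_le"
 by (auto simp: Sigma2_le_def b_Sigma2_le_def b_Sigma2pp_le_def enc_nat_def)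

lemma reduces_b_Sigma2_b_Sigma2pp: "reduces b_Sigma2_le b_Sigma2pp_le"
proof (rule reduces_on_langs[OF tame_insert_premise, of "[16, 16, 20]"])
 fix w assume "w \<in> langs [16, 16, 20]"
 then obtain m n \<Phi> where w: "w = enc_nat m @ enc_nat n @ enc_qff \<Phi>" and \<Phi>: "qff_le \<Phi>"
  unfolding langs_bounded by blast
 let ?v = "enc_nat m @ enc_nat n @ enc_qff trivial @ enc_qff \<Phi>"
 have "?v \<in> langs [16, 16, 20, 20]"
  unfolding langs_premise using \<Phi> by (auto simp: trivial_def simp del: enc_qff.simps)
 then have "?v \<in> words" by (rule langs_words)
 moreover have "w \<in> b_Sigma2_le \<longleftrightarrow> ?v \<in> b_Sigma2pp_le"
  unfolding w mem_b_Sigma2_le mem_b_Sigma2pp_le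
  by (simp add: trivial_def b_sigma2_true_def b_sigma2pp_true_def)
 ultimately show "\<exists>v\<in>words. runs insert_premise (init_regs w) (init_regs v) \<and> (w \<in> b_Sigma2_le \<longleftrightarrow> v \<in> b_Sigma2pp_le)"
  unfolding w using runs_insert_premise by blast
qed (auto simp: base_def b_Sigma2_le_def langs_bounded enc_nat_def Nil_notin)

section \<open>Translating formulas\<close>

lemma runs_Loop_unary:
 assumes "r \<notin> mods p" "r < tmp"
 shows "(!!j. j < n ==> runs p ((T j)(r := replicate (n - j) a)) ((T (Suc j))(r := replicate (n - j) a))) ==>
  runs (Loop r every p) ((T 0)(r := replicate n a)) ((T n)(r := []))"
proof (induction n arbitrary: T)
 case 0
 then show ?case using runs_Loop_stop[of "(T 0)(r := [])" r every p] by simp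
next
 case (Suc n)
 have 1: "runs p ((T 0)(r := replicate (Suc n) a)) ((T (Suc 0))(r := replicate (Suc n) a))"
  using Suc.prems[of 0] by simp
 have 2: "runs (Loop r every p) ((T (Suc 0))(r := replicate n a)) ((T (Suc n))(r := []))"
  by (rule Suc.IH[of "\<lambda>j. T (Suc j)"]) (use Suc.prems[of "Suc _"] in simp)
 show ?case
  by (rule runs_Loop_step[of _ r a "replicate n a", OF _ _ assms 1]) (use 2 in simp_all)
qed

text \<open>Templates: a number \<open>a < base\<close> stands for itself, \<open>base + r\<close> for the contents of register \<open>r\<close>.\<close>
definition piece :: "regs => nat => nat list" where
 "piece R a = (if a < base then [a] else rev (R (a - base)))"

definition pieces :: "regs => nat list => nat list" where
 "pieces R t = concat (map (piece R) t)"

definition emit :: "nat list => prog" where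
 "emit t = foldr (\<lambda>a q. (if a < base then Push 0 a else copy (a - base) 0) ;; q) t Skip"

definition template :: "nat set => nat list => bool" where
 "template A t \<longleftrightarrow> (\<forall>a\<in>set t. 0 < a \<and> (a < base \<or> a - base \<in> A))"

lemma runs_emit: "template {1..<tmp} t ==> runs (emit t) R (R(0 := rev (pieces R t) @ R 0))"
proof (induction t arbitrary: R)
 case Nil
 then show ?case by (simp add: emit_def pieces_def runs_Skip)
next
 case (Cons a t)
 let ?R = "R(0 := rev (piece R a) @ R 0)"
 have 1: "runs (if a < base then Push 0 a else copy (a - base) 0) R ?R"
  using Cons.prems by (auto simp: piece_def template_def intro!: runs_Push runs_copy)
 have t: "template {1..<tmp} t" using Cons.prems by (simp add: template_def)
 have "piece ?R b = piece R b" if "b \<in> set t" for b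
  using t that by (auto simp: piece_def template_def)
 then have "pieces ?R t = pieces R t" unfolding pieces_def by (metis map_cong)
 then have "runs (emit t) ?R (R(0 := rev (pieces R (a # t)) @ R 0))"
  using Cons.IH[OF t, of ?R] by (simp add: pieces_def)
 then have "runs ((if a < base then Push 0 a else copy (a - base) 0) ;; emit t) R (R(0 := rev (pieces R (a # t)) @ R 0))"
  by (rule runs_Seq[OF 1])
 then show ?case by (simp add: emit_def)
qed

lemma light_emit:
 assumes "finite A" "0 \<notin> A" "A \<subseteq> {..<tmp}"
 shows "template A t ==> light A (emit t)"
proof (induction t)
 case Nil
 then show ?case using assms by (auto simp: emit_def)
next
 case (Cons a t)
 have "light A (if a < base then Push 0 a else copy (a - base) 0)"
  using Cons.prems assms by (cases "a = base") (auto simp: template_def nreg_def intro!: light_Push light_copy)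
 moreover have "light A (emit t)" using Cons by (simp add: template_def)
 ultimately have "light A ((if a < base then Push 0 a else copy (a - base) 0) ;; emit t)" by (rule light_Seq)
 then show ?case by (simp add: emit_def)
qed

lemma mods_copying: "mods (copying s p) \<subseteq> {s, tmp} \<union> mods p"
 using mods_echo[of s tmp] mods_echo[of tmp s] by (auto simp: copying_def)

lemma mods_copy: "mods (copy s r) \<subseteq> {s, tmp, r}"
 using mods_copying[of s "echo tmp r"] mods_echo[of tmp r] by (auto simp: copy_def)

lemma mods_copies: "mods (copies s a r) \<subseteq> {s, tmp, r}"
 using mods_copying[of s "Push r a"] by (auto simp: copies_def)

lemma mods_emit: "template A t ==> mods (emit t) \<subseteq> {0, tmp} \<union> A"
proof (induction t)
 case (Cons a t)
 then have "mods (emit t) \<subseteq> {0, tmp} \<union> A" by (simp add: template_def)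
 moreover have "mods (if a < base then Push 0 a else copy (a - base) 0) \<subseteq> {0, tmp} \<union> A"
  using Cons.prems mods_copy[of "a - base" 0] by (auto simp: template_def)
 ultimately show ?case by (simp add: emit_def)
qed (simp add: emit_def)

text \<open>Register use from here on: 0 output, 1 input, 4 the bits of \<open>m\<close>, and 6, 7,
  8 the numbers \<open>P\<close>, \<open>q\<close> and \<open>3 * q\<close> in unary. The cube of
  the length arises by multiplying twice in unary, in registers 10 and 12. The constants satisfy
  \<open>98 > 96 = 3 * 32\<close>, so \<open>P\<close> exceeds \<open>3 * q\<close> by at least 2
  and all auxiliary names stay below the renamed indices.\<close>

definition prepare :: prog where
 "prepare =
   Loop 0 every (echo 0 1 ;; Push 9 2 ;; Push 10 2) ;;
   Loop 10 every (copies 9 2 12) ;;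
   Loop 12 every (copies 9 2 10) ;;
   Loop 10 every (pushs 7 (replicate 32 2) ;; pushs 8 (replicate 96 2) ;; pushs 6 (replicate 98 2)) ;;
   clear 9 ;;
   copy 6 0 ;; skip_to4 1 4 ;; copy 4 0 ;; Push 0 4 ;; Pop 1 ;;
   IfTop 1 4 Skip (copies 6 1 0 ;; skip_to4 1 0) ;; Push 0 4 ;; Pop 1"

lemma light_replicate: "[| finite A; r < nreg; r \<noteq> tmp; 0 < a; a < base |] ==> light A (pushs r (replicate n a))"
 by (rule light_pushs) auto

lemma notin_mods:
 "r \<noteq> t ==> r \<notin> mods (echo s t)"
 "r \<noteq> t ==> r \<notin> mods (pushs t xs)"
 "r \<notin> {s, tmp, t} ==> r \<notin> mods (copy s t)"
 "r \<notin> {s, tmp, t} ==> r \<notin> mods (copies s a t)"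
 "(!!a. a < base ==> r \<notin> mods (p a)) ==> r \<notin> mods (branch s p)"
 by (auto simp: mods_branch dest: subsetD[OF mods_echo] subsetD[OF mods_pushs] subsetD[OF mods_copy] subsetD[OF mods_copies])

named_theorems light_intros
lemmas [light_intros] = light_Seq light_echo light_Push light_Pop light_pushs light_IfTop light_copy light_copies
 light_skip_to4 light_clear light_shift light_Skip light_replicate light_emit light_branch

lemma tame_prepare: "tame prepare"
proof -
 have 1: "tame (Loop 0 every (echo 0 1 ;; Push 9 2 ;; Push 10 2))"
 proof (rule tame_Loop[of "{}"])
  show "light {} (echo 0 1 ;; Push 9 2 ;; Push 10 2)"
   by (intro light_intros) (simp_all add: nreg_def base_def)
 qed (simp_all add: nreg_def notin_mods)
 have 2: "tame (Loop 10 every (copies 9 2 12))"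
 proof (rule tame_Loop[of "{9}"])
  show "light {9} (copies 9 2 12)" by (intro light_intros) (simp_all add: nreg_def base_def)
 qed (simp_all add: nreg_def notin_mods)
 have 3: "tame (Loop 12 every (copies 9 2 10))"
 proof (rule tame_Loop[of "{9}"])
  show "light {9} (copies 9 2 10)" by (intro light_intros) (simp_all add: nreg_def base_def)
 qed (simp_all add: nreg_def notin_mods)
 have 4: "tame (Loop 10 every (pushs 7 (replicate 32 2) ;; pushs 8 (replicate 96 2) ;; pushs 6 (replicate 98 2)))"
 proof (rule tame_Loop[of "{}"])
  show "light {} (pushs 7 (replicate 32 2) ;; pushs 8 (replicate 96 2) ;; pushs 6 (replicate 98 2))"
   by (intro light_Seq light_replicate) (simp_all add: nreg_def base_def)
 qed (simp_all add: nreg_def notin_mods)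
 have 5: "light {1, 4, 6, 9} (clear 9 ;; copy 6 0 ;; skip_to4 1 4 ;; copy 4 0 ;; Push 0 4 ;; Pop 1 ;;
   IfTop 1 4 Skip (copies 6 1 0 ;; skip_to4 1 0) ;; Push 0 4 ;; Pop 1)"
  by (intro light_intros) (simp_all add: nreg_def base_def)
 show ?thesis unfolding prepare_def
  by (rule tame_Seq[OF 1 tame_Seq[OF 2 tame_Seq[OF 3 tame_Seq[OF 4 tame_light[OF 5]]]]]) (simp add: nreg_def)
qed

definition params :: "nat => nat => nat => regs" where
 "params m P q = (\<lambda>_. [])(4 := rev (bits m), 6 := replicate P 2, 7 := replicate q 2, 8 := replicate (3 * q) 2)"

lemma runs_Loop_count:
 "R 0 = xs ==> runs (Loop 0 every (echo 0 1 ;; Push 9 2 ;; Push 10 2)) R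
  (R(0 := [], 1 := rev xs @ R 1, 9 := replicate (length xs) 2 @ R 9, 10 := replicate (length xs) 2 @ R 10))"
proof (induction xs arbitrary: R)
 case Nil
 then have "R = R(0 := [], 1 := rev [] @ R 1, 9 := replicate (length []) 2 @ R 9, 10 := replicate (length []) 2 @ R 10)"
  by (simp add: fun_upd_idem)
 moreover have "runs (Loop 0 every (echo 0 1 ;; Push 9 2 ;; Push 10 2)) R R"
  using Nil by (intro runs_Loop_stop) simp
 ultimately show ?case by simp
next
 case (Cons x xs)
 let ?R = "R(1 := x # R 1, 9 := 2 # R 9, 10 := 2 # R 10)"
 have 1: "runs (echo 0 1 ;; Push 9 2 ;; Push 10 2) R ?R"
  by (rule runs_eq[OF runs_Seq[OF runs_echo runs_Seq[OF runs_Push runs_Push]]])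
   (simp_all add: Cons.prems base_def)
 have e: "(?R(0 := xs))(0 := [], 1 := rev xs @ (?R(0 := xs)) 1, 9 := replicate (length xs) 2 @ (?R(0 := xs)) 9, 10 := replicate (length xs) 2 @ (?R(0 := xs)) 10)
   = R(0 := [], 1 := rev (x # xs) @ R 1, 9 := replicate (length (x # xs)) 2 @ R 9, 10 := replicate (length (x # xs)) 2 @ R 10)"
  by (rule ext) (simp add: replicate_app_Cons_same)
 have 2: "runs (Loop 0 every (echo 0 1 ;; Push 9 2 ;; Push 10 2)) (?R(0 := xs))
  (R(0 := [], 1 := rev (x # xs) @ R 1, 9 := replicate (length (x # xs)) 2 @ R 9, 10 := replicate (length (x # xs)) 2 @ R 10))"
  unfolding e[symmetric] by (rule Cons.IH) simp
 show ?case
  by (rule runs_Loop_step[OF Cons.prems _ _ _ 1 2]) (simp_all add: notin_mods)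
qed

lemma runs_Loop_copies:
 assumes "R r = replicate n 2" "R s = replicate l 2" "r < tmp" "s < tmp" "t < tmp" "r \<noteq> s" "r \<noteq> t" "s \<noteq> t"
 shows "runs (Loop r every (copies s 2 t)) R (R(r := [], t := replicate (n * l) 2 @ R t))"
proof -
 let ?T = "\<lambda>j. R(t := replicate (j * l) 2 @ R t)"
 have "runs (Loop r every (copies s 2 t)) ((?T 0)(r := replicate n 2)) ((?T n)(r := []))"
 proof (rule runs_Loop_unary[where T = ?T])
  fix j
  show "runs (copies s 2 t) ((?T j)(r := replicate (n - j) 2)) ((?T (Suc j))(r := replicate (n - j) 2))"
   by (rule runs_eq[OF runs_copies]) (use assms in \<open>auto simp: base_def replicate_add fun_upd_twist\<close>)
 qed (use assms in \<open>simp_all add: notin_mods\<close>)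
 moreover have "(?T 0)(r := replicate n 2) = R" using assms by (simp add: fun_upd_idem)
 ultimately show ?thesis using assms by (simp add: fun_upd_twist)
qed

text \<open>The first number is \<open>ren P m\<close>: every auxiliary index is below it and
  becomes existential. With the second number the total is \<open>ren P (m + n)\<close>, so indices
  are in range after renaming exactly if they were before.\<close>

definition header :: "nat => nat => nat => nat list" where
 "header P m n = enc_nat (2 ^ P * (m + 1) - 1) @ enc_nat (2 ^ P * n)"

lemma header_eq: "header P m n = replicate P 2 @ bits m @ 4 # (if n = 0 then [] else replicate P 1 @ bits n) @ [4]"
 using bits_ones[of P m] bits_zeros[of n P] by (cases "n = 0") (simp_all add: header_def enc_nat_def)

lemma runs_prepare:
 assumes w: "w = enc_nat m @ enc_nat n @ v"
 defines "P \<equiv> 98 * length w ^ 3" and "q \<equiv> 32 * length w ^ 3"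
 shows "runs prepare (init_regs w) ((params m P q)(0 := rev (header P m n), 1 := v))"
proof -
 define l where "l = length w"
 let ?z = "(\<lambda>_. []) :: regs"
 let ?s1 = "?z(1 := w, 9 := replicate l 2, 10 := replicate l 2)"
 have 1: "runs (Loop 0 every (echo 0 1 ;; Push 9 2 ;; Push 10 2)) (init_regs w) ?s1"
  by (rule runs_eq[OF runs_Loop_count[OF refl]]) (auto simp: init_regs_def l_def fun_eq_iff)
 let ?s2 = "?z(1 := w, 9 := replicate l 2, 12 := replicate (l * l) 2)"
 have 2: "runs (Loop 10 every (copies 9 2 12)) ?s1 ?s2"
  by (rule runs_eq[OF runs_Loop_copies[of _ _ l _ l]]) (auto simp: fun_eq_iff)
 let ?s3 = "?z(1 := w, 9 := replicate l 2, 10 := replicate (l * l * l) 2)"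
 have 3: "runs (Loop 12 every (copies 9 2 10)) ?s2 ?s3"
  by (rule runs_eq[OF runs_Loop_copies[of _ _ "l * l" _ l]]) (auto simp: fun_eq_iff)
 let ?t = "\<lambda>j. ?z(1 := w, 9 := replicate l 2, 6 := replicate (98 * j) 2, 7 := replicate (32 * j) 2, 8 := replicate (96 * j) 2)"
 have "runs (Loop 10 every (pushs 7 (replicate 32 2) ;; pushs 8 (replicate 96 2) ;; pushs 6 (replicate 98 2)))
   ((?t 0)(10 := replicate (l * l * l) 2)) ((?t (l * l * l))(10 := []))"
 proof (rule runs_Loop_unary[where T = ?t])
  fix j
  have r: "replicate (c * Suc j) 2 = rev (replicate c 2) @ replicate (c * j) 2" for c
   by (simp add: replicate_add)
  have p: "set (replicate c 2) \<subseteq> {1..<base}" for c by (auto simp: base_def)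
  show "runs (pushs 7 (replicate 32 2) ;; pushs 8 (replicate 96 2) ;; pushs 6 (replicate 98 2))
   ((?t j)(10 := replicate (l * l * l - j) 2)) ((?t (Suc j))(10 := replicate (l * l * l - j) 2))"
   unfolding r
   by (rule runs_eq[OF runs_Seq[OF runs_pushs[OF _ p] runs_Seq[OF runs_pushs[OF _ p] runs_pushs[OF _ p]]]])
    (auto simp: fun_eq_iff simp del: rev_replicate)
 qed (simp_all add: notin_mods)
 moreover have "(?t 0)(10 := replicate (l * l * l) 2) = ?s3" by (auto simp: fun_eq_iff)
 moreover have "(?t (l * l * l))(10 := []) = (params m P q)(4 := [], 1 := w, 9 := replicate l 2)"
  by (auto simp: fun_eq_iff params_def P_def q_def l_def power3_eq_cube)
 ultimately have 4: "runs (Loop 10 every (pushs 7 (replicate 32 2) ;; pushs 8 (replicate 96 2) ;; pushs 6 (replicate 98 2)))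
   ?s3 ((params m P q)(4 := [], 1 := w, 9 := replicate l 2))" by simp
 let ?s5 = "(params m P q)(0 := rev (replicate P 2 @ bits m @ [4]), 1 := enc_nat n @ v)"
 let ?s6 = "(params m P q)(0 := rev (replicate P 2 @ bits m @ 4 # (if n = 0 then [] else replicate P 1 @ bits n)), 1 := 4 # v)"
 have 6: "runs (IfTop 1 4 Skip (copies 6 1 0 ;; skip_to4 1 0)) ?s5 ?s6"
 proof (rule runs_IfTop)
  assume "hd0 (?s5 1) = 4"
  then have "bits n = []" using set_bits[of n] by (cases "bits n") (auto simp: enc_nat_def)
  then have "n = 0" using bits_value_bits[of n] by simp
  then show "runs Skip ?s5 ?s6" by (intro runs_eq[OF runs_Skip]) (auto simp: enc_nat_def)
 next
  assume "hd0 (?s5 1) \<noteq> 4"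
  then have "n \<noteq> 0" by (cases "n = 0") (auto simp: enc_nat_def)
  then show "runs (copies 6 1 0 ;; skip_to4 1 0) ?s5 ?s6"
   by (intro runs_eq[OF runs_Seq[OF runs_copies runs_skip_to4[of _ _ _ n v]]])
    (auto simp: fun_eq_iff params_def base_def enc_nat_def)
 qed
 have 5: "runs (clear 9 ;; copy 6 0 ;; skip_to4 1 4 ;; copy 4 0 ;; Push 0 4 ;; Pop 1 ;;
   IfTop 1 4 Skip (copies 6 1 0 ;; skip_to4 1 0) ;; Push 0 4 ;; Pop 1)
   ((params m P q)(4 := [], 1 := w, 9 := replicate l 2)) ((params m P q)(0 := rev (header P m n), 1 := v))"
  by (rule runs_Seq[OF runs_clear runs_Seq[OF runs_copy runs_Seq[OF runs_skip_to4[of _ _ _ m "enc_nat n @ v"]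
    runs_Seq[OF runs_copy runs_Seq[OF runs_Push runs_Seq[OF runs_eq[OF runs_Pop] runs_Seq[OF 6
     runs_Seq[OF runs_Push runs_eq[OF runs_Pop]]]]]]]]])
   (auto simp: fun_eq_iff params_def base_def w enc_nat_def header_eq)
 show ?thesis unfolding prepare_def
  by (rule runs_Seq[OF 1 runs_Seq[OF 2 runs_Seq[OF 3 runs_Seq[OF 4 5]]]])
qed

section \<open>Visiting the occurrences of variables\<close>

primrec occ_trm :: "trm => nat list" where
 "occ_trm (Var i) = [i]"
| "occ_trm (Const c) = []"
| "occ_trm (Add s t) = occ_trm s @ occ_trm t"
| "occ_trm (Mul s t) = occ_trm s @ occ_trm t"

text \<open>One entry for each occurrence, with repetitions: a single pass over the text prints a
  clause per occurrence and does not collect sets.\<close>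

primrec occ_qff :: "qff => nat list" where
 "occ_qff (Le s t) = occ_trm s @ occ_trm t"
| "occ_qff (Lt s t) = occ_trm s @ occ_trm t"
| "occ_qff (Conj f g) = occ_qff f @ occ_qff g"
| "occ_qff (Disj f g) = occ_qff f @ occ_qff g"

lemma set_occ_trm: "set (occ_trm s) = vars_trm s"
 by (induction s) auto

lemma set_occ_qff: "set (occ_qff \<Phi>) = vars_qff \<Phi>"
 by (induction \<Phi>) (auto simp: set_occ_trm)

text \<open>Register 3 holds one bit of state: 20 lies on it while the index of a variable is being
  read into register 5. At the terminator 4, \<open>p\<close> runs with the reversed bits of that
  index.\<close>

definition visit :: "prog => prog" where
 "visit p = branch 1 (\<lambda>x. if x = 5 then Push 3 20 else
   branch 3 (\<lambda>t. if t = 20 then (if x = 4 then Pop 3 ;; p ;; clear 5 else echo 1 5) else Skip))"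

lemma notin_mods_visit: "r \<notin> mods p ==> r \<notin> {3, 5} ==> r \<notin> mods (visit p)"
 by (auto simp: visit_def mods_branch clear_def dest: subsetD[OF mods_echo] split: if_splits)

lemma light_visit: "[| light A p; finite A; 5 \<in> A |] ==> light A (visit p)"
 unfolding visit_def
 by (intro light_branch; (split if_split | intro conjI impI light_intros)?)
  (auto simp: nreg_def base_def intro!: light_Seq light_clear light_echo light_Pop light_Push light_branch light_Skip)

definition st :: "regs => nat list => nat list => nat list => nat list => regs" where
 "st B v w k b = B(0 := v, 1 := w, 3 := k, 5 := b)"

lemma st_upd [simp]:
 "(st B v w k b)(0 := x) = st B x w k b" "(st B v w k b)(1 := x) = st B v x k b"
 "(st B v w k b)(3 := x) = st B v w x b" "(st B v w k b)(5 := x) = st B v w k x"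
 "(st B v w k b)(Suc 0 := x) = st B v x k b"
 by (auto simp: st_def fun_eq_iff)

lemma st_get [simp]:
 "st B v w k b 0 = v" "st B v w k b 1 = w" "st B v w k b 3 = k" "st B v w k b 5 = b"
 "st B v w k b (Suc 0) = w" "r \<notin> {0, 1, 3, 5} ==> st B v w k b r = B r"
 by (auto simp: st_def)

context
 fixes p :: prog and out :: "nat => nat list" and B :: regs
 assumes p: "!!i v w. runs p (st B v w [] (rev (bits i))) (st B (rev (out i) @ v) w [] (rev (bits i)))"
  and m: "1 \<notin> mods p"
begin

lemma visit_step:
 assumes "runs (visit p) (st B v (x # w) k b) (st B v' (x # w) k' b')"
  "scans (visit p) (st B v' w k' b') T"
 shows "scans (visit p) (st B v (x # w) k b) T"
 by (rule runs_Loop_step[OF _ _ _ _ assms(1)]) (use assms(2) m in \<open>auto simp: notin_mods_visit\<close>)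

lemma visit_skip:
 assumes "scans (visit p) (st B v w [] []) T" "5 \<notin> set u"
 shows "scans (visit p) (st B v (u @ w) [] []) T"
 using assms(2)
proof (induction u)
 case (Cons x u)
 have "runs (visit p) (st B v (x # u @ w) [] []) (st B v (x # u @ w) [] [])"
  unfolding visit_def using Cons.prems by (auto intro!: runs_branch runs_Skip)
 then show ?case unfolding append_Cons by (rule visit_step) (use Cons in auto)
qed (use assms in simp)

lemma visit_cons: "scans (visit p) (st B v w [] []) T ==> x \<noteq> 5 ==> scans (visit p) (st B v (x # w) [] []) T"
 using visit_skip[of v w T "[x]"] by simp

lemma visit_bits:
 assumes "scans (visit p) (st B v w [20] (rev u @ b)) T" "set u \<subseteq> {1, 2}"
 shows "scans (visit p) (st B v (u @ w) [20] b) T"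
 using assms
proof (induction u arbitrary: b)
 case (Cons x u)
 have "runs (visit p) (st B v (x # u @ w) [20] b) (st B v (x # u @ w) [20] (x # b))"
  unfolding visit_def using Cons.prems by (auto intro!: runs_branch runs_eq[OF runs_echo])
 then show ?case unfolding append_Cons by (rule visit_step) (use Cons in auto)
qed simp

lemma visit_trm:
 assumes "scans (visit p) (st B (rev (concat (map out (occ_trm s))) @ v) w [] []) T"
 shows "scans (visit p) (st B v (enc_trm s @ w) [] []) T"
 using assms
proof (induction s arbitrary: v w)
 case (Var i)
 have "runs (visit p) (st B v (4 # w) [20] (rev (bits i))) (st B (rev (out i) @ v) (4 # w) [] [])"
  unfolding visit_def
  by (auto intro!: runs_branch runs_Seq[OF runs_eq[OF runs_Pop] runs_Seq[OF p[of v "4 # w" i] runs_eq[OF runs_clear]]])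
 then have "scans (visit p) (st B v (4 # w) [20] (rev (bits i))) T"
  by (rule visit_step) (use Var in simp)
 then have "scans (visit p) (st B v (bits i @ 4 # w) [20] []) T"
  using set_bits by (intro visit_bits) auto
 note 1 = this
 have "runs (visit p) (st B v (5 # bits i @ 4 # w) [] []) (st B v (5 # bits i @ 4 # w) [20] [])"
  unfolding visit_def by (auto intro!: runs_branch runs_eq[OF runs_Push] simp: base_def)
 then have "scans (visit p) (st B v (5 # bits i @ 4 # w) [] []) T"
  by (rule visit_step[OF _ 1])
 then show ?case by (simp add: enc_nat_def)
next
 case (Const c)
 have "5 \<notin> set (enc_trm (Const c))" using set_enc_nat[of "nat \<bar>c\<bar>"] by auto
 then show ?case using Const by (intro visit_skip) simp_all
qed (simp_all add: visit_cons del: One_nat_def)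

lemma visit_qff:
 "scans (visit p) (st B (rev (concat (map out (occ_qff \<Phi>))) @ v) w [] []) T ==>
  scans (visit p) (st B v (enc_qff \<Phi> @ w) [] []) T"
 by (induction \<Phi> arbitrary: v w) (simp_all add: visit_cons visit_trm del: One_nat_def)

lemma runs_visit:
 "scans (visit p) (st B v (enc_qff \<Phi>) [] []) (st B (rev (concat (map out (occ_qff \<Phi>))) @ v) [] [] [])"
 using visit_qff[of \<Phi> v "[]"] runs_Loop_stop[of "st B _ [] [] []" 1 every "visit p"] by simp

end

text \<open>The parser stack of the first formula becomes empty exactly at its last symbol; all
  later input is diverted to another register.\<close>

definition split_step :: prog where
 "split_step = branch 3 (\<lambda>t. if t = 0 then echo 1 2
   else echo 1 9 ;; branch 1 (\<lambda>x. Pop 3 ;; pushs 3 (rev (expand t x))))"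

definition split_formulas :: prog where
 "split_formulas = Push 3 20 ;; Loop 1 every split_step ;; shift 9 14 ;; shift 2 13"

lemma parse_blocked: "parse w (21 # k) \<noteq> []"
proof (induction w arbitrary: k)
 case (Cons x w)
 then show ?case by (simp add: expand_def)
qed simp

lemma one_notin_split: "1 \<notin> mods split_step"
 by (auto simp: split_step_def mods_branch dest: subsetD[OF mods_echo] subsetD[OF mods_pushs] split: if_splits)

lemma split_rest:
 "R 3 = [] ==> R 1 = w ==> scans split_step R (R(1 := [], 2 := rev w @ R 2))"
proof (induction w arbitrary: R)
 case Nil
 then have "R(1 := [], 2 := rev [] @ R 2) = R" by (simp add: fun_upd_idem)
 moreover have "scans split_step R R" using Nil by (intro runs_Loop_stop) simp
 ultimately show ?case by simp
next
 case (Cons x w)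
 have 1: "runs split_step R (R(2 := x # R 2))"
  unfolding split_step_def using Cons.prems by (auto intro!: runs_branch runs_eq[OF runs_echo])
 have e: "R(2 := x # R 2, 1 := w, 1 := [], 2 := rev w @ (R(2 := x # R 2, 1 := w)) 2) = R(1 := [], 2 := rev (x # w) @ R 2)"
  by (rule ext) simp
 have "scans split_step (R(2 := x # R 2, 1 := w)) (R(1 := [], 2 := rev (x # w) @ R 2))"
  unfolding e[symmetric] by (rule Cons.IH) (use Cons.prems in simp_all)
 then show ?case by (rule runs_Loop_step[OF Cons.prems(2) _ one_notin_split _ 1, rotated 2]) simp_all
qed

lemma split_first:
 "[| parse u (R 3) = []; set (R 3) \<subseteq> {1..}; R 1 = u @ w;
  scans split_step (R(1 := w, 3 := [], 9 := rev u @ R 9)) T |] ==> scans split_step R T"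
proof (induction u arbitrary: R)
 case Nil
 then have "R(1 := w, 3 := [], 9 := rev [] @ R 9) = R" by (simp add: fun_upd_idem)
 then show ?case using Nil.prems(4) by simp
next
 case (Cons x u)
 let ?k = "expand (hd0 (R 3)) x @ tl (R 3)"
 have "R 3 \<noteq> []"
 proof
  assume "R 3 = []"
  then have "parse u [21] = []" using Cons.prems(1) by (simp add: expand_def)
  then show False using parse_blocked by blast
 qed
 then have h: "hd0 (R 3) \<noteq> 0" using Cons.prems(2) by (cases "R 3") auto
 have x: "hd0 (R 1) = x" "R 1 \<noteq> []" "hd (R 1) = x" using Cons.prems(3) by auto
 have 1: "runs split_step R (R(9 := x # R 9, 3 := ?k))"
  unfolding split_step_def
 proof (rule runs_branch)
  have "runs (echo 1 9 ;; branch 1 (\<lambda>x. Pop 3 ;; pushs 3 (rev (expand (hd0 (R 3)) x)))) R (R(9 := x # R 9, 3 := ?k))"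
   by (rule runs_Seq[OF runs_echo runs_branch[OF runs_Seq[OF runs_Pop runs_eq[OF runs_pushs]]]])
    (use x expand_range in \<open>auto simp: fun_eq_iff\<close>)
  then show "runs (if hd0 (R 3) = 0 then echo 1 2 else echo 1 9 ;;
    branch 1 (\<lambda>x. Pop 3 ;; pushs 3 (rev (expand (hd0 (R 3)) x)))) R (R(9 := x # R 9, 3 := ?k))"
   using h by simp
 qed
 let ?R = "R(9 := x # R 9, 3 := ?k, 1 := u @ w)"
 have e: "?R(1 := w, 3 := [], 9 := rev u @ ?R 9) = R(1 := w, 3 := [], 9 := rev (x # u) @ R 9)"
  by (rule ext) simp
 have "scans split_step ?R T"
 proof (rule Cons.IH)
  have "set (tl (R 3)) \<subseteq> {1..}" using Cons.prems(2) by (cases "R 3") auto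
  then show "set (?R 3) \<subseteq> {1..}" using expand_range[of "hd0 (R 3)" x] by auto
  show "scans split_step (?R(1 := w, 3 := [], 9 := rev u @ ?R 9)) T"
   unfolding e by (rule Cons.prems(4))
 qed (use Cons.prems in simp_all)
 then show ?case
  by (rule runs_Loop_step[OF Cons.prems(3)[unfolded append_Cons] _ one_notin_split _ 1, rotated 2]) simp_all
qed

lemma runs_split_formulas:
 assumes "qff_le \<Psi>" "R 1 = enc_qff \<Psi> @ v" "R 2 = []" "R 3 = []" "R 9 = []" "R 13 = []" "R 14 = []"
 shows "runs split_formulas R (R(1 := [], 13 := v, 14 := enc_qff \<Psi>))"
proof -
 have p: "parse (enc_qff \<Psi>) [20] = []" using parse_enc_qff[OF assms(1), of "[]" "[]"] by simp
 have 1: "scans split_step (R(3 := [20])) (R(1 := [], 2 := rev v, 9 := rev (enc_qff \<Psi>)))"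
 proof (rule split_first[of "enc_qff \<Psi>" _ v])
  let ?R = "R(3 := [20])"
  let ?R2 = "?R(1 := v, 3 := [], 9 := rev (enc_qff \<Psi>) @ ?R 9)"
  have "scans split_step ?R2 (?R2(1 := [], 2 := rev v @ ?R2 2))"
   by (rule split_rest) simp_all
  then show "scans split_step ?R2 (R(1 := [], 2 := rev v, 9 := rev (enc_qff \<Psi>)))"
   by (rule runs_eq) (use assms in \<open>auto simp: fun_eq_iff\<close>)
 qed (use assms p in auto)
 show ?thesis unfolding split_formulas_def
  by (rule runs_Seq[OF runs_eq[OF runs_Push] runs_Seq[OF 1 runs_Seq[OF runs_shift runs_eq[OF runs_shift]]]])
   (use assms in \<open>auto simp: base_def fun_eq_iff\<close>)
qed

lemma tame_split_formulas: "tame split_formulas"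
proof -
 have "light {1} (pushs 3 (rev (expand t x)))" for t x
  by (rule light_pushs) (use expand_range[of t x] in \<open>simp_all add: nreg_def\<close>)
 then have 1: "light {1} split_step"
  unfolding split_step_def
  by (auto simp: nreg_def intro!: light_echo light_Seq light_branch light_Pop)
 have "tame (Loop 1 every split_step)"
  by (rule tame_Loop[OF 1]) (use one_notin_split in \<open>auto simp: nreg_def\<close>)
 moreover have "tame (Push 3 20)" by (rule tame_light[of "{}"]) (auto simp: nreg_def base_def intro!: light_Push)
 moreover have "light {9, 2} (shift 9 14 ;; shift 2 13)"
  by (intro light_intros) (simp_all add: nreg_def)
 then have "tame (shift 9 14 ;; shift 2 13)" by (rule tame_light) (simp add: nreg_def)
 ultimately show ?thesis unfolding split_formulas_def by (metis tame_Seq)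
qed

text \<open>A syntax-directed transducer in one pass: nonterminal and input symbol determine the
  printed template, the nonterminals that are pushed, and whether the unary counter in register 5
  loses a unit. \<open>pre\<close> may rearrange stack and counter before the table is
  consulted.\<close>

definition translate :: "prog => (nat => nat => nat list) => (nat => nat => nat list) => (nat => nat => bool) => prog" where
 "translate pre tpl rep dec = pre ;; branch 3 (\<lambda>t. branch 1 (\<lambda>x.
   emit (tpl t x) ;; Pop 3 ;; pushs 3 (rev (rep t x)) ;; (if dec t x then Pop 5 else Skip)))"

lemma one_notin_translate:
 assumes "1 \<notin> mods pre" "!!t x. template {2..<tmp} (tpl t x)"
 shows "1 \<notin> mods (translate pre tpl rep dec)"
proof -
 have "1 \<notin> mods (emit (tpl t x))" for t x
  using mods_emit[OF assms(2)[of t x]] by auto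
 then show ?thesis using assms(1)
  by (auto simp: translate_def mods_branch dest: subsetD[OF mods_pushs] split: if_splits)
qed

lemma template_mono: "template A t ==> A \<subseteq> B ==> template B t"
 by (auto simp: template_def)

lemma translate_step:
 assumes pre: "1 \<notin> mods pre" and tpl: "!!t x. template {2..<tmp} (tpl t x)"
  and rep: "!!t x. set (rep t x) \<subseteq> {1..<base}"
  and 1: "runs pre (st B v (x # w) k b) (st B v' (x # w) (t # k') b')"
  and 2: "scans (translate pre tpl rep dec)
   (st B (rev (pieces (st B v' (x # w) (t # k') b') (tpl t x)) @ v') w (rep t x @ k') (if dec t x then tl b' else b')) T"
 shows "scans (translate pre tpl rep dec) (st B v (x # w) k b) T"
proof -
 let ?v = "rev (pieces (st B v' (x # w) (t # k') b') (tpl t x)) @ v'" and ?b = "if dec t x then tl b' else b'"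
 have e: "runs (emit (tpl t x)) R (R(0 := rev (pieces R (tpl t x)) @ R 0))" for R
  by (rule runs_emit) (rule template_mono[OF tpl], auto)
 have d: "runs (if dec t x then Pop 5 else Skip) (st B ?v (x # w) (rep t x @ k') b') (st B ?v (x # w) (rep t x @ k') ?b)"
  by (auto intro: runs_Skip runs_eq[OF runs_Pop])
 have "runs (emit (tpl t x) ;; Pop 3 ;; pushs 3 (rev (rep t x)) ;; (if dec t x then Pop 5 else Skip))
   (st B v' (x # w) (t # k') b') (st B ?v (x # w) (rep t x @ k') ?b)"
  by (rule runs_Seq[OF e runs_Seq[OF runs_Pop runs_Seq[OF runs_eq[OF runs_pushs] d]]]) (use rep in auto)
 then have body: "runs (translate pre tpl rep dec) (st B v (x # w) k b) (st B ?v (x # w) (rep t x @ k') ?b)"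
  unfolding translate_def by (intro runs_Seq[OF 1] runs_branch) simp
 show ?thesis
  by (rule runs_Loop_step[OF _ _ one_notin_translate[OF pre tpl] _ body]) (use 2 in auto)
qed

lemma light_translate:
 assumes "light A pre" "finite A" "0 \<notin> A" "A \<subseteq> {..<tmp}" "!!t x. template A (tpl t x)" "!!t x. set (rep t x) \<subseteq> {1..<base}"
 shows "light A (translate pre tpl rep dec)"
proof -
 have "light A (if dec t x then Pop 5 else Skip)" for t x
  using assms(2) by (auto intro!: light_Pop light_Skip simp: nreg_def)
 moreover have "light A (pushs 3 (rev (rep t x)))" for t x
  by (rule light_pushs) (use assms(2,6) in \<open>simp_all add: nreg_def\<close>)
 ultimately show ?thesis unfolding translate_def
  by (intro light_Seq light_branch light_emit light_Pop assms) (simp_all add: nreg_def)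
qed

primrec vmap_trm :: "(nat => nat) => trm => trm" where
 "vmap_trm f (Var i) = Var (f i)"
| "vmap_trm f (Const c) = Const c"
| "vmap_trm f (Add s t) = Add (vmap_trm f s) (vmap_trm f t)"
| "vmap_trm f (Mul s t) = Mul (vmap_trm f s) (vmap_trm f t)"

primrec vmap_qff :: "(nat => nat) => qff => qff" where
 "vmap_qff f (Le s t) = Le (vmap_trm f s) (vmap_trm f t)"
| "vmap_qff f (Lt s t) = Lt (vmap_trm f s) (vmap_trm f t)"
| "vmap_qff f (Conj g h) = Conj (vmap_qff f g) (vmap_qff f h)"
| "vmap_qff f (Disj g h) = Disj (vmap_qff f g) (vmap_qff f h)"

text \<open>Bits are listed from the least significant one, so that renaming puts \<open>P\<close> ones in front of the
 code of \<open>i\<close>. The indices below \<open>2 ^ P - 1\<close> are left for auxiliary variables.\<close>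
definition ren :: "nat => nat => nat" where
 "ren P i = 2 ^ P * (i + 1) - 1"

lemma enc_ren: "enc_nat (ren P i) = replicate P 2 @ enc_nat i"
 using bits_ones[of P i] by (simp add: enc_nat_def ren_def)

lemma pieces_simps [simp]:
 "pieces R [] = []" "pieces R (a # t) = piece R a @ pieces R t"
 "a < base ==> piece R a = [a]" "piece R (base + r) = rev (R r)"
 by (simp_all add: pieces_def piece_def)

lemma pieces_append: "pieces R (s @ t) = pieces R s @ pieces R t"
 by (simp add: pieces_def)

lemma translate_number:
 assumes tr: "1 \<notin> mods pre" "!!t x. template {2..<tmp} (tpl t x)" "!!t x. set (rep t x) \<subseteq> {1..<base}"
  and pre: "!!v x w k b. runs pre (st B v (x # w) (16 # k) b) (st B v (x # w) (16 # k) b)"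
  and tab: "!!x. x \<in> {1, 2, 4} ==> tpl 16 x = [x]" "!!x. rep 16 x = (if x = 4 then [] else [16])" "!!x. \<not> dec 16 x"
  and fin: "scans (translate pre tpl rep dec) (st B (rev (enc_nat n) @ v) w k b) T"
 shows "scans (translate pre tpl rep dec) (st B v (enc_nat n @ w) (16 # k) b) T"
proof -
 have "scans (translate pre tpl rep dec) (st B (rev (u @ [4]) @ v) w k b) T ==>
  scans (translate pre tpl rep dec) (st B v (u @ 4 # w) (16 # k) b) T"
  if "set u \<subseteq> {1, 2}" for u v
  using that
 proof (induction u arbitrary: v)
  case Nil
  then show ?case unfolding append_Nil
   by (intro translate_step[OF tr pre]) (simp add: tab base_def)
 next
  case (Cons x u)
  then have "x \<in> {1, 2, 4}" "x \<noteq> 4" "x < base" by (auto simp: base_def)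
  then show ?case unfolding append_Cons using Cons
   by (intro translate_step[OF tr pre]) (simp add: tab)
 qed
 from this[OF set_bits[of n]] fin show ?thesis by (simp add: enc_nat_def)
qed

text \<open>The extra nonterminal 25 stands for the right-hand side of an atom, in front of which
  the added constant and the factor \<open>c\<close> have to be printed. Once this is done it is an
  ordinary term.\<close>

definition scl_pre :: "nat list => nat list => prog" where
 "scl_pre c k = IfTop 3 25 (Pop 3 ;; Push 3 19 ;; emit (8 # k @ 9 # c)) Skip"

definition scl_tpl :: "bool => nat list => nat => nat => nat list" where
 "scl_tpl sw c t x =
  (if t = 20 \<and> x = 10 then 10 # 9 # c
   else if t = 20 \<and> x = 12 then [if sw then 13 else 12]
   else if t = 20 \<and> x = 13 then [if sw then 12 else 13]
   else if t = 19 \<and> x = 5 then [5, base + 6]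
   else if 0 < x \<and> x < base then [x] else [])"

definition scl_rep :: "nat => nat => nat list" where
 "scl_rep t x =
  (if t = 20 then (if x = 10 then [19, 25] else [20, 20])
   else if t = 19 then (if x = 8 \<or> x = 9 then [19, 19] else [16])
   else if x = 4 then [] else [16])"

lemma scl_table:
 "scl_tpl sw c 20 10 = 10 # 9 # c" "scl_tpl sw c 20 12 = [if sw then 13 else 12]"
 "scl_tpl sw c 20 13 = [if sw then 12 else 13]" "scl_tpl sw c 19 5 = [5, base + 6]"
 "x \<in> {6, 7, 8, 9} ==> scl_tpl sw c 19 x = [x]" "x \<in> {1, 2, 4} ==> scl_tpl sw c 16 x = [x]"
 "scl_rep 20 10 = [19, 25]" "x \<in> {12, 13} ==> scl_rep 20 x = [20, 20]"
 "x \<in> {8, 9} ==> scl_rep 19 x = [19, 19]" "x \<in> {5, 6, 7} ==> scl_rep 19 x = [16]"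
 "scl_tpl sw c 19 (if b then 6 else 7) = [if b then 6 else 7]" "scl_rep 19 (if b then 6 else 7) = [16]"
 "scl_rep 16 x = (if x = 4 then [] else [16])"
 by (auto simp: scl_tpl_def scl_rep_def base_def)

lemma less_base:
 "5 < base" "6 < base" "7 < base" "8 < base" "9 < base" "10 < base" "12 < base" "13 < base" "1 < base" "2 < base" "4 < base" "Suc 0 < base"
 by (simp_all add: base_def)

lemma if_less_base: "(if b then 6 else 7) < base" "(if b then 13 else 12) < base" "(if b then 12 else 13) < base"
 by (simp_all add: base_def)

lemma enc_if:
 "enc_qff ((if b then Disj else Conj) f g) = (if b then 13 else 12) # enc_qff f @ enc_qff g"
 "enc_qff ((if b then Conj else Disj) f g) = (if b then 12 else 13) # enc_qff f @ enc_qff g"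
 by simp_all

lemma template_simps [simp]:
 "template A []" "template A (a # t) \<longleftrightarrow> 0 < a \<and> (a < base \<or> a - base \<in> A) \<and> template A t"
 by (auto simp: template_def)

lemma template_append: "template A (s @ t) \<longleftrightarrow> template A s \<and> template A t"
 by (auto simp: template_def)

abbreviation scl_translate :: "bool => nat list => nat list => prog" where
 "scl_translate sw c k \<equiv> translate (scl_pre c k) (scl_tpl sw c) scl_rep (\<lambda>_ _. False)"

lemma scl_translate_wf:
 assumes tc: "template {2..<tmp} c" "template {2..<tmp} k"
 shows "1 \<notin> mods (scl_pre c k)" "template {2..<tmp} (scl_tpl sw c t x)" "set (scl_rep t x) \<subseteq> {1..<base}"
proof -
 have "template {2..<tmp} (8 # k @ 9 # c)" using tc by (simp add: template_append base_def)
 from mods_emit[OF this] show "1 \<notin> mods (scl_pre c k)" by (auto simp: scl_pre_def)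
 show "template {2..<tmp} (scl_tpl sw c t x)" using tc by (simp add: scl_tpl_def base_def)
 show "set (scl_rep t x) \<subseteq> {1..<base}" by (simp add: scl_rep_def base_def)
qed

context
 fixes sw :: bool and c k :: "nat list" and ct :: trm and kc :: int and B :: regs and P :: nat
 assumes tc: "template {2..<tmp} c" "template {2..<tmp} k"
  and c: "!!v w l b. pieces (st B v w l b) c = enc_trm ct"
  and k: "!!v w l b. pieces (st B v w l b) k = enc_trm (Const kc)"
  and P: "B 6 = replicate P 2"
begin

definition "side t = (if t = 25 then 8 # enc_trm (Const kc) @ 9 # enc_trm ct else [] :: nat list)"

lemma runs_scl_pre:
 assumes "t \<in> {19, 25}"
 shows "runs (scl_pre c k) (st B v w (t # l) b) (st B (rev (side t) @ v) w (19 # l) b)"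
proof (cases "t = 25")
 case True
 have "template {1..<tmp} (8 # k @ 9 # c)" using tc template_mono[of "{2..<tmp}" _ "{1..<tmp}"]
  by (simp add: template_append base_def)
 then have e: "runs (emit (8 # k @ 9 # c)) R (R(0 := rev (pieces R (8 # k @ 9 # c)) @ R 0))" for R
  by (rule runs_emit)
 have "runs (Pop 3 ;; Push 3 19 ;; emit (8 # k @ 9 # c)) (st B v w (25 # l) b) (st B (rev (side 25) @ v) w (19 # l) b)"
  by (rule runs_Seq[OF runs_eq[OF runs_Pop] runs_Seq[OF runs_eq[OF runs_Push] runs_eq[OF e]]])
   (auto simp: pieces_append c k side_def base_def)
 then show ?thesis unfolding scl_pre_def True by (intro runs_IfTop) auto
next
 case False
 then have "runs Skip (st B v w (t # l) b) (st B (rev (side t) @ v) w (19 # l) b)"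
  using assms by (auto simp: side_def runs_Skip)
 then show ?thesis unfolding scl_pre_def using False by (intro runs_IfTop) auto
qed

lemma runs_scl_pre':
 assumes "t \<noteq> 25"
 shows "runs (scl_pre c k) (st B v w (t # l) b) (st B v w (t # l) b)"
 unfolding scl_pre_def using assms by (intro runs_IfTop) (auto intro: runs_Skip)

lemma scl_translate_trm:
 assumes "t \<in> {19, 25}" "scans (scl_translate sw c k) (st B (rev (side t @ enc_trm (vmap_trm (ren P) s)) @ v) w l []) T"
 shows "scans (scl_translate sw c k) (st B v (enc_trm s @ w) (t # l) []) T"
 using assms
proof (induction s arbitrary: t v w l)
 case (Var i)
 show ?case unfolding enc_trm.simps append_Cons
  by (rule translate_step[OF scl_translate_wf[OF tc] runs_scl_pre[OF Var(1)]])
   (use Var(2) in \<open>auto simp del: One_nat_def simp: scl_table enc_ren less_base P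
    intro!: translate_number[OF scl_translate_wf[OF tc] runs_scl_pre']\<close>)
next
 case (Const x)
 show ?case unfolding enc_trm.simps append_Cons
  by (rule translate_step[OF scl_translate_wf[OF tc] runs_scl_pre[OF Const(1)]])
   (use Const(2) in \<open>auto simp del: One_nat_def split del: if_split simp: scl_table less_base if_less_base
    intro!: translate_number[OF scl_translate_wf[OF tc] runs_scl_pre']\<close>)
next
 case (Add s1 s2)
 show ?case unfolding enc_trm.simps append_Cons append_assoc
  by (rule translate_step[OF scl_translate_wf[OF tc] runs_scl_pre[OF Add(3)]])
   (use Add.prems(2) in \<open>auto simp del: One_nat_def simp: scl_table less_base side_def[of 19] intro!: Add.IH\<close>)
next
 case (Mul s1 s2)
 show ?case unfolding enc_trm.simps append_Cons append_assoc
  by (rule translate_step[OF scl_translate_wf[OF tc] runs_scl_pre[OF Mul(3)]])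
   (use Mul.prems(2) in \<open>auto simp del: One_nat_def simp: scl_table less_base side_def[of 19] intro!: Mul.IH\<close>)
qed

lemma scl_translate_qff:
 assumes "qff_le \<Phi>" "scans (scl_translate sw c k) (st B (rev (enc_qff (scl sw ct kc (vmap_qff (ren P) \<Phi>))) @ v) w l []) T"
 shows "scans (scl_translate sw c k) (st B v (enc_qff \<Phi> @ w) (20 # l) []) T"
 using assms
proof (induction \<Phi> arbitrary: v w l)
 case (Le s t)
 show ?case unfolding enc_qff.simps append_Cons append_assoc
  by (rule translate_step[OF scl_translate_wf[OF tc] runs_scl_pre'], simp)
   (use Le.prems(2) in \<open>auto simp del: One_nat_def simp: scl_table less_base side_def c intro!: scl_translate_trm\<close>)
next
 case (Conj f g)
 show ?case unfolding enc_qff.simps append_Cons append_assoc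
  by (rule translate_step[OF scl_translate_wf[OF tc] runs_scl_pre'], simp)
   (use Conj.prems in \<open>auto simp del: One_nat_def split del: if_split simp: scl_table enc_if less_base if_less_base intro!: Conj.IH\<close>)
next
 case (Disj f g)
 show ?case unfolding enc_qff.simps append_Cons append_assoc
  by (rule translate_step[OF scl_translate_wf[OF tc] runs_scl_pre'], simp)
   (use Disj.prems in \<open>auto simp del: One_nat_def split del: if_split simp: scl_table enc_if less_base if_less_base intro!: Disj.IH\<close>)
qed simp

lemma runs_scl_translate:
 "qff_le \<Phi> ==> scans (scl_translate sw c k) (st B v (enc_qff \<Phi>) [20] [])
  (st B (rev (enc_qff (scl sw ct kc (vmap_qff (ren P) \<Phi>))) @ v) [] [] [])"
 using scl_translate_qff[of \<Phi> v "[]" "[]"] runs_Loop_stop[of "st B _ [] [] []" 1 every "scl_translate sw c k"] by (simp del: One_nat_def)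

end

section \<open>The sentence without bounds on the quantifiers\<close>

definition eqf :: "trm => trm => qff" where "eqf s t = Conj (Le s t) (Le t s)"

text \<open>The binary code is a zero bit followed by \<open>j\<close> one bits, printable from a
  unary counter. These indices are even, and they lie below \<open>2 ^ P - 1\<close> for
  \<open>j < P\<close>.\<close>

definition name :: "nat => trm" where "name j = Var (2 * (2 ^ j - 1))"

lemma bits_mersenne: "bits (2 ^ j - 1) = replicate j 2"
 using bits_ones[of j 0] by simp

lemma enc_name: "j > 0 ==> enc_trm (name j) = 5 # 1 # replicate j 2 @ [4]"
proof -
 assume "j > 0"
 then have "0 < (2::nat) ^ j - 1" using one_less_power[of "2::nat" j] by simp
 then show ?thesis using bits_mersenne[of j] by (simp add: name_def enc_nat_def bits_even)
qed

lemma bits_two_one: "bits 1 = [2]" "bits (Suc 0) = [2]" "bits 2 = [1, 2]"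
 using bits_mersenne[of 1] bits_even[of 1] by simp_all

abbreviation conjuncts :: "qff list => nat list" where
 "conjuncts cs \<equiv> concat (map (\<lambda>c. 12 # enc_qff c) cs)"

lemma enc_foldr_Conj: "enc_qff (foldr Conj cs f) = conjuncts cs @ enc_qff f"
 by (induction cs) simp_all

lemma runs_emit_st:
 assumes "template {2..<tmp} t"
 shows "runs (emit t) (st B v w k b) (st B (rev (pieces (st B v w k b) t) @ v) w k b)"
 by (rule runs_eq[OF runs_emit[OF template_mono[OF assms]]]) auto

lemma st_upd_other: "r \<notin> {0, 1, 3, 5} ==> (st B v w k b)(r := x) = st (B(r := x)) v w k b"
 by (rule ext) (simp add: st_def)

lemma mods_emit': "template {2..<tmp} t ==> 1 \<notin> mods (emit t)"
 using mods_emit[of "{2..<tmp}" t] by auto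

definition tv :: "nat list" where "tv = [5, base + 6, base + 5, 4]"
definition tu :: "nat list" where "tu = [10, 6, base + 4, 4, 6, base + 5, 4]"

text \<open>Whether \<open>i\<close> is a universally quantified index is not decided by the program but by an atom
 between two constants.\<close>
definition univ :: "nat => nat => qff" where "univ m i = Le (Const (int m)) (Const (int i))"

lemma pieces_tv: "B 6 = replicate P 2 ==> pieces (st B v w k (rev (bits i))) tv = enc_trm (Var (ren P i))"
 by (simp add: tv_def less_base enc_ren) (simp add: enc_nat_def)

lemma pieces_tu: "B 4 = rev (bits m) ==> pieces (st B v w k (rev (bits i))) tu = enc_qff (univ m i)"
 by (simp add: tu_def less_base univ_def enc_nat_def)

definition zt :: trm where "zt = Var 0"

definition escape :: "nat => nat => nat => qff" where
 "escape P m i = Conj (univ m i) (Le (Mul zt (Mul (Var (ren P i)) (Var (ren P i)))) (Add zt (Const (-1))))"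

definition te :: "nat list" where
 "te = 12 # tu @ [10, 9, 5, 4, 9] @ tv @ tv @ [8, 5, 4, 7, 2, 4]"

lemma pieces_te: "[| B 4 = rev (bits m); B 6 = replicate P 2 |] ==>
  pieces (st B v w k (rev (bits i))) te = enc_qff (escape P m i)"
 by (simp add: te_def pieces_append pieces_tu pieces_tv less_base escape_def zt_def enc_nat_def bits_two_one)

text \<open>That the premise has only universal variables is verified by the sentence instead of the
  program: an index below \<open>m\<close> makes both disjuncts false.\<close>

definition wrap_premise :: "nat => nat => nat => qff => qff" where
 "wrap_premise P m i f = Disj (escape P m i) (Conj (univ m i) f)"

text \<open>For an existential index the clause contributes the bound \<open>x ^ 2 \<le> 1\<close>,
  for a universal one the way out when \<open>Y\<close> leaves the box. The constants in
  \<open>univ\<close> select between the two.\<close>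

definition wrap_conclusion :: "nat => nat => nat => qff => qff" where
 "wrap_conclusion P m i f = Disj (escape P m i)
   (Conj (Disj (univ m i) (Le (Mul (Var (ren P i)) (Var (ren P i))) (Const 1))) f)"

definition t_premise :: "nat list" where "t_premise = 13 # te @ 12 # tu"
definition t_conclusion :: "nat list" where "t_conclusion = 13 # te @ 12 # 13 # tu @ [10, 9] @ tv @ tv @ [6, 2, 4]"

lemma templates:
 assumes "{4, 5, 6} \<subseteq> A"
 shows "template A tv" "template A tu" "template A te" "template A t_premise" "template A t_conclusion"
proof -
 show a: "template A tv" "template A tu" using assms by (auto simp: tv_def tu_def base_def)
 show b: "template A te" using a by (simp add: te_def template_append less_base)
 show "template A t_premise" "template A t_conclusion" using a b
  by (simp_all add: t_premise_def t_conclusion_def template_append less_base)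
qed

lemma pieces_premise: "[| B 4 = rev (bits m); B 6 = replicate P 2 |] ==>
  pieces (st B v w k (rev (bits i))) t_premise @ enc_qff f = enc_qff (wrap_premise P m i f)"
 by (simp add: t_premise_def pieces_append pieces_te pieces_tu less_base wrap_premise_def)

lemma pieces_conclusion: "[| B 4 = rev (bits m); B 6 = replicate P 2 |] ==>
  pieces (st B v w k (rev (bits i))) t_conclusion @ enc_qff f = enc_qff (wrap_conclusion P m i f)"
 by (simp add: t_conclusion_def pieces_append pieces_te pieces_tu pieces_tv less_base wrap_conclusion_def enc_nat_def bits_two_one)

definition squares :: "nat => qff list" where
 "squares q = map (\<lambda>j. eqf (name (Suc (Suc j))) (Mul (name (Suc j)) (name (Suc j)))) [0..<q]"

text \<open>Constraints forcing \<open>name (Suc j) = 2 ^ 2 ^ j\<close>.\<close>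
definition big :: "nat => qff list" where
 "big q = eqf (name 1) (Const 2) # squares q"

definition scaled :: "nat => nat => qff => qff => qff" where
 "scaled P q \<Psi> \<Phi> = Disj (scl True zt (-1) (vmap_qff (ren P) \<Psi>)) (scl False (name (Suc q)) 1 (vmap_qff (ren P) \<Phi>))"

definition unbounded :: "nat => nat => nat => qff => qff => qff" where
 "unbounded P q m \<Psi> \<Phi> = foldr Conj (Le zt (Const 0) # big q)
   (foldr (wrap_premise P m) (occ_qff \<Psi>) (foldr (wrap_conclusion P m) (occ_qff \<Phi>) (scaled P q \<Psi> \<Phi>)))"

definition tn :: "nat list" where "tn = [5, 1, base + 11, 4]"
definition tn' :: "nat list" where "tn' = [5, 1, base + 11, 2, 4]"

definition t_square :: "nat list" where
 "t_square = [12, 12, 10] @ tn' @ 9 # tn @ tn @ [10, 9] @ tn @ tn @ tn'"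

text \<open>Register 11 advances by one in each iteration, so that the template always prints the
  names of the next two levels.\<close>

definition chain :: "nat => nat list => prog" where
 "chain s t = copy s 10 ;; Loop 10 every (emit t ;; Push 11 2)"

primrec clears :: "nat list => prog" where
 "clears [] = Skip"
| "clears (r # rs) = clear r ;; clears rs"

definition big_chain :: prog where
 "big_chain = emit [12, 10, 5, 4, 6, 4] ;; Push 11 2 ;;
   emit ([12, 12, 10] @ tn @ [6, 1, 2, 4, 10, 6, 1, 2, 4] @ tn) ;;
   chain 7 t_square"

definition unbound :: prog where
 "unbound = prepare ;; split_formulas ;; big_chain ;;
   copy 14 1 ;; Loop 1 every (visit (emit t_premise)) ;;
   copy 13 1 ;; Loop 1 every (visit (emit t_conclusion)) ;;
   Push 0 13 ;;
   copy 14 1 ;; Push 3 20 ;; Loop 1 every (scl_translate True [5, 4] [7, 2, 4]) ;;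
   copy 13 1 ;; Push 3 20 ;; Loop 1 every (scl_translate False tn [6, 2, 4]) ;;
   clears [4, 6, 7, 8, 11, 13, 14]"

lemma template_tn: "11 \<in> A ==> template A tn" "11 \<in> A ==> template A tn'"
 by (simp_all add: tn_def tn'_def base_def)

lemma pieces_tn: "j > 0 ==> B 11 = replicate j 2 ==> pieces (st B v w k b) tn = enc_trm (name j)"
  "j > 0 ==> B 11 = replicate j 2 ==> pieces (st B v w k b) tn' = enc_trm (name (Suc j))"
 using replicate_append_same[of j "2::nat"]
 by (simp_all add: tn_def tn'_def less_base enc_name)

lemma template_square: "11 \<in> A ==> template A t_square"
 by (simp add: t_square_def template_append template_tn less_base)

lemma runs_chain:
 assumes t: "template {8, 11} t" and B: "B 11 = replicate c 2" "B 10 = []" "B s = replicate q 2" "s \<in> {7, 8}"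
  and F: "!!j v z. pieces (st (B(10 := z, 11 := replicate (c + j) 2)) v w [] []) t = 12 # enc_qff (F j)"
 shows "runs (chain s t) (st B v w [] []) (st (B(11 := replicate (c + q) 2)) (rev (conjuncts (map F [0..<q])) @ v) w [] [])"
proof -
 let ?S = "\<lambda>j z. st (B(10 := z, 11 := replicate (c + j) 2)) (rev (conjuncts (map F [0..<j])) @ v) w [] []"
 have e: "(?S j z)(10 := y) = ?S j y" for j y z by (simp add: st_upd_other fun_upd_twist[of 10 11])
 have "runs (emit t ;; Push 11 2) ((?S j [])(10 := z)) ((?S (Suc j) [])(10 := z))" for j z
  unfolding e by (rule runs_Seq[OF runs_emit_st[OF template_mono[OF t]] runs_eq[OF runs_Push]])
   (simp_all add: base_def F st_upd_other)
 then have 1: "runs (Loop 10 every (emit t ;; Push 11 2)) ((?S 0 [])(10 := replicate q 2)) ((?S q [])(10 := []))"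
  by (intro runs_Loop_unary[where T = "\<lambda>j. ?S j []"]) (use mods_emit[OF t] in auto)
 have "runs (copy s 10) (st B v w [] []) ((?S 0 [])(10 := replicate q 2))"
  unfolding e by (rule runs_eq[OF runs_copy]) (use B in \<open>auto simp: st_upd_other fun_upd_idem\<close>)
 from runs_Seq[OF this 1] show ?thesis unfolding chain_def e using B(2) by (simp add: fun_upd_idem)
qed

lemma runs_square_chain:
 assumes "B 11 = [2]" "B 10 = []" "B s = replicate q 2" "s \<in> {7, 8}"
 shows "runs (chain s t_square) (st B v w [] []) (st (B(11 := replicate (Suc q) 2)) (rev (conjuncts (squares q)) @ v) w [] [])"
proof -
 let ?F = "\<lambda>j. eqf (name (Suc (Suc j))) (Mul (name (Suc j)) (name (Suc j)))"
 have "runs (chain s t_square) (st B v w [] []) (st (B(11 := replicate (1 + q) 2)) (rev (conjuncts (map ?F [0..<q])) @ v) w [] [])"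
  by (rule runs_chain) (use assms in \<open>simp_all add: template_append template_tn t_square_def pieces_append
   pieces_tn[of "Suc _"] less_base eqf_def\<close>)
 then show ?thesis by (simp add: squares_def)
qed

lemma runs_clears: "set rs \<subseteq> {..<tmp} ==> runs (clears rs) R (\<lambda>r. if r \<in> set rs then [] else R r)"
proof (induction rs arbitrary: R)
 case (Cons r rs)
 let ?T = "\<lambda>a. if a \<in> set rs then [] else (R(r := [])) a"
 have "runs (clears rs) (R(r := [])) ?T" using Cons by simp
 then have "runs (clears (r # rs)) R ?T"
  unfolding clears.simps using Cons.prems by (intro runs_Seq[OF runs_clear]) auto
 moreover have "?T = (\<lambda>a. if a \<in> set (r # rs) then [] else R a)" by auto
 ultimately show ?case by (simp only:)
qed (simp add: runs_Skip)

abbreviation outs :: "regs => nat list => nat list => nat list" where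
 "outs B t xs \<equiv> concat (map (\<lambda>i. pieces (st B [] [] [] (rev (bits i))) t) xs)"

lemma scans_visit_emit:
 assumes t: "template {4, 5, 6, 7, 8} t"
 shows "scans (visit (emit t)) (st B v (enc_qff \<Phi>) [] []) (st B (rev (outs B t (occ_qff \<Phi>)) @ v) [] [] [])"
proof (rule runs_visit)
 have t': "template {2..<tmp} t" using t by (rule template_mono) simp
 then show "1 \<notin> mods (emit t)" by (rule mods_emit')
 fix i v w
 let ?b = "rev (bits i)"
 have "piece (st B v w [] ?b) a = piece (st B [] [] [] ?b) a" if "a \<in> set t" for a
  using t that by (auto simp: piece_def template_def)
 then have "pieces (st B v w [] ?b) t = pieces (st B [] [] [] ?b) t" unfolding pieces_def by (metis map_cong)
 then show "runs (emit t) (st B v w [] ?b) (st B (rev (pieces (st B [] [] [] ?b) t) @ v) w [] ?b)"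
  using runs_emit_st[OF t'] by metis
qed

lemma runs_big_chain:
 assumes "B 11 = []" "B 10 = []" "B 7 = replicate q 2"
 shows "runs big_chain (st B v [] [] []) (st (B(11 := replicate (Suc q) 2))
  (rev (conjuncts (Le zt (Const 0) # big q)) @ v) [] [] [])"
proof -
 let ?B = "\<lambda>j. B(11 := replicate (Suc j) 2)"
 let ?v0 = "rev (12 # enc_qff (Le zt (Const 0))) @ v"
 have p1: "pieces (st B v [] [] []) [12, 10, 5, 4, 6, 4] = 12 # enc_qff (Le zt (Const 0))"
  by (simp add: less_base zt_def enc_nat_def)
 have p2: "pieces (st (?B 0) ?v0 [] [] []) ([12, 12, 10] @ tn @ [6, 1, 2, 4, 10, 6, 1, 2, 4] @ tn)
  = 12 # enc_qff (eqf (name 1) (Const 2))"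
  by (simp add: pieces_append pieces_tn[of 1] less_base eqf_def enc_nat_def bits_two_one)
 have t1: "template {2..<tmp} [12, 10, 5, 4, 6, 4]" "template {2..<tmp} ([12, 12, 10] @ tn @ [6, 1, 2, 4, 10, 6, 1, 2, 4] @ tn)"
  by (simp_all add: template_append template_tn less_base)
 note s1 = runs_emit_st[OF t1(1), of B v "[]" "[]" "[]", unfolded p1]
 note s3 = runs_emit_st[OF t1(2), of "?B 0" ?v0 "[]" "[]" "[]", unfolded p2]
 have s2: "runs (Push 11 2) (st B ?v0 [] [] []) (st (?B 0) ?v0 [] [] [])"
  by (rule runs_eq[OF runs_Push]) (simp_all add: base_def, rule ext, simp add: st_def assms)
 have s4: "runs (chain 7 t_square) (st (?B 0) v [] [] []) (st (B(11 := replicate (Suc q) 2))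
  (rev (conjuncts (squares q)) @ v) [] [] [])" for v
  by (rule runs_eq[OF runs_square_chain[of "?B 0" 7 q]]) (simp_all add: assms)
 show ?thesis unfolding big_chain_def
  by (rule runs_Seq[OF s1 runs_Seq[OF s2 runs_Seq[OF s3 runs_eq[OF s4]]]]) (simp add: big_def)
qed

text \<open>In prefix notation a wrapper is fixed text in front of the wrapped formula. Text printed
  occurrence by occurrence therefore is a nested formula, without any closing symbols.\<close>

lemma enc_foldr_wrap:
 assumes "!!i f. out i @ enc_qff f = enc_qff (h i f)"
 shows "concat (map out xs) @ enc_qff f = enc_qff (foldr h xs f)"
 using assms by (induction xs) simp_all

lemma runs_unbound:
 assumes le: "qff_le \<Psi>" "qff_le \<Phi>" and w: "w = enc_nat m @ enc_nat n @ enc_qff \<Psi> @ enc_qff \<Phi>"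
 defines "P \<equiv> 98 * length w ^ 3" and "q \<equiv> 32 * length w ^ 3"
 shows "runs unbound (init_regs w) (init_regs (header P m n @ enc_qff (unbounded P q m \<Psi> \<Phi>)))"
proof -
 define B1 where "B1 = (params m P q)(13 := enc_qff \<Phi>, 14 := enc_qff \<Psi>)"
 define B where "B = B1(11 := replicate (Suc q) 2)"
 define h where "h = header P m n"
 have B: "B 4 = rev (bits m)" "B 6 = replicate P 2" "B 7 = replicate q 2" "B 11 = replicate (Suc q) 2"
  "B 13 = enc_qff \<Phi>" "B 14 = enc_qff \<Psi>"
  by (simp_all add: B_def B1_def params_def)
 have s1: "runs prepare (init_regs w) ((params m P q)(0 := rev h, 1 := enc_qff \<Psi> @ enc_qff \<Phi>))"
  unfolding P_def q_def h_def by (rule runs_prepare[OF w])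
 have s2: "runs split_formulas ((params m P q)(0 := rev h, 1 := enc_qff \<Psi> @ enc_qff \<Phi>)) (st B1 (rev h) [] [] [])"
  by (rule runs_eq[OF runs_split_formulas[OF le(1), of _ "enc_qff \<Phi>"]])
   (simp_all add: params_def, rule ext, simp add: st_def B1_def params_def)
 let ?C = "conjuncts (Le zt (Const 0) # big q)"
 let ?v1 = "rev ?C @ rev h"
 have s3: "runs big_chain (st B1 (rev h) [] [] []) (st B ?v1 [] [] [])"
  unfolding B_def by (rule runs_big_chain) (simp_all add: B1_def params_def)
 have load: "runs (copy 14 1) (st B v [] k []) (st B v (enc_qff \<Psi>) k [])"
   "runs (copy 13 1) (st B v [] k []) (st B v (enc_qff \<Phi>) k [])" for v k
  by (rule runs_eq[OF runs_copy]; simp add: B)+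
 have start: "runs (Push 3 20) (st B v w [] []) (st B v w [20] [])" for v w
  by (rule runs_eq[OF runs_Push]) (simp_all add: base_def)
 let ?o1 = "outs B t_premise (occ_qff \<Psi>)" and ?o2 = "outs B t_conclusion (occ_qff \<Phi>)"
 let ?v2 = "rev ?o1 @ ?v1"
 let ?v3 = "rev ?o2 @ ?v2"
 have s5: "scans (visit (emit t_premise)) (st B ?v1 (enc_qff \<Psi>) [] []) (st B ?v2 [] [] [])"
  and s7: "scans (visit (emit t_conclusion)) (st B ?v2 (enc_qff \<Phi>) [] []) (st B ?v3 [] [] [])"
  by (rule scans_visit_emit, simp add: templates)+
 let ?v4 = "13 # ?v3"
 have s8: "runs (Push 0 13) (st B ?v3 [] [] []) (st B ?v4 [] [] [])"
  by (rule runs_eq[OF runs_Push]) (simp_all add: base_def)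
 let ?f1 = "scl True zt (-1) (vmap_qff (ren P) \<Psi>)" and ?f2 = "scl False (name (Suc q)) 1 (vmap_qff (ren P) \<Phi>)"
 let ?v5 = "rev (enc_qff ?f1) @ ?v4" and ?v6 = "rev (enc_qff ?f2) @ rev (enc_qff ?f1) @ ?v4"
 have s11: "scans (scl_translate True [5, 4] [7, 2, 4]) (st B ?v4 (enc_qff \<Psi>) [20] []) (st B ?v5 [] [] [])"
  by (rule runs_scl_translate[where B = B and P = P and \<Phi> = \<Psi> and ct = zt]) (simp_all add: B le less_base zt_def enc_nat_def bits_two_one)
 have s14: "scans (scl_translate False tn [6, 2, 4]) (st B ?v5 (enc_qff \<Phi>) [20] []) (st B ?v6 [] [] [])"
  by (rule runs_scl_translate[where B = B and P = P and \<Phi> = \<Phi> and ct = "name (Suc q)"])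
   (simp_all add: B(2) le less_base enc_nat_def bits_two_one template_tn pieces_tn(1)[of "Suc q" B, OF _ B(4)])
 have out: "h @ enc_qff (unbounded P q m \<Psi> \<Phi>) = rev ?v6"
 proof -
  note w = enc_foldr_wrap[OF pieces_premise[OF B(1,2)]] enc_foldr_wrap[OF pieces_conclusion[OF B(1,2)]]
  have "rev ?v6 = h @ ?C @ ?o1 @ ?o2 @ enc_qff (scaled P q \<Psi> \<Phi>)"
   by (simp add: scaled_def)
  then show ?thesis unfolding w enc_foldr_Conj[symmetric] unbounded_def
   by simp
 qed
 have s15: "runs (clears [4, 6, 7, 8, 11, 13, 14]) (st B ?v6 [] [] []) (init_regs (h @ enc_qff (unbounded P q m \<Psi> \<Phi>)))"
  unfolding out
  by (rule runs_eq[OF runs_clears]) (simp, rule ext, simp add: st_def B_def B1_def params_def init_regs_def)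
 show ?thesis unfolding unbound_def h_def[symmetric]
  by (rule runs_Seq[OF s1 runs_Seq[OF s2 runs_Seq[OF s3 runs_Seq[OF load(1) runs_Seq[OF s5
    runs_Seq[OF load(2) runs_Seq[OF s7 runs_Seq[OF s8 runs_Seq[OF load(1) runs_Seq[OF start runs_Seq[OF s11
    runs_Seq[OF load(2) runs_Seq[OF start runs_Seq[OF s14 s15]]]]]]]]]]]]]])
qed

lemma light_scl_translate:
 assumes "template A c" "template A k" "finite A" "0 \<notin> A" "A \<subseteq> {..<tmp}" "6 \<in> A"
 shows "light A (scl_translate sw c k)"
proof (rule light_translate)
 show "light A (scl_pre c k)" unfolding scl_pre_def
  by (intro light_IfTop light_Seq light_Pop light_Push light_emit light_Skip)
   (use assms in \<open>simp_all add: template_append less_base nreg_def base_def\<close>)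
 show "template A (scl_tpl sw c t x)" for t x using assms by (simp add: scl_tpl_def base_def)
 show "set (scl_rep t x) \<subseteq> {1..<base}" for t x by (simp add: scl_rep_def base_def)
qed (use assms in auto)

lemma tame_emit: "[| template A T; A \<subseteq> {1..<tmp} |] ==> tame (emit T)"
 by (rule tame_light[OF light_emit[of A]]) (auto simp: nreg_def intro: finite_subset)

lemma tame_copy: "[| s \<noteq> r; s < tmp; r < tmp |] ==> tame (copy s r)"
 by (rule tame_light[of "{s}"]) (auto simp: nreg_def)

lemma tame_Push: "[| r < tmp; 0 < a; a < base |] ==> tame (Push r a)"
 by (rule tame_light[of "{}"]) (auto simp: nreg_def intro!: light_Push)

lemma tame_clear: "r < tmp ==> tame (clear r)"
 by (rule tame_light[of "{r}"]) (auto simp: nreg_def intro!: light_clear)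

lemma tame_clears: "set rs \<subseteq> {..<tmp} ==> tame (clears rs)"
proof -
 assume rs: "set rs \<subseteq> {..<tmp}"
 have "light (set qs) (clears rs)" if "set rs \<subseteq> set qs \<inter> {..<tmp}" for qs rs
  using that by (induction rs) (auto simp: nreg_def intro!: light_Seq light_clear)
 from this[of rs rs] rs show ?thesis by (intro tame_light[of "set rs"]) (auto simp: nreg_def)
qed

lemma tame_chain:
 assumes t: "template {8, 11} t" and s: "s \<in> {7, 8}"
 shows "tame (chain s t)"
proof -
 have "light {8, 11} (emit t ;; Push 11 2)"
  by (intro light_Seq light_emit t light_Push) (simp_all add: nreg_def base_def)
 then have "tame (Loop 10 every (emit t ;; Push 11 2))"
  by (rule tame_Loop) (use mods_emit[OF t] in \<open>auto simp: nreg_def\<close>)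
 then show ?thesis unfolding chain_def using s by (intro tame_Seq[of "copy _ _"] tame_copy) auto
qed

lemma tame_visit_emit:
 assumes t: "template {4, 5, 6, 7, 8} t"
 shows "tame (Loop 1 every (visit (emit t)))"
proof -
 have "template {2..<tmp} t" using t by (rule template_mono) simp
 then show ?thesis
  by (intro tame_Loop[OF light_visit[OF light_emit[OF _ _ _ t]]])
   (simp_all add: nreg_def notin_mods_visit mods_emit' del: One_nat_def)
qed

lemma tame_unbound: "tame unbound"
proof -
 have l: "tame (copy 14 1)" "tame (copy 13 1)" by (simp_all add: tame_copy)
 have p: "tame (Push 0 13)" "tame (Push 3 20)" "tame (Push 11 2)" by (simp_all add: tame_Push base_def)
 have v: "tame (Loop 1 every (visit (emit t_premise)))" "tame (Loop 1 every (visit (emit t_conclusion)))"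
  by (rule tame_visit_emit, simp add: templates)+
 have s: "tame (Loop 1 every (scl_translate True [5, 4] [7, 2, 4]))" "tame (Loop 1 every (scl_translate False tn [6, 2, 4]))"
 proof -
  have "light {6, 11} (scl_translate True [5, 4] [7, 2, 4])" "light {6, 11} (scl_translate False tn [6, 2, 4])"
   by (rule light_scl_translate; simp add: less_base template_tn)+
  moreover have "1 \<notin> mods (scl_translate sw c k)" if "template {2..<tmp} c" "template {2..<tmp} k" for sw c k
   using scl_translate_wf[OF that] by (intro one_notin_translate)
  then have "1 \<notin> mods (scl_translate True [5, 4] [7, 2, 4])" "1 \<notin> mods (scl_translate False tn [6, 2, 4])"
   by (simp_all add: template_tn less_base)
  ultimately show "tame (Loop 1 every (scl_translate True [5, 4] [7, 2, 4]))" "tame (Loop 1 every (scl_translate False tn [6, 2, 4]))"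
   by (auto intro!: tame_Loop[of "{6, 11}"] simp: nreg_def)
 qed
 have b: "tame big_chain"
  unfolding big_chain_def
  by (intro tame_Seq[of "emit _"] tame_Seq[of "Push _ _"] tame_emit[of "{11}"] p(3) tame_chain)
   (simp_all add: template_square template_append template_tn less_base)
 show ?thesis unfolding unbound_def
  by (rule tame_Seq[OF tame_prepare tame_Seq[OF tame_split_formulas tame_Seq[OF b tame_Seq[OF l(1) tame_Seq[OF v(1)
   tame_Seq[OF l(2) tame_Seq[OF v(2) tame_Seq[OF p(1) tame_Seq[OF l(1) tame_Seq[OF p(2) tame_Seq[OF s(1)
   tame_Seq[OF l(2) tame_Seq[OF p(2) tame_Seq[OF s(2) tame_clears]]]]]]]]]]]]]]) simp
qed

section \<open>Homogenisation and rescaling\<close>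

definition unit_name :: "nat => trm" where "unit_name j = Var (2 ^ j - 1)"

text \<open>A run of one bits again comes from a unary counter. These indices are odd for positive
  \<open>j\<close>, hence different from those of \<open>name\<close>.\<close>

lemma enc_unit_name: "enc_trm (unit_name j) = 5 # replicate j 2 @ [4]"
 using bits_mersenne[of j] by (simp add: unit_name_def enc_nat_def)

text \<open>Variables stand for scaled values \<open>x = u * v\<close> with \<open>u = name Q\<close>; the value of a term at level
 \<open>j\<close> is scaled by \<open>u ^ 2 ^ j\<close>, where \<open>unit_name j = u ^ (2 ^ j - 1)\<close>.\<close>
primrec hom_trm :: "nat => nat => trm => nat => trm" where
 "hom_trm P Q (Var i) j = Mul (unit_name j) (Var (ren P i))"
| "hom_trm P Q (Const c) j = Mul (Mul (unit_name j) (name Q)) (Const c)"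
| "hom_trm P Q (Add s t) j = Add (hom_trm P Q s j) (hom_trm P Q t j)"
| "hom_trm P Q (Mul s t) j = Mul (hom_trm P Q s (j - 1)) (hom_trm P Q t (j - 1))"

primrec hom_qff :: "nat => nat => nat => qff => qff" where
 "hom_qff P Q j (Le s t) = Le (hom_trm P Q s j) (hom_trm P Q t j)"
| "hom_qff P Q j (Lt s t) = Lt (hom_trm P Q s j) (hom_trm P Q t j)"
| "hom_qff P Q j (Conj f g) = Conj (hom_qff P Q j f) (hom_qff P Q j g)"
| "hom_qff P Q j (Disj f g) = Disj (hom_qff P Q j f) (hom_qff P Q j g)"

primrec mul_depth :: "trm => nat" where
 "mul_depth (Var i) = 0"
| "mul_depth (Const c) = 0"
| "mul_depth (Add s t) = max (mul_depth s) (mul_depth t)"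
| "mul_depth (Mul s t) = Suc (max (mul_depth s) (mul_depth t))"

primrec mul_depth_qff :: "qff => nat" where
 "mul_depth_qff (Le s t) = max (mul_depth s) (mul_depth t)"
| "mul_depth_qff (Lt s t) = max (mul_depth s) (mul_depth t)"
| "mul_depth_qff (Conj f g) = max (mul_depth_qff f) (mul_depth_qff g)"
| "mul_depth_qff (Disj f g) = max (mul_depth_qff f) (mul_depth_qff g)"

text \<open>Number of multiplications ending at the end of a term; the level is restored lazily, by
 markers 22 on the stack.\<close>
primrec pending :: "trm => nat" where
 "pending (Var i) = 0"
| "pending (Const c) = 0"
| "pending (Add s t) = pending t"
| "pending (Mul s t) = Suc (pending t)"

primrec pending_qff :: "qff => nat" where
 "pending_qff (Le s t) = pending t"
| "pending_qff (Lt s t) = pending t"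
| "pending_qff (Conj f g) = pending_qff g"
| "pending_qff (Disj f g) = pending_qff g"

lemma pending_le: "pending s \<le> mul_depth s"
 by (induction s) auto

lemma pending_qff_le: "pending_qff \<Phi> \<le> mul_depth_qff \<Phi>"
 by (induction \<Phi>) (auto intro: order_trans[OF pending_le])

definition hom_pre :: prog where "hom_pre = Loop 3 (\<lambda>x. x = 22) (Push 5 2)"

definition hom_tpl :: "nat => nat => nat list" where
 "hom_tpl t x =
  (if t = 19 \<and> x = 5 then [9, 5, base + 5, 4, 5, base + 6]
   else if t = 19 \<and> (x = 6 \<or> x = 7) then [9, 9, 5, base + 5, 4, 5, 1, base + 8, 4, x]
   else if 0 < x \<and> x < base then [x] else [])"

definition hom_rep :: "nat => nat => nat list" where
 "hom_rep t x =
  (if t = 20 then (if x = 10 then [19, 19] else [20, 20])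
   else if t = 19 then (if x = 8 then [19, 19] else if x = 9 then [19, 19, 22] else [16])
   else if x = 4 then [] else [16])"

definition hom_dec :: "nat => nat => bool" where "hom_dec t x \<longleftrightarrow> t = 19 \<and> x = 9"

lemma hom_table:
 "x \<in> {10, 12, 13} ==> hom_tpl 20 x = [x]" "hom_tpl 19 5 = [9, 5, base + 5, 4, 5, base + 6]"
 "x \<in> {8, 9} ==> hom_tpl 19 x = [x]" "x \<in> {1, 2, 4} ==> hom_tpl 16 x = [x]"
 "hom_tpl 19 (if b then 6 else 7) = [9, 9, 5, base + 5, 4, 5, 1, base + 8, 4, if b then 6 else 7]"
 "hom_rep 20 10 = [19, 19]" "x \<in> {12, 13} ==> hom_rep 20 x = [20, 20]"
 "hom_rep 19 8 = [19, 19]" "hom_rep 19 9 = [19, 19, 22]" "hom_rep 19 5 = [16]" "hom_rep 19 (if b then 6 else 7) = [16]"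
 "hom_rep 16 x = (if x = 4 then [] else [16])"
 "hom_dec 19 9" "x \<noteq> 9 ==> \<not> hom_dec t x" "\<not> hom_dec 16 x" "\<not> hom_dec 20 x" "\<not> hom_dec 19 (if b then 6 else 7)"
 by (auto simp: hom_tpl_def hom_rep_def hom_dec_def base_def)

abbreviation hom_translate :: prog where
 "hom_translate \<equiv> translate hom_pre hom_tpl hom_rep hom_dec"

lemma hom_translate_wf:
 "1 \<notin> mods hom_pre" "template {2..<tmp} (hom_tpl t x)" "set (hom_rep t x) \<subseteq> {1..<base}"
 by (auto simp: hom_pre_def hom_tpl_def hom_rep_def base_def)

lemma runs_hom_pre:
 assumes "t \<noteq> 22"
 shows "runs hom_pre (st B v w (replicate u 22 @ t # l) b) (st B v w (t # l) (replicate u 2 @ b))"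
proof (induction u arbitrary: b)
 case 0
 then show ?case unfolding hom_pre_def using assms by (auto intro: runs_Loop_stop)
next
 case (Suc u)
 have 1: "runs (Push 5 2) (st B v w (replicate (Suc u) 22 @ t # l) b) (st B v w (replicate (Suc u) 22 @ t # l) (2 # b))"
  by (rule runs_eq[OF runs_Push]) (simp_all add: base_def)
 have 2: "runs (Loop 3 (\<lambda>x. x = 22) (Push 5 2)) (st B v w (replicate u 22 @ t # l) (2 # b)) (st B v w (t # l) (replicate (Suc u) 2 @ b))"
  using Suc[of "2 # b"] by (simp add: hom_pre_def replicate_app_Cons_same)
 show ?case unfolding hom_pre_def
  by (rule runs_Loop_step[OF _ _ _ _ 1]) (use 2 in auto)
qed

lemma runs_hom_pre':
 assumes "t \<noteq> 22"
 shows "runs hom_pre (st B v w (t # l) b) (st B v w (t # l) b)"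
 using runs_hom_pre[OF assms, of _ _ _ 0] by simp

context
 fixes B :: regs and P Q :: nat
 assumes P: "B 6 = replicate P 2" and Q: "B 8 = replicate Q 2" "Q > 0"
begin

lemma refill: "u \<le> L ==> replicate u 2 @ replicate (L - u) 2 = replicate L (2::nat)"
 by (simp add: replicate_add[symmetric])

text \<open>The invariant of lazy restoration: the counter together with the \<open>u\<close>
  markers on top of the stack shows the level \<open>L\<close> of the term. Afterwards the markers
  of the products that end with the term, \<open>pending s\<close> in number, are still on the
  stack.\<close>

lemma hom_translate_trm:
 assumes "mul_depth s \<le> L" "u \<le> L"
  "scans hom_translate (st B (rev (enc_trm (hom_trm P Q s L)) @ v) w (replicate (pending s) 22 @ l) (replicate (L - pending s) 2)) T"
 shows "scans hom_translate (st B v (enc_trm s @ w) (replicate u 22 @ 19 # l) (replicate (L - u) 2)) T"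
 using assms
proof (induction s arbitrary: L u v w l)
 case (Var i)
 show ?case unfolding enc_trm.simps append_Cons
  by (rule translate_step[OF hom_translate_wf runs_hom_pre], simp, unfold refill[OF Var(2)])
   (use Var(3) in \<open>auto simp del: One_nat_def split del: if_split simp: hom_table less_base P enc_unit_name enc_ren
    intro!: translate_number[OF hom_translate_wf runs_hom_pre']\<close>)
next
 case (Const x)
 show ?case unfolding enc_trm.simps append_Cons
  by (rule translate_step[OF hom_translate_wf runs_hom_pre], simp, unfold refill[OF Const(2)])
   (use Const(3) in \<open>auto simp del: One_nat_def split del: if_split simp: hom_table less_base if_less_base Q(1)
    enc_unit_name enc_name[OF Q(2)] intro!: translate_number[OF hom_translate_wf runs_hom_pre']\<close>)
next
 case (Add s1 s2)
 have d: "mul_depth s1 \<le> L" "mul_depth s2 \<le> L" "pending s1 \<le> L"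
  using Add(3) pending_le[of s1] by auto
 show ?case unfolding enc_trm.simps append_Cons append_assoc
  by (rule translate_step[OF hom_translate_wf runs_hom_pre], simp, unfold refill[OF Add(4)])
   (use Add.prems(3) Add.IH(1)[OF d(1), of 0] Add.IH(2)[OF d(2,3)] in \<open>simp del: One_nat_def add: hom_table less_base\<close>)
next
 case (Mul s1 s2)
 have d: "mul_depth s1 \<le> L - 1" "mul_depth s2 \<le> L - 1" "pending s1 \<le> L - 1"
  using Mul(3) pending_le[of s1] by auto
 have tl: "tl (replicate L 2) = replicate (L - 1) (2::nat)" by (cases L) auto
 have "scans hom_translate (st B (rev (enc_trm (hom_trm P Q s1 (L - 1))) @ 9 # v) (enc_trm s2 @ w)
   (replicate (pending s1) 22 @ 19 # 22 # l) (replicate (L - 1 - pending s1) 2)) T"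
  using Mul.prems(3) by (intro Mul.IH(2)[OF d(2,3)]) (simp add: replicate_app_Cons_same plus_1_eq_Suc[THEN fun_cong] del: One_nat_def)
 then show ?case unfolding enc_trm.simps append_Cons append_assoc
  by (intro translate_step[OF hom_translate_wf runs_hom_pre], simp, unfold refill[OF Mul(4)])
   (use Mul.IH(1)[OF d(1), of 0] tl in \<open>simp del: One_nat_def add: hom_table less_base\<close>)
qed

lemma hom_translate_qff:
 assumes "qff_le \<Phi>" "mul_depth_qff \<Phi> \<le> L" "u \<le> L"
  "scans hom_translate (st B (rev (enc_qff (hom_qff P Q L \<Phi>)) @ v) w (replicate (pending_qff \<Phi>) 22 @ l) (replicate (L - pending_qff \<Phi>) 2)) T"
 shows "scans hom_translate (st B v (enc_qff \<Phi> @ w) (replicate u 22 @ 20 # l) (replicate (L - u) 2)) T"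
 using assms
proof (induction \<Phi> arbitrary: u v w l)
 case (Le s t)
 have d: "mul_depth s \<le> L" "mul_depth t \<le> L" "pending s \<le> L"
  using Le(2) pending_le[of s] by auto
 show ?case unfolding enc_qff.simps append_Cons append_assoc
  by (rule translate_step[OF hom_translate_wf runs_hom_pre], simp, unfold refill[OF Le(3)])
   (use Le.prems(4) hom_translate_trm[OF d(1), of 0] hom_translate_trm[OF d(2,3)]
    in \<open>simp del: One_nat_def add: hom_table less_base\<close>)
next
 case (Conj f g)
 have d: "mul_depth_qff f \<le> L" "mul_depth_qff g \<le> L" "pending_qff f \<le> L" "qff_le f" "qff_le g"
  using Conj.prems pending_qff_le[of f] by auto
 show ?case unfolding enc_qff.simps append_Cons append_assoc
  by (rule translate_step[OF hom_translate_wf runs_hom_pre], simp, unfold refill[OF Conj(5)])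
   (use Conj.prems(4) Conj.IH(1)[OF d(4,1), of 0] Conj.IH(2)[OF d(5,2,3)]
    in \<open>simp del: One_nat_def add: hom_table less_base\<close>)
next
 case (Disj f g)
 have d: "mul_depth_qff f \<le> L" "mul_depth_qff g \<le> L" "pending_qff f \<le> L" "qff_le f" "qff_le g"
  using Disj.prems pending_qff_le[of f] by auto
 show ?case unfolding enc_qff.simps append_Cons append_assoc
  by (rule translate_step[OF hom_translate_wf runs_hom_pre], simp, unfold refill[OF Disj(5)])
   (use Disj.prems(4) Disj.IH(1)[OF d(4,1), of 0] Disj.IH(2)[OF d(5,2,3)]
    in \<open>simp del: One_nat_def add: hom_table less_base\<close>)
qed simp

lemma runs_hom_translate:
 "[| qff_le \<Phi>; mul_depth_qff \<Phi> \<le> L |] ==> \<exists>k b. scans hom_translate (st B v (enc_qff \<Phi>) [20] (replicate L 2))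
  (st B (rev (enc_qff (hom_qff P Q L \<Phi>)) @ v) [] k b)"
 using hom_translate_qff[of \<Phi> L 0 v "[]" "[]"] runs_Loop_stop[of "st B _ [] _ _" 1 every hom_translate]
 by (simp del: One_nat_def) blast

end

definition ta :: "nat list" where "ta = [5, base + 11, 4]"
definition ta' :: "nat list" where "ta' = [5, base + 11, 2, 4]"
definition tQ :: "nat list" where "tQ = [5, 1, base + 8, 4]"
definition tq :: "nat list" where "tq = [5, 1, base + 7, 4]"

text \<open>Constraints forcing \<open>name (Suc j) = (1 / 2) ^ 2 ^ j\<close> and \<open>unit_name j = u ^ (2 ^ j - 1)\<close>.\<close>
definition small :: "nat => qff list" where
 "small Q = eqf (Mul (Const 2) (name 1)) (Const 1) # squares Q"

definition unit_step :: "nat => nat => qff" where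
 "unit_step Q j = eqf (unit_name (Suc j)) (Mul (Mul (unit_name j) (unit_name j)) (name Q))"

definition units :: "nat => nat => qff list" where
 "units Q q = eqf (unit_name 0) (Const 1) # map (unit_step Q) [0..<q]"

text \<open>For \<open>x = u * v\<close> with \<open>u = name Q\<close> the clause says
  \<open>v ^ 2 \<le> 2 ^ 2 ^ q\<close>, since the square of \<open>name q\<close> is the reciprocal
  of that number. Only values in the unit interval are multiplied.\<close>

definition wrap_bound :: "nat => nat => nat => nat => nat => qff => qff" where
 "wrap_bound P q Q m i f = Conj (Disj (univ m i)
   (Le (Mul (Mul (Var (ren P i)) (name q)) (Mul (Var (ren P i)) (name q))) (Mul (name Q) (name Q)))) f"

definition rescaled :: "nat => nat => nat => nat => qff => qff" where
 "rescaled P q Q m \<Phi> = foldr Conj (small Q @ units Q q)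
   (foldr (wrap_bound P q Q m) (occ_qff \<Phi>) (hom_qff P Q q \<Phi>))"

definition t_bound :: "nat list" where
 "t_bound = 12 # 13 # tu @ [10, 9, 9] @ tv @ tq @ [9] @ tv @ tq @ [9] @ tQ @ tQ"

lemma pieces_bound: "[| B 4 = rev (bits m); B 6 = replicate P 2; B 7 = replicate q 2; B 8 = replicate Q 2; q > 0; Q > 0 |] ==>
  pieces (st B v w k (rev (bits i))) t_bound @ enc_qff f = enc_qff (wrap_bound P q Q m i f)"
 by (simp add: t_bound_def pieces_append pieces_tu pieces_tv less_base wrap_bound_def tq_def tQ_def enc_name)

lemma template_bound: "{4, 5, 6, 7, 8} \<subseteq> A ==> template A t_bound"
 using templates(1,2)[of A] by (simp add: t_bound_def template_append less_base tq_def tQ_def)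

definition small_chain :: prog where
 "small_chain = Push 11 2 ;;
   emit ([12, 12, 10, 9, 6, 1, 2, 4] @ tn @ [6, 2, 4, 10, 6, 2, 4, 9, 6, 1, 2, 4] @ tn) ;;
   chain 8 t_square ;; clear 11"

definition t_unit :: "nat list" where
 "t_unit = [12, 12, 10] @ ta' @ [9, 9] @ ta @ ta @ tQ @ [10, 9, 9] @ ta @ ta @ tQ @ ta'"

definition unit_chain :: prog where
 "unit_chain = emit ([12, 12, 10] @ ta @ [6, 2, 4, 10, 6, 2, 4] @ ta) ;;
   chain 7 t_unit"

definition rescale :: prog where
 "rescale = prepare ;; copy 1 13 ;; small_chain ;; unit_chain ;;
   Loop 1 every (visit (emit t_bound)) ;;
   copy 13 1 ;; copy 7 5 ;; Push 3 20 ;; Loop 1 every hom_translate ;;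
   clears [3, 4, 5, 6, 7, 8, 11, 13]"

lemma pieces_ta: "B 11 = replicate j 2 ==> pieces (st B v w k b) ta = enc_trm (unit_name j)"
  "B 11 = replicate j 2 ==> pieces (st B v w k b) ta' = enc_trm (unit_name (Suc j))"
 using replicate_append_same[of j "2::nat"]
 by (simp_all add: ta_def ta'_def less_base enc_unit_name)

lemma pieces_tQ: "B 8 = replicate Q 2 ==> Q > 0 ==> pieces (st B v w k b) tQ = enc_trm (name Q)"
 by (simp add: tQ_def less_base enc_name)

lemma template_ta: "11 \<in> A ==> template A ta" "11 \<in> A ==> template A ta'" "8 \<in> A ==> template A tQ"
 by (simp_all add: ta_def ta'_def tQ_def base_def)

lemma template_unit: "{8, 11} \<subseteq> A ==> template A t_unit"
 by (simp add: t_unit_def template_append template_ta less_base)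

lemma runs_small_chain:
 assumes "B 11 = []" "B 10 = []" "B 8 = replicate Q 2"
 shows "runs small_chain (st B v w [] []) (st B
  (rev (conjuncts (small Q)) @ v) w [] [])"
proof -
 let ?t = "[12, 12, 10, 9, 6, 1, 2, 4] @ tn @ [6, 2, 4, 10, 6, 2, 4, 9, 6, 1, 2, 4] @ tn"
 let ?B = "B(11 := [2])"
 have p: "pieces (st ?B v w [] []) ?t = 12 # enc_qff (eqf (Mul (Const 2) (name 1)) (Const 1))"
  by (simp add: pieces_append pieces_tn[of 1] less_base eqf_def enc_nat_def bits_two_one)
 have s1: "runs (Push 11 2) (st B v w [] []) (st ?B v w [] [])"
  by (rule runs_eq[OF runs_Push]) (simp_all add: base_def st_upd_other assms)
 have s2: "runs (emit ?t) (st ?B v w [] []) (st ?B (rev (pieces (st ?B v w [] []) ?t) @ v) w [] [])"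
  by (rule runs_emit_st) (simp add: template_append template_tn less_base)
 have s3: "runs (chain 8 t_square) (st ?B v w [] []) (st (B(11 := replicate (Suc Q) 2))
  (rev (conjuncts (squares Q)) @ v) w [] [])" for v
  by (rule runs_eq[OF runs_square_chain[of ?B 8 Q]]) (simp_all add: assms)
 show ?thesis unfolding small_chain_def
  by (rule runs_Seq[OF s1 runs_Seq[OF s2[unfolded p] runs_Seq[OF s3 runs_eq[OF runs_clear]]]])
   (simp_all add: small_def st_upd_other assms fun_upd_idem)
qed

lemma runs_unit_chain:
 assumes "B 11 = []" "B 10 = []" "B 8 = replicate Q 2" "B 7 = replicate q 2" "Q > 0"
 shows "runs unit_chain (st B v w [] []) (st (B(11 := replicate q 2))
  (rev (conjuncts (units Q q)) @ v) w [] [])"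
proof -
 let ?t = "[12, 12, 10] @ ta @ [6, 2, 4, 10, 6, 2, 4] @ ta" and ?u = "eqf (unit_name 0) (Const 1)"
 have p: "pieces (st B v w [] []) ?t = 12 # enc_qff ?u"
  by (simp add: pieces_append pieces_ta[of _ 0] less_base eqf_def enc_nat_def bits_two_one assms)
 have s1: "runs (emit ?t) (st B v w [] []) (st B (rev (12 # enc_qff ?u) @ v) w [] [])"
  unfolding p[symmetric] by (rule runs_emit_st) (simp add: template_append template_ta less_base)
 have s2: "runs (chain 7 t_unit) (st B v w [] []) (st (B(11 := replicate (0 + q) 2))
   (rev (conjuncts (map (unit_step Q) [0..<q])) @ v) w [] [])" for v
  by (rule runs_chain) (use assms in \<open>simp_all add: template_append template_ta t_unit_def pieces_append pieces_ta
   pieces_tQ[of _ Q] less_base eqf_def unit_step_def\<close>)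
 show ?thesis unfolding unit_chain_def
  by (rule runs_Seq[OF s1 runs_eq[OF s2]]) (simp add: units_def)
qed

lemma runs_rescale:
 assumes le: "qff_le \<Phi>" and w: "w = enc_nat m @ enc_nat n @ enc_qff \<Phi>"
 defines "P \<equiv> 98 * length w ^ 3" and "q \<equiv> 32 * length w ^ 3" and "Q \<equiv> 96 * length w ^ 3"
 assumes depth: "mul_depth_qff \<Phi> \<le> q"
 shows "runs rescale (init_regs w) (init_regs (header P m n @ enc_qff (rescaled P q Q m \<Phi>)))"
proof -
 have pos: "q > 0" "Q > 0" using w by (auto simp: q_def Q_def enc_nat_def)
 have Q: "Q = 3 * q" by (simp add: q_def Q_def)
 define B where "B = (params m P q)(13 := enc_qff \<Phi>)"
 define B' where "B' = B(11 := replicate q 2)"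
 define h where "h = header P m n"
 have B: "B 4 = rev (bits m)" "B 6 = replicate P 2" "B 7 = replicate q 2" "B 8 = replicate Q 2" "B 11 = []" "B 10 = []"
  by (simp_all add: B_def params_def Q)
 have B': "B' 4 = rev (bits m)" "B' 6 = replicate P 2" "B' 7 = replicate q 2" "B' 8 = replicate Q 2" "B' 13 = enc_qff \<Phi>"
  by (simp_all add: B'_def B_def params_def Q)
 have s1: "runs prepare (init_regs w) ((params m P q)(0 := rev h, 1 := enc_qff \<Phi>))"
  unfolding P_def q_def h_def by (rule runs_prepare[OF w])
 have s2: "runs (copy 1 13) ((params m P q)(0 := rev h, 1 := enc_qff \<Phi>)) (st B (rev h) (enc_qff \<Phi>) [] [])"
  by (rule runs_eq[OF runs_copy]) (simp_all, rule ext, simp add: st_def B_def params_def)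
 let ?C1 = "conjuncts (small Q)" and ?C2 = "conjuncts (units Q q)"
 have s3: "runs small_chain (st B (rev h) (enc_qff \<Phi>) [] []) (st B (rev ?C1 @ rev h) (enc_qff \<Phi>) [] [])"
  by (rule runs_small_chain) (rule B)+
 let ?v1 = "rev ?C2 @ rev ?C1 @ rev h"
 have s4: "runs unit_chain (st B (rev ?C1 @ rev h) (enc_qff \<Phi>) [] []) (st B' ?v1 (enc_qff \<Phi>) [] [])"
  unfolding B'_def by (rule runs_unit_chain) (rule B pos)+
 let ?o = "outs B' t_bound (occ_qff \<Phi>)"
 let ?v2 = "rev ?o @ ?v1"
 have s5: "scans (visit (emit t_bound)) (st B' ?v1 (enc_qff \<Phi>) [] []) (st B' ?v2 [] [] [])"
  by (rule scans_visit_emit) (simp add: template_bound)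
 have s6: "runs (copy 13 1) (st B' ?v2 [] [] []) (st B' ?v2 (enc_qff \<Phi>) [] [])"
  by (rule runs_eq[OF runs_copy]) (simp_all add: B')
 have s7: "runs (copy 7 5) (st B' ?v2 (enc_qff \<Phi>) [] []) (st B' ?v2 (enc_qff \<Phi>) [] (replicate q 2))"
  by (rule runs_eq[OF runs_copy]) (simp_all add: B')
 have s8: "runs (Push 3 20) (st B' ?v2 (enc_qff \<Phi>) [] (replicate q 2)) (st B' ?v2 (enc_qff \<Phi>) [20] (replicate q 2))"
  by (rule runs_eq[OF runs_Push]) (simp_all add: base_def)
 let ?v3 = "rev (enc_qff (hom_qff P Q q \<Phi>)) @ ?v2"
 from runs_hom_translate[OF B'(2,4) pos(2) le depth, of ?v2] obtain k b where
  s9: "scans hom_translate (st B' ?v2 (enc_qff \<Phi>) [20] (replicate q 2)) (st B' ?v3 [] k b)"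
  by (elim exE)
 have out: "h @ enc_qff (rescaled P q Q m \<Phi>) = rev ?v3"
 proof -
  have "rev ?v3 = h @ conjuncts (small Q @ units Q q) @ ?o @ enc_qff (hom_qff P Q q \<Phi>)"
   by simp
  then show ?thesis
   unfolding enc_foldr_wrap[OF pieces_bound[OF B'(1-4) pos]] enc_foldr_Conj[symmetric] rescaled_def
   by simp
 qed
 have s10: "runs (clears [3, 4, 5, 6, 7, 8, 11, 13]) (st B' ?v3 [] k b) (init_regs (h @ enc_qff (rescaled P q Q m \<Phi>)))"
  unfolding out
  by (rule runs_eq[OF runs_clears]) (simp, rule ext, simp add: st_def B'_def B_def params_def init_regs_def)
 show ?thesis unfolding rescale_def h_def[symmetric]
  by (rule runs_Seq[OF s1 runs_Seq[OF s2 runs_Seq[OF s3 runs_Seq[OF s4 runs_Seq[OF s5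
    runs_Seq[OF s6 runs_Seq[OF s7 runs_Seq[OF s8 runs_Seq[OF s9 s10]]]]]]]]])
qed

lemma tame_rescale: "tame rescale"
proof -
 have h: "tame (Loop 1 every hom_translate)"
 proof (rule tame_Loop)
  show "light {3, 5, 6, 8} hom_translate"
  proof (rule light_translate)
   show "light {3, 5, 6, 8} hom_pre" unfolding hom_pre_def
    by (rule light_Loop_Push) (simp_all add: nreg_def base_def)
   show "template {3, 5, 6, 8} (hom_tpl t x)" "set (hom_rep t x) \<subseteq> {1..<base}" for t x
    by (auto simp: hom_tpl_def hom_rep_def base_def)
  qed auto
  show "1 \<notin> mods hom_translate" by (rule one_notin_translate[OF hom_translate_wf(1,2)])
 qed (auto simp: nreg_def)
 have s: "tame small_chain" unfolding small_chain_def
  by (rule tame_Seq[OF tame_Push tame_Seq[OF tame_emit[of "{11}"] tame_Seq[OF tame_chain[OF template_square] tame_clear]]])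
   (simp_all add: template_append template_tn less_base)
 have u: "tame unit_chain" unfolding unit_chain_def
  by (intro tame_Seq[OF tame_emit[of "{11}"] tame_chain] template_unit)
   (simp_all add: template_append template_ta less_base)
 show ?thesis unfolding rescale_def
  by (rule tame_Seq[OF tame_prepare tame_Seq[OF tame_copy tame_Seq[OF s tame_Seq[OF u tame_Seq[OF tame_visit_emit[OF template_bound]
   tame_Seq[OF tame_copy tame_Seq[OF tame_copy tame_Seq[OF tame_Push tame_Seq[OF h tame_clears]]]]]]]]])
   (simp_all add: nreg_def base_def)
qed

section \<open>Correctness of the reductions\<close>

lemma less_power_bits: "n < 2 ^ length (bits n)"
proof (induction n rule: less_induct)
 case (less n)
 show ?case
 proof (cases n rule: bits_cases)
  case (3 k)
  then have "k < 2 ^ length (bits k)" by (intro less) simp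
  then have "Suc (2 * k) < 2 * 2 ^ length (bits k)" by linarith
  then show ?thesis using 3 by (simp add: bits_odd)
 qed (use less in \<open>auto simp: bits_even\<close>)
qed

lemma length_enc_nat: "length (enc_nat n) \<ge> 1"
 by (simp add: enc_nat_def)

lemma length_enc_trm: "length (enc_trm s) \<ge> 2"
 by (induction s) (auto simp: enc_nat_def)

lemma tdeg_le_length: "tdeg s + 1 \<le> length (enc_trm s)"
 by (induction s) (auto simp: enc_nat_def)

lemma fdeg_le_length: "fdeg \<Phi> \<le> length (enc_qff \<Phi>)"
proof (induction \<Phi>)
 case (Le s t)
 then show ?case using tdeg_le_length[of s] tdeg_le_length[of t] by simp
next
 case (Lt s t)
 then show ?case using tdeg_le_length[of s] tdeg_le_length[of t] by simp
qed simp_all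

text \<open>The factor 2 and the summand 1 strengthen the induction: they make both sums and
  products go through, and they cover the summand 1 in the norm of an atom.\<close>

lemma tnorm_le_length: "2 * (tnorm s + 1) \<le> 2 ^ length (enc_trm s)"
proof (induction s)
 case (Var i)
 have "(2::nat) ^ 2 \<le> 2 ^ length (enc_trm (Var i))" using length_enc_trm by (rule power_increasing) simp
 then show ?case by simp
next
 case (Const c)
 have "nat \<bar>c\<bar> + 1 \<le> 2 ^ length (bits (nat \<bar>c\<bar>))" using less_power_bits[of "nat \<bar>c\<bar>"] by linarith
 then show ?case by (simp add: enc_nat_def)
next
 case (Add s t)
 have a: "(2::nat) ^ a + 2 ^ b \<le> 2 * (2 ^ a * 2 ^ b)" for a b :: nat
 proof -
  have "(2::nat) ^ a * 1 \<le> 2 ^ a * 2 ^ b" "1 * (2::nat) ^ b \<le> 2 ^ a * 2 ^ b"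
   by (intro mult_le_mono2 mult_le_mono1 one_le_power; simp)+
  then show ?thesis by linarith
 qed
 show ?case using Add a[of "length (enc_trm s)" "length (enc_trm t)"] by (simp add: power_add)
next
 case (Mul s t)
 have "2 * (tnorm s * tnorm t + 1) \<le> (2 * (tnorm s + 1)) * (2 * (tnorm t + 1))" by (simp add: algebra_simps)
 also have "\<dots> \<le> 2 ^ length (enc_trm s) * 2 ^ length (enc_trm t)" by (rule mult_le_mono[OF Mul])
 also have "\<dots> \<le> 2 ^ length (enc_trm (Mul s t))" by (simp add: power_add)
 finally show ?case by simp
qed

lemma fnorm_le_length: "fnorm \<Phi> \<le> 2 ^ length (enc_qff \<Phi>)"
proof (induction \<Phi>)
 case (Le s t)
 have "fnorm (Le s t) \<le> 2 * (tnorm (Add s t) + 1)" by simp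
 also have "\<dots> \<le> 2 ^ length (enc_qff (Le s t))" using tnorm_le_length[of "Add s t"] by simp
 finally show ?case .
next
 case (Lt s t)
 have "fnorm (Lt s t) \<le> 2 * (tnorm (Add s t) + 1)" by simp
 also have "\<dots> \<le> 2 ^ length (enc_qff (Lt s t))" using tnorm_le_length[of "Add s t"] by simp
 finally show ?case .
next
 case (Conj f g)
 have "fnorm f * fnorm g \<le> 2 ^ length (enc_qff f) * 2 ^ length (enc_qff g)" by (rule mult_le_mono[OF Conj])
 then show ?case by (simp add: power_add)
next
 case (Disj f g)
 have "fnorm f * fnorm g \<le> 2 ^ length (enc_qff f) * 2 ^ length (enc_qff g)" by (rule mult_le_mono[OF Disj])
 then show ?case by (simp add: power_add)
qed

lemma length_occ_trm: "length (occ_trm s) = tdeg s"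
 by (induction s) simp_all

lemma card_vars_le_length: "card (vars_qff \<Phi>) \<le> length (enc_qff \<Phi>)"
proof -
 have "length (occ_qff \<Phi>) \<le> fdeg \<Phi>" by (induction \<Phi>) (auto simp: length_occ_trm)
 moreover have "card (vars_qff \<Phi>) \<le> length (occ_qff \<Phi>)" using card_length[of "occ_qff \<Phi>"] by (simp add: set_occ_qff)
 ultimately show ?thesis using fdeg_le_length[of \<Phi>] by linarith
qed

lemma mul_depth_le_length: "mul_depth s \<le> length (enc_trm s)"
 by (induction s) auto

lemma mul_depth_qff_le_length: "mul_depth_qff \<Phi> \<le> length (enc_qff \<Phi>)"
proof (induction \<Phi>)
 case (Le s t)
 then show ?case using mul_depth_le_length[of s] mul_depth_le_length[of t] by simp
next
 case (Lt s t)
 then show ?case using mul_depth_le_length[of s] mul_depth_le_length[of t] by simp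
qed simp_all

lemma length_enc_qff: "length (enc_qff \<Phi>) \<ge> 5"
proof (induction \<Phi>)
 case (Le s t)
 then show ?case using length_enc_trm[of s] length_enc_trm[of t] by simp
next
 case (Lt s t)
 then show ?case using length_enc_trm[of s] length_enc_trm[of t] by simp
qed simp_all

section \<open>Truth in terms of occurring variables\<close>

lemma env_mix: "env m X Y = mix m X (\<lambda>i. Y (i - m))" "mix m X Y = env m X (\<lambda>j. Y (m + j))"
 by (auto simp: env_def mix_def fun_eq_iff)

lemma sigma2_true_mix: "sigma2_true m n \<Phi> \<longleftrightarrow> (\<exists>X. \<forall>Y. holds (mix m X Y) \<Phi>)"
proof
 assume "sigma2_true m n \<Phi>"
 then obtain X where "!!Y. holds (env m X Y) \<Phi>" by (auto simp: sigma2_true_def)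
 then show "\<exists>X. \<forall>Y. holds (mix m X Y) \<Phi>" unfolding env_mix(2) by blast
next
 assume "\<exists>X. \<forall>Y. holds (mix m X Y) \<Phi>"
 then obtain X where "!!Y. holds (mix m X Y) \<Phi>" by blast
 then show "sigma2_true m n \<Phi>" unfolding sigma2_true_def env_mix(1) by blast
qed

text \<open>Only occurring variables carry bounds on the right. Coordinates that do not occur are
  set to 0, which lies in the box.\<close>

lemma b_sigma2pp_true_mix:
 assumes V: "vars_qff \<Psi> \<union> vars_qff \<Phi> = V" "V \<subseteq> {..<m+n}"
 shows "b_sigma2pp_true m n \<Psi> \<Phi> \<longleftrightarrow> (\<exists>X. (\<forall>i\<in>V. i < m --> \<bar>X i\<bar> \<le> 1) \<and>
  (\<forall>Y. (\<forall>i\<in>V. m \<le> i --> \<bar>Y i\<bar> \<le> 1) --> holds (mix m X Y) \<Psi> --> holds (mix m X Y) \<Phi>))"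
proof
 assume "b_sigma2pp_true m n \<Psi> \<Phi>"
 then obtain X where X: "!!Y. (\<exists>j<n. \<bar>Y j\<bar> > 1) \<or>
    ((\<forall>i<m. \<bar>X i\<bar> \<le> 1) \<and> (holds (env m X Y) \<Psi> --> holds (env m X Y) \<Phi>))"
  unfolding b_sigma2pp_true_def by blast
 \<comment> \<open>The bound on \<open>X\<close> stands inside the scope of \<open>Y\<close>; the
   choice \<open>Y = 0\<close>, a point of the box, releases it.\<close>
 have "\<forall>i<m. \<bar>X i\<bar> \<le> 1" using X[of "\<lambda>_. 0"] by simp
 moreover have "holds (mix m X Y) \<Phi>" if Y: "\<forall>i\<in>V. m \<le> i --> \<bar>Y i\<bar> \<le> 1" and h: "holds (mix m X Y) \<Psi>" for Y
 proof -
  let ?Y = "\<lambda>j. if m + j \<in> V then Y (m + j) else 0"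
  have "\<not> (\<exists>j<n. \<bar>?Y j\<bar> > 1)" using Y by (auto simp: not_less)
  then have "holds (env m X ?Y) \<Psi> --> holds (env m X ?Y) \<Phi>" using X[of ?Y] by blast
  moreover have "env m X ?Y i = mix m X Y i" if "i \<in> V" for i using that by (simp add: env_def mix_def)
  then have "holds (env m X ?Y) \<Psi> = holds (mix m X Y) \<Psi>" "holds (env m X ?Y) \<Phi> = holds (mix m X Y) \<Phi>"
   using V(1) by (auto intro!: holds_cong)
  ultimately show ?thesis using h by blast
 qed
 ultimately show "\<exists>X. (\<forall>i\<in>V. i < m --> \<bar>X i\<bar> \<le> 1) \<and>
  (\<forall>Y. (\<forall>i\<in>V. m \<le> i --> \<bar>Y i\<bar> \<le> 1) --> holds (mix m X Y) \<Psi> --> holds (mix m X Y) \<Phi>)" by blast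
next
 assume "\<exists>X. (\<forall>i\<in>V. i < m --> \<bar>X i\<bar> \<le> 1) \<and>
  (\<forall>Y. (\<forall>i\<in>V. m \<le> i --> \<bar>Y i\<bar> \<le> 1) --> holds (mix m X Y) \<Psi> --> holds (mix m X Y) \<Phi>)"
 then obtain X where X: "\<forall>i\<in>V. i < m --> \<bar>X i\<bar> \<le> 1" and
  XY: "\<forall>Y. (\<forall>i\<in>V. m \<le> i --> \<bar>Y i\<bar> \<le> 1) --> holds (mix m X Y) \<Psi> --> holds (mix m X Y) \<Phi>"
  by (elim exE conjE)
 let ?X = "\<lambda>i. if i \<in> V then X i else 0"
 have "(\<exists>j<n. \<bar>Y j\<bar> > 1) \<or>
    ((\<forall>i<m. \<bar>?X i\<bar> \<le> 1) \<and> (holds (env m ?X Y) \<Psi> --> holds (env m ?X Y) \<Phi>))" for Y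
 proof (cases "\<exists>j<n. \<bar>Y j\<bar> > 1")
  case False
  let ?Y = "\<lambda>i. Y (i - m)"
  have "\<forall>i\<in>V. m \<le> i --> \<bar>?Y i\<bar> \<le> 1"
  proof (intro ballI impI)
   fix i assume "i \<in> V" "m \<le> i"
   then have "i - m < n" using V(2) by auto
   then show "\<bar>?Y i\<bar> \<le> 1" using False by (meson not_less)
  qed
  then have "holds (mix m X ?Y) \<Psi> --> holds (mix m X ?Y) \<Phi>" by (rule XY[THEN spec, THEN mp])
  moreover have "env m ?X Y i = mix m X ?Y i" if "i \<in> V" for i using that by (simp add: env_def mix_def)
  then have "holds (env m ?X Y) \<Psi> = holds (mix m X ?Y) \<Psi>" "holds (env m ?X Y) \<Phi> = holds (mix m X ?Y) \<Phi>"
   using V(1) by (auto intro!: holds_cong)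
  moreover have "\<forall>i<m. \<bar>?X i\<bar> \<le> 1" using X by simp
  ultimately show ?thesis by simp
 qed simp
 then show "b_sigma2pp_true m n \<Psi> \<Phi>" unfolding b_sigma2pp_true_def by (intro exI[of _ ?X] allI)
qed

lemma b_sigma2_true_pp: "b_sigma2_true m n \<Phi> \<longleftrightarrow> b_sigma2pp_true m n trivial \<Phi>"
 by (simp add: trivial_def b_sigma2_true_def b_sigma2pp_true_def)

section \<open>Meaning of the sentence without bounds\<close>

lemma eval_vmap: "eval_trm x (vmap_trm f s) = eval_trm (x \<circ> f) s"
 by (induction s) simp_all

lemma gval_vmap: "gval x (vmap_qff f \<Phi>) = gval (x \<circ> f) \<Phi>"
 by (induction \<Phi>) (simp_all only: vmap_qff.simps gval.simps eval_vmap)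

lemma vars_vmap_trm: "vars_trm (vmap_trm f s) = f ` vars_trm s"
 by (induction s) auto

lemma vars_vmap: "vars_qff (vmap_qff f \<Phi>) = f ` vars_qff \<Phi>"
 by (induction \<Phi>) (auto simp: vars_vmap_trm)

lemma qff_le_vmap: "qff_le (vmap_qff f \<Phi>) = qff_le \<Phi>"
 by (induction \<Phi>) auto

definition unren :: "nat => nat => nat" where "unren P k = (k + 1) div 2 ^ P - 1"

lemma Suc_ren: "Suc (ren P i) = 2 ^ P * (i + 1)"
 by (simp add: ren_def)

lemma unren_ren [simp]: "unren P (ren P i) = i"
 unfolding unren_def Suc_eq_plus1[symmetric] Suc_ren by simp

lemma ren_less_iff [simp]: "ren P i < ren P j \<longleftrightarrow> i < j"
proof -
 have "ren P i < ren P j \<longleftrightarrow> 2 ^ P * (i + 1) < 2 ^ P * (j + 1)" unfolding Suc_ren[symmetric] by simp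
 then show ?thesis by simp
qed

lemma ren_less_sum: "ren P i < ren P m + 2 ^ P * n \<longleftrightarrow> i < m + n"
proof -
 have "ren P m + 2 ^ P * n = ren P (m + n)"
  using Suc_ren[of P m] Suc_ren[of P "m + n"] by (simp add: algebra_simps)
 then show ?thesis by simp
qed

lemma ren_ge: "2 ^ P - 1 \<le> ren P i"
 using Suc_ren[of P i] by (simp add: algebra_simps)

lemma name_less: "j < P ==> 2 * (2 ^ j - 1) < 2 ^ P - (1::nat)"
proof -
 assume "j < P"
 then have "(2::nat) ^ Suc j \<le> 2 ^ P" by (intro power_increasing) auto
 moreover have "(1::nat) \<le> 2 ^ j" by simp
 ultimately have "2 * 2 ^ j - 2 < 2 ^ P - (1::nat)" unfolding power_Suc by linarith
 then show ?thesis by (simp add: diff_mult_distrib2)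
qed

text \<open>A nest of clauses \<open>E \<or> (D \<and> ...)\<close> is in general neither a
  disjunction nor a conjunction, but it collapses to one if all \<open>D\<close> hold or if no
  \<open>E\<close> holds. The second case, at \<open>Y = 0\<close>, establishes the
  \<open>D\<close>; the first then applies to every \<open>Y\<close>.\<close>

lemma foldr_wrap:
 assumes "!!i f. holds x (h i f) \<longleftrightarrow> E i \<or> (D i \<and> holds x f)"
 shows "(\<forall>i\<in>set xs. D i) ==> holds x (foldr h xs f) \<longleftrightarrow> (\<exists>i\<in>set xs. E i) \<or> holds x f"
  "(\<forall>i\<in>set xs. \<not> E i) ==> holds x (foldr h xs f) \<longleftrightarrow> (\<forall>i\<in>set xs. D i) \<and> holds x f"
 using assms by (induction xs) auto

lemma holds_eqf [simp]: "holds x (eqf s t) \<longleftrightarrow> eval_trm x s = eval_trm x t"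
 by (auto simp: eqf_def)

lemma holds_squares:
 assumes "\<forall>c\<in>set (squares q). holds x c" "j \<le> q"
 shows "eval_trm x (name (Suc j)) = eval_trm x (name 1) ^ (2 ^ j)"
 using assms(2)
proof (induction j)
 case (Suc j)
 have "holds x (eqf (name (Suc (Suc j))) (Mul (name (Suc j)) (name (Suc j))))"
  using assms(1) Suc.prems unfolding squares_def by auto
 then have "eval_trm x (name (Suc (Suc j))) = (eval_trm x (name (Suc j)))\<^sup>2" by (simp add: power2_eq_square)
 also have "\<dots> = (eval_trm x (name 1) ^ (2 ^ j))\<^sup>2" using Suc.IH Suc.prems by simp
 finally show ?case by (simp only: power_Suc2 power_mult)
qed simp

lemma holds_squares_iff:
 assumes "!!j. j \<le> q ==> eval_trm x (name (Suc j)) = c ^ (2 ^ j)"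
 shows "\<forall>c\<in>set (squares q). holds x c"
proof -
 have "eval_trm x (name (Suc (Suc j))) = eval_trm x (name (Suc j)) * eval_trm x (name (Suc j))" if "j < q" for j
 proof -
  have "eval_trm x (name (Suc (Suc j))) = c ^ (2 ^ Suc j)" "eval_trm x (name (Suc j)) = c ^ (2 ^ j)"
   using assms that by simp_all
  then show ?thesis by (simp only: power_Suc mult_2 power_add)
 qed
 then show ?thesis by (auto simp: squares_def simp del: eval_trm.simps(1))
qed

lemma holds_escape: "holds x (escape P m i) \<longleftrightarrow> m \<le> i \<and> x 0 * (x (ren P i))\<^sup>2 \<le> x 0 - 1"
 by (simp add: escape_def univ_def zt_def power2_eq_square)

lemma holds_wrap_premise:
 "holds x (wrap_premise P m i f) \<longleftrightarrow> (m \<le> i \<and> x 0 * (x (ren P i))\<^sup>2 \<le> x 0 - 1) \<or> (m \<le> i \<and> holds x f)"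
 by (simp only: wrap_premise_def holds.simps holds_escape) (simp add: univ_def)

lemma holds_wrap_conclusion:
 "holds x (wrap_conclusion P m i f) \<longleftrightarrow> (m \<le> i \<and> x 0 * (x (ren P i))\<^sup>2 \<le> x 0 - 1) \<or>
   ((m \<le> i \<or> (x (ren P i))\<^sup>2 \<le> 1) \<and> holds x f)"
 by (simp only: wrap_conclusion_def holds.simps holds_escape) (simp add: univ_def power2_eq_square)

definition wrapped :: "nat => nat => nat => qff => qff => qff" where
 "wrapped P q m \<Psi> \<Phi> = foldr (wrap_premise P m) (occ_qff \<Psi>) (foldr (wrap_conclusion P m) (occ_qff \<Phi>) (scaled P q \<Psi> \<Phi>))"

lemma holds_wrapped:
 assumes "\<forall>i\<in>vars_qff \<Psi>. m \<le> i" "\<forall>i\<in>vars_qff \<Phi>. m \<le> i \<or> (x (ren P i))\<^sup>2 \<le> 1"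
 shows "holds x (wrapped P q m \<Psi> \<Phi>) \<longleftrightarrow>
  (\<exists>i\<in>vars_qff \<Psi> \<union> vars_qff \<Phi>. m \<le> i \<and> x 0 * (x (ren P i))\<^sup>2 \<le> x 0 - 1) \<or> holds x (scaled P q \<Psi> \<Phi>)"
proof -
 have 1: "holds x (foldr (wrap_conclusion P m) (occ_qff \<Phi>) (scaled P q \<Psi> \<Phi>)) \<longleftrightarrow>
  (\<exists>i\<in>set (occ_qff \<Phi>). m \<le> i \<and> x 0 * (x (ren P i))\<^sup>2 \<le> x 0 - 1) \<or> holds x (scaled P q \<Psi> \<Phi>)"
  by (rule foldr_wrap(1)[OF holds_wrap_conclusion]) (use assms(2) in \<open>simp add: set_occ_qff\<close>)
 have 2: "holds x (wrapped P q m \<Psi> \<Phi>) \<longleftrightarrow> (\<exists>i\<in>set (occ_qff \<Psi>). m \<le> i \<and> x 0 * (x (ren P i))\<^sup>2 \<le> x 0 - 1) \<or>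
   holds x (foldr (wrap_conclusion P m) (occ_qff \<Phi>) (scaled P q \<Psi> \<Phi>))"
  unfolding wrapped_def
  by (rule foldr_wrap(1)[OF holds_wrap_premise]) (use assms(1) in \<open>simp add: set_occ_qff\<close>)
 show ?thesis unfolding 2 1 set_occ_qff by auto
qed

lemma wrapped_constraints:
 assumes "holds x (wrapped P q m \<Psi> \<Phi>)"
  "\<forall>i\<in>vars_qff \<Psi> \<union> vars_qff \<Phi>. m \<le> i --> \<not> x 0 * (x (ren P i))\<^sup>2 \<le> x 0 - 1"
 shows "\<forall>i\<in>vars_qff \<Psi>. m \<le> i" "\<forall>i\<in>vars_qff \<Phi>. m \<le> i \<or> (x (ren P i))\<^sup>2 \<le> 1"
proof -
 have 1: "holds x (foldr (wrap_conclusion P m) (occ_qff \<Phi>) (scaled P q \<Psi> \<Phi>)) \<longleftrightarrow>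
  (\<forall>i\<in>set (occ_qff \<Phi>). m \<le> i \<or> (x (ren P i))\<^sup>2 \<le> 1) \<and> holds x (scaled P q \<Psi> \<Phi>)"
  by (rule foldr_wrap(2)[OF holds_wrap_conclusion]) (use assms(2) in \<open>auto simp: set_occ_qff\<close>)
 have 2: "holds x (wrapped P q m \<Psi> \<Phi>) \<longleftrightarrow> (\<forall>i\<in>set (occ_qff \<Psi>). m \<le> i) \<and>
   holds x (foldr (wrap_conclusion P m) (occ_qff \<Phi>) (scaled P q \<Psi> \<Phi>))"
  unfolding wrapped_def
  by (rule foldr_wrap(2)[OF holds_wrap_premise]) (use assms(2) in \<open>auto simp: set_occ_qff\<close>)
 show "\<forall>i\<in>vars_qff \<Psi>. m \<le> i" "\<forall>i\<in>vars_qff \<Phi>. m \<le> i \<or> (x (ren P i))\<^sup>2 \<le> 1"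
  using assms(1) unfolding 2 1 set_occ_qff by auto
qed

lemma holds_unbounded: "holds x (unbounded P q m \<Psi> \<Phi>) \<longleftrightarrow>
  x 0 \<le> 0 \<and> (\<forall>c\<in>set (big q). holds x c) \<and> holds x (wrapped P q m \<Psi> \<Phi>)"
 by (simp add: unbounded_def wrapped_def holds_foldr_Conj zt_def conj_assoc)

lemma big_value: "\<forall>c\<in>set (big q). holds x c ==> eval_trm x (name (Suc q)) = 2 ^ (2 ^ q)"
 using holds_squares[of q x q] by (simp add: big_def)

lemma holds_scaled:
 assumes "qff_le \<Psi>" "qff_le \<Phi>" "x 0 \<le> 0" "eval_trm x (name (Suc q)) = 2 ^ (2 ^ q)"
 shows "holds x (scaled P q \<Psi> \<Phi>) \<longleftrightarrow> 1 \<le> - x 0 * gval (x \<circ> ren P) \<Psi> \<or> 2 ^ (2 ^ q) * gval (x \<circ> ren P) \<Phi> \<le> 1"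
proof -
 have z: "eval_trm x zt = x 0" by (simp add: zt_def)
 have 1: "holds x (scl True zt (-1) (vmap_qff (ren P) \<Psi>)) \<longleftrightarrow> 1 \<le> - x 0 * gval (x \<circ> ren P) \<Psi>"
  using holds_scl_dual[of "vmap_qff (ren P) \<Psi>" x zt] assms by (simp only: z gval_vmap qff_le_vmap)
 have 2: "holds x (scl False (name (Suc q)) 1 (vmap_qff (ren P) \<Phi>)) \<longleftrightarrow> 2 ^ (2 ^ q) * gval (x \<circ> ren P) \<Phi> \<le> 1"
  using holds_scl_relax[of "vmap_qff (ren P) \<Phi>" x "name (Suc q)"] assms
  by (simp only: gval_vmap qff_le_vmap) simp
 show ?thesis unfolding scaled_def holds.simps 1 2 ..
qed

lemma mix_ren: "mix (ren P m) X Y \<circ> ren P = mix m (X \<circ> ren P) (Y \<circ> ren P)"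
 by (auto simp: mix_def fun_eq_iff)

lemma length_bits_name: "j > 0 ==> length (bits (2 * (2 ^ j - 1))) = Suc j"
proof -
 assume "j > 0"
 then have "0 < (2::nat) ^ j - 1" using one_less_power[of "2::nat" j] by simp
 then show ?thesis using bits_mersenne[of j] by (simp add: bits_even)
qed

lemma ren_pos: "P > 0 ==> 0 < ren P i"
 using ren_ge[of P i] one_less_power[of "2::nat" P] by linarith

text \<open>The constraints that do not involve \<open>Y\<close> are extracted first. What remains
  is \<open>relaxed\<close> at \<open>t = 2 ^ 2 ^ q\<close>, read through the renaming, with
  variable 0 as the margin.\<close>

lemma sigma2_true_unbounded:
 assumes le: "qff_le \<Psi>" "qff_le \<Phi>" and P: "q + 1 < P" and q: "q = 32 * l ^ 3"
  and l: "l \<ge> 7" "card (vars_qff \<Psi> \<union> vars_qff \<Phi>) + 1 \<le> l" "fdeg \<Psi> + fdeg \<Phi> \<le> l" "fnorm \<Psi> * fnorm \<Phi> \<le> 2 ^ l"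
  and V: "vars_qff \<Psi> \<union> vars_qff \<Phi> \<subseteq> {..<m+n}"
 shows "sigma2_true (ren P m) n' (unbounded P q m \<Psi> \<Phi>) \<longleftrightarrow> vars_qff \<Psi> \<subseteq> {m..} \<and> b_sigma2pp_true m n \<Psi> \<Phi>"
proof -
 define W where "W = vars_qff \<Psi> \<union> vars_qff \<Phi>"
 let ?F = "unbounded P q m \<Psi> \<Phi>" and ?m = "ren P m" and ?t = "2 ^ (2 ^ q) :: real"
 have m0: "0 < ?m" using P by (intro ren_pos) simp
 have step: "holds (mix ?m X Y) ?F \<longleftrightarrow> X 0 \<le> 0 \<and> (\<forall>c\<in>set (big q). holds (mix ?m X Y) c) \<and>
   ((\<exists>i\<in>W. m \<le> i \<and> X 0 * (Y (ren P i))\<^sup>2 \<le> X 0 - 1) \<or>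
    1 \<le> - X 0 * gval (mix m (X \<circ> ren P) (Y \<circ> ren P)) \<Psi> \<or> ?t * gval (mix m (X \<circ> ren P) (Y \<circ> ren P)) \<Phi> \<le> 1)"
  if D: "\<forall>i\<in>vars_qff \<Psi>. m \<le> i" "\<forall>i\<in>vars_qff \<Phi>. i < m --> (X (ren P i))\<^sup>2 \<le> 1" for X Y
 proof -
  have x0: "mix ?m X Y 0 = X 0" using m0 by (simp add: mix_def)
  have E: "m \<le> i \<and> X 0 * (mix ?m X Y (ren P i))\<^sup>2 \<le> X 0 - 1 \<longleftrightarrow> m \<le> i \<and> X 0 * (Y (ren P i))\<^sup>2 \<le> X 0 - 1" for i
   by (auto simp: mix_def)
  have w: "holds (mix ?m X Y) (wrapped P q m \<Psi> \<Phi>) \<longleftrightarrow>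
   (\<exists>i\<in>W. m \<le> i \<and> X 0 * (Y (ren P i))\<^sup>2 \<le> X 0 - 1) \<or> holds (mix ?m X Y) (scaled P q \<Psi> \<Phi>)"
   unfolding W_def using holds_wrapped[of \<Psi> m \<Phi> "mix ?m X Y" P q] D
   unfolding x0 E by (auto simp: mix_def not_le)
  show ?thesis
  proof (cases "X 0 \<le> 0 \<and> (\<forall>c\<in>set (big q). holds (mix ?m X Y) c)")
   case True
   have "holds (mix ?m X Y) (scaled P q \<Psi> \<Phi>) \<longleftrightarrow>
    1 \<le> - X 0 * gval (mix m (X \<circ> ren P) (Y \<circ> ren P)) \<Psi> \<or> ?t * gval (mix m (X \<circ> ren P) (Y \<circ> ren P)) \<Phi> \<le> 1"
    using holds_scaled[OF le, of "mix ?m X Y" q P] True big_value[of q "mix ?m X Y"]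
    unfolding x0 mix_ren by blast
   with True w show ?thesis unfolding holds_unbounded x0 by blast
  qed (auto simp: holds_unbounded x0)
 qed
 have rel: "b_sigma2pp_true m n \<Psi> \<Phi> \<longleftrightarrow> (\<exists>z X. relaxed m W \<Psi> \<Phi> ?t z X)" if "vars_qff \<Psi> \<subseteq> {m..}"
  unfolding W_def b_sigma2pp_true_mix[OF refl V]
  by (rule bounded_iff_relaxed[OF le that l]) (simp add: q)
 show ?thesis
 proof
  assume "sigma2_true ?m n' ?F"
  then obtain X where X: "\<forall>Y. holds (mix ?m X Y) ?F" unfolding sigma2_true_mix by (rule exE)
  have x0: "mix ?m X Y 0 = X 0" for Y using m0 by (simp add: mix_def)
  have F0: "holds (mix ?m X (\<lambda>_. 0)) ?F" using X by simp
  \<comment> \<open>At \<open>Y = 0\<close> an escape clause would say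
    \<open>0 \<le> X 0 - 1\<close>, whereas \<open>X 0 \<le> 0\<close>.\<close>
  have no: "\<forall>i\<in>vars_qff \<Psi> \<union> vars_qff \<Phi>. m \<le> i --> \<not> mix ?m X (\<lambda>_. 0) 0 * (mix ?m X (\<lambda>_. 0) (ren P i))\<^sup>2 \<le> mix ?m X (\<lambda>_. 0) 0 - 1"
   using F0 by (auto simp: mix_def holds_unbounded)
  have D: "\<forall>i\<in>vars_qff \<Psi>. m \<le> i" "\<forall>i\<in>vars_qff \<Phi>. i < m --> (X (ren P i))\<^sup>2 \<le> 1"
  proof -
   have "holds (mix ?m X (\<lambda>_. 0)) (wrapped P q m \<Psi> \<Phi>)" using F0 unfolding holds_unbounded by blast
   note c = wrapped_constraints[OF this no]
   show "\<forall>i\<in>vars_qff \<Psi>. m \<le> i" by (rule c(1))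
   show "\<forall>i\<in>vars_qff \<Phi>. i < m --> (X (ren P i))\<^sup>2 \<le> 1" using c(2) by (auto simp: mix_def)
  qed
  have "relaxed m W \<Psi> \<Phi> ?t (X 0) (X \<circ> ren P)"
   unfolding relaxed_def
  proof (intro conjI allI)
   show "X 0 \<le> 0" using F0 x0 by (simp add: holds_unbounded)
   show "\<forall>i\<in>W. i < m --> ((X \<circ> ren P) i)\<^sup>2 \<le> 1" using D by (auto simp: W_def)
   fix Y
   have "holds (mix ?m X (Y \<circ> unren P)) ?F" using X by simp
   moreover have "(Y \<circ> unren P) \<circ> ren P = Y" by (simp add: fun_eq_iff)
   ultimately show "(\<exists>i\<in>W. m \<le> i \<and> X 0 * (Y i)\<^sup>2 \<le> X 0 - 1) \<or>
     1 \<le> - X 0 * gval (mix m (X \<circ> ren P) Y) \<Psi> \<or> ?t * gval (mix m (X \<circ> ren P) Y) \<Phi> \<le> 1"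
    unfolding step[OF D] by simp
  qed
  moreover have "vars_qff \<Psi> \<subseteq> {m..}" using D by auto
  ultimately show "vars_qff \<Psi> \<subseteq> {m..} \<and> b_sigma2pp_true m n \<Psi> \<Phi>" using rel by blast
 next
  assume a: "vars_qff \<Psi> \<subseteq> {m..} \<and> b_sigma2pp_true m n \<Psi> \<Phi>"
  with rel have "\<exists>z X. relaxed m W \<Psi> \<Phi> ?t z X" by simp
  then obtain z X where zX: "relaxed m W \<Psi> \<Phi> ?t z X" by (elim exE)
  \<comment> \<open>\<open>name (Suc j)\<close> has an index of \<open>j + 2\<close> bits and must
    receive the value \<open>2 ^ 2 ^ j\<close>, hence the subtraction of 2 in the exponent. Index 0
    carries the margin.\<close>
  define X' where "X' k = (if k = 0 then z else if k < 2 ^ P - 1 then 2 ^ (2 ^ (length (bits k) - 2)) else X (unren P k))" for k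
  have Xr: "X' (ren P i) = X i" for i using ren_ge[of P i] ren_pos[of P i] P by (simp add: X'_def)
  have Xr': "X' \<circ> ren P = X" by (simp add: fun_eq_iff Xr)
  have nm: "eval_trm (mix ?m X' Y) (name (Suc j)) = 2 ^ (2 ^ j)" if "j \<le> q" for j Y
  proof -
   let ?k = "2 * (2 ^ Suc j - 1) :: nat"
   have k: "?k < 2 ^ P - 1" using that P by (intro name_less) simp
   moreover have "?k \<noteq> 0" using one_less_power[of "2::nat" "Suc j"] by simp
   moreover have "?k < ?m" using k ren_ge[of P m] by linarith
   moreover have "length (bits ?k) = Suc (Suc j)" by (rule length_bits_name) simp
   ultimately show ?thesis unfolding name_def eval_trm.simps mix_def X'_def by simp
  qed
  have D: "\<forall>i\<in>vars_qff \<Psi>. m \<le> i" "\<forall>i\<in>vars_qff \<Phi>. i < m --> (X' (ren P i))\<^sup>2 \<le> 1"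
   using a zX by (auto simp: relaxed_def W_def Xr)
  have z: "X' 0 = z" by (simp add: X'_def)
  have "holds (mix ?m X' Y) ?F" for Y
   unfolding step[OF D] z Xr'
  proof (intro conjI)
   show "z \<le> 0" using zX by (simp add: relaxed_def)
   have "\<forall>c\<in>set (squares q). holds (mix ?m X' Y) c"
    by (rule holds_squares_iff[of q _ 2]) (rule nm)
   then show "\<forall>c\<in>set (big q). holds (mix ?m X' Y) c" using nm[of 0 Y] by (simp add: big_def)
   have "(\<exists>i\<in>W. m \<le> i \<and> z * ((Y \<circ> ren P) i)\<^sup>2 \<le> z - 1) \<or>
    1 \<le> - z * gval (mix m X (Y \<circ> ren P)) \<Psi> \<or> ?t * gval (mix m X (Y \<circ> ren P)) \<Phi> \<le> 1"
    using zX unfolding relaxed_def by blast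
   then show "(\<exists>i\<in>W. m \<le> i \<and> z * (Y (ren P i))\<^sup>2 \<le> z - 1) \<or>
    1 \<le> - z * gval (mix m X (Y \<circ> ren P)) \<Psi> \<or> ?t * gval (mix m X (Y \<circ> ren P)) \<Phi> \<le> 1" by simp
  qed
  then show "sigma2_true ?m n' ?F" unfolding sigma2_true_mix by blast
 qed
qed

lemma qff_le_foldr_wrap: "(!!i f. qff_le (h i f) = qff_le f) ==> qff_le (foldr h xs f) = qff_le f"
 by (induction xs) auto

lemma qff_le_squares: "c \<in> set (squares q) ==> qff_le c"
 by (auto simp: squares_def eqf_def)

lemma qff_le_unbounded: "qff_le \<Psi> ==> qff_le \<Phi> ==> qff_le (unbounded P q m \<Psi> \<Phi>)"
proof -
 assume le: "qff_le \<Psi>" "qff_le \<Phi>"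
 have "qff_le (wrap_premise P m i f) = qff_le f" "qff_le (wrap_conclusion P m i f) = qff_le f" for i f
  by (simp_all add: wrap_premise_def wrap_conclusion_def escape_def univ_def)
 then have "qff_le (foldr (wrap_premise P m) (occ_qff \<Psi>) (foldr (wrap_conclusion P m) (occ_qff \<Phi>) (scaled P q \<Psi> \<Phi>)))"
  using le by (simp add: qff_le_foldr_wrap scaled_def qff_le_scl qff_le_vmap)
 then show ?thesis unfolding unbounded_def qff_le_foldr by (auto simp: big_def eqf_def qff_le_squares)
qed

lemma vars_foldr_wrap:
 assumes "!!i f. ren P i \<in> vars_qff (h i f)" "!!i f. vars_qff f \<subseteq> vars_qff (h i f)"
  "!!i f. vars_qff (h i f) \<subseteq> A \<union> {ren P i} \<union> vars_qff f"
 shows "ren P ` set xs \<union> vars_qff f \<subseteq> vars_qff (foldr h xs f)"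
  "vars_qff (foldr h xs f) \<subseteq> A \<union> ren P ` set xs \<union> vars_qff f"
proof -
 show "ren P ` set xs \<union> vars_qff f \<subseteq> vars_qff (foldr h xs f)"
  using assms(1,2) by (induction xs) (auto, blast+)
 show "vars_qff (foldr h xs f) \<subseteq> A \<union> ren P ` set xs \<union> vars_qff f"
 proof (induction xs)
  case (Cons i xs)
  then show ?case using assms(3)[of i "foldr h xs f"] by auto
 qed simp
qed

lemma vars_name: "j < P ==> vars_trm (name j) \<subseteq> {..<2 ^ P - 1}"
 using name_less by (simp add: name_def)

lemma vars_squares: "Suc q < P ==> c \<in> set (squares q) ==> vars_qff c \<subseteq> {..<2 ^ P - 1}"
 using vars_name by (auto simp: squares_def eqf_def) (meson Suc_less_eq less_trans_Suc lessThan_iff subset_iff less_trans)+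

lemma vars_unbounded:
 assumes "Suc q < P"
 shows "ren P ` (vars_qff \<Psi> \<union> vars_qff \<Phi>) \<subseteq> vars_qff (unbounded P q m \<Psi> \<Phi>)"
  "vars_qff (unbounded P q m \<Psi> \<Phi>) \<subseteq> {..<2 ^ P - 1} \<union> ren P ` (vars_qff \<Psi> \<union> vars_qff \<Phi>)"
proof -
 let ?A = "{..<2 ^ P - 1} :: nat set"
 have zero: "0 \<in> ?A" using assms one_less_power[of "2::nat" P] by simp
 note v1 = vars_foldr_wrap[of P "wrap_premise P m" ?A] and v2 = vars_foldr_wrap[of P "wrap_conclusion P m" ?A]
 have w1: "ren P i \<in> vars_qff (wrap_premise P m i f)" "vars_qff f \<subseteq> vars_qff (wrap_premise P m i f)"
  "vars_qff (wrap_premise P m i f) \<subseteq> ?A \<union> {ren P i} \<union> vars_qff f" for i f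
  using zero by (auto simp: wrap_premise_def escape_def univ_def zt_def)
 have w2: "ren P i \<in> vars_qff (wrap_conclusion P m i f)" "vars_qff f \<subseteq> vars_qff (wrap_conclusion P m i f)"
  "vars_qff (wrap_conclusion P m i f) \<subseteq> ?A \<union> {ren P i} \<union> vars_qff f" for i f
  using zero by (auto simp: wrap_conclusion_def escape_def univ_def zt_def)
 have s: "vars_qff (scaled P q \<Psi> \<Phi>) \<subseteq> ?A \<union> ren P ` (vars_qff \<Psi> \<union> vars_qff \<Phi>)"
  using vars_qff_scl[of True zt "-1" "vmap_qff (ren P) \<Psi>"] vars_qff_scl[of False "name (Suc q)" 1 "vmap_qff (ren P) \<Phi>"]
   vars_name[OF assms] zero by (auto simp: scaled_def vars_vmap zt_def)
 let ?f = "foldr (wrap_conclusion P m) (occ_qff \<Phi>) (scaled P q \<Psi> \<Phi>)"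
 note f = v2[OF w2, of "occ_qff \<Phi>" "scaled P q \<Psi> \<Phi>", unfolded set_occ_qff]
 note g = v1[OF w1, of "occ_qff \<Psi>" ?f, unfolded set_occ_qff]
 define B where "B = vars_qff (foldr (wrap_premise P m) (occ_qff \<Psi>) ?f)"
 define C where "C = vars_qff ?f"
 define D where "D = (\<Union>c\<in>set (Le zt (Const 0) # big q). vars_qff c)"
 have e: "vars_qff (unbounded P q m \<Psi> \<Phi>) = D \<union> B"
  unfolding unbounded_def B_def D_def by (rule vars_qff_foldr)
 have "ren P ` vars_qff \<Psi> \<subseteq> B" "C \<subseteq> B" "ren P ` vars_qff \<Phi> \<subseteq> C"
  using f(1) g(1) by (simp_all only: Un_subset_iff B_def C_def)
 then show "ren P ` (vars_qff \<Psi> \<union> vars_qff \<Phi>) \<subseteq> vars_qff (unbounded P q m \<Psi> \<Phi>)"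
  unfolding e image_Un by (metis Un_subset_iff order_trans Un_upper2)
 have "vars_qff c \<subseteq> ?A" if "c \<in> set (Le zt (Const 0) # big q)" for c
  using that zero vars_squares[OF assms] vars_name[of 1 P] assms by (auto simp: big_def eqf_def zt_def)
 then have "D \<subseteq> ?A" unfolding D_def by (rule UN_least)
 moreover have "B \<subseteq> ?A \<union> ren P ` vars_qff \<Psi> \<union> C" "C \<subseteq> ?A \<union> ren P ` vars_qff \<Phi> \<union> vars_qff (scaled P q \<Psi> \<Phi>)"
  using g(2) f(2) by (simp_all only: B_def C_def)
 ultimately show "vars_qff (unbounded P q m \<Psi> \<Phi>) \<subseteq> ?A \<union> ren P ` (vars_qff \<Psi> \<union> vars_qff \<Phi>)"
  unfolding e using s by (auto simp: image_Un)
qed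

text \<open>All auxiliary indices are in range by construction, so the range condition on the output
  is that of the input, and the program does not test it.\<close>

lemma vars_range_iff:
 assumes "ren P ` V \<subseteq> W" "W \<subseteq> {..<2 ^ P - 1} \<union> ren P ` V"
 shows "W \<subseteq> {..<ren P m + 2 ^ P * n} \<longleftrightarrow> V \<subseteq> {..<m + n}"
proof -
 have "{..<2 ^ P - 1} \<subseteq> {..<ren P m + 2 ^ P * n}" using ren_ge[of P m] by auto
 from this have "W \<subseteq> {..<ren P m + 2 ^ P * n} \<longleftrightarrow> ren P ` V \<subseteq> {..<ren P m + 2 ^ P * n}"
  using order_trans[OF assms(1)] order_trans[OF assms(2) Un_least] by iprover
 also have "\<dots> \<longleftrightarrow> V \<subseteq> {..<m + n}" by (auto simp: image_subset_iff ren_less_sum)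
 finally show ?thesis .
qed

lemma header_words: "header P m n @ enc_qff \<Phi> \<in> words"
proof -
 have "set (enc_nat n) \<subseteq> alphabet" for n using set_enc_nat[of n] by (auto simp: alphabet_def)
 then show ?thesis using set_enc_qff[of \<Phi>] by (simp add: header_def words_def)
qed

lemma reduces_b_Sigma2pp_Sigma2: "reduces b_Sigma2pp_le Sigma2_le"
proof (rule reduces_on_langs[OF tame_unbound, of "[16, 16, 20, 20]"])
 fix w assume "w \<in> langs [16, 16, 20, 20]"
 then obtain m n \<Psi> \<Phi> where w: "w = enc_nat m @ enc_nat n @ enc_qff \<Psi> @ enc_qff \<Phi>" and le: "qff_le \<Psi>" "qff_le \<Phi>"
  unfolding langs_premise by blast
 define l where "l = length w"
 define P where "P = 98 * l ^ 3"
 define q where "q = 32 * l ^ 3"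
 let ?v = "header P m n @ enc_qff (unbounded P q m \<Psi> \<Phi>)"
 have len: "l = length (enc_nat m) + length (enc_nat n) + length (enc_qff \<Psi>) + length (enc_qff \<Phi>)"
  by (simp add: l_def w)
 have l: "l \<ge> length (enc_qff \<Psi>) + length (enc_qff \<Phi>) + 2" "l \<ge> 7"
  using length_enc_nat[of m] length_enc_nat[of n] length_enc_qff[of \<Phi>] unfolding len by linarith+
 have "1 \<le> l ^ 3" using l(2) by (intro one_le_power) simp
 then have qP: "q + 1 < P" "Suc q < P" unfolding q_def P_def by linarith+
 have "card (vars_qff \<Psi> \<union> vars_qff \<Phi>) \<le> card (vars_qff \<Psi>) + card (vars_qff \<Phi>)" by (rule card_Un_le)
 then have c: "card (vars_qff \<Psi> \<union> vars_qff \<Phi>) + 1 \<le> l"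
  using card_vars_le_length[of \<Psi>] card_vars_le_length[of \<Phi>] l(1) by linarith
 have d: "fdeg \<Psi> + fdeg \<Phi> \<le> l" using fdeg_le_length[of \<Psi>] fdeg_le_length[of \<Phi>] l(1) by linarith
 have "fnorm \<Psi> * fnorm \<Phi> \<le> 2 ^ length (enc_qff \<Psi>) * 2 ^ length (enc_qff \<Phi>)"
  by (rule mult_le_mono[OF fnorm_le_length fnorm_le_length])
 also have "\<dots> = 2 ^ (length (enc_qff \<Psi>) + length (enc_qff \<Phi>))" by (simp only: power_add)
 also have "\<dots> \<le> 2 ^ l" using l(1) by (intro power_increasing) auto
 finally have h: "fnorm \<Psi> * fnorm \<Phi> \<le> 2 ^ l" .
 have range: "vars_qff (unbounded P q m \<Psi> \<Phi>) \<subseteq> {..<ren P m + 2 ^ P * n} \<longleftrightarrow> vars_qff \<Psi> \<union> vars_qff \<Phi> \<subseteq> {..<m + n}"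
  by (rule vars_range_iff[OF vars_unbounded[OF qP(2)]])
 have "w \<in> b_Sigma2pp_le \<longleftrightarrow> vars_qff \<Psi> \<union> vars_qff \<Phi> \<subseteq> {..<m+n} \<and> vars_qff \<Psi> \<subseteq> {m..} \<and> b_sigma2pp_true m n \<Psi> \<Phi>"
  unfolding w mem_b_Sigma2pp_le using le by auto
 also have "\<dots> \<longleftrightarrow> vars_qff \<Psi> \<union> vars_qff \<Phi> \<subseteq> {..<m+n} \<and> sigma2_true (ren P m) (2 ^ P * n) (unbounded P q m \<Psi> \<Phi>)"
  using sigma2_true_unbounded[OF le qP(1) q_def l(2) c d h] by blast
 also have "\<dots> \<longleftrightarrow> ?v \<in> Sigma2_le"
  unfolding header_def append_assoc mem_Sigma2_le ren_def[symmetric] range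
  using qff_le_unbounded[OF le] by simp
 finally have "w \<in> b_Sigma2pp_le \<longleftrightarrow> ?v \<in> Sigma2_le" .
 moreover have "runs unbound (init_regs w) (init_regs ?v)"
  unfolding P_def q_def l_def by (rule runs_unbound[OF le w])
 ultimately show "\<exists>v\<in>words. runs unbound (init_regs w) (init_regs v) \<and> (w \<in> b_Sigma2pp_le \<longleftrightarrow> v \<in> Sigma2_le)"
  using header_words by blast
qed (auto simp: base_def b_Sigma2pp_le_def langs_premise enc_nat_def Nil_notin)

section \<open>Meaning of the rescaled sentence\<close>

lemma eval_hom_trm:
 assumes u: "eval_trm x (name Q) = u" "u \<noteq> 0"
  and a: "!!j. j \<le> L ==> eval_trm x (unit_name j) = u ^ (2 ^ j - 1)"
 shows "[| mul_depth s \<le> j; j \<le> L |] ==> eval_trm x (hom_trm P Q s j) = u ^ 2 ^ j * eval_trm (\<lambda>i. x (ren P i) / u) s"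
proof (induction s arbitrary: j)
 case (Var i)
 have "u ^ (2 ^ j - 1) * u = u ^ 2 ^ j" by (metis power_minus_mult zero_less_numeral zero_less_power)
 then show ?case using a[OF Var(2)] u by (simp add: field_simps)
next
 case (Const c)
 have "u ^ (2 ^ j - 1) * u = u ^ 2 ^ j" by (metis power_minus_mult zero_less_numeral zero_less_power)
 then show ?case using a[OF Const(2)] u by simp
next
 case (Add s t)
 then show ?case by (simp add: distrib_left)
next
 case (Mul s t)
 obtain i where j: "j = Suc i" using Mul.prems by (cases j) auto
 \<comment> \<open>Both factors of a product are at the level below, and their scalings multiply to
   the square. At a variable, whose value contains one factor \<open>u\<close>, the unit supplies
   the missing power \<open>2 ^ j - 1\<close>.\<close>
 have e: "u ^ 2 ^ j = u ^ 2 ^ i * u ^ 2 ^ i" unfolding j by (simp only: power_Suc mult_2 power_add)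
 have "eval_trm x (hom_trm P Q s i) = u ^ 2 ^ i * eval_trm (\<lambda>i. x (ren P i) / u) s"
  "eval_trm x (hom_trm P Q t i) = u ^ 2 ^ i * eval_trm (\<lambda>i. x (ren P i) / u) t"
  using Mul j by simp_all
 then show ?case unfolding e by (simp add: j)
qed

text \<open>Both sides of an atom are at the same level, so they carry the same positive factor and
  their order is unchanged.\<close>

lemma holds_hom_qff:
 assumes u: "eval_trm x (name Q) = u" "u > 0"
  and a: "!!j. j \<le> L ==> eval_trm x (unit_name j) = u ^ (2 ^ j - 1)"
 shows "mul_depth_qff \<Phi> \<le> L ==> holds x (hom_qff P Q L \<Phi>) \<longleftrightarrow> holds (\<lambda>i. x (ren P i) / u) \<Phi>"
proof (induction \<Phi>)
 case (Le s t)
 have "u ^ 2 ^ L > 0" using u by simp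
 then show ?case using Le eval_hom_trm[OF u(1) _ a, of L s L P] eval_hom_trm[OF u(1) _ a, of L t L P] u
  by simp
next
 case (Lt s t)
 have "u ^ 2 ^ L > 0" using u by simp
 then show ?case using Lt eval_hom_trm[OF u(1) _ a, of L s L P] eval_hom_trm[OF u(1) _ a, of L t L P] u
  by simp
qed simp_all

lemma holds_wrap_bound: "holds x (wrap_bound P q Q m i f) \<longleftrightarrow>
  (m \<le> i \<or> (x (ren P i) * eval_trm x (name q))\<^sup>2 \<le> (eval_trm x (name Q))\<^sup>2) \<and> holds x f"
 by (simp add: wrap_bound_def univ_def power2_eq_square)

lemma holds_bounds: "holds x (foldr (wrap_bound P q Q m) xs f) \<longleftrightarrow>
  (\<forall>i\<in>set xs. m \<le> i \<or> (x (ren P i) * eval_trm x (name q))\<^sup>2 \<le> (eval_trm x (name Q))\<^sup>2) \<and> holds x f"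
 by (induction xs) (auto simp: holds_wrap_bound)

lemma small_value:
 assumes "\<forall>c\<in>set (small Q). holds x c" "0 < j" "j \<le> Suc Q"
 shows "eval_trm x (name j) = (1 / 2) ^ 2 ^ (j - 1)"
proof -
 have 1: "eval_trm x (name 1) = 1 / 2" using assms(1) by (simp add: small_def)
 have 2: "eval_trm x (name (Suc (j - 1))) = eval_trm x (name 1) ^ 2 ^ (j - 1)"
  by (rule holds_squares[of Q]) (use assms in \<open>auto simp: small_def\<close>)
 have "Suc (j - 1) = j" using assms(2) by simp
 with 2 show ?thesis unfolding 1 by simp
qed

lemma double_mersenne: "(2 ^ j - 1) + (2 ^ j - 1) + 1 = 2 ^ Suc j - (1::nat)"
 using one_le_power[of "2::nat" j] unfolding power_Suc by linarith

lemma units_value: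
 assumes "\<forall>c\<in>set (units Q q). holds x c"
 shows "j \<le> q ==> eval_trm x (unit_name j) = eval_trm x (name Q) ^ (2 ^ j - 1)"
proof (induction j)
 case 0
 then show ?case using assms by (simp add: units_def)
next
 case (Suc j)
 have "holds x (unit_step Q j)" using assms Suc.prems by (auto simp: units_def)
 then have "eval_trm x (unit_name (Suc j)) = eval_trm x (unit_name j) * eval_trm x (unit_name j) * eval_trm x (name Q)"
  by (simp add: unit_step_def)
 also have "\<dots> = eval_trm x (name Q) ^ ((2 ^ j - 1) + (2 ^ j - 1) + 1)"
  using Suc.IH Suc.prems by (simp only: power_add power_one_right Suc_leD)
 finally show ?case unfolding double_mersenne .
qed

lemma holds_units:
 assumes "!!j. j \<le> q ==> eval_trm x (unit_name j) = u ^ (2 ^ j - 1)" "eval_trm x (name Q) = u"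
 shows "\<forall>c\<in>set (units Q q). holds x c"
proof -
 have "holds x (unit_step Q j)" if "j < q" for j
 proof -
  have "u ^ (2 ^ Suc j - 1) = u ^ (2 ^ j - 1) * u ^ (2 ^ j - 1) * u"
   unfolding double_mersenne[symmetric] by (simp only: power_add power_one_right)
  then show ?thesis using assms(1)[of j] assms(1)[of "Suc j"] assms(2) that
   unfolding unit_step_def holds_eqf eval_trm.simps(4) by simp
 qed
 then show ?thesis using assms(1)[of 0] by (auto simp: units_def)
qed

lemma holds_rescaled:
 "holds x (rescaled P q Q m \<Phi>) \<longleftrightarrow> (\<forall>c\<in>set (small Q). holds x c) \<and> (\<forall>c\<in>set (units Q q). holds x c) \<and>
  (\<forall>i\<in>vars_qff \<Phi>. m \<le> i \<or> (x (ren P i) * eval_trm x (name q))\<^sup>2 \<le> (eval_trm x (name Q))\<^sup>2) \<and> holds x (hom_qff P Q q \<Phi>)"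
 unfolding rescaled_def holds_foldr_Conj holds_bounds set_occ_qff by auto

lemma b_sigma2_true_mix:
 assumes V: "vars_qff \<Phi> \<subseteq> {..<m+n}"
 shows "b_sigma2_true m n \<Phi> \<longleftrightarrow> (\<exists>X. (\<forall>i\<in>vars_qff \<Phi>. i < m --> \<bar>X i\<bar> \<le> 1) \<and>
  (\<forall>Y. (\<forall>i\<in>vars_qff \<Phi>. m \<le> i --> \<bar>Y i\<bar> \<le> 1) --> holds (mix m X Y) \<Phi>))"
proof -
 have "vars_qff trivial = {}" "holds x trivial" for x by (simp_all add: trivial_def)
 then show ?thesis unfolding b_sigma2_true_pp using b_sigma2pp_true_mix[of trivial \<Phi> "vars_qff \<Phi>" m n] V by simp
qed

lemma length_bits_mersenne: "length (bits (2 ^ j - 1)) = j"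
 unfolding bits_mersenne by simp

text \<open>Values of the auxiliary variables: odd names are units, even positive names are the repeated squares.\<close>
definition rescaled_env :: "nat => real => (nat => real) => nat => real" where
 "rescaled_env P u X k = (if k < 2 ^ P - 1
   then if k = 0 then 1 else if odd k then u ^ (2 ^ length (bits k) - 1) else (1 / 2) ^ 2 ^ (length (bits k) - 2)
   else u * X (unren P k))"

lemma rescaled_env_ren: "rescaled_env P u X (ren P i) = u * X i"
 using ren_ge[of P i] by (simp add: rescaled_env_def)

lemma rescaled_env_name:
 assumes "0 < j" "j < P"
 shows "rescaled_env P u X (2 * (2 ^ j - 1)) = (1 / 2) ^ 2 ^ (j - 1)"
proof -
 have "2 * (2 ^ j - 1) \<noteq> (0::nat)" using assms one_less_power[of "2::nat" j] by simp
 then show ?thesis unfolding rescaled_env_def length_bits_name[OF assms(1)]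
  using name_less[OF assms(2)] by simp
qed

lemma rescaled_env_unit:
 assumes "j < P"
 shows "rescaled_env P u X (2 ^ j - 1) = u ^ (2 ^ j - 1)"
proof (cases j)
 case (Suc i)
 have "(2::nat) ^ j < 2 ^ P" using assms by simp
 then have "2 ^ j - 1 < 2 ^ P - (1::nat)" by (simp add: diff_less_mono)
 moreover have "odd (2 ^ j - 1 :: nat)" using Suc by simp
 moreover have "2 ^ j - 1 \<noteq> (0::nat)" using Suc one_less_power[of "2::nat" j] by simp
 ultimately show ?thesis unfolding rescaled_env_def length_bits_mersenne by simp
next
 case 0
 then show ?thesis using assms one_less_power[of "2::nat" P] by (simp add: rescaled_env_def)
qed

lemma vars_rescaled:
 assumes "Suc (Suc Q) \<le> P" "0 < q" "q \<le> Q"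
 shows "ren P ` vars_qff \<Phi> \<subseteq> vars_qff (rescaled P q Q m \<Phi>)"
  "vars_qff (rescaled P q Q m \<Phi>) \<subseteq> {..<2 ^ P - 1} \<union> ren P ` vars_qff \<Phi>"
proof -
 let ?A = "{..<2 ^ P - 1} :: nat set"
 have n: "vars_trm (name j) \<subseteq> ?A" if "j \<le> Suc Q" for j using that assms by (intro vars_name) simp
 have un: "vars_trm (unit_name j) \<subseteq> ?A" if "j \<le> Suc Q" for j
 proof -
  have "(2::nat) ^ j < 2 ^ P" using that assms by simp
  then show ?thesis by (simp add: unit_name_def diff_less_mono)
 qed
 have w: "ren P i \<in> vars_qff (wrap_bound P q Q m i f)" "vars_qff f \<subseteq> vars_qff (wrap_bound P q Q m i f)"
  "vars_qff (wrap_bound P q Q m i f) \<subseteq> ?A \<union> {ren P i} \<union> vars_qff f" for i f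
  using n[of q] n[of Q] assms(3) by (auto simp: wrap_bound_def univ_def)
 have ht: "vars_trm (hom_trm P Q s j) \<subseteq> ?A \<union> ren P ` vars_trm s" if "j \<le> q" for s j
  using that
 proof (induction s arbitrary: j)
  case (Mul s t)
  have "j - 1 \<le> q" using Mul.prems by simp
  from Mul.IH(1)[OF this] Mul.IH(2)[OF this] show ?case by auto
 next
  case (Add s t)
  from Add.IH(1)[OF Add.prems] Add.IH(2)[OF Add.prems] show ?case by auto
 next
  case (Var i)
  then show ?case using un[of j] assms(3) by auto
 next
  case (Const c)
  then show ?case using un[of j] n[of Q] assms(3) by auto
 qed
 have h: "vars_qff (hom_qff P Q q \<Phi>) \<subseteq> ?A \<union> ren P ` vars_qff \<Phi>"
 proof (induction \<Phi>)
  case (Le s t)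
  show ?case using ht[OF order_refl, of s] ht[OF order_refl, of t] by auto
 next
  case (Lt s t)
  show ?case using ht[OF order_refl, of s] ht[OF order_refl, of t] by auto
 qed auto
 note f = vars_foldr_wrap[of P "wrap_bound P q Q m" ?A, OF w, of "occ_qff \<Phi>" "hom_qff P Q q \<Phi>", unfolded set_occ_qff]
 define B where "B = vars_qff (foldr (wrap_bound P q Q m) (occ_qff \<Phi>) (hom_qff P Q q \<Phi>))"
 define D where "D = (\<Union>c\<in>set (small Q @ units Q q). vars_qff c)"
 have e: "vars_qff (rescaled P q Q m \<Phi>) = D \<union> B"
  unfolding rescaled_def B_def D_def by (rule vars_qff_foldr)
 have "ren P ` vars_qff \<Phi> \<subseteq> B" using f(1) by (simp only: Un_subset_iff B_def)
 then show "ren P ` vars_qff \<Phi> \<subseteq> vars_qff (rescaled P q Q m \<Phi>)"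
  unfolding e by (rule le_supI2)
 have "vars_qff c \<subseteq> ?A" if "c \<in> set (small Q)" for c
  using that vars_squares[of Q P c] n[of 1] assms by (auto simp: small_def eqf_def)
 moreover have "vars_qff c \<subseteq> ?A" if "c \<in> set (units Q q)" for c
 proof -
  from that consider "c = eqf (unit_name 0) (Const 1)" | j where "j < q" "c = unit_step Q j"
   by (auto simp: units_def)
  then show ?thesis
  proof cases
   case 1
   then show ?thesis using un[of 0] by (simp add: eqf_def)
  next
   case (2 j)
   then show ?thesis using un[of j] un[of "Suc j"] n[of Q] assms(3) by (simp add: unit_step_def eqf_def)
  qed
 qed
 ultimately have "D \<subseteq> ?A" unfolding D_def by (auto simp del: lessThan_iff)
 moreover have "B \<subseteq> ?A \<union> ren P ` vars_qff \<Phi> \<union> vars_qff (hom_qff P Q q \<Phi>)"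
  using f(2) by (simp only: B_def)
 ultimately show "vars_qff (rescaled P q Q m \<Phi>) \<subseteq> ?A \<union> ren P ` vars_qff \<Phi>"
  unfolding e using h by auto
qed

lemma qff_le_rescaled: "qff_le \<Phi> ==> qff_le (rescaled P q Q m \<Phi>)"
proof -
 assume le: "qff_le \<Phi>"
 have "qff_le (wrap_bound P q Q m i f) = qff_le f" for i f
  by (simp add: wrap_bound_def univ_def)
 moreover have "qff_le (hom_qff P Q q \<Phi>)" using le by (induction \<Phi>) auto
 ultimately have "qff_le (foldr (wrap_bound P q Q m) (occ_qff \<Phi>) (hom_qff P Q q \<Phi>))"
  by (simp add: qff_le_foldr_wrap)
 then show ?thesis unfolding rescaled_def qff_le_foldr
  by (auto simp: small_def units_def unit_step_def eqf_def qff_le_squares)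
qed

text \<open>In unscaled values, the unit box means \<open>(Y i) ^ 2 \<le> 2 ^ 2 ^ Q\<close> and the
  wrappers mean \<open>(X i) ^ 2 \<le> 2 ^ 2 ^ q\<close>. These are the bounds of
  \<open>truth_from_bounded_Y\<close>, which gives one direction; \<open>exists_bounded_X\<close>
  gives the other.\<close>

lemma b_sigma2_true_rescaled:
 assumes le: "qff_le \<Phi>" and P: "Suc (Suc Q) \<le> P" and q: "q = 32 * l ^ 3" and Q: "Q = 96 * l ^ 3"
  and l: "l \<ge> 7" "card (vars_qff \<Phi>) \<le> l" "fdeg \<Phi> \<le> l" "fnorm \<Phi> \<le> 2 ^ l"
  and depth: "mul_depth_qff \<Phi> \<le> q" and V: "vars_qff \<Phi> \<subseteq> {..<m+n}"
 shows "b_sigma2_true (ren P m) (2 ^ P * n) (rescaled P q Q m \<Phi>) \<longleftrightarrow> sigma2_true m n \<Phi>"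
proof -
 let ?F = "rescaled P q Q m \<Phi>" and ?m = "ren P m"
 have "1 \<le> l ^ 3" using l(1) by (intro one_le_power) simp
 then have q0: "0 < q" "q \<le> Q" "0 < Q" unfolding q Q by linarith+
 note vF = vars_rescaled[OF P q0(1,2), where \<Phi> = \<Phi> and m = m]
 have VF: "vars_qff ?F \<subseteq> {..<?m + 2 ^ P * n}"
  using vars_range_iff[OF vF] V by simp
 define u :: real where "u = (1 / 2) ^ 2 ^ (Q - 1)"
 define uA :: real where "uA = (1 / 2) ^ 2 ^ (q - 1)"
 have u0: "u > 0" "u \<le> 1" "uA > 0" by (simp_all add: u_def uA_def power_le_one)
 \<comment> \<open>\<open>name j\<close> is reached after \<open>j - 1\<close> squarings, so it is
   its square that has the exponent \<open>2 ^ j\<close>.\<close>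
 have sq: "((1 / 2 :: real) ^ 2 ^ (j - 1))\<^sup>2 = 1 / 2 ^ 2 ^ j" if j0: "0 < j" for j
 proof -
  obtain i where j: "j = Suc i" using j0 by (cases j) auto
  show ?thesis unfolding j diff_Suc_1 power_Suc2 power_mult by (simp add: power_divide)
 qed
 have uu: "u\<^sup>2 = 1 / 2 ^ 2 ^ Q" "uA\<^sup>2 = 1 / 2 ^ 2 ^ q" unfolding u_def uA_def using sq q0 by simp_all
 show ?thesis
 proof
  assume "b_sigma2_true ?m (2 ^ P * n) ?F"
  then obtain X' where XY: "\<forall>Y. (\<forall>i\<in>vars_qff ?F. ?m \<le> i --> \<bar>Y i\<bar> \<le> 1) --> holds (mix ?m X' Y) ?F"
   unfolding b_sigma2_true_mix[OF VF] by (elim exE conjE)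
  define X where "X i = X' (ren P i) / u" for i
  have vals: "eval_trm x (name Q) = u" "eval_trm x (name q) = uA" "j \<le> q ==> eval_trm x (unit_name j) = u ^ (2 ^ j - 1)"
   if "holds x ?F" for x j
  proof -
   have s: "\<forall>c\<in>set (small Q). holds x c" "\<forall>c\<in>set (units Q q). holds x c" using that by (auto simp: holds_rescaled)
   show 1: "eval_trm x (name Q) = u" unfolding u_def using q0 by (intro small_value[OF s(1)]) simp_all
   show "eval_trm x (name q) = uA" unfolding uA_def using q0 by (intro small_value[OF s(1)]) simp_all
   show "j \<le> q ==> eval_trm x (unit_name j) = u ^ (2 ^ j - 1)" using units_value[OF s(2), of j] 1 by simp
  qed
  have X2: "(X i)\<^sup>2 \<le> 2 ^ (2 ^ (32 * l ^ 3))" if i: "i \<in> vars_qff \<Phi>" "i < m" for i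
  proof -
   have F: "holds (mix ?m X' (\<lambda>_. 0)) ?F" using XY by simp
   have "mix ?m X' (\<lambda>_. 0) (ren P i) = X' (ren P i)" using i by (simp add: mix_def)
   then have "(X' (ren P i) * uA)\<^sup>2 \<le> u\<^sup>2"
    using F[unfolded holds_rescaled] vals(1,2)[OF F] i by (auto simp: not_le)
   then have "(X i)\<^sup>2 * uA\<^sup>2 \<le> 1" using u0 by (simp add: X_def power_mult_distrib power_divide field_simps)
   then show ?thesis unfolding uu q by (simp add: field_simps)
  qed
  have "holds (mix m X Y) \<Phi>" if Y: "!!i. i \<in> vars_qff \<Phi> ==> i \<ge> m ==> (Y i)\<^sup>2 < 2 ^ (2 ^ (96 * l ^ 3))" for Y
  proof -
   \<comment> \<open>The given \<open>Y\<close> is scaled down and spread over the renamed indices;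
     it lies in the unit box because \<open>Y\<close> is below the square root of
     \<open>2 ^ 2 ^ Q\<close>.\<close>
   define Y' where "Y' k = u * Y (unren P k)" for k
   have "\<forall>i\<in>vars_qff ?F. ?m \<le> i --> \<bar>Y' i\<bar> \<le> 1"
   proof (intro ballI impI)
    fix k assume k: "k \<in> vars_qff ?F" "?m \<le> k"
    then have "\<not> k < 2 ^ P - 1" using ren_ge[of P m] by linarith
    then obtain i where i: "k = ren P i" "i \<in> vars_qff \<Phi>" using k vF(2) by auto
    have "m \<le> i" using k(2) unfolding i(1) by (metis not_le ren_less_iff)
    then have "u\<^sup>2 * (Y i)\<^sup>2 \<le> u\<^sup>2 * 2 ^ (2 ^ Q)" using Y[OF i(2)] unfolding Q by (intro mult_left_mono) auto
    then have "(u * Y i)\<^sup>2 \<le> 1" unfolding power_mult_distrib uu by simp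
    then show "\<bar>Y' k\<bar> \<le> 1" unfolding Y'_def i(1) by (simp add: abs_square_le_1)
   qed
   then have F: "holds (mix ?m X' Y') ?F" by (rule XY[THEN spec, THEN mp])
   have "holds (mix ?m X' Y') (hom_qff P Q q \<Phi>)" using F by (simp add: holds_rescaled)
   then have "holds (\<lambda>i. mix ?m X' Y' (ren P i) / u) \<Phi>"
    using holds_hom_qff[where L = q and P = P and \<Phi> = \<Phi>, OF vals(1)[OF F] u0(1) vals(3)[OF F]] depth by simp
   moreover have "(\<lambda>i. mix ?m X' Y' (ren P i) / u) = mix m X Y"
    using u0 by (auto simp: fun_eq_iff mix_def X_def Y'_def)
   ultimately show ?thesis by simp
  qed
  from truth_from_bounded_Y[OF le l order_refl X2 this] show "sigma2_true m n \<Phi>"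
   unfolding sigma2_true_mix .
 next
  assume "sigma2_true m n \<Phi>"
  then obtain X0 where X0: "!!Y. holds (mix m X0 Y) \<Phi>" unfolding sigma2_true_mix by blast
  obtain X1 where X1: "!!i. i \<in> vars_qff \<Phi> ==> i < m ==> (X1 i)\<^sup>2 \<le> 2 ^ (2 ^ (32 * l ^ 3))" "!!Y. holds (mix m X1 Y) \<Phi>"
   by (rule exists_bounded_X[OF le l order_refl X0]) (rule that)
  define X' where "X' = rescaled_env P u X1"
  have fresh: "2 ^ P - 1 \<le> ?m" by (rule ren_ge)
  have nm: "eval_trm (mix ?m X' Y) (name j) = (1 / 2) ^ 2 ^ (j - 1)" if "0 < j" "j \<le> Suc Q" for j Y
  proof -
   have "j < P" using that P by simp
   with name_less[OF this] fresh show ?thesis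
    using rescaled_env_name[OF that(1)] by (simp add: name_def mix_def X'_def)
  qed
  have un: "eval_trm (mix ?m X' Y) (unit_name j) = u ^ (2 ^ j - 1)" if "j \<le> q" for j Y
  proof -
   have j: "j < P" using that P q0 by simp
   then have "(2::nat) ^ j < 2 ^ P" by simp
   then have "2 ^ j - 1 < 2 ^ P - (1::nat)" by (intro diff_less_mono) simp_all
   then have "2 ^ j - 1 < ?m" using fresh by linarith
   then show ?thesis unfolding unit_name_def eval_trm.simps mix_def X'_def using rescaled_env_unit[OF j] by simp
  qed
  have nQ: "eval_trm (mix ?m X' Y) (name Q) = u" "eval_trm (mix ?m X' Y) (name q) = uA" for Y
   unfolding u_def uA_def using q0 by (simp_all add: nm)
  have F: "holds (mix ?m X' Y) ?F" for Y
   unfolding holds_rescaled nQ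
  proof (intro conjI ballI)
   fix c
   have "\<forall>c\<in>set (squares Q). holds (mix ?m X' Y) c"
    by (rule holds_squares_iff[of Q _ "1 / 2"]) (use nm[of "Suc _"] in simp)
   then show "c \<in> set (small Q) ==> holds (mix ?m X' Y) c"
    using nm[of 1 Y] by (auto simp: small_def)
   show "c \<in> set (units Q q) ==> holds (mix ?m X' Y) c"
    using holds_units[of q "mix ?m X' Y" u Q, OF un nQ(1)] by blast
  next
   fix i assume i: "i \<in> vars_qff \<Phi>"
   show "m \<le> i \<or> (mix ?m X' Y (ren P i) * uA)\<^sup>2 \<le> u\<^sup>2"
   proof (cases "m \<le> i")
    case False
    have "(X1 i)\<^sup>2 * uA\<^sup>2 \<le> 1" using X1(1)[OF i] False unfolding uu q by (simp add: field_simps)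
    then have "u\<^sup>2 * ((X1 i)\<^sup>2 * uA\<^sup>2) \<le> u\<^sup>2 * 1" by (rule mult_left_mono) simp
    then show ?thesis using False by (simp add: mix_def X'_def rescaled_env_ren power_mult_distrib mult.assoc)
   qed simp
  next
   have "(\<lambda>i. mix ?m X' Y (ren P i) / u) = mix m X1 (\<lambda>i. Y (ren P i) / u)"
    using u0 by (auto simp: fun_eq_iff mix_def X'_def rescaled_env_ren)
   then show "holds (mix ?m X' Y) (hom_qff P Q q \<Phi>)"
    using holds_hom_qff[where L = q and P = P and \<Phi> = \<Phi>, OF nQ(1) u0(1) un] depth X1(2) by simp
  qed
  have "\<bar>X' k\<bar> \<le> 1" if k: "k \<in> vars_qff ?F" "k < ?m" for k
  proof (cases "k < 2 ^ P - 1")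
   case True
   \<comment> \<open>All auxiliary values are 1 or powers of \<open>1 / 2\<close> and of
     \<open>u\<close>, hence in the unit box. This is the reason for squaring \<open>1 / 2\<close>
     and not 2.\<close>
   then show ?thesis using u0 by (simp add: X'_def rescaled_env_def power_le_one power_abs)
  next
   case False
   then obtain i where i: "k = ren P i" "i \<in> vars_qff \<Phi>" using k vF(2) by auto
   then have "(X1 i)\<^sup>2 \<le> 2 ^ 2 ^ q" using X1(1) k(2) unfolding q by simp
   \<comment> \<open>The common scale \<open>u\<close> is made for the larger bound on
     \<open>Y\<close>; it brings the existential values into the box as well because
     \<open>q \<le> Q\<close>.\<close>
   also have "\<dots> \<le> 2 ^ 2 ^ Q" using q0 by (intro power_increasing) auto
   finally have "u\<^sup>2 * (X1 i)\<^sup>2 \<le> u\<^sup>2 * 2 ^ 2 ^ Q" by (rule mult_left_mono) simp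
   then have "(u * X1 i)\<^sup>2 \<le> 1" unfolding power_mult_distrib uu by simp
   then show ?thesis unfolding X'_def i(1) rescaled_env_ren by (simp add: abs_square_le_1)
  qed
  with F show "b_sigma2_true ?m (2 ^ P * n) ?F"
   unfolding b_sigma2_true_mix[OF VF] by (intro exI[of _ X']) simp
 qed
qed

lemma reduces_Sigma2_b_Sigma2: "reduces Sigma2_le b_Sigma2_le"
proof (rule reduces_on_langs[OF tame_rescale, of "[16, 16, 20]"])
 fix w assume "w \<in> langs [16, 16, 20]"
 then obtain m n \<Phi> where w: "w = enc_nat m @ enc_nat n @ enc_qff \<Phi>" and le: "qff_le \<Phi>"
  unfolding langs_bounded by blast
 define l where "l = length w"
 define P where "P = 98 * l ^ 3"
 define q where "q = 32 * l ^ 3"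
 define Q where "Q = 96 * l ^ 3"
 have len: "l = length (enc_nat m) + length (enc_nat n) + length (enc_qff \<Phi>)"
  by (simp add: l_def w)
 have l: "length (enc_qff \<Phi>) \<le> l" "l \<ge> 7"
  using length_enc_nat[of m] length_enc_nat[of n] length_enc_qff[of \<Phi>] unfolding len by linarith+
 have l3: "1 \<le> l ^ 3" "l \<le> l ^ 3" using l(2) self_le_power[of l 3] by (auto intro: one_le_power)
 then have P: "Suc (Suc Q) \<le> P" and q0: "0 < q" "q \<le> Q" unfolding q_def Q_def P_def by linarith+
 have c: "card (vars_qff \<Phi>) \<le> l" using card_vars_le_length[of \<Phi>] l(1) by linarith
 have d: "fdeg \<Phi> \<le> l" using fdeg_le_length[of \<Phi>] l(1) by linarith
 have "(2::nat) ^ length (enc_qff \<Phi>) \<le> 2 ^ l" using l(1) by (intro power_increasing) auto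
 then have h: "fnorm \<Phi> \<le> 2 ^ l" using fnorm_le_length[of \<Phi>] by linarith
 have depth: "mul_depth_qff \<Phi> \<le> q" using mul_depth_qff_le_length[of \<Phi>] l(1) l3 unfolding q_def by linarith
 let ?v = "header P m n @ enc_qff (rescaled P q Q m \<Phi>)"
 have range: "vars_qff (rescaled P q Q m \<Phi>) \<subseteq> {..<ren P m + 2 ^ P * n} \<longleftrightarrow> vars_qff \<Phi> \<subseteq> {..<m + n}"
  by (rule vars_range_iff[OF vars_rescaled[OF P q0]])
 have "w \<in> Sigma2_le \<longleftrightarrow> vars_qff \<Phi> \<subseteq> {..<m+n} \<and> sigma2_true m n \<Phi>"
  unfolding w mem_Sigma2_le using le by simp
 also have "\<dots> \<longleftrightarrow> vars_qff \<Phi> \<subseteq> {..<m+n} \<and> b_sigma2_true (ren P m) (2 ^ P * n) (rescaled P q Q m \<Phi>)"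
  using b_sigma2_true_rescaled[OF le P q_def Q_def l(2) c d h depth] by blast
 also have "\<dots> \<longleftrightarrow> ?v \<in> b_Sigma2_le"
  unfolding header_def append_assoc mem_b_Sigma2_le ren_def[symmetric] range
  using qff_le_rescaled[OF le] by simp
 finally have "w \<in> Sigma2_le \<longleftrightarrow> ?v \<in> b_Sigma2_le" .
 moreover have "runs rescale (init_regs w) (init_regs ?v)"
  unfolding P_def q_def Q_def l_def by (rule runs_rescale[OF le w depth[unfolded q_def l_def]])
 ultimately show "\<exists>v\<in>words. runs rescale (init_regs w) (init_regs v) \<and> (w \<in> Sigma2_le \<longleftrightarrow> v \<in> b_Sigma2_le)"
  using header_words by blast
qed (auto simp: base_def Sigma2_le_def langs_bounded enc_nat_def Nil_notin)

theorem theorem2: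
  shows "poly_reducible Sigma2_le b_Sigma2_le \<and> poly_reducible b_Sigma2_le Sigma2_le \<and>
         poly_reducible Sigma2_le b_Sigma2pp_le \<and> poly_reducible b_Sigma2pp_le Sigma2_le \<and>
         poly_reducible b_Sigma2_le b_Sigma2pp_le \<and> poly_reducible b_Sigma2pp_le b_Sigma2_le"
proof -
  note r = reduces_Sigma2_b_Sigma2 reduces_b_Sigma2_b_Sigma2pp reduces_b_Sigma2pp_Sigma2
  show ?thesis
    by (intro conjI reduces_poly_reducible r reduces_trans[OF r(1,2)] reduces_trans[OF r(2,3)] reduces_trans[OF r(3,1)])
qed

end
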